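(* Suppose that Condition C holds (i.e. both C1 and C2), that for $\mathbb{P}$-almost every $\omega$ the random walk $\xi(\cdot)=(X(\cdot),Y(\cdot))$ on the strip is recurrent, and that $\mathcal{J}_0\not\subset\mathcal{J}_{al}$. Then there is a sequence of random variables $b_t=b_t(\omega)$, $t=1,2,\dots$, on $(\Omega,\mathbb{P})$ which converges weakly (in distribution) as $t\to\infty$ and such that for any $\epsilon>0$ $$\mathbb{P}\left\{\omega : Pr_{\omega}\left(\left|\frac{X(t)}{(\log t)^2}-b_t(\omega)\right|\le\epsilon\right)\ge 1-\epsilon\right\}\to 1\quad\text{as } t\to\infty .$$
   Context: Fix a positive integer $m$. $\mathbf{1}$ is the column vector in $\mathbb{R}^m$ with all components $1$. For a matrix $A=(a(i,j))$ put $\|A\|=\max_i\sum_j|a(i,j)|$. Matrix inequalities such as $P\ge 0$ are entrywise. $\mathcal{J}$ is the set of triples $(P,Q,R)$ of $m\times m$ matrices with $P,Q,R\ge0$ and $(P+Q+R)\mathbf{1}=\mathbf{1}$. An environment is a sequence $\omega=(\omega_n)_{n\in\mathbb{Z}}=((P_n,Q_n,R_n))_{n\in\mathbb{Z}}$ of elements of $\mathcal{J}$; it is random, $\Omega$ is the space of such sequences and $\mathbb{P}$ its law on $\Omega$. $\mathcal{J}_0\subset\mathcal{J}$ is the support of the distribution of $(P_n,Q_n,R_n)$ (it does not depend on $n$). For fixed $\omega$, the random walk $\xi(t)=(X(t),Y(t))$, $t=0,1,2,\dots$, on the strip $\mathbb{S}=\mathbb{Z}\times\{1,\dots,m\}$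 is the Markov chain which from $(n,i)$ jumps to $(n+1,j)$ with probability $P_n(i,j)$, to $(n,j)$ with probability $R_n(i,j)$, and to $(n-1,j)$ with probability $Q_n(i,j)$. $Pr_{\omega}=Pr_{\omega,z}$ is the law of this chain in the environment $\omega$ started from an arbitrary fixed point $z\in\mathbb{S}$. Condition C consists of: C1: $(P_n,Q_n,R_n)$, $-\infty<n<\infty$, is a sequence of independent identically distributed random variables. C2: there are $\varepsilon>0$ and a positive integer $l<\infty$ such that for any $(P,Q,R)\in\mathcal{J}_0$ and all $i,j\in\{1,\dots,m\}$: $\|R^l\|\le1-\varepsilon$, $((I-R)^{-1}P)(i,j)\ge\varepsilon$, $((I-R)^{-1}Q)(i,j)\ge\varepsilon$. For $(P,Q,R)\in\mathcal{J}_0$, under C2 there is a unique row vector $\pi=(\pi_1,\dots,\pi_m)$ with non-negative components, $\sum_j\pi_j=1$ and $\pi(P+Q+R)=\pi$. The set $\mathcal{J}_{al}$ is $$\mathcal{J}_{al}=\{(P,Q,R)\in\mathcal{J}:\ \pi(P-Q)\mathbf{1}=0,\ \text{where } \pi(P+Q+R)=\pi\},$$ where $\pi(P-Q)\mathbf{1}=\sum_{i=1}^m\pi_i\sum_{j=1}^m(P(i,j)-Q(i,j))$ and $\pi$ is the probability vector just described. *)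

theory Defs
  imports "HOL-Probability.Probability"
begin

text \<open>
  The finite index type \<open>'m\<close> plays the role of \<open>{1, \<dots>, m}\<close>. Order and \<open>1\<close> on vectors and matrices
  are componentwise, so \<open>0 \<le> P\<close> is the entrywise inequality and \<open>1 :: real ^ 'm\<close> is the all-ones
  vector, whereas the identity matrix is \<open>mat 1\<close>.
\<close>

type_synonym 'm triple = "(real ^ 'm ^ 'm) \<times> (real ^ 'm ^ 'm) \<times> (real ^ 'm ^ 'm)"
type_synonym 'm env = "int \<Rightarrow> 'm triple"
type_synonym 'm site = "int \<times> 'm"


section \<open>Environments\<close>

definition triples :: "'m::finite triple set" where
  "triples = {(P, Q, R). 0 \<le> P \<and> 0 \<le> Q \<and> 0 \<le> R \<and> (P + Q + R) *v 1 = 1}"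

definition triple_space :: "'m::finite triple measure" where
  "triple_space = restrict_space borel triples"

definition env_space :: "'m::finite env measure" where
  "env_space = (\<Pi>\<^sub>M n\<in>UNIV. triple_space)"

text \<open>Topological support of a Borel measure.\<close>

definition support :: "'a::topological_space measure \<Rightarrow> 'a set" where
  "support N = {x. \<forall>U. open U \<longrightarrow> x \<in> U \<longrightarrow> 0 < emeasure N U}"

text \<open>
  The set of all possible triples. It is read off at site \<open>0\<close>; for identically distributed triples
  any other site gives the same set.
\<close>

definition env_support :: "'m::finite env measure \<Rightarrow> 'm triple set" where
  "env_support \<PP> = support (distr \<PP> borel (\<lambda>\<omega>. \<omega> 0))"

definition matrix_norm :: "real ^ 'm ^ 'm::finite \<Rightarrow> real" where
  "matrix_norm A = (MAX i. \<Sum>j\<in>UNIV. \<bar>A $ i $ j\<bar>)"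

text \<open>Powers for the matrix product; the operation \<open>A ^ l\<close> of the library is the entrywise power.\<close>

definition matrix_power :: "real ^ 'm ^ 'm \<Rightarrow> nat \<Rightarrow> real ^ 'm ^ 'm::finite" where
  "matrix_power A l = (((**) A) ^^ l) (mat 1)"

definition condition_C1 :: "'m::finite env measure \<Rightarrow> bool" where
  "condition_C1 \<PP> \<longleftrightarrow>
     prob_space.indep_vars \<PP> (\<lambda>_. triple_space) (\<lambda>n \<omega>. \<omega> n) UNIV \<and>
     (\<forall>n. distr \<PP> triple_space (\<lambda>\<omega>. \<omega> n) = distr \<PP> triple_space (\<lambda>\<omega>. \<omega> 0))"

definition condition_C2 :: "'m::finite env measure \<Rightarrow> bool" where
  "condition_C2 \<PP> \<longleftrightarrow>
     (\<exists>\<epsilon>>0. \<exists>l>0. \<forall>(P, Q, R) \<in> env_support \<PP>. \<forall>i j.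
        matrix_norm (matrix_power R l) \<le> 1 - \<epsilon> \<and>
        (matrix_inv (mat 1 - R) ** P) $ i $ j \<ge> \<epsilon> \<and>
        (matrix_inv (mat 1 - R) ** Q) $ i $ j \<ge> \<epsilon>)"

definition condition_C :: "'m::finite env measure \<Rightarrow> bool" where
  "condition_C \<PP> \<longleftrightarrow> condition_C1 \<PP> \<and> condition_C2 \<PP>"

definition stationary :: "real ^ 'm \<Rightarrow> real ^ 'm ^ 'm::finite \<Rightarrow> bool" where
  "stationary p A \<longleftrightarrow> 0 \<le> p \<and> (\<Sum>i\<in>UNIV. p $ i) = 1 \<and> p v* A = p"

text \<open>
  On triples satisfying the second condition the stationary probability vector of \<open>P + Q + R\<close> exists
  and is unique, so there the existential quantifier merely names it.
\<close>

definition algebraic_triples :: "'m::finite triple set" where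
  "algebraic_triples =
     {(P, Q, R) \<in> triples. \<exists>p. stationary p (P + Q + R) \<and> p \<bullet> ((P - Q) *v 1) = 0}"


section \<open>The random walk in a fixed environment\<close>

fun trans_prob :: "'m::finite env \<Rightarrow> 'm site \<Rightarrow> 'm site \<Rightarrow> real" where
  "trans_prob \<omega> (n, i) (n', j) =
     (case \<omega> n of (P, Q, R) \<Rightarrow>
        if n' = n + 1 then P $ i $ j
        else if n' = n then R $ i $ j
        else if n' = n - 1 then Q $ i $ j
        else 0)"

definition step :: "'m::finite env \<Rightarrow> 'm site \<Rightarrow> 'm site pmf" where
  "step \<omega> s = embed_pmf (trans_prob \<omega> s)"

text \<open>
  The conditional law of the position at time \<open>t\<close> given the positions \<open>h 0, \<dots>, h (t - 1)\<close>, which is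
  the form of transition kernel used by the Ionescu-Tulcea construction.
\<close>

definition walk_kernel :: "'m::finite env \<Rightarrow> 'm site \<Rightarrow> nat \<Rightarrow> (nat \<Rightarrow> 'm site) \<Rightarrow> 'm site measure" where
  "walk_kernel \<omega> z t h = measure_pmf (if t = 0 then return_pmf z else step \<omega> (h (t - 1)))"

text \<open>The law of the whole trajectory started at \<open>z\<close>; see \<open>walk_law_cylinder\<close> below.\<close>

definition walk_law :: "'m::finite env \<Rightarrow> 'm site \<Rightarrow> (nat \<Rightarrow> 'm site) measure" where
  "walk_law \<omega> z =
     projective_family.lim UNIV (Ionescu_Tulcea.CI (walk_kernel \<omega> z) (\<lambda>_. count_space UNIV))
       (\<lambda>_. count_space UNIV)"

definition recurrent :: "'m::finite env \<Rightarrow> bool" where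
  "recurrent \<omega> \<longleftrightarrow>
     (\<forall>z. measure (walk_law \<omega> z) {\<xi> \<in> space (walk_law \<omega> z). \<exists>t>0. \<xi> t = z} = 1)"


section \<open>Basic facts about the law of the walk\<close>

lemma pmf_step:
  fixes \<omega> :: "'m::finite env"
  assumes "\<And>n. \<omega> n \<in> triples"
  shows "pmf (step \<omega> s) s' = trans_prob \<omega> s s'"
proof -
  obtain n i where s: "s = (n, i)" by (cases s)
  obtain P Q R where PQR: "\<omega> n = (P, Q, R)" by (cases "\<omega> n")
  have nn: "0 \<le> P $ i $ j" "0 \<le> Q $ i $ j" "0 \<le> R $ i $ j" for j
    using assms[of n] by (auto simp: PQR triples_def less_eq_vec_def)
  have pos: "0 \<le> trans_prob \<omega> s u" for u
    by (cases u) (auto simp: s PQR nn)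
  let ?A = "{n - 1, n, n + 1} \<times> (UNIV :: 'm set)"
  have "((P + Q + R) *v 1) $ i = 1"
    using assms[of n] by (auto simp: PQR triples_def)
  hence one: "(\<Sum>j\<in>UNIV. Q $ i $ j) + (\<Sum>j\<in>UNIV. R $ i $ j) + (\<Sum>j\<in>UNIV. P $ i $ j) = 1"
    by (simp add: matrix_vector_mult_def sum.distrib algebra_simps)
  have "(\<integral>\<^sup>+u. ennreal (trans_prob \<omega> s u) \<partial>count_space UNIV)
      = (\<Sum>u\<in>?A. ennreal (trans_prob \<omega> s u))"
    by (rule nn_integral_count_space')
       (auto simp: s PQR split: if_splits)
  also have "\<dots> = ennreal (\<Sum>u\<in>?A. trans_prob \<omega> s u)"
    by (rule sum_ennreal) (rule pos)
  also have "(\<Sum>u\<in>?A. trans_prob \<omega> s u)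
      = (\<Sum>k\<in>{n - 1, n, n + 1}. \<Sum>j\<in>UNIV. trans_prob \<omega> s (k, j))"
    by (subst sum.cartesian_product) (simp add: case_prod_unfold)
  also have "\<dots> = 1"
    using one by (simp add: s PQR)
  finally have "(\<integral>\<^sup>+u. ennreal (trans_prob \<omega> s u) \<partial>count_space UNIV) = 1"
    by simp
  thus ?thesis
    unfolding step_def by (intro pmf_embed_pmf pos)
qed

lemma Ionescu_Tulcea_walk:
  fixes \<omega> :: "'m::finite env"
  shows "Ionescu_Tulcea (walk_kernel \<omega> z) (\<lambda>_. count_space UNIV)"
proof (rule Ionescu_Tulcea.intro)
  fix t :: nat
  let ?H = "Pi\<^sub>M {0..<t} (\<lambda>_. count_space UNIV) :: (nat \<Rightarrow> 'm site) measure"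
  show "walk_kernel \<omega> z t \<in> ?H \<rightarrow>\<^sub>M subprob_algebra (count_space UNIV)"
  proof (cases "t = 0")
    case True
    thus ?thesis
      by (simp add: walk_kernel_def[abs_def] space_subprob_algebra measure_pmf.subprob_space_axioms)
  next
    case False
    have "(\<lambda>h. h (t - 1)) \<in> ?H \<rightarrow>\<^sub>M count_space UNIV"
      using False by (intro measurable_component_singleton) auto
    moreover have "(\<lambda>s. measure_pmf (step \<omega> s))
        \<in> count_space UNIV \<rightarrow>\<^sub>M subprob_algebra (count_space UNIV)"
      by (simp add: space_subprob_algebra measure_pmf.subprob_space_axioms)
    ultimately show ?thesis
      using False by (auto simp: walk_kernel_def[abs_def] intro: measurable_compose)
  qed
next
  fix t :: nat and h :: "nat \<Rightarrow> 'm site"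
  show "prob_space (walk_kernel \<omega> z t h)"
    by (simp add: walk_kernel_def measure_pmf.prob_space_axioms)
qed

lemma sets_walk_law: "sets (walk_law \<omega> z) = sets (\<Pi>\<^sub>M t\<in>UNIV. count_space UNIV)"
proof -
  interpret Ionescu_Tulcea "walk_kernel \<omega> z" "\<lambda>_. count_space UNIV"
    by (rule Ionescu_Tulcea_walk)
  show ?thesis unfolding walk_law_def by simp
qed

lemma space_walk_law: "space (walk_law \<omega> z) = UNIV"
  using sets_eq_imp_space_eq[OF sets_walk_law[of \<omega> z]] by (auto simp: space_PiM)

text \<open>
  The defining property of the Markov chain: finite-dimensional distributions are products of
  one-step transition probabilities.
\<close>

lemma walk_law_cylinder:
  fixes \<omega> :: "'m::finite env"
  assumes \<omega>: "\<And>n. \<omega> n \<in> triples"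
  shows "emeasure (walk_law \<omega> z) {\<xi>. \<forall>k\<le>t. \<xi> k = s k}
       = (if s 0 = z then \<Prod>k<t. ennreal (trans_prob \<omega> (s k) (s (Suc k))) else 0)"
proof -
  interpret IT: Ionescu_Tulcea "walk_kernel \<omega> z" "\<lambda>_. count_space UNIV :: 'm site measure"
    by (rule Ionescu_Tulcea_walk)
  let ?M = "\<lambda>_::nat. count_space UNIV :: 'm site measure"
  let ?S = "\<lambda>n. {restrict s {0..<n}}"
  have S_eq: "?S n = Pi\<^sub>E {0..<n} (\<lambda>k. {s k})" for n
    by (auto simp: PiE_singleton fun_eq_iff PiE_iff extensional_def restrict_def)
  have S[measurable]: "?S n \<in> sets (Pi\<^sub>M {0..<n} ?M)" for n
    unfolding S_eq by (rule sets_PiM_I_finite) auto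
  have C: "emeasure (IT.C 0 n (\<lambda>_. undefined)) (?S n)
      = (\<Prod>k<n. emeasure (walk_kernel \<omega> z k s) {s k})" for n
  proof (induction n)
    case 0
    have "emeasure (return (Pi\<^sub>M {0..<0} ?M) (\<lambda>_. undefined)) (?S 0) = 1"
      by (subst emeasure_return[OF S]) (simp add: restrict_def)
    thus ?case by (simp add: restrict_def)
  next
    case (Suc n)
    have u: "(\<lambda>_. undefined) \<in> space (Pi\<^sub>M {0..<0} ?M)" by (simp add: space_PiM)
    have "emeasure (IT.C 0 (Suc n) (\<lambda>_. undefined)) (?S (Suc n))
        = (\<integral>\<^sup>+h. emeasure (IT.eP n h) (?S (Suc n)) \<partial>IT.C 0 n (\<lambda>_. undefined))"
      using IT.prob_space_C[OF u, of n] IT.measurable_eP[of n]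
      by (simp, subst emeasure_bind[where N="Pi\<^sub>M {0..<Suc n} ?M"])
         (auto simp: IT.space_C[OF u] IT.sets_C[OF u] space_PiM cong: measurable_cong_sets)
    also have "\<dots> = (\<integral>\<^sup>+h. emeasure (walk_kernel \<omega> z n s) {s n} * indicator (?S n) h
                      \<partial>IT.C 0 n (\<lambda>_. undefined))"
    proof (rule nn_integral_cong)
      fix h assume "h \<in> space (IT.C 0 n (\<lambda>_. undefined))"
      hence h: "h \<in> space (Pi\<^sub>M {0..<n} ?M)" by (simp add: IT.space_C[OF u])
      hence he: "h \<in> extensional {0..<n}" by (auto simp: space_PiM PiE_iff)
      have "{x. h(n := x) = restrict s {0..<Suc n}}
          = (if h = restrict s {0..<n} then {s n} else {})"
        using he by (auto simp: fun_eq_iff restrict_def extensional_def)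
      hence "emeasure (IT.eP n h) (?S (Suc n))
          = emeasure (walk_kernel \<omega> z n h) (if h = restrict s {0..<n} then {s n} else {})"
        by (simp add: IT.emeasure_eP[OF h S] vimage_def)
      also have "\<dots> = emeasure (walk_kernel \<omega> z n s) {s n} * indicator (?S n) h"
        by (auto simp: walk_kernel_def)
      finally show "emeasure (IT.eP n h) (?S (Suc n))
          = emeasure (walk_kernel \<omega> z n s) {s n} * indicator (?S n) h" .
    qed
    also have "\<dots> = emeasure (walk_kernel \<omega> z n s) {s n}
                    * emeasure (IT.C 0 n (\<lambda>_. undefined)) (?S n)"
      using S[of n] by (intro nn_integral_cmult_indicator) (simp add: IT.sets_C[OF u])
    finally show ?case by (simp only: Suc.IH prod.lessThan_Suc mult.commute)
  qed
  have "{\<xi>. \<forall>k\<le>t. \<xi> k = s k} = prod_emb UNIV ?M {0..<Suc t} (?S (Suc t))"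
    by (auto simp: prod_emb_def space_PiM restrict_def fun_eq_iff) (metis less_Suc_eq_le)+
  hence "emeasure (walk_law \<omega> z) {\<xi>. \<forall>k\<le>t. \<xi> k = s k}
      = emeasure (IT.CI {0..<Suc t}) (?S (Suc t))"
    unfolding walk_law_def using IT.lim[OF _ S, of "Suc t"] by simp
  also have "\<dots> = emeasure (IT.C 0 (Suc t) (\<lambda>_. undefined)) (?S (Suc t))"
    by (subst IT.emeasure_CI[OF order_refl S]) (simp add: prod_emb_id extensional_def space_PiM)
  also have "\<dots> = (\<Prod>k<Suc t. emeasure (walk_kernel \<omega> z k s) {s k})"
    by (rule C)
  also have "\<dots> = emeasure (walk_kernel \<omega> z 0 s) {s 0}
                  * (\<Prod>k<t. emeasure (walk_kernel \<omega> z (Suc k) s) {s (Suc k)})"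
    by (rule prod.lessThan_Suc_shift)
  also have "\<dots> = (if s 0 = z then \<Prod>k<t. ennreal (trans_prob \<omega> (s k) (s (Suc k))) else 0)"
    by (auto simp: walk_kernel_def emeasure_pmf_single pmf_step[OF \<omega>])
  finally show ?thesis .
qed

end

theory Submission
 imports Defs "HOL-Real_Asymp.Real_Asymp"
begin

text \<open>
  The exit probabilities of the walk from an interval satisfy a Harnack inequality, and the logarithm
  of their odds is a potential: a functional of the environment which is additive along the strip up
  to a bounded error. Comparison of the stationary measures of the walk in finite boxes with this
  potential shows that at time \<open>t\<close> the walk is near the bottom of a valley of the potential, as soon as
  the walls of the valley are higher than \<open>log t\<close> and the bottom can be reached across smaller barriers.

  Quasi-additivity and independence give fourth moment bounds, a linear variance and a central limit
  theorem. Recurrence keeps the mean bounded; the variance can only degenerate if the potential is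
  bounded in every constant environment in the support, and then the triple has zero drift. Hence
  on the scale \<open>(log t)\<^sup>2\<close> the potential is close to a Gaussian random walk, which has such a valley with
  probability close to one. The centre \<open>b\<^sub>t\<close> is the rescaled median of the quenched law; its law is
  Cauchy in \<open>t\<close> because the valleys at two times are compared with those of the same Gaussian walk.
\<close>

section \<open>Harmonic functions on an elliptic strip\<close>

text \<open>For a single state per layer the potential is an exact sum of independent terms. With
  several states it is built from products of matrices that do not commute, and no exact sum is
  available. Odds of exit probabilities restore additivity up to a constant, because the stationary
  flow of a finite box obeys exact balance laws and reproduces these odds up to Harnack factors.
  Beyond this point the probabilistic part uses only locality, stationarity and a bounded additive
  error, and is therefore stated for abstract functionals of independent variables.

  The place of uniqueness of the valley is taken by an argument about the walk: any two valleys of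
  the same path both hold the walk at time t, so both bottoms lie near the quenched median. What has
  to be produced is one valley with a definite margin. The margin is there to be spent: a valley
  must survive the passage from the Gaussian walk to the coarse increments of the potential, and
  from these to the potential inside a mesh cell.\<close>

abbreviation up :: "'m::finite env => int => real ^ 'm ^ 'm" where
 "up e n \<equiv> fst (e n)"

abbreviation down :: "'m::finite env => int => real ^ 'm ^ 'm" where
 "down e n \<equiv> fst (snd (e n))"

abbreviation stay :: "'m::finite env => int => real ^ 'm ^ 'm" where
 "stay e n \<equiv> snd (snd (e n))"

text \<open>The one-step transition operator, written as a finite sum of entries so that the
  quenched estimates are real arithmetic; \<open>nn_integral_step\<close> identifies it with
  integration against \<open>step\<close>.\<close>

definition step_op :: "'m::finite env => (int => 'm => real) => int => 'm => real" where
 "step_op e f n i = (SUM j:UNIV. up e n $ i $ j * f (n + 1) j + stay e n $ i $ j * f n j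
                + down e n $ i $ j * f (n - 1) j)"

text \<open>\<open>G\<close> is the Green matrix of the motion inside one layer. Hence
  \<open>G ** fst x\<close> and \<open>G ** fst (snd x)\<close> hold the probabilities of leaving
  the layer upwards and downwards into a given state, and \<open>D\<close> bounds the mean time
  spent in the layer. The quenched bounds depend on the environment only through
  \<open>\<epsilon>\<close>, \<open>D\<close> and the potential.\<close>

definition elliptic :: "real => real => 'm::finite triple => bool" where
 "elliptic \<epsilon> D x \<longleftrightarrow> x \<in> triples &
   (\<exists>G. 0 <= G & G ** (mat 1 - snd (snd x)) = mat 1 &
    (\<forall>i j. \<epsilon> <= (G ** fst x) $ i $ j & \<epsilon> <= (G ** fst (snd x)) $ i $ j) & (\<forall>i. (G *v 1) $ i <= D))"

definition valid :: "'m::finite env => bool" where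
 "valid e \<longleftrightarrow> (\<forall>n. e n \<in> triples)"

lemma step_op_mono:
 assumes "valid e"
  and "!!j. f (n+1) j <= g (n+1) j" "!!j. f n j <= g n j" "!!j. f (n-1) j <= g (n-1) j"
 shows "step_op e f n i <= step_op e g n i"
 unfolding step_op_def using assms(1)[unfolded valid_def, rule_format, of n] assms(2-)
 by (intro sum_mono add_mono mult_left_mono) (auto simp: triples_def less_eq_vec_def)

lemma triples_sum:
 assumes "e n \<in> triples"
 shows "(SUM j:UNIV. up e n $ i $ j + stay e n $ i $ j + down e n $ i $ j) = 1"
proof -
 have "((up e n + down e n + stay e n) *v 1) $ i = 1"
  using assms by (auto simp: triples_def split_def)
 thus ?thesis by (simp add: matrix_vector_mult_def algebra_simps)
qed

lemma step_op_const:
 assumes "valid e"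
 shows "step_op e (%_ _. c) n i = c"
proof -
 have "step_op e (%_ _. c) n i = c * (SUM j:UNIV. up e n $ i $ j + stay e n $ i $ j + down e n $ i $ j)"
  unfolding step_op_def by (simp add: sum_distrib_left algebra_simps)
 thus ?thesis using assms by (simp add: triples_sum valid_def)
qed

lemma step_op_add: "step_op e (%n i. f n i + g n i) n i = step_op e f n i + step_op e g n i"
 unfolding step_op_def by (simp add: sum.distrib algebra_simps)

lemma step_op_cmult: "step_op e (%n i. c * f n i) n i = c * step_op e f n i"
 unfolding step_op_def by (simp add: sum_distrib_left algebra_simps)

lemma step_op_diff: "step_op e (%n i. f n i - g n i) n i = step_op e f n i - step_op e g n i"
 unfolding step_op_def sum_subtractf[symmetric] by (intro sum.cong) (auto simp: algebra_simps)

lemma step_op_sum: "finite S ==> step_op e (%n i. SUM s:S. f s n i) n i = (SUM s:S. step_op e (f s) n i)"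
 by (induction S rule: finite_induct) (auto simp: step_op_add, simp add: step_op_def)

lemma step_op_cong:
 assumes "f (n+1) = g (n+1)" "f n = g n" "f (n-1) = g (n-1)"
 shows "step_op e f n = step_op e g n"
 using assms by (auto simp: step_op_def)

lemma step_op_env_cong: "e n = e' n ==> step_op e f n = step_op e' f n"
 by (auto simp: step_op_def)

section \<open>Exit probabilities of an interval\<close>

fun hit :: "'m::finite env => int => int => nat => int => 'm => real" where
 "hit e a b 0 n i = (if n >= b then 1 else 0)"
| "hit e a b (Suc t) n i = (if n <= a then 0 else if n >= b then 1 else step_op e (hit e a b t) n i)"

text \<open>For valid environments an increasing limit of polynomials in the entries; this form
  yields measurability and, in \<open>exit_up_lsc\<close>, semicontinuity.\<close>

definition exit_up :: "'m::finite env => int => int => int => 'm => real" where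
 "exit_up e a b n i = lim (%t. hit e a b t n i)"

lemma hit_bounds:
 assumes "valid e"
 shows "0 <= hit e a b t n i & hit e a b t n i <= 1"
proof (induction t arbitrary: n i)
 case (Suc t)
 have "step_op e (%_ _. 0) n i <= step_op e (hit e a b t) n i"
  by (intro step_op_mono assms) (use Suc in auto)
 moreover have "step_op e (hit e a b t) n i <= step_op e (%_ _. 1) n i"
  by (intro step_op_mono assms) (use Suc in auto)
 ultimately show ?case using step_op_const[of e] assms by simp
qed simp

lemma hit_Suc_mono:
 assumes "valid e" "a < b"
 shows "hit e a b t n i <= hit e a b (Suc t) n i"
proof (induction t arbitrary: n i)
 case 0
 show ?case using hit_bounds[OF assms(1), of a b "Suc 0" n i] assms(2) by auto
next
 case (Suc t)
 have "step_op e (hit e a b t) n i <= step_op e (hit e a b (Suc t)) n i"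
  by (intro step_op_mono assms Suc)
 thus ?case by (simp del: hit.simps(2) add: hit.simps(2)[of e a b t] hit.simps(2)[of e a b "Suc t"])
qed

lemma exit_up_tendsto:
 assumes "valid e" "a < b"
 shows "(%t. hit e a b t n i) \<longlonglongrightarrow> exit_up e a b n i"
proof -
 have "incseq (%t. hit e a b t n i)" using hit_Suc_mono[OF assms] by (intro incseq_SucI)
 moreover have "\<forall>t. hit e a b t n i <= 1" using hit_bounds[OF assms(1)] by metis
 ultimately obtain L where "(%t. hit e a b t n i) \<longlonglongrightarrow> L"
  by (rule incseq_convergent)
 thus ?thesis unfolding exit_up_def by (simp add: limI)
qed

lemma hit_le_exit_up:
 assumes "valid e" "a < b"
 shows "hit e a b t n i <= exit_up e a b n i"
proof -
 have "incseq (%t. hit e a b t n i)" using hit_Suc_mono[OF assms] by (intro incseq_SucI)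
 thus ?thesis using incseq_le exit_up_tendsto[OF assms] by metis
qed

lemma exit_up_below: "n <= a ==> a < b ==> exit_up e a b n i = 0"
proof -
 assume "n <= a" "a < b"
 hence "hit e a b t n i = 0" for t by (cases t) auto
 thus ?thesis unfolding exit_up_def by simp
qed

lemma exit_up_above: "b <= n ==> a < b ==> exit_up e a b n i = 1"
proof -
 assume "b <= n" "a < b"
 hence "hit e a b t n i = 1" for t by (cases t) auto
 thus ?thesis unfolding exit_up_def by simp
qed

lemma step_op_tendsto:
 assumes "!!n i. (%t. f t n i) \<longlonglongrightarrow> g n i"
 shows "(%t. step_op e (f t) n i) \<longlonglongrightarrow> step_op e g n i"
 unfolding step_op_def by (intro tendsto_intros assms)

lemma exit_up_harmonic:
 assumes "valid e" "a < n" "n < b"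
 shows "exit_up e a b n i = step_op e (exit_up e a b) n i"
proof -
 have "a < b" using assms by simp
 have "(%t. hit e a b (Suc t) n i) \<longlonglongrightarrow> exit_up e a b n i"
  using exit_up_tendsto[OF assms(1) \<open>a < b\<close>] by (rule LIMSEQ_Suc)
 moreover have "(%t. hit e a b (Suc t) n i) \<longlonglongrightarrow> step_op e (exit_up e a b) n i"
  using assms step_op_tendsto[OF exit_up_tendsto[OF assms(1) \<open>a < b\<close>]] by simp
 ultimately show ?thesis by (rule LIMSEQ_unique)
qed

lemma exit_up_bounds:
 assumes "valid e" "a < b"
 shows "0 <= exit_up e a b n i" "exit_up e a b n i <= 1"
proof -
 show "0 <= exit_up e a b n i"
  by (rule LIMSEQ_le_const[OF exit_up_tendsto[OF assms]]) (use hit_bounds[OF assms(1)] in blast)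
 show "exit_up e a b n i <= 1"
  by (rule LIMSEQ_le_const2[OF exit_up_tendsto[OF assms]]) (use hit_bounds[OF assms(1)] in blast)
qed

section \<open>The walk observed when it changes layer\<close>

locale elliptic_env =
 fixes e :: "'m::finite env" and \<epsilon> D :: real
 assumes eps_pos: "0 < \<epsilon>" and ell: "!!n. elliptic \<epsilon> D (e n)"
begin

lemma trip: "valid e" using ell by (simp add: elliptic_def valid_def)

definition G :: "int => real ^ 'm ^ 'm" where
 "G n = (SOME G. 0 <= G & G ** (mat 1 - stay e n) = mat 1 &
    (\<forall>i j. \<epsilon> <= (G ** up e n) $ i $ j & \<epsilon> <= (G ** down e n) $ i $ j) & (\<forall>i. (G *v 1) $ i <= D))"

lemma G: "0 <= G n" "G n ** (mat 1 - stay e n) = mat 1"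
  "\<epsilon> <= (G n ** up e n) $ i $ j" "\<epsilon> <= (G n ** down e n) $ i $ j" "(G n *v 1) $ i <= D"
proof -
 have "\<exists>G. 0 <= G & G ** (mat 1 - stay e n) = mat 1 &
    (\<forall>i j. \<epsilon> <= (G ** up e n) $ i $ j & \<epsilon> <= (G ** down e n) $ i $ j) & (\<forall>i. (G *v 1) $ i <= D)"
  using ell[of n] by (simp add: elliptic_def)
 from someI_ex[OF this, folded G_def]
 show "0 <= G n" "G n ** (mat 1 - stay e n) = mat 1"
  "\<epsilon> <= (G n ** up e n) $ i $ j" "\<epsilon> <= (G n ** down e n) $ i $ j" "(G n *v 1) $ i <= D"
  by auto
qed

lemma G_right: "(mat 1 - stay e n) ** G n = mat 1"
 using G(2)[of n] by (simp add: matrix_left_right_inverse)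

lemma G_nonneg: "0 <= G n $ i $ j"
 using G(1)[of n] by (simp add: less_eq_vec_def)

abbreviation A :: "int => 'm => 'm => real" where "A n i j \<equiv> (G n ** up e n) $ i $ j"
abbreviation B :: "int => 'm => 'm => real" where "B n i j \<equiv> (G n ** down e n) $ i $ j"

text \<open>The average over the site at which the walk first arrives in another layer. Unlike those
  of \<open>step_op\<close>, its weights are all at least \<open>\<epsilon>\<close>, which is what
  the maximum principle and the Harnack inequality use.\<close>

definition emb :: "(int => 'm => real) => int => 'm => real" where
 "emb f n i = (SUM j:UNIV. A n i j * f (n + 1) j + B n i j * f (n - 1) j)"

text \<open>Apply \<open>G n\<close> to the defect of \<open>f\<close> on layer \<open>n\<close> and
  use \<open>G n ** (mat 1 - stay e n) = mat 1\<close>: harmonicity for the walk becomes harmonicity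
  for the embedded walk.\<close>

lemma G_step:
 "f (n::int) i = (SUM k:UNIV. G n $ i $ k * (f n k - step_op e f n k)) + emb f n i"
proof -
 define v where "v m = (\<chi> j. f m j)" for m :: int
 have so: "step_op e f n k = (up e n *v v (n+1) + stay e n *v v n + down e n *v v (n-1)) $ k" for k
  unfolding step_op_def v_def matrix_vector_mult_def by (simp only: sum.distrib vector_add_component vec_lambda_beta)
 have "(SUM k:UNIV. G n $ i $ k * (f n k - step_op e f n k))
  = (G n *v (v n - (up e n *v v (n+1) + stay e n *v v n + down e n *v v (n-1)))) $ i"
  unfolding so by (simp only: matrix_vector_mult_def[of "G n"] vec_lambda_beta vector_minus_component)
   (simp add: v_def)
 also have "v n - (up e n *v v (n+1) + stay e n *v v n + down e n *v v (n-1))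
  = (mat 1 - stay e n) *v v n - up e n *v v (n+1) - down e n *v v (n-1)"
  by (simp add: matrix_vector_mult_diff_rdistrib)
 also have "(G n *v ...) $ i
  = ((G n ** (mat 1 - stay e n)) *v v n - (G n ** up e n) *v v (n+1) - (G n ** down e n) *v v (n-1)) $ i"
  by (simp only: matrix_vector_mult_diff_distrib matrix_vector_mul_assoc)
 also have "... = f n i - emb f n i"
  unfolding G(2) matrix_vector_mul_lid unfolding emb_def v_def matrix_vector_mult_def
  by (simp only: sum.distrib vector_minus_component vector_add_component vec_lambda_beta diff_diff_eq)
 finally show ?thesis by simp
qed

lemma emb_ge: "(!!k. f n k <= step_op e f n k) ==> f n i <= emb f n i"
 using G_step[of f n i] G_nonneg by (smt (verit) mult_nonneg_nonpos sum_nonpos)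

lemma emb_eq: "(!!k. f n k = step_op e f n k) ==> f n i = emb f n i"
 using G_step[of f n i] by simp

lemma AB_sum: "(SUM j:UNIV. A n i j + B n i j) = 1"
 using emb_eq[of "%_ _. 1" n i] step_op_const[OF trip, of 1] by (simp add: emb_def)

lemma A_nonneg: "0 <= A n i j" using G(3)[of n i j] eps_pos by simp
lemma B_nonneg: "0 <= B n i j" using G(4)[of n i j] eps_pos by simp

lemma AB_le1: "A n i j <= 1" "B n i j <= 1"
proof -
 have "A n i j + B n i j <= (SUM j:UNIV. A n i j + B n i j)"
  by (rule member_le_sum) (auto simp: A_nonneg B_nonneg add_nonneg_nonneg)
 thus "A n i j <= 1" "B n i j <= 1" using A_nonneg[of n i j] B_nonneg[of n i j] by (simp_all add: AB_sum)
qed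

lemma eps_le1: "\<epsilon> <= 1" using G(3) AB_le1(1) by (meson order_trans)

lemma emb_lt:
 assumes "!!j. f (n+1) j <= M" "!!j. f (n-1) j < M"
 shows "emb f n i < M"
proof -
 have "emb f n i < (SUM j:UNIV. A n i j * M + B n i j * M)"
  unfolding emb_def
  by (rule sum_strict_mono)
   (use assms A_nonneg G(4)[of n i] eps_pos in \<open>auto intro!: add_le_less_mono mult_left_mono mult_strict_left_mono simp: less_le_trans\<close>)
 also have "... = M * (SUM j:UNIV. A n i j + B n i j)" by (simp add: sum_distrib_left algebra_simps)
 finally show ?thesis by (simp add: AB_sum)
qed

text \<open>The maximum cannot first be attained, counted from \<open>a\<close>, inside the
  interval: all sites of the layer to the left would then lie strictly below it and carry positive
  weight in the embedded average.\<close>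

lemma max_principle:
 assumes sub: "!!n i. a < n ==> n < b ==> f n i <= step_op e f n i"
  and bd: "!!i. f a i <= M" "!!i. f b i <= M" and n: "a <= n" "n <= b"
 shows "f n i <= M"
proof (rule ccontr)
 assume neg: "~ f n i <= M"
 define m where "m = Max ((%(n,i). f n i) ` ({a..b} \<times> UNIV))"
 have mge: "f n i <= m" if "a <= n" "n <= b" for n i
  unfolding m_def using that by (intro Max_ge) (auto simp: image_iff)
 have "m \<in> (%(n,i). f n i) ` ({a..b} \<times> UNIV)"
  unfolding m_def using n by (intro Max_in) auto
 then obtain n0 i0 where n0: "a <= n0" "n0 <= b" "f n0 i0 = m" by auto
 then have "a + int (nat (n0 - a)) <= b & f (a + int (nat (n0 - a))) i0 = m" by simp
 then have ex: "\<exists>k. \<exists>i. a + int k <= b & f (a + int k) i = m" by blast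
 define k where "k = (LEAST k. \<exists>i. a + int k <= b & f (a + int k) i = m)"
 obtain i' where k: "a + int k <= b" "f (a + int k) i' = m" using LeastI_ex[OF ex] unfolding k_def by auto
 have mM: "m > M" using neg mge[OF n, of i] by simp
 have k0: "k > 0" using k bd(1)[of i'] mM by (cases k) auto
 have kb: "a + int k < b" using k bd(2)[of i'] mM by (cases "a + int k = b") auto
 have less: "f (a + int k - 1) j < m" for j
 proof -
  have "a + int (k-1) <= b" using k by auto
  moreover have "f (a + int (k-1)) j \<noteq> m"
   using not_less_Least[of "k-1" "%k. \<exists>i. a + int k <= b & f (a + int k) i = m"] k0 k(1) unfolding k_def[symmetric] by auto
  moreover have "a + int (k-1) = a + int k - 1" using k0 by auto
  ultimately have "f (a + int k - 1) j \<noteq> m" by metis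
  moreover have "f (a + int k - 1) j <= m" by (rule mge) (use k0 kb in auto)
  ultimately show ?thesis by linarith
 qed
 have "emb f (a + int k) i' < m"
  by (rule emb_lt) (use mge[of "a + int k + 1"] kb less in auto)
 moreover have "f (a + int k) i' <= emb f (a + int k) i'"
  by (rule emb_ge) (use sub k0 kb in auto)
 ultimately show False using k by simp
qed

lemma harmonic_unique:
 assumes "!!n i. a < n ==> n < b ==> f n i = step_op e f n i"
  "!!n i. a < n ==> n < b ==> g n i = step_op e g n i"
  "!!i. f a i = g a i" "!!i. f b i = g b i" "a <= n" "n <= b"
 shows "f n i = g n i"
proof -
 have "f n i - g n i <= 0"
  by (rule max_principle[where a=a and b=b]) (use assms in \<open>auto simp: step_op_diff\<close>)
 moreover have "g n i - f n i <= 0"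
  by (rule max_principle[where a=a and b=b]) (use assms in \<open>auto simp: step_op_diff\<close>)
 ultimately show ?thesis by simp
qed

text \<open>Seen from any two sites of a layer the exit weights lie between
  \<open>\<epsilon>\<close> and 1, so the two averages of a non-negative function over the
  neighbouring layers are comparable.\<close>

lemma harnack:
 assumes "!!k. f n k = step_op e f n k" "!!j. 0 <= f (n+1) j" "!!j. 0 <= f (n-1) j"
 shows "\<epsilon> * f n i <= f n i'"
proof -
 have "\<epsilon> * emb f n i <= emb f n i'"
  unfolding emb_def sum_distrib_left
 proof (rule sum_mono)
  fix j
  have "\<epsilon> * A n i j <= A n i' j" "\<epsilon> * B n i j <= B n i' j"
   using AB_le1[of n i j] G(3,4)[of n i' j] eps_pos
   by (smt (verit) mult_left_le)+
  thus "\<epsilon> * (A n i j * f (n + 1) j + B n i j * f (n - 1) j) <= A n i' j * f (n + 1) j + B n i' j * f (n - 1) j"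
   using mult_right_mono[OF _ assms(2), of "\<epsilon> * A n i j" "A n i' j" j] mult_right_mono[OF _ assms(3), of "\<epsilon> * B n i j" "B n i' j" j]
   by (simp add: algebra_simps)
 qed
 thus ?thesis using emb_eq[of f n] assms(1) by simp
qed

lemma exit_up_pos: assumes "a < n" "n <= b" shows "0 < exit_up e a b n i"
proof -
 have ab: "a < b" using assms by simp
 have "a < n --> (\<forall>i. 0 < exit_up e a b n i)" using \<open>n <= b\<close>
 proof (induction n rule: int_le_induct)
  case base thus ?case using exit_up_above[of b b a e] ab by simp
 next
  case (step m)
  show ?case
  proof (intro impI allI)
   fix i assume am: "a < m - 1"
   have pos: "0 < exit_up e a b m j" for j using step am by auto
   have "0 < (SUM j:UNIV. A (m-1) i j * exit_up e a b (m-1+1) j + B (m-1) i j * exit_up e a b (m-1-1) j)"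
    by (rule sum_pos) (use pos G(3)[of "m-1" i] eps_pos B_nonneg exit_up_bounds(1)[OF trip ab] in
     \<open>auto intro!: add_pos_nonneg mult_pos_pos mult_nonneg_nonneg simp: less_le_trans\<close>)
   also have "... = exit_up e a b (m-1) i"
    using emb_eq[of "exit_up e a b" "m-1" i] exit_up_harmonic[OF trip, of a "m-1" b] am step by (auto simp: emb_def)
   finally show "0 < exit_up e a b (m - 1) i" .
  qed
 qed
 thus ?thesis using assms by blast
qed

end

section \<open>Reflection of the strip\<close>

definition mirror :: "'m::finite env => 'm env" where
 "mirror e n = (down e (- n), up e (- n), stay e (- n))"

lemma mirror_mirror [simp]: "mirror (mirror e) = e"
 by (auto simp: mirror_def fun_eq_iff)

lemma elliptic_mirror: "elliptic \<epsilon> D (e (- n)) ==> elliptic \<epsilon> D (mirror e n)"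
 unfolding mirror_def elliptic_def triples_def split_def by (auto simp: add.commute)

lemma step_op_mirror: "step_op (mirror e) f n i = step_op e (%k. f (- k)) (- n) i"
 unfolding step_op_def mirror_def by (intro sum.cong) (auto simp: algebra_simps)

lemma (in elliptic_env) mirror_env: "elliptic_env (mirror e) \<epsilon> D"
 by unfold_locales (use eps_pos ell in \<open>simp_all add: elliptic_mirror\<close>)

context elliptic_env begin

text \<open>Both sides are harmonic with the same boundary values. This is where almost sure exit
  from the interval is used: on the reflected strip \<open>exit_up\<close> is the chance of reaching
  \<open>a\<close> first, and the two exit chances add up to 1.\<close>

lemma exit_up_mirror:
 assumes "a < b"
 shows "exit_up (mirror e) (-b) (-a) n i = 1 - exit_up e a b (-n) i"
proof -
 interpret m: elliptic_env "mirror e" \<epsilon> D by (rule mirror_env)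
 consider "n <= -b" | "n >= -a" | "-b < n" "n < -a" by linarith
 thus ?thesis
 proof cases
  case 1 thus ?thesis using assms by (simp add: exit_up_below exit_up_above)
 next
  case 2 thus ?thesis using assms by (simp add: exit_up_below exit_up_above)
 next
  case 3
  show ?thesis
  proof (rule m.harmonic_unique[where a="-b" and b="-a" and g="%n i. 1 - exit_up e a b (-n) i"])
   fix n i assume "-b < n" "n < -a"
   thus "exit_up (mirror e) (-b) (-a) n i = step_op (mirror e) (exit_up (mirror e) (-b) (-a)) n i"
    by (intro exit_up_harmonic m.trip)
   have "step_op (mirror e) (%n i. 1 - exit_up e a b (-n) i) n i = 1 - step_op e (exit_up e a b) (-n) i"
    unfolding step_op_mirror by (simp add: step_op_diff step_op_const trip)
   also have "step_op e (exit_up e a b) (-n) i = exit_up e a b (-n) i"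
    using exit_up_harmonic[OF trip, of a "-n" b i] \<open>-b < n\<close> \<open>n < -a\<close> by auto
   finally show "1 - exit_up e a b (-n) i = step_op (mirror e) (%n i. 1 - exit_up e a b (-n) i) n i" by simp
  qed (use 3 assms in \<open>auto simp: exit_up_below exit_up_above\<close>)
 qed
qed

lemma exit_up_less1: assumes "a <= n" "n < b" shows "exit_up e a b n i < 1"
proof -
 interpret m: elliptic_env "mirror e" \<epsilon> D by (rule mirror_env)
 show ?thesis using m.exit_up_pos[of "-b" "-n" "-a" i] exit_up_mirror[of a b "-n" i] assms by simp
qed

lemma exit_up_harnack: assumes "a < b" "n \<noteq> a"
 shows "\<epsilon> * exit_up e a b n i <= exit_up e a b n i'"
proof (cases "a < n & n < b")
 case True
 thus ?thesis using exit_up_harmonic[OF trip] exit_up_bounds(1)[OF trip] assms by (intro harnack) auto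
next
 case False
 thus ?thesis using assms eps_le1 eps_pos by (cases "n <= a") (auto simp: exit_up_below exit_up_above)
qed

lemma exit_down_harnack: assumes "a < b" "n \<noteq> b"
 shows "\<epsilon> * (1 - exit_up e a b n i) <= 1 - exit_up e a b n i'"
proof -
 interpret m: elliptic_env "mirror e" \<epsilon> D by (rule mirror_env)
 show ?thesis using m.exit_up_harnack[of "-b" "-a" "-n" i i'] exit_up_mirror[of a b "-n"] assms by simp
qed

end

text \<open>
  The potential difference between the edges \<open>{a, a + 1}\<close> and \<open>{b - 1, b}\<close>. In the case of a single
  state per layer it is exactly the logarithm of the product of the ratios \<open>Q / P\<close> over the layers
  strictly between \<open>a\<close> and \<open>b\<close>.
\<close>

definition pot :: "'m::finite env => int => int => real" where
 "pot e a b = ln ((1 - exit_up e a b (b - 1) undefined) / exit_up e a b (a + 1) undefined)"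

lemma pot_unit: "pot e a (a + 1) = 0"
 by (simp add: pot_def exit_up_below exit_up_above)

lemma (in elliptic_env) exp_pot:
 "a < b ==> exp (pot e a b) = (1 - exit_up e a b (b - 1) undefined) / exit_up e a b (a + 1) undefined"
 unfolding pot_def using exit_up_pos[of a "a+1" b] exit_up_less1[of a "b-1" b] by simp

lemma (in elliptic_env) pot_mirror: "a < b ==> pot (mirror e) (-b) (-a) = - pot e a b"
proof -
 assume "a < b"
 have "- (- a - 1) = a + 1" "- (- b + 1) = b - 1" by auto
 hence "pot (mirror e) (-b) (-a) = ln (exit_up e a b (a+1) undefined / (1 - exit_up e a b (b-1) undefined))"
  unfolding pot_def using exit_up_mirror[OF \<open>a < b\<close>] by (simp add: add.commute)
 thus ?thesis unfolding pot_def using exit_up_pos[of a "a+1" b undefined] exit_up_less1[of a "b-1" b undefined] \<open>a < b\<close>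
  by (simp add: ln_div)
qed

lemma hit_cong:
 assumes "!!n. a < n ==> n < b ==> e n = e' n"
 shows "hit e a b t n i = hit e' a b t n i"
proof (induction t arbitrary: n i)
 case (Suc t)
 hence "hit e a b t = hit e' a b t" by (auto simp: fun_eq_iff)
 thus ?case using assms[of n] step_op_env_cong[of e n e'] by (cases "a < n"; cases "n < b"; simp)
qed simp

text \<open>Locality on the open interval: potentials of intervals that share only an endpoint are
  functions of disjoint sets of layers, hence independent in a random environment.\<close>

lemma pot_cong:
 assumes "!!n. a < n ==> n < b ==> e n = e' n"
 shows "pot e a b = pot e' a b"
 unfolding pot_def exit_up_def using hit_cong[of a b e e'] assms by simp

lemma hit_shift: "hit e (a + k) (b + k) t (n + k) i = hit (%n. e (n + k)) a b t n i"
proof (induction t arbitrary: n i)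
 case (Suc t)
 have "hit e (a+k) (b+k) t (n+k+1) j = hit (%n. e (n + k)) a b t (n+1) j"
  "hit e (a+k) (b+k) t (n+k-1) j = hit (%n. e (n + k)) a b t (n-1) j" for j
  using Suc[of "n+1" j] Suc[of "n-1" j] by (simp_all add: algebra_simps)
 thus ?case by (simp add: step_op_def Suc)
qed simp

lemma pot_shift: "pot e (a + k) (b + k) = pot (%n. e (n + k)) a b"
proof -
 have *: "exit_up e (a+k) (b+k) (n+k) i = exit_up (%n. e (n + k)) a b n i" for n i
  by (simp add: exit_up_def hit_shift)
 show ?thesis using *[of "b-1"] *[of "a+1"] unfolding pot_def by (simp add: algebra_simps)
qed

section \<open>Invariant measures and the potential\<close>

text \<open>Induction on the number of states: a state \<open>s\<close> is eliminated by watching the chain outside \<open>s\<close> only.\<close>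

lemma finite_stationary_exists:
 fixes q :: "'s => 's => real"
 assumes "finite S" "S \<noteq> {}" "!!x y. x \<in> S ==> y \<in> S ==> 0 <= q x y" "!!x. x \<in> S ==> (SUM y:S. q x y) = 1"
 shows "\<exists>\<mu>. (\<forall>x\<in>S. 0 <= \<mu> x) & (SUM x:S. \<mu> x) = 1 & (\<forall>y\<in>S. (SUM x:S. \<mu> x * q x y) = \<mu> y)"
 using assms
proof (induction S arbitrary: q rule: finite_ne_induct)
 case (singleton x)
 thus ?case by (intro exI[of _ "%_. 1"]) auto
next
 case (insert s F)
 have row: "(SUM y:F. q x y) = 1 - q x s" if "x \<in> insert s F" for x
  using insert.prems(2)[OF that] insert.hyps by simp
 show ?case
 proof (cases "q s s = 1")
  case True
  have "(SUM y:F. q s y) = 0" using row[of s] True by simp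
  hence z: "q s y = 0" if "y \<in> F" for y
   using that insert.hyps insert.prems(1)[of s] by (subst (asm) sum_nonneg_eq_0_iff) auto
  show ?thesis
  proof (intro exI[of _ "%x. if x = s then 1 else 0"] conjI ballI)
   fix y assume "y \<in> insert s F"
   have "(SUM x:insert s F. (if x = s then 1 else 0) * q x y) = q s y"
    using insert.hyps by (simp add: if_distrib[of "%x. x * _"] sum.delta cong: if_cong)
   thus "(SUM x:insert s F. (if x = s then 1 else 0) * q x y) = (if y = s then 1 else 0)"
    using z True \<open>y \<in> insert s F\<close> by auto
  qed (use insert.hyps in \<open>auto simp: sum.delta\<close>)
 next
  case False
  have "0 <= (SUM y:F. q s y)" using insert.prems(1) by (intro sum_nonneg) auto
  hence c: "1 - q s s > 0" using row[of s] False by simp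
  \<comment> \<open>Transition probabilities of the chain watched on \<open>F\<close>; the geometric
    series of stays at \<open>s\<close> gives the factor \<open>1 / (1 - q s s)\<close>.\<close>
  define q' where "q' x y = q x y + q x s * q s y / (1 - q s s)" for x y
  have q'0: "0 <= q' x y" if "x \<in> F" "y \<in> F" for x y
   unfolding q'_def using that c insert.prems(1) by (auto intro!: add_nonneg_nonneg mult_nonneg_nonneg divide_nonneg_nonneg)
  have q'1: "(SUM y:F. q' x y) = 1" if "x \<in> F" for x
  proof -
   have "(SUM y:F. q' x y) = (SUM y:F. q x y) + q x s * (SUM y:F. q s y) / (1 - q s s)"
    unfolding q'_def by (simp add: sum.distrib sum_distrib_left sum_divide_distrib)
   thus ?thesis using row[of x] row[of s] that c by simp
  qed
  obtain \<mu>' where m: "\<forall>x\<in>F. 0 <= \<mu>' x" "(SUM x:F. \<mu>' x) = 1" "\<forall>y\<in>F. (SUM x:F. \<mu>' x * q' x y) = \<mu>' y"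
   using insert.IH[of q'] q'0 q'1 by blast
  \<comment> \<open>The balance equation at \<open>s\<close> forces this mass; division by
    \<open>1 + ms\<close> restores total mass 1.\<close>
  define ms where "ms = (SUM x:F. \<mu>' x * q x s) / (1 - q s s)"
  have ms0: "0 <= ms" unfolding ms_def using c m(1) insert.prems(1) by (intro divide_nonneg_pos sum_nonneg mult_nonneg_nonneg) auto
  define \<mu> where "\<mu> x = (if x = s then ms else \<mu>' x) / (1 + ms)" for x
  have split: "(SUM x:insert s F. \<mu> x * g x) = (ms * g s + (SUM x:F. \<mu>' x * g x)) / (1 + ms)" for g
  proof -
   have "(SUM x:F. \<mu> x * g x) = (SUM x:F. \<mu>' x * g x) / (1 + ms)"
    unfolding sum_divide_distrib using insert.hyps by (intro sum.cong) (auto simp: \<mu>_def)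
   thus ?thesis using insert.hyps by (simp add: \<mu>_def add_divide_distrib)
  qed
  show ?thesis
  proof (intro exI[of _ \<mu>] conjI ballI)
   show "0 <= \<mu> x" if "x \<in> insert s F" for x using that m(1) ms0 by (auto simp: \<mu>_def)
   show "(SUM x:insert s F. \<mu> x) = 1" using split[of "%_. 1"] m(2) ms0 by simp
   fix y assume y: "y \<in> insert s F"
   show "(SUM x:insert s F. \<mu> x * q x y) = \<mu> y"
   proof (cases "y = s")
    case True
    have "ms * q s s + (SUM x:F. \<mu>' x * q x s) = ms" using c by (simp add: ms_def field_simps)
    thus ?thesis unfolding split True by (simp add: \<mu>_def)
   next
    case False
    hence "y \<in> F" using y by simp
    have "\<mu>' y = (SUM x:F. \<mu>' x * q' x y)" using m(3) \<open>y \<in> F\<close> by simp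
    also have "... = (SUM x:F. \<mu>' x * q x y) + ms * q s y"
     unfolding q'_def ms_def by (simp add: sum.distrib distrib_left sum_distrib_right sum_divide_distrib mult.assoc)
    finally show ?thesis unfolding split using False by (simp add: \<mu>_def add.commute)
   qed
  qed
 qed
qed

context elliptic_env begin

text \<open>Reflecting walls: from layer \<open>L\<close> the walk always moves up and from
  \<open>R\<close> always down, keeping its state within the layer.\<close>

definition boxed :: "int => int => 'm env" where
 "boxed L R = e(L := (mat 1, 0, 0), R := (0, mat 1, 0))"

lemma boxed_valid: "valid (boxed L R)"
proof -
 have "(mat 1 + 0 + 0) *v 1 = (1::real^'m)" "(0 + mat 1 + 0) *v 1 = (1::real^'m)" by simp_all
 moreover have "0 <= (mat 1 :: real^'m^'m)" by (simp add: less_eq_vec_def mat_def)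
 ultimately show ?thesis using trip unfolding valid_def boxed_def by (auto simp: triples_def)
qed

lemma boxed_inner: "L < n ==> n < R ==> boxed L R n = e n"
 by (simp add: boxed_def)

text \<open>Since the walls keep the walk inside the box, \<open>step_op\<close> acts there as a
  finite stochastic matrix \<open>q\<close>, read off on indicators of sites.\<close>

lemma box_measure_exists:
 assumes "L < R"
 shows "\<exists>\<mu>::int => 'm => real. (\<forall>n\<in>{L..R}. \<forall>i. 0 <= \<mu> n i) & (SUM n:{L..R}. SUM i:UNIV. \<mu> n i) = 1 &
  (\<forall>f. (SUM n:{L..R}. SUM i:UNIV. \<mu> n i * step_op (boxed L R) f n i) = (SUM n:{L..R}. SUM i:UNIV. \<mu> n i * f n i))"
proof -
 let ?S = "{L..R} \<times> (UNIV :: 'm set)"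
 let ?e = "boxed L R"
 define ind :: "int \<times> 'm => int => 'm => real" where "ind s n i = (if (n, i) = s then 1 else 0)" for s n i
 define q where "q x y = step_op ?e (ind y) (fst x) (snd x)" for x y
 have rep: "step_op ?e f n i = (SUM s:?S. q (n, i) s * f (fst s) (snd s))" if n: "n \<in> {L..R}" for f n i
 proof -
  let ?g = "%n i. SUM s:?S. f (fst s) (snd s) * ind s n i"
  have g: "?g n i = (if n \<in> {L..R} then f n i else 0)" for n i
   unfolding ind_def by (auto simp: if_distrib[of "%x. _ * x"] sum.delta cong: if_cong)
  have "step_op ?e f n i = step_op ?e ?g n i"
   unfolding step_op_def g using n assms by (intro sum.cong) (auto simp: boxed_def)
  also have "... = (SUM s:?S. f (fst s) (snd s) * step_op ?e (ind s) n i)"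
   by (subst step_op_sum) (auto simp: step_op_cmult)
  finally show ?thesis by (simp add: q_def mult.commute)
 qed
 have q0: "0 <= q x y" for x y
  using step_op_mono[OF boxed_valid[of L R], of "%_ _. 0" "fst x" "ind y" "snd x"] step_op_const[OF boxed_valid, of L R 0]
  unfolding q_def by (auto simp: ind_def)
 have q1: "(SUM y:?S. q x y) = 1" if "x \<in> ?S" for x
  using rep[of "fst x" "%_ _. 1" "snd x"] step_op_const[OF boxed_valid, of L R 1] that by auto
 obtain \<mu> where m: "\<forall>x\<in>?S. 0 <= \<mu> x" "(SUM x:?S. \<mu> x) = 1" "\<forall>y\<in>?S. (SUM x:?S. \<mu> x * q x y) = \<mu> y"
  using finite_stationary_exists[of ?S q] q0 q1 assms by auto
 show ?thesis
 proof (intro exI[of _ "%n i. \<mu> (n, i)"] conjI allI)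
  show "(SUM n:{L..R}. SUM i:UNIV. \<mu> (n, i)) = 1"
   using m(2) by (simp add: sum.cartesian_product case_prod_unfold)
  show "\<forall>n\<in>{L..R}. \<forall>i. 0 <= \<mu> (n, i)" using m(1) by auto
  fix f
  have "(SUM n:{L..R}. SUM i:UNIV. \<mu> (n, i) * step_op ?e f n i)
    = (SUM n:{L..R}. SUM i:UNIV. \<mu> (n, i) * (SUM s:?S. q (n, i) s * f (fst s) (snd s)))"
   by (intro sum.cong refl) (simp add: rep)
  also have "... = (SUM x:?S. \<mu> x * (SUM s:?S. q x s * f (fst s) (snd s)))"
   by (simp add: sum.cartesian_product case_prod_unfold)
  also have "... = (SUM s:?S. (SUM x:?S. \<mu> x * q x s) * f (fst s) (snd s))"
   unfolding sum_distrib_left sum_distrib_right by (subst sum.swap) (simp add: mult.assoc)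
  also have "... = (SUM s:?S. \<mu> s * f (fst s) (snd s))"
   by (rule sum.cong[OF refl]) (use m(3) in auto)
  finally show "(SUM n:{L..R}. SUM i:UNIV. \<mu> (n, i) * step_op ?e f n i) = (SUM n:{L..R}. SUM i:UNIV. \<mu> (n, i) * f n i)"
   by (simp add: sum.cartesian_product case_prod_unfold)
 qed
qed

end

section \<open>Stationary flows in a box\<close>

locale box_measure = elliptic_env +
 fixes L R :: int and \<mu> :: "int => 'a => real"
 assumes LR: "L < R" and mu_nonneg: "!!n i. L <= n ==> n <= R ==> 0 <= \<mu> n i"
  and mu_total: "(SUM n:{L..R}. SUM i:UNIV. \<mu> n i) = 1"
  and mu_inv: "!!f. (SUM n:{L..R}. SUM i:UNIV. \<mu> n i * step_op (boxed L R) f n i) = (SUM n:{L..R}. SUM i:UNIV. \<mu> n i * f n i)"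
begin

abbreviation "be \<equiv> boxed L R"

text \<open>The stationary flow upwards across the edge from \<open>n\<close> to
  \<open>n + 1\<close>; by \<open>kappa_edge\<close> it equals the flow downwards. Its negative
  logarithm \<open>V\<close> is a function of the layer, so differences of \<open>V\<close> are
  exactly additive.\<close>

definition \<kappa> :: "int => real" where
 "\<kappa> n = (SUM i:UNIV. \<mu> n i * (SUM j:UNIV. up be n $ i $ j))"

text \<open>The stationary flow into the site \<open>(n, j)\<close> from the two neighbouring
  layers.\<close>

definition \<rho> :: "int => 'a => real" where
 "\<rho> n j = (SUM i:UNIV. \<mu> (n-1) i * up be (n-1) $ i $ j + \<mu> (n+1) i * down be (n+1) $ i $ j)"

lemma be_nonneg: "0 <= up be n $ i $ j" "0 <= down be n $ i $ j" "0 <= stay be n $ i $ j"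
 using boxed_valid[of L R, unfolded valid_def, rule_format, of n]
 by (auto simp: triples_def split_def less_eq_vec_def)

lemma mu_inv0: "(SUM n:{L..R}. SUM i:UNIV. \<mu> n i * (step_op be f n i - f n i)) = 0"
 using mu_inv[of f] by (simp add: algebra_simps sum_subtractf)

text \<open>Invariance is tested on the exit probability, which in the box is harmonic except on the
  layers \<open>a\<close> and \<open>b\<close>. The two remaining terms count the crossings from
  \<open>a\<close> to \<open>b\<close> and from \<open>b\<close> to \<open>a\<close>.\<close>

lemma crossing_balance:
 assumes "L <= a" "a < b" "b <= R"
 shows "(SUM i:UNIV. \<mu> a i * (SUM j:UNIV. up be a $ i $ j * exit_up e a b (a+1) j))
    = (SUM i:UNIV. \<mu> b i * (SUM j:UNIV. down be b $ i $ j * (1 - exit_up e a b (b-1) j)))"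
proof -
 let ?h = "exit_up e a b"
 let ?d = "%n i. step_op be ?h n i - ?h n i"
 have da: "?d a i = (SUM j:UNIV. up be a $ i $ j * ?h (a+1) j)" for i
  using assms by (simp add: step_op_def exit_up_below)
 have "?h b = (%_. 1)" "?h (b+1) = (%_. 1)" using assms by (auto simp: exit_up_above)
 hence "?d b i = step_op be ?h b i - step_op be (%_ _. 1) b i" for i
  using step_op_const[OF boxed_valid, of L R 1] by simp
 also have "... i = (SUM j:UNIV. down be b $ i $ j * (?h (b-1) j - 1))" for i
  using \<open>?h b = (%_. 1)\<close> \<open>?h (b+1) = (%_. 1)\<close> by (simp add: step_op_def sum_subtractf[symmetric] algebra_simps)
 finally have db: "?d b i = - (SUM j:UNIV. down be b $ i $ j * (1 - ?h (b-1) j))" for i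
  by (simp add: sum_negf[symmetric] algebra_simps)
 have d0: "?d n i = 0" if "n \<noteq> a" "n \<noteq> b" "L <= n" "n <= R" for n i
 proof -
  have "n < a \<or> a < n & n < b \<or> b < n" using that by auto
  then consider "n < a" | "a < n" "n < b" | "b < n" by blast
  thus ?thesis
  proof cases
   case 1 thus ?thesis using assms by (simp add: step_op_def exit_up_below)
  next
   case 2
   hence "be n = e n" using assms by (intro boxed_inner) auto
   thus ?thesis using exit_up_harmonic[OF trip 2, of i] step_op_env_cong[of be n e] by simp
  next
   case 3
   hence "step_op be ?h n = step_op be (%_ _. 1) n" using assms by (intro step_op_cong) (auto simp: exit_up_above fun_eq_iff)
   thus ?thesis using 3 assms step_op_const[OF boxed_valid, of L R 1] by (simp add: exit_up_above)
  qed
 qed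
 have "0 = (SUM n:{L..R}. SUM i:UNIV. \<mu> n i * ?d n i)" using mu_inv0[of ?h] by simp
 also have "... = (SUM n:{a,b}. SUM i:UNIV. \<mu> n i * ?d n i)"
  by (rule sum.mono_neutral_right) (use assms d0 in auto)
 also have "... = (SUM i:UNIV. \<mu> a i * ?d a i) + (SUM i:UNIV. \<mu> b i * ?d b i)" using assms by simp
 finally show ?thesis unfolding da db by (simp add: sum_negf)
qed

lemma kappa_edge:
 assumes "L <= n" "n < R"
 shows "\<kappa> n = (SUM i:UNIV. \<mu> (n+1) i * (SUM j:UNIV. down be (n+1) $ i $ j))"
 using crossing_balance[of n "n+1"] assms by (simp add: \<kappa>_def exit_up_above exit_up_below)

lemma layer_balance:
 assumes "L < n" "n < R"
 shows "(SUM i:UNIV. \<mu> n i * (v i - (SUM j:UNIV. stay e n $ i $ j * v j))) = (SUM j:UNIV. \<rho> n j * v j)"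
proof -
 let ?f = "%k i. if k = n then v i else (0::real)"
 have "0 = (SUM k:{L..R}. SUM i:UNIV. \<mu> k i * (step_op be ?f k i - ?f k i))" using mu_inv0[of ?f] by simp
 also have "... = (SUM k:{n-1,n,n+1}. SUM i:UNIV. \<mu> k i * (step_op be ?f k i - ?f k i))"
  by (rule sum.mono_neutral_right) (use assms in \<open>auto simp: step_op_def\<close>)
 also have "... = (SUM i:UNIV. \<mu> (n-1) i * (SUM j:UNIV. up be (n-1) $ i $ j * v j))
   + (SUM i:UNIV. \<mu> n i * ((SUM j:UNIV. stay be n $ i $ j * v j) - v i))
   + (SUM i:UNIV. \<mu> (n+1) i * (SUM j:UNIV. down be (n+1) $ i $ j * v j))"
  by (simp add: step_op_def)
 also have "(SUM i:UNIV. \<mu> n i * ((SUM j:UNIV. stay be n $ i $ j * v j) - v i))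
   = - (SUM i:UNIV. \<mu> n i * (v i - (SUM j:UNIV. stay e n $ i $ j * v j)))"
  using assms by (simp add: boxed_inner sum_negf[symmetric] algebra_simps)
 finally have "(SUM i:UNIV. \<mu> n i * (v i - (SUM j:UNIV. stay e n $ i $ j * v j)))
  = (SUM i:UNIV. \<mu> (n-1) i * (SUM j:UNIV. up be (n-1) $ i $ j * v j))
   + (SUM i:UNIV. \<mu> (n+1) i * (SUM j:UNIV. down be (n+1) $ i $ j * v j))" by simp
 also have "... = (SUM j:UNIV. \<rho> n j * v j)"
  unfolding sum_distrib_left \<rho>_def sum_distrib_right
  by (subst (1 2) sum.swap) (simp add: sum.distrib[symmetric] algebra_simps)
 finally show ?thesis .
qed

text \<open>Time spent in a layer is inflow times Green matrix: this is \<open>layer_balance\<close>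
  for the solution \<open>v\<close> of \<open>(mat 1 - stay e n) *v v = w\<close>.\<close>

lemma mu_G:
 assumes "L < n" "n < R"
 shows "(SUM i:UNIV. \<mu> n i * w i) = (SUM j:UNIV. \<rho> n j * (SUM k:UNIV. G n $ j $ k * w k))"
proof -
 define v where "v = G n *v (\<chi> k. w k)"
 have v: "v $ i = (SUM k:UNIV. G n $ i $ k * w k)" for i unfolding v_def matrix_vector_mult_def by simp
 have "(mat 1 - stay e n) *v v = (\<chi> k. w k)"
  unfolding v_def by (simp add: matrix_vector_mul_assoc G_right)
 hence "v $ i - (stay e n *v v) $ i = w i" for i
  by (simp add: matrix_vector_mult_diff_rdistrib vec_eq_iff)
 hence w: "w i = v $ i - (SUM j:UNIV. stay e n $ i $ j * v $ j)" for i
  by (simp add: matrix_vector_mult_def)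
 show ?thesis unfolding v[symmetric] using layer_balance[OF assms, of "%i. v $ i"] by (simp add: w)
qed

lemma rho_nonneg: "L < n ==> n < R ==> 0 <= \<rho> n j"
 unfolding \<rho>_def by (intro sum_nonneg add_nonneg_nonneg mult_nonneg_nonneg mu_nonneg be_nonneg) auto

lemma rho_sum: "L < n ==> n < R ==> (SUM j:UNIV. \<rho> n j) = \<kappa> (n-1) + \<kappa> n"
 using kappa_edge[of n] unfolding \<rho>_def \<kappa>_def sum_distrib_left
 by (subst sum.swap) (simp add: sum.distrib)

lemma sum_up_rho:
 assumes "L < n" "n < R"
 shows "(SUM i:UNIV. \<mu> n i * up e n $ i $ j) = (SUM k:UNIV. \<rho> n k * A n k j)"
  "(SUM i:UNIV. \<mu> n i * down e n $ i $ j) = (SUM k:UNIV. \<rho> n k * B n k j)"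
 using mu_G[OF assms, of "%i. up e n $ i $ j"] mu_G[OF assms, of "%i. down e n $ i $ j"]
 by (simp_all add: matrix_matrix_mult_def)

lemma rho_A_ge:
 assumes "L < n" "n < R"
 shows "\<epsilon> * (\<kappa> (n-1) + \<kappa> n) <= (SUM k:UNIV. \<rho> n k * A n k j)" "\<epsilon> * (\<kappa> (n-1) + \<kappa> n) <= (SUM k:UNIV. \<rho> n k * B n k j)"
 unfolding rho_sum[OF assms, symmetric] sum_distrib_left using rho_nonneg[OF assms] G(3,4)
 by (auto intro!: sum_mono simp: mult.commute[of \<epsilon>] mult_left_mono)

lemma kappa_nonneg: "L <= n ==> n <= R ==> 0 <= \<kappa> n"
 unfolding \<kappa>_def by (intro sum_nonneg mult_nonneg_nonneg mu_nonneg be_nonneg) auto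

text \<open>The inflow of layer \<open>n\<close> is \<open>\<kappa> (n-1) + \<kappa> n\<close>, and
  whatever enters leaves upwards with probability at least \<open>\<epsilon>\<close> and downwards
  with probability at least \<open>\<epsilon>\<close>.\<close>

lemma kappa_step:
 assumes "L < n" "n < R"
 shows "\<epsilon> * (\<kappa> (n-1) + \<kappa> n) <= \<kappa> n" "\<epsilon> * (\<kappa> (n-1) + \<kappa> n) <= \<kappa> (n-1)"
proof -
 have k0: "0 <= \<epsilon> * (\<kappa> (n-1) + \<kappa> n)" using eps_pos kappa_nonneg assms by simp
 have "\<kappa> n = (SUM j:UNIV. SUM i:UNIV. \<mu> n i * up e n $ i $ j)"
  unfolding \<kappa>_def sum_distrib_left using assms by (subst sum.swap) (simp add: boxed_inner)
 also have "... >= (SUM j:(UNIV::'a set). \<epsilon> * (\<kappa> (n-1) + \<kappa> n))"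
  unfolding sum_up_rho(1)[OF assms] by (intro sum_mono rho_A_ge assms)
 moreover have "(SUM j:(UNIV::'a set). \<epsilon> * (\<kappa> (n-1) + \<kappa> n)) >= \<epsilon> * (\<kappa> (n-1) + \<kappa> n)"
  using member_le_sum[of "undefined" "UNIV::'a set" "%_. \<epsilon> * (\<kappa> (n-1) + \<kappa> n)"] k0 by simp
 ultimately show "\<epsilon> * (\<kappa> (n-1) + \<kappa> n) <= \<kappa> n" by linarith
 have "\<kappa> (n-1) = (SUM j:UNIV. SUM i:UNIV. \<mu> n i * down e n $ i $ j)"
  using kappa_edge[of "n-1"] assms unfolding sum_distrib_left by (subst sum.swap) (simp add: boxed_inner)
 also have "... >= (SUM j:(UNIV::'a set). \<epsilon> * (\<kappa> (n-1) + \<kappa> n))"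
  unfolding sum_up_rho(2)[OF assms] by (intro sum_mono rho_A_ge assms)
 moreover have "(SUM j:(UNIV::'a set). \<epsilon> * (\<kappa> (n-1) + \<kappa> n)) >= \<epsilon> * (\<kappa> (n-1) + \<kappa> n)"
  using member_le_sum[of "undefined" "UNIV::'a set" "%_. \<epsilon> * (\<kappa> (n-1) + \<kappa> n)"] k0 by simp
 ultimately show "\<epsilon> * (\<kappa> (n-1) + \<kappa> n) <= \<kappa> (n-1)" by linarith
qed

lemma kappa_lip: "L < n ==> n < R ==> \<epsilon> * \<kappa> (n-1) <= \<kappa> n" "L < n ==> n < R ==> \<epsilon> * \<kappa> n <= \<kappa> (n-1)"
 using kappa_step[of n] kappa_nonneg[of n] kappa_nonneg[of "n-1"] eps_pos
 by (smt (verit) distrib_left mult_nonneg_nonneg)+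

lemma kappa_zero:
 assumes "L <= m" "m < R" "\<kappa> m = 0" "L <= n" "n < R"
 shows "\<kappa> n = 0"
proof -
 have up: "\<kappa> (m + int k) = 0" if "m + int k < R" for k
  using that
 proof (induction k)
  case (Suc k)
  have "\<epsilon> * \<kappa> (m + int (Suc k)) <= \<kappa> (m + int k)"
   using kappa_lip(2)[of "m + int (Suc k)"] Suc.prems assms by (simp add: algebra_simps)
  hence "\<kappa> (m + int (Suc k)) <= 0" using Suc eps_pos by (simp add: mult_le_0_iff)
  thus ?case using kappa_nonneg[of "m + int (Suc k)"] Suc.prems assms by simp
 qed (use assms in simp)
 have dn: "\<kappa> (m - int k) = 0" if "L <= m - int k" for k
  using that
 proof (induction k)
  case (Suc k)
  have "\<epsilon> * \<kappa> (m - int (Suc k)) <= \<kappa> (m - int k)"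
   using kappa_lip(1)[of "m - int k"] Suc.prems assms by (simp add: algebra_simps)
  hence "\<kappa> (m - int (Suc k)) <= 0" using Suc eps_pos by (simp add: mult_le_0_iff)
  thus ?case using kappa_nonneg[of "m - int (Suc k)"] Suc.prems assms by simp
 qed (use assms in simp)
 show ?thesis using up[of "nat (n - m)"] dn[of "nat (m - n)"] assms by (cases "m <= n") auto
qed

text \<open>Neighbouring flows are comparable, so one zero flow makes all flows vanish; then no
  layer carries mass, against \<open>mu_total\<close>.\<close>

lemma kappa_pos: assumes "L <= n" "n < R" shows "0 < \<kappa> n"
proof (rule ccontr)
 assume "~ 0 < \<kappa> n"
 hence "\<kappa> n = 0" using kappa_nonneg[of n] assms by auto
 hence z: "\<kappa> m = 0" if "L <= m" "m < R" for m using kappa_zero[of n m] assms that by simp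
 have "\<mu> m i = 0" if m: "L <= m" "m <= R" for m i
 proof -
  have "(SUM i:UNIV. \<mu> m i) = 0"
  proof -
   consider "m = L" | "m = R" | "L < m" "m < R" using m by linarith
   thus ?thesis
   proof cases
    case 1
    have "(SUM j:UNIV. up be L $ i $ j) = 1" for i using LR by (simp add: boxed_def mat_def)
    thus ?thesis using z[of L] LR 1 by (simp add: \<kappa>_def)
   next
    case 2
    have "(SUM j:UNIV. down be R $ i $ j) = 1" for i using LR by (simp add: boxed_def mat_def)
    thus ?thesis using z[of "R-1"] kappa_edge[of "R-1"] LR 2 by simp
   next
    case 3
    have "(SUM j:UNIV. \<rho> m j) = 0" using rho_sum[OF 3] z[of m] z[of "m-1"] 3 by simp
    hence "\<rho> m j = 0" for j using rho_nonneg[OF 3] by (subst (asm) sum_nonneg_eq_0_iff) auto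
    thus ?thesis using mu_G[OF 3, of "%_. 1"] by simp
   qed
  qed
  thus ?thesis using mu_nonneg[OF m] by (subst (asm) sum_nonneg_eq_0_iff) auto
 qed
 hence "(SUM n:{L..R}. SUM i:UNIV. \<mu> n i) = 0" by simp
 thus False using mu_total by simp
qed

lemma mass_le: assumes "L < n" "n < R" shows "(SUM i:UNIV. \<mu> n i) <= D * (\<kappa> (n-1) + \<kappa> n)"
proof -
 have "(SUM i:UNIV. \<mu> n i) = (SUM j:UNIV. \<rho> n j * (G n *v 1) $ j)"
  using mu_G[OF assms, of "%_. 1"] by (simp add: matrix_vector_mult_def)
 also have "... <= (SUM j:UNIV. \<rho> n j * D)" using rho_nonneg[OF assms] G(5) by (intro sum_mono mult_left_mono) auto
 finally show ?thesis unfolding sum_distrib_right[symmetric] rho_sum[OF assms] by (simp only: mult.commute)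
qed

lemma D_ge1: "1 <= D"
proof -
 define u :: "real^'a" where "u = G 0 *v 1"
 have "u = G 0 *v ((mat 1 - stay e 0) *v 1 + stay e 0 *v 1)"
  unfolding u_def by (simp add: matrix_vector_mult_diff_rdistrib)
 also have "... = 1 + G 0 *v (stay e 0 *v 1)"
  unfolding matrix_vector_right_distrib matrix_vector_mul_assoc[of "G 0" "mat 1 - stay e 0"] G(2) by simp
 finally have "u $ i = 1 + (G 0 *v (stay e 0 *v 1)) $ i" for i by simp
 moreover have "0 <= (G 0 *v (stay e 0 *v 1)) $ i" for i
  using trip G_nonneg unfolding matrix_vector_mult_def
  by (auto intro!: sum_nonneg mult_nonneg_nonneg simp: valid_def triples_def split_def less_eq_vec_def)
 ultimately have "1 <= u $ undefined" by simp
 thus ?thesis using G(5)[of 0 undefined] unfolding u_def by linarith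
qed

lemma mass_le': assumes "L < n" "n < R" shows "(SUM i:UNIV. \<mu> n i) <= 2 * D / \<epsilon> * \<kappa> n"
proof -
 have "\<kappa> (n-1) <= \<kappa> n / \<epsilon>" using kappa_lip(1)[OF assms] eps_pos by (simp add: field_simps)
 moreover have "\<kappa> n <= \<kappa> n / \<epsilon>" using eps_le1 eps_pos kappa_nonneg[of n] assms by (simp add: field_simps mult_left_le_one_le)
 ultimately have "D * (\<kappa> (n-1) + \<kappa> n) <= D * (\<kappa> n / \<epsilon> + \<kappa> n / \<epsilon>)" using D_ge1 by (intro mult_left_mono add_mono) auto
 thus ?thesis using mass_le[OF assms] by (simp add: field_simps)
qed

text \<open>The mass of a site is at least its inflow, of which the part coming down from layer
  \<open>n + 1\<close> is already at least \<open>\<epsilon> * \<kappa> n\<close>. The layers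
  \<open>n - 1\<close> and \<open>n + 1\<close> must avoid the walls, hence the margins.\<close>

lemma mu_ge: assumes "L + 1 < n" "n < R - 1" shows "\<epsilon> * \<kappa> n <= \<mu> n i"
proof -
 have n: "L < n" "n < R" using assms by auto
 have "(SUM k:UNIV. \<mu> n k * ((if k = i then 1 else 0) - stay e n $ k $ i)) = \<rho> n i"
  using layer_balance[OF n, of "%j. if j = i then 1 else 0"]
  by (simp add: if_distrib[of "%x. _ * x"] sum.delta' cong: if_cong)
 hence "\<mu> n i - (SUM k:UNIV. \<mu> n k * stay e n $ k $ i) = \<rho> n i"
  by (simp add: right_diff_distrib sum_subtractf if_distrib[of "%x. _ * x"] sum.delta' cong: if_cong)
 moreover have "0 <= (SUM k:UNIV. \<mu> n k * stay e n $ k $ i)"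
  using be_nonneg(3)[of n] boxed_inner[OF n] mu_nonneg[of n] n by (intro sum_nonneg mult_nonneg_nonneg) auto
 ultimately have "\<rho> n i <= \<mu> n i" by simp
 moreover have "\<rho> n i = (SUM k:UNIV. \<mu> (n-1) k * up e (n-1) $ k $ i) + (SUM k:UNIV. \<mu> (n+1) k * down e (n+1) $ k $ i)"
  unfolding \<rho>_def using assms by (simp add: boxed_inner sum.distrib)
 moreover have "0 <= (SUM k:UNIV. \<mu> (n-1) k * up e (n-1) $ k $ i)"
  using be_nonneg(1)[of "n-1"] boxed_inner[of L "n-1" R] mu_nonneg[of "n-1"] assms by (intro sum_nonneg mult_nonneg_nonneg) auto
 moreover have "\<epsilon> * \<kappa> n <= (SUM k:UNIV. \<mu> (n+1) k * down e (n+1) $ k $ i)"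
 proof -
  have "\<epsilon> * \<kappa> n <= \<epsilon> * (\<kappa> n + \<kappa> (n+1))" using kappa_nonneg[of "n+1"] assms eps_pos by simp
  thus ?thesis using rho_A_ge(2)[of "n+1" i] sum_up_rho(2)[of "n+1" i] assms by simp
 qed
 ultimately show ?thesis by linarith
qed

lemma weighted_bounds:
 fixes m :: "'a => real"
 assumes "!!i. 0 <= m i" "!!i j. 0 <= w i j"
 shows "(!!j. c <= x j) ==> c * (SUM i:UNIV. m i * (SUM j:UNIV. w i j)) <= (SUM i:UNIV. m i * (SUM j:UNIV. w i j * x j))"
  "(!!j. d * x j <= c) ==> d * (SUM i:UNIV. m i * (SUM j:UNIV. w i j * x j)) <= c * (SUM i:UNIV. m i * (SUM j:UNIV. w i j))"
proof -
 assume c: "!!j. c <= x j"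
 have "c * (m i * w i j) <= m i * (w i j * x j)" for i j
  using mult_left_mono[OF c, of "m i * w i j" j] assms by (simp add: mult_ac)
 thus "c * (SUM i:UNIV. m i * (SUM j:UNIV. w i j)) <= (SUM i:UNIV. m i * (SUM j:UNIV. w i j * x j))"
  unfolding sum_distrib_left by (intro sum_mono)
next
 assume c: "!!j. d * x j <= c"
 have "d * (m i * (w i j * x j)) <= c * (m i * w i j)" for i j
  using mult_left_mono[OF c, of "m i * w i j" j] assms by (simp add: mult_ac)
 thus "d * (SUM i:UNIV. m i * (SUM j:UNIV. w i j * x j)) <= c * (SUM i:UNIV. m i * (SUM j:UNIV. w i j))"
  unfolding sum_distrib_left by (intro sum_mono)
qed

text \<open>In \<open>crossing_balance\<close> the exit probabilities of the individual states are
  replaced by those of the reference state \<open>undefined\<close>, once on each side; each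
  replacement costs one factor \<open>\<epsilon>\<close>.\<close>

lemma pot_kappa:
 assumes "L <= a" "a < b" "b <= R"
 shows "\<epsilon>^2 * \<kappa> a <= exp (pot e a b) * \<kappa> (b-1)" "\<epsilon>^2 * (exp (pot e a b) * \<kappa> (b-1)) <= \<kappa> a"
proof -
 define h where "h = exit_up e a b (a+1) undefined"
 define g where "g = 1 - exit_up e a b (b-1) undefined"
 have h: "0 < h" "0 < g" and ex: "exp (pot e a b) = g / h"
  unfolding h_def g_def using assms exit_up_pos[of a "a+1" b] exit_up_less1[of a "b-1" b] exp_pot[of a b] by auto
 define X where "X = (SUM i:UNIV. \<mu> a i * (SUM j:UNIV. up be a $ i $ j * exit_up e a b (a+1) j))"
 have X2: "X = (SUM i:UNIV. \<mu> b i * (SUM j:UNIV. down be b $ i $ j * (1 - exit_up e a b (b-1) j)))"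
  unfolding X_def using crossing_balance[OF assms] .
 have hj: "\<epsilon> * h <= exit_up e a b (a+1) j" "\<epsilon> * exit_up e a b (a+1) j <= h" for j
  unfolding h_def using exit_up_harnack[of a b "a+1"] assms by auto
 have gj: "\<epsilon> * g <= 1 - exit_up e a b (b-1) j" "\<epsilon> * (1 - exit_up e a b (b-1) j) <= g" for j
  unfolding g_def using exit_down_harnack[of a b "b-1"] assms by auto
 have k2: "\<kappa> (b-1) = (SUM i:UNIV. \<mu> b i * (SUM j:UNIV. down be b $ i $ j))" using kappa_edge[of "b-1"] assms by simp
 have ma: "0 <= \<mu> a i" "0 <= \<mu> b i" for i using mu_nonneg assms by auto
 have "\<epsilon> * h * \<kappa> a <= X" unfolding X_def \<kappa>_def
  by (rule weighted_bounds(1)) (use hj be_nonneg ma in auto)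
 moreover have "\<epsilon> * X <= h * \<kappa> a" unfolding X_def \<kappa>_def
  by (rule weighted_bounds(2)) (use hj be_nonneg ma in auto)
 moreover have "\<epsilon> * g * \<kappa> (b-1) <= X" unfolding X2 k2
  by (rule weighted_bounds(1)) (use gj be_nonneg ma in auto)
 moreover have "\<epsilon> * X <= g * \<kappa> (b-1)" unfolding X2 k2
  by (rule weighted_bounds(2)) (use gj be_nonneg ma in auto)
 ultimately have "\<epsilon> * (\<epsilon> * h * \<kappa> a) <= g * \<kappa> (b-1)" "\<epsilon> * (\<epsilon> * g * \<kappa> (b-1)) <= h * \<kappa> a"
  using eps_pos by (meson mult_left_mono order_trans less_imp_le)+
 thus "\<epsilon>^2 * \<kappa> a <= exp (pot e a b) * \<kappa> (b-1)" "\<epsilon>^2 * (exp (pot e a b) * \<kappa> (b-1)) <= \<kappa> a"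
  unfolding ex using h by (simp_all add: field_simps power2_eq_square)
qed

lemma mu_inv_inner:
 assumes "!!n i. n < L + 2 \<or> R - 2 < n ==> f n i = 0"
 shows "(SUM n:{L..R}. SUM i:UNIV. \<mu> n i * step_op e f n i) = (SUM n:{L..R}. SUM i:UNIV. \<mu> n i * f n i)"
proof -
 have "step_op e f n i = step_op be f n i" if "n \<in> {L..R}" for n i
 proof (cases "L < n & n < R")
  case True
  hence "be n = e n" by (simp add: boxed_inner)
  thus ?thesis using step_op_env_cong[of be n e f] by simp
 next
  case False thus ?thesis using that assms by (auto simp: step_op_def intro!: sum.cong)
 qed
 hence "(SUM n:{L..R}. SUM i:UNIV. \<mu> n i * step_op e f n i) = (SUM n:{L..R}. SUM i:UNIV. \<mu> n i * step_op be f n i)"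
  by (intro sum.cong) auto
 thus ?thesis using mu_inv[of f] by simp
qed

end

context elliptic_env begin

lemma box_measure_obtain:
 assumes "L < R"
 obtains \<mu> where "box_measure e \<epsilon> D L R \<mu>"
proof -
 obtain \<mu> where "(\<forall>n\<in>{L..R}. \<forall>i. 0 <= \<mu> n i)" "(SUM n:{L..R}. SUM i:UNIV. \<mu> n i) = 1"
  "\<forall>f. (SUM n:{L..R}. SUM i:UNIV. \<mu> n i * step_op (boxed L R) f n i) = (SUM n:{L..R}. SUM i:UNIV. \<mu> n i * f n i)"
  using box_measure_exists[OF assms] by blast
 hence "box_measure e \<epsilon> D L R \<mu>" by unfold_locales (use assms in auto)
 thus ?thesis by (rule that)
qed

definition "c0 = ln (1 / \<epsilon>)"

lemma c0_nonneg: "0 <= c0" unfolding c0_def using eps_pos eps_le1 by simp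

end

context box_measure begin

definition V :: "int => real" where "V n = - ln (\<kappa> n)"

lemma V_pot: assumes "L <= a" "a < b" "b <= R" shows "abs(pot e a b - (V (b-1) - V a)) <= 2 * c0"
proof -
 have k: "0 < \<kappa> a" "0 < \<kappa> (b-1)" using kappa_pos assms by auto
 have "ln (\<epsilon>^2 * \<kappa> a) <= ln (exp (pot e a b) * \<kappa> (b-1))" "ln (\<epsilon>^2 * (exp (pot e a b) * \<kappa> (b-1))) <= ln (\<kappa> a)"
  using pot_kappa[OF assms] k eps_pos by (subst ln_le_cancel_iff; simp)+
 thus ?thesis unfolding V_def c0_def using k eps_pos by (simp add: ln_mult ln_realpow ln_div)
qed

lemma V_lip: assumes "L < n" "n < R" shows "abs(V n - V (n-1)) <= c0"
proof -
 have k: "0 < \<kappa> n" "0 < \<kappa> (n-1)" using kappa_pos assms by auto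
 have "ln (\<epsilon> * \<kappa> (n-1)) <= ln (\<kappa> n)" "ln (\<epsilon> * \<kappa> n) <= ln (\<kappa> (n-1))"
  using kappa_lip[OF assms] k eps_pos by (subst ln_le_cancel_iff; simp)+
 thus ?thesis unfolding V_def c0_def using k eps_pos by (simp add: ln_mult ln_div)
qed

end

text \<open>The flow of one box over \<open>a..c\<close> serves all three intervals. The three
  comparisons cost \<open>2 * c0\<close> each, and one more \<open>c0\<close> pays for the step from
  edge \<open>b - 1\<close> to edge \<open>b\<close>.\<close>

lemma (in elliptic_env) pot_quasi_additive:
 assumes "a < b" "b < c"
 shows "abs(pot e a c - pot e a b - pot e b c) <= 7 * c0"
proof -
 obtain \<mu> where "box_measure e \<epsilon> D a c \<mu>" using box_measure_obtain[of a c] assms by auto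
 then interpret box_measure e \<epsilon> D a c \<mu> .
 show ?thesis using V_pot[of a b] V_pot[of a c] V_pot[of b c] V_lip[of b] assms by linarith
qed

section \<open>Quenched estimates\<close>

context elliptic_env begin

text \<open>In one dimension the reciprocal of the exit probability is exactly a sum of exponentials
  of the potential. Here the sum gains one term when the end moves from \<open>n\<close> to
  \<open>n + 1\<close>: the new exit probability is at least \<open>m\<close> on layer
  \<open>n\<close>, hence at least \<open>m\<close> times the old one.\<close>

lemma inverse_exit_up_le:
 assumes "a < b"
 shows "1 / exit_up e a b (a+1) undefined <= 1 + (SUM k:{a+1..<b}. exp (pot e a (k+1))) / \<epsilon>"
proof -
 have "a + 1 <= b" using assms by simp
 thus ?thesis
 proof (induction b rule: int_ge_induct)
  case base thus ?case by (simp add: exit_up_above)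
 next
  case (step n)
  let ?h = "exit_up e a (n+1)"
  define x where "x = ?h (a+1) undefined"
  define y where "y = exit_up e a n (a+1) undefined"
  define E where "E = exp (pot e a (n+1))"
  have an: "a < n" using step by simp
  have xy: "0 < x" "0 < y" unfolding x_def y_def using exit_up_pos an by auto
  have ex: "1 - ?h n undefined = E * x"
   using exp_pot[of a "n+1"] an xy unfolding E_def x_def by simp
  define m where "m = 1 - E * x / \<epsilon>"
  have "m * exit_up e a n (a+1) undefined - ?h (a+1) undefined <= 0"
  proof (rule max_principle[where a=a and b=n and f="%k i. m * exit_up e a n k i - ?h k i"])
   fix k i assume k: "a < k" "k < n"
   have "m * exit_up e a n k i - ?h k i = m * step_op e (exit_up e a n) k i - step_op e ?h k i"
    using exit_up_harmonic[OF trip k, of i] exit_up_harmonic[OF trip k(1), of "n+1" i] k by simp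
   thus "m * exit_up e a n k i - ?h k i <= step_op e (%k i. m * exit_up e a n k i - ?h k i) k i"
    by (simp add: step_op_diff step_op_cmult)
  next
   fix i
   have "\<epsilon> * (1 - ?h n i) <= E * x" using exit_down_harnack[of a "n+1" n i undefined] an ex by simp
   hence "1 - ?h n i <= E * x / \<epsilon>" using eps_pos by (simp add: field_simps)
   thus "m * exit_up e a n n i - ?h n i <= 0" using an by (simp add: exit_up_above m_def)
  qed (use an in \<open>auto simp: exit_up_below\<close>)
  hence "y <= x + E * x / \<epsilon> * y" unfolding x_def[symmetric] y_def[symmetric] m_def by (simp add: algebra_simps)
  hence "1 / x <= 1 / y + E / \<epsilon>" using xy eps_pos by (simp add: field_simps)
  moreover have "{a+1..<n+1} = insert n {a+1..<n}" using an by auto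
  ultimately show ?case using step.IH unfolding x_def y_def E_def by (simp add: add_divide_distrib)
 qed
qed

text \<open>Moving \<open>b\<close> one layer up lowers the exit probability at most by its defect
  on the old layer \<open>b\<close>, which the potential controls.\<close>

lemma exit_down_le:
 assumes "a < n" "n <= b"
 shows "1 - exit_up e a b n i <= (SUM k:{n..<b}. exp (pot e a (k+1))) / \<epsilon>"
 using assms(2)
proof (induction b rule: int_ge_induct)
 case base thus ?case using assms by (simp add: exit_up_above)
next
 case (step b)
 let ?h = "exit_up e a (b+1)"
 have ab: "a < b" using step assms by simp
 define c where "c = exp (pot e a (b+1)) / \<epsilon>"
 have "?h (a+1) undefined <= 1" using exit_up_bounds(2)[OF trip, of a "b+1"] ab by simp
 moreover have "1 - ?h b undefined = exp (pot e a (b+1)) * ?h (a+1) undefined"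
  using exp_pot[of a "b+1"] ab exit_up_pos[of a "a+1" "b+1" undefined] by simp
 ultimately have hb: "1 - ?h b undefined <= exp (pot e a (b+1))" by simp
 have "exit_up e a b n i - ?h n i <= c"
 proof (rule max_principle[where a=a and b=b and f="%k i. exit_up e a b k i - ?h k i"])
  fix k i assume k: "a < k" "k < b"
  show "exit_up e a b k i - ?h k i <= step_op e (%k i. exit_up e a b k i - ?h k i) k i"
   using exit_up_harmonic[OF trip k, of i] exit_up_harmonic[OF trip k(1), of "b+1" i] k by (simp add: step_op_diff)
 next
  fix i
  have "\<epsilon> * (1 - ?h b i) <= exp (pot e a (b+1))" using exit_down_harnack[of a "b+1" b i undefined] ab hb by simp
  hence "1 - ?h b i <= c" unfolding c_def using eps_pos by (simp add: field_simps)
  thus "exit_up e a b b i - ?h b i <= c" using ab by (simp add: exit_up_above)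
 qed (use ab assms step eps_pos in \<open>auto simp: exit_up_below c_def\<close>)
 moreover have "{n..<b+1} = insert b {n..<b}" using step by auto
 ultimately show ?case using step.IH unfolding c_def by (simp add: add_divide_distrib)
qed

end

section \<open>Survival in an interval\<close>

fun surv :: "'m::finite env => int => int => nat => int => 'm => real" where
 "surv e a b 0 n i = (if a < n & n < b then 1 else 0)"
| "surv e a b (Suc t) n i = (if a < n & n < b then step_op e (surv e a b t) n i else 0)"

lemma step_op_nonneg:
 assumes "valid e" "!!n i. 0 <= f n i" shows "0 <= step_op e f n i"
 using step_op_mono[OF assms(1), of "%_ _. 0" n f i] step_op_const[OF assms(1), of 0] assms(2) by simp

lemma step_op_le1:
 assumes "valid e" "!!n i. f n i <= c" shows "step_op e f n i <= c"
 using step_op_mono[OF assms(1), of f n "%_ _. c" i] step_op_const[OF assms(1), of c] assms(2) by simp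

lemma surv_decreasing:
 assumes "valid e" shows "surv e a b (Suc t) n i <= surv e a b t n i"
proof (induction t arbitrary: n i)
 case 0
 have "step_op e (surv e a b 0) n i <= 1" by (rule step_op_le1[OF assms]) auto
 thus ?case by simp
next
 case (Suc t)
 have "step_op e (surv e a b (Suc t)) n i <= step_op e (surv e a b t) n i"
  by (rule step_op_mono[OF assms]) (rule Suc)+
 thus ?case by (subst (1 2) surv.simps(2)) (simp del: surv.simps)
qed

text \<open>\<open>F\<close> dominates the mean exit time, that is the sum of all survival
  probabilities; these decrease in time, so each of the first \<open>t\<close> terms is at least the
  one at time \<open>t\<close>.\<close>

lemma surv_le:
 assumes e: "valid e" and F0: "!!n i. 0 <= F n i"
  and F: "!!n i. a < n ==> n < b ==> 1 + step_op e F n i <= F n i"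
 shows "real t * surv e a b t n i <= F n i"
proof -
 have dec: "surv e a b t n i <= surv e a b s n i" if "s <= t" for s
  using that by (rule lift_Suc_antimono_le[of "%s. surv e a b s n i", rotated]) (rule surv_decreasing[OF e])
 have *: "(SUM s<t. surv e a b s n i) <= F n i" for t n i
 proof (induction t arbitrary: n i)
  case (Suc t)
  show ?case
  proof (cases "a < n & n < b")
   case True
   have "(SUM s<Suc t. surv e a b s n i) = 1 + step_op e (%n i. SUM s<t. surv e a b s n i) n i"
    using True by (subst sum.lessThan_Suc_shift) (simp add: step_op_sum)
   also have "... <= 1 + step_op e F n i" using step_op_mono[OF e] Suc by simp
   also have "... <= F n i" using F True by simp
   finally show ?thesis .
  next
   case False
   hence "surv e a b s n i = 0" for s by (cases s) auto
   thus ?thesis using F0 by simp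
  qed
 qed (simp add: F0)
 have "real t * surv e a b t n i = (SUM s<t. surv e a b t n i)" by simp
 also have "... <= (SUM s<t. surv e a b s n i)" by (intro sum_mono dec) auto
 finally show ?thesis using * order_trans by blast
qed

context elliptic_env begin

text \<open>
  A supersolution of \<open>1 + step_op e F \<le> F\<close> on the single layer \<open>k\<close>: the probability of reaching
  layer \<open>k\<close> before \<open>b\<close>, times a bound for the time spent on layer \<open>k\<close>.
\<close>

lemma layer_supersolution:
 assumes "k < b"
 defines "x \<equiv> exit_up e k b (k+1) undefined"
 shows "\<exists>F. (\<forall>n i. 0 <= F n i & F n i <= D / (\<epsilon>^2 * x)) &
   (\<forall>n i. n < b --> (if n = k then 1 else 0) + step_op e F n i <= F n i)"
proof -
 \<comment> \<open>Each visit to layer \<open>k\<close> lasts at most \<open>D\<close> on average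
   and ends in an escape to \<open>b\<close> with probability at least
   \<open>\<epsilon> * x\<close>, so \<open>K\<close> bounds the total time on the layer.\<close>
 define K where "K = D / (\<epsilon>^2 * x)"
 have x: "0 < x" unfolding x_def using assms exit_up_pos by simp
 obtain i0 :: 'm where True by simp
 have "0 <= (G k *v 1) $ i0" unfolding matrix_vector_mult_def using G_nonneg by (simp add: sum_nonneg)
 hence D0: "0 <= D" using G(5)[of k i0] by linarith
 have K: "0 <= K" "K * (\<epsilon> * (\<epsilon> * x)) = D" unfolding K_def using x eps_pos D0 by (auto simp: power2_eq_square)
 define g where "g n i = K * (1 - exit_up e k b n i)" for n i
 have g01: "0 <= g n i" "g n i <= K" for n i
  unfolding g_def using K(1) exit_up_bounds[OF trip assms(1), of n i] by (auto simp: mult_left_le)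
 define w where "w j = 1 + (SUM l:UNIV. up e k $ j $ l * g (k+1) l + down e k $ j $ l * g (k-1) l)" for j
 \<comment> \<open>On layer \<open>k\<close> the inequality is made an equality by solving with the
   Green matrix. By \<open>uK\<close> the solution stays below \<open>g\<close>, so
   \<open>F <= g\<close> and \<open>g\<close> controls the other layers.\<close>
 define u where "u i = (SUM j:UNIV. G k $ i $ j * w j)" for i
 define F where "F n i = (if n = k then u i else g n i)" for n i
 have ud: "0 <= up e n $ i $ j" "0 <= down e n $ i $ j" for n i j
  using trip by (auto simp: valid_def triples_def split_def less_eq_vec_def)
 have w0: "0 <= w j" for j unfolding w_def using ud g01
  by (intro add_nonneg_nonneg sum_nonneg mult_nonneg_nonneg) auto
 have u_emb: "u i = (G k *v 1) $ i + emb g k i" for i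
 proof -
  have "u i = (SUM j:UNIV. G k $ i $ j) + (SUM j:UNIV. SUM l:UNIV. G k $ i $ j * (up e k $ j $ l * g (k+1) l + down e k $ j $ l * g (k-1) l))"
   unfolding u_def w_def by (simp add: distrib_left sum.distrib sum_distrib_left)
  also have "(SUM j:UNIV. SUM l:UNIV. G k $ i $ j * (up e k $ j $ l * g (k+1) l + down e k $ j $ l * g (k-1) l)) = emb g k i"
   unfolding emb_def matrix_matrix_mult_def by (subst sum.swap)
    (simp add: sum.distrib sum_distrib_left sum_distrib_right algebra_simps)
  finally show ?thesis by (simp add: matrix_vector_mult_def)
 qed
 have uK: "u i <= K" for i
 proof -
  have "K * (\<epsilon> * (\<epsilon> * x)) <= K * (A k i undefined * exit_up e k b (k+1) undefined)"
   using K(1) G(3)[of k i undefined] x eps_pos eps_le1 unfolding x_def[symmetric]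
   by (intro mult_left_mono mult_mono) (auto simp: mult_le_cancel_right1)
  also have "... <= K * (SUM j:UNIV. A k i j * exit_up e k b (k+1) j)"
   by (intro mult_left_mono K(1) member_le_sum) (auto simp: A_nonneg exit_up_bounds[OF trip assms(1)])
  finally have *: "D <= K * (SUM j:UNIV. A k i j * exit_up e k b (k+1) j)" using K(2) by simp
  have "emb g k i = K * (SUM j:UNIV. A k i j + B k i j) - K * (SUM j:UNIV. A k i j * exit_up e k b (k+1) j)"
   unfolding emb_def g_def using assms
   by (simp add: exit_up_below sum_distrib_left sum_subtractf[symmetric] algebra_simps)
  hence "emb g k i <= K - D" using * by (simp add: AB_sum)
  thus ?thesis using u_emb[of i] G(5)[of k i] by simp
 qed
 have u0: "0 <= u i" for i unfolding u_def using G_nonneg w0 by (intro sum_nonneg mult_nonneg_nonneg) auto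
 have gk: "g k i = K" for i using assms by (simp add: g_def exit_up_below)
 have Fg: "F n i <= g n i" for n i using uK gk by (simp add: F_def)
 have "(if n = k then 1 else 0) + step_op e F n i <= F n i" if "n < b" for n i
 proof (cases "n = k")
  case True
  have "(mat 1 - stay e k) *v (G k *v (\<chi> j. w j)) = (\<chi> j. w j)"
   by (simp add: matrix_vector_mul_assoc G_right)
  moreover have "G k *v (\<chi> j. w j) = (\<chi> i. u i)" by (simp add: u_def matrix_vector_mult_def vec_eq_iff)
  ultimately have "((mat 1 - stay e k) *v (\<chi> i. u i)) $ i = w i" by simp
  hence "u i - (SUM j:UNIV. stay e k $ i $ j * u j) = w i"
   unfolding matrix_vector_mult_diff_rdistrib matrix_vector_mul_lid by (simp add: matrix_vector_mult_def)
  thus ?thesis using True by (simp add: F_def step_op_def w_def sum.distrib)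
 next
  case False
  have "step_op e F n i <= step_op e g n i" by (rule step_op_mono[OF trip]) (rule Fg)+
  also have "step_op e g n i = K * (1 - step_op e (exit_up e k b) n i)"
   unfolding g_def by (simp add: step_op_cmult step_op_diff step_op_const[OF trip])
  also have "... <= g n i"
  proof (cases "k < n")
   case True thus ?thesis using exit_up_harmonic[OF trip True that, of i] by (simp add: g_def)
  next
   case False
   hence "step_op e (exit_up e k b) n = step_op e (%_ _. 0) n"
    using \<open>n \<noteq> k\<close> assms by (intro step_op_cong) (auto simp: exit_up_below fun_eq_iff)
   thus ?thesis using False assms by (simp add: g_def exit_up_below step_op_const[OF trip])
  qed
  finally show ?thesis using False by (simp add: F_def)
 qed
 moreover have "0 <= F n i & F n i <= D / (\<epsilon>^2 * x)" for n i
  using u0 uK g01 unfolding K_def[symmetric] by (simp add: F_def)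
 ultimately show ?thesis by (intro exI[of _ F]) blast
qed

lemma surv_bound:
 assumes "a < b"
 shows "real t * surv e a b t n i <= (SUM k:{a<..<b}. D / (\<epsilon>^2 * exit_up e k b (k+1) undefined))"
proof -
 have "\<forall>k\<in>{a<..<b}. \<exists>F. (\<forall>n i. 0 <= F n i & F n i <= D / (\<epsilon>^2 * exit_up e k b (k+1) undefined)) &
   (\<forall>n i. n < b --> (if n = k then 1 else 0) + step_op e F n i <= F n i)"
  using layer_supersolution by auto
 then obtain F where F: "!!k n i. k \<in> {a<..<b} ==> 0 <= F k n i & F k n i <= D / (\<epsilon>^2 * exit_up e k b (k+1) undefined)"
  "!!k n i. k \<in> {a<..<b} ==> n < b ==> (if n = k then 1 else 0) + step_op e (F k) n i <= F k n i"
  unfolding bchoice_iff by blast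
 let ?F = "%n i. SUM k:{a<..<b}. F k n i"
 have "real t * surv e a b t n i <= ?F n i"
 proof (rule surv_le[OF trip])
  fix n i assume n: "a < n" "n < b"
  have "1 + step_op e ?F n i = (SUM k:{a<..<b}. (if n = k then 1 else 0) + step_op e (F k) n i)"
   using n by (simp add: step_op_sum sum.distrib)
  also have "... <= ?F n i" using F(2) n by (intro sum_mono) auto
  finally show "1 + step_op e ?F n i <= ?F n i" .
 qed (use F(1) in \<open>auto intro: sum_nonneg\<close>)
 also have "... <= (SUM k:{a<..<b}. D / (\<epsilon>^2 * exit_up e k b (k+1) undefined))"
  using F(1) by (intro sum_mono) auto
 finally show ?thesis .
qed

end

section \<open>Iterates of the transition operator\<close>

abbreviation walk_op :: "'m::finite env => nat => (int => 'm => real) => int => 'm => real" where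
 "walk_op e t f \<equiv> (step_op e ^^ t) f"

lemma walk_op_bounds:
 assumes "valid e" "\<forall>n i. 0 <= f n i & f n i <= 1"
 shows "0 <= walk_op e t f n i & walk_op e t f n i <= 1"
proof (induction t arbitrary: n i)
 case (Suc t)
 show ?case using step_op_nonneg[OF assms(1), of "walk_op e t f"] step_op_le1[OF assms(1), of "walk_op e t f" 1] Suc by simp
qed (use assms in simp)

text \<open>At time \<open>t\<close> the walk is still inside, or it has left through
  \<open>a\<close>, or it has reached \<open>b\<close>; in the last case \<open>S\<close> bounds
  what happens in the remaining time.\<close>

lemma first_passage_bound:
 assumes e: "valid e" and f: "\<forall>n i. 0 <= f n i & f n i <= 1" and ab: "a < b" and S: "0 <= S"
  and "!!s i. s <= t ==> walk_op e s f b i <= S" and "a <= n" "n <= b"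
 shows "walk_op e t f n i <= surv e a b t n i + (1 - exit_up e a b n i) + S"
 using assms(5-)
proof (induction t arbitrary: n i)
 case 0
 consider "n = a" | "n = b" | "a < n" "n < b" using 0 by linarith
 thus ?case
 proof cases
  case 1 thus ?thesis using f[rule_format, of n i] S ab by (simp add: exit_up_below)
 next
  case 2 thus ?thesis using 0(1)[of 0 i] ab by (simp add: exit_up_above)
 next
  case 3 thus ?thesis using f[rule_format, of n i] S exit_up_bounds(2)[OF e ab, of n i] by simp
 qed
next
 case (Suc t)
 let ?B = "%n i. surv e a b t n i + (1 - exit_up e a b n i) + S"
 consider "n = a" | "n = b" | "a < n" "n < b" using Suc.prems by linarith
 thus ?case
 proof cases
  case 1 thus ?thesis using walk_op_bounds[OF e f, of "Suc t" n i] S ab by (simp add: exit_up_below)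
 next
  case 2 thus ?thesis using Suc.prems(1)[of "Suc t" i] ab by (simp add: exit_up_above)
 next
  case 3
  have IH: "walk_op e t f k j <= ?B k j" if "a <= k" "k <= b" for k j
   by (rule Suc.IH) (use that Suc.prems(1) le_SucI in auto)
  have "walk_op e (Suc t) f n i <= step_op e ?B n i"
   unfolding funpow.simps comp_def using 3 by (intro step_op_mono[OF e] IH) auto
  also have "... = step_op e (surv e a b t) n i + (1 - step_op e (exit_up e a b) n i) + S"
   by (simp add: step_op_add step_op_diff step_op_const[OF e])
  finally show ?thesis using 3 exit_up_harmonic[OF e 3, of i] by simp
 qed
qed

text \<open>A walk that is outside \<open>a..c\<close> at time \<open>s\<close> has visited
  \<open>a\<close> or \<open>c\<close> before. Summing over all times is affordable since the walls
  of a valley are visited rarely.\<close>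

lemma leave_bound:
 assumes e: "valid e" and f: "\<forall>n i. 0 <= f n i & f n i <= 1" and n: "a <= n" "n <= c"
 shows "walk_op e s f n i <= walk_op e s (%n i. if a <= n & n <= c then f n i else 0) n i
   + (SUM u<=s. walk_op e u (%n i. if n = a \<or> n = c then 1 else 0) n i)"
 using n
proof (induction s arbitrary: n i)
 case 0 thus ?case by auto
next
 case (Suc s)
 let ?f = "%n i. if a <= n & n <= c then f n i else 0"
 let ?g = "%(n::int) i. if n = a \<or> n = c then (1::real) else 0"
 have f': "\<forall>k j. 0 <= ?f k j & ?f k j <= 1" using f by auto
 have g': "\<forall>k (j::'a). 0 <= ?g k j & ?g k j <= 1" by auto
 have sum: "(SUM u<=Suc s. walk_op e u ?g n i) = ?g n i + (SUM u<=s. walk_op e (Suc u) ?g n i)"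
  by (subst sum.atMost_Suc_shift) simp
 show ?case
 proof (cases "n = a \<or> n = c")
  case True
  have "0 <= (SUM u<=s. walk_op e (Suc u) ?g n i)" by (intro sum_nonneg walk_op_bounds[OF e g', THEN conjunct1])
  hence "1 <= (SUM u<=Suc s. walk_op e u ?g n i)" unfolding sum using True by simp
  thus ?thesis using walk_op_bounds[OF e f, of "Suc s" n i] walk_op_bounds[OF e f', of "Suc s" n i] by linarith
 next
  case False
  hence n: "a <= n-1" "n+1 <= c" using Suc.prems by auto
  have "walk_op e (Suc s) f n i <= step_op e (%n i. walk_op e s ?f n i + (SUM u<=s. walk_op e u ?g n i)) n i"
   unfolding funpow.simps comp_def using n by (intro step_op_mono[OF e] Suc.IH) auto
  also have "... = walk_op e (Suc s) ?f n i + (SUM u<=s. walk_op e (Suc u) ?g n i)"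
   by (simp add: step_op_add step_op_sum)
  finally show ?thesis unfolding sum using g'[rule_format, of n] by linarith
 qed
qed

lemma walk_op_support:
 assumes "!!n i. n < lo \<or> hi < n ==> f n i = 0"
 shows "n < lo - int u \<or> hi + int u < n ==> walk_op e u f n i = 0"
proof (induction u arbitrary: n i)
 case (Suc u)
 hence "walk_op e u f (n+1) j = 0" "walk_op e u f n j = 0" "walk_op e u f (n-1) j = 0" for j by auto
 thus ?case unfolding funpow.simps comp_def step_op_def[of e "walk_op e u f"] by simp
qed (use assms in simp)

context box_measure begin

text \<open>Functions supported at distance more than \<open>u\<close> from the walls do not feel
  them in \<open>u\<close> steps, so for them the stationary measure of the box is invariant under
  the walk on the whole strip.\<close>

lemma mu_walk_op:
 assumes "!!n i. n < lo \<or> hi < n ==> f n i = 0" "L + 2 + int u <= lo" "hi <= R - 2 - int u"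
 shows "(SUM n:{L..R}. SUM i:UNIV. \<mu> n i * walk_op e u f n i) = (SUM n:{L..R}. SUM i:UNIV. \<mu> n i * f n i)"
 using assms(2,3)
proof (induction u)
 case (Suc u)
 have "walk_op e u f n i = 0" if "n < L + 2 \<or> R - 2 < n" for n i
  by (rule walk_op_support[of lo hi f]) (use assms(1) Suc that in auto)
 hence "(SUM n:{L..R}. SUM i:UNIV. \<mu> n i * walk_op e (Suc u) f n i) = (SUM n:{L..R}. SUM i:UNIV. \<mu> n i * walk_op e u f n i)"
  using mu_inv_inner[of "walk_op e u f"] by simp
 thus ?case using Suc by simp
qed simp

text \<open>By invariance, \<open>\<mu> b i\<close> times the probability of being in
  \<open>N\<close> after \<open>u\<close> steps from \<open>(b, i)\<close> is at most the stationary
  mass of \<open>N\<close>. The resulting bound is uniform in \<open>u\<close>.\<close>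

lemma walk_op_layers_le:
 assumes N: "N \<subseteq> {lo..hi}" and "L + 2 + int u <= lo" "hi <= R - 2 - int u" "lo <= b" "b <= hi"
 shows "walk_op e u (%n i. if n \<in> N then 1 else 0) b i <= 2 * D / \<epsilon>^2 * (SUM n:N. exp (V b - V n))"
proof -
 let ?f = "%n (i::'a). if n \<in> N then 1 else (0::real)"
 have f: "\<forall>n i. 0 <= ?f n i & ?f n i <= 1" by auto
 have b: "L + 1 < b" "b < R - 1" using assms by auto
 have T0: "0 <= walk_op e u ?f n i" for n i by (rule walk_op_bounds[OF trip f, THEN conjunct1])
 have NLR: "N \<subseteq> {L..R}" using assms by auto
 have "\<epsilon> * \<kappa> b * walk_op e u ?f b i <= \<mu> b i * walk_op e u ?f b i"
  using mu_ge[OF b] T0 by (intro mult_right_mono) auto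
 also have "... <= (SUM i:UNIV. \<mu> b i * walk_op e u ?f b i)"
  by (rule member_le_sum) (use T0 mu_nonneg b in auto)
 also have "... <= (SUM n:{L..R}. SUM i:UNIV. \<mu> n i * walk_op e u ?f n i)"
  by (rule member_le_sum[where f="%n. SUM i:UNIV. \<mu> n i * walk_op e u ?f n i"])
   (use T0 mu_nonneg b in \<open>auto intro!: sum_nonneg mult_nonneg_nonneg\<close>)
 also have "... = (SUM n:{L..R}. SUM i:UNIV. \<mu> n i * ?f n i)"
  by (rule mu_walk_op[of lo hi]) (use assms in auto)
 also have "... = (SUM n:N. SUM i:UNIV. \<mu> n i)"
  by (rule sum.mono_neutral_cong_right) (use NLR in auto)
 also have "... <= (SUM n:N. 2 * D / \<epsilon> * \<kappa> n)"
  by (intro sum_mono mass_le') (use assms in auto)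
 also have "... = (SUM n:N. 2 * D / \<epsilon> * (\<kappa> b * exp (V b - V n)))"
 proof (intro sum.cong refl)
  fix n assume "n \<in> N"
  hence "0 < \<kappa> n" "0 < \<kappa> b" using kappa_pos assms b by auto
  thus "2 * D / \<epsilon> * \<kappa> n = 2 * D / \<epsilon> * (\<kappa> b * exp (V b - V n))" by (simp add: V_def exp_diff)
 qed
 also have "... = \<epsilon> * \<kappa> b * (2 * D / \<epsilon>^2 * (SUM n:N. exp (V b - V n)))"
  using eps_pos by (simp add: sum_distrib_left power2_eq_square field_simps)
 finally show ?thesis using kappa_pos[of b] b eps_pos by (subst (asm) mult_le_cancel_left_pos) auto
qed

end

definition site_pot :: "'m::finite env => int => real" where
 "site_pot e n = (if 0 <= n then pot e 0 (n + 1) else - pot e n 1)"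

lemma (in box_measure) V_site_pot:
 assumes "L <= n" "n < R" "L <= 0" "1 <= R"
 shows "abs(site_pot e n - (V n - V 0)) <= 2 * c0"
 using V_pot[of 0 "n+1"] V_pot[of n 1] assms by (auto simp: site_pot_def)

context elliptic_env begin

lemma site_pot_diff:
 assumes "a < b"
 shows "abs(pot e a b - (site_pot e (b-1) - site_pot e a)) <= 6 * c0"
proof -
 obtain L R :: int where bnds: "L < R" "L <= a" "L <= 0" "b <= R" "1 <= R"
  by (rule that[of "min a 0" "max b 1"]) auto
 obtain \<mu> where "box_measure e \<epsilon> D L R \<mu>" using box_measure_obtain[OF bnds(1)] .
 then interpret box_measure e \<epsilon> D L R \<mu> .
 have "abs(pot e a b - (V (b-1) - V a)) <= 2 * c0" by (intro V_pot) (use bnds assms in auto)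
 moreover have "abs(site_pot e a - (V a - V 0)) <= 2 * c0" by (intro V_site_pot) (use bnds assms in auto)
 moreover have "abs(site_pot e (b-1) - (V (b-1) - V 0)) <= 2 * c0" by (intro V_site_pot) (use bnds assms in auto)
 ultimately show ?thesis by linarith
qed

text \<open>Reflection sends the edge from \<open>n\<close> to \<open>n + 1\<close> to the edge from
  \<open>- n - 1\<close> to \<open>- n\<close>. Besides two comparisons with \<open>V\<close>, this
  shift by one edge is paid twice, at \<open>n\<close> and at the origin.\<close>

lemma site_pot_mirror: "abs(site_pot (mirror e) n - site_pot e (- n)) <= 6 * c0"
proof -
 obtain L R :: int where bnds: "L < R" "L <= -n-1" "L <= -1" "-n+1 <= R" "1 <= R"
  by (rule that[of "min (-n-1) (-1)" "max (-n+1) 1"]) auto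
 obtain \<mu> where "box_measure e \<epsilon> D L R \<mu>" using box_measure_obtain[OF bnds(1)] .
 then interpret box_measure e \<epsilon> D L R \<mu> .
 have "pot (mirror e) 0 (n+1) = - pot e (-n-1) 0" if "0 <= n"
  using pot_mirror[of "-n-1" 0] that by (simp add: add.commute)
 moreover have "pot (mirror e) n 1 = - pot e (-1) (-n)" if "n < 0"
  using pot_mirror[of "-1" "-n"] that by simp
 moreover have "abs(V (-n-1) - V (-n)) <= c0" unfolding abs_minus_commute[of "V (-n-1)"] by (intro V_lip) (use bnds in auto)
 moreover have "abs(V (-1) - V 0) <= c0" using V_lip[of 0] bnds by auto
 moreover have "abs(pot e (-n-1) 0 - (V (-1) - V (-n-1))) <= 2 * c0" if "0 <= n" using V_pot[of "-n-1" 0] that bnds by simp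
 moreover have "abs(pot e (-1) (-n) - (V (-n-1) - V (-1))) <= 2 * c0" if "n < 0" using V_pot[of "-1" "-n"] that bnds by simp
 moreover have "abs(site_pot e (-n) - (V (-n) - V 0)) <= 2 * c0" by (intro V_site_pot) (use bnds in auto)
 moreover have "site_pot (mirror e) n = (if 0 <= n then pot (mirror e) 0 (n+1) else - pot (mirror e) n 1)"
  by (simp add: site_pot_def)
 moreover have "0 <= n \<or> n < 0" by linarith
 ultimately show ?thesis by (smt (verit))
qed

text \<open>The box is chosen after \<open>u\<close>, with walls out of reach in \<open>u\<close>
  steps. It leaves no trace in the bound, which therefore holds at all times.\<close>

lemma layers_bound:
 fixes N :: "int set"
 assumes "finite N"
 shows "walk_op e u (%n i. if n \<in> N then 1 else 0) b i
  <= 2 * D / \<epsilon>^2 * exp (4 * c0) * (SUM n:N. exp (site_pot e b - site_pot e n))"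
proof -
 define lo where "lo = Min (insert b (insert 0 N))"
 define hi where "hi = Max (insert b (insert 0 N))"
 have lohi: "N \<subseteq> {lo..hi}" "lo <= b" "b <= hi" "lo <= 0" "0 <= hi"
  unfolding lo_def hi_def using assms by (auto intro!: Min_le Max_ge simp del: Min_insert Max_insert)
 let ?L = "lo - 2 - int u" and ?R = "hi + 2 + int u"
 have "?L < ?R" using lohi by linarith
 then obtain \<mu> where "box_measure e \<epsilon> D ?L ?R \<mu>" by (rule box_measure_obtain)
 then interpret box_measure e \<epsilon> D ?L ?R \<mu> .
 have "walk_op e u (%n i. if n \<in> N then 1 else 0) b i <= 2 * D / \<epsilon>^2 * (SUM n:N. exp (V b - V n))"
  by (rule walk_op_layers_le[of N lo hi]) (use lohi in auto)
 also have "(SUM n:N. exp (V b - V n)) <= (SUM n:N. exp (4 * c0) * exp (site_pot e b - site_pot e n))"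
 proof (rule sum_mono)
  fix n assume "n \<in> N"
  hence "lo <= n" "n <= hi" using lohi by auto
  hence "V b - V n <= 4 * c0 + (site_pot e b - site_pot e n)"
   using V_site_pot[of b] V_site_pot[of n] lohi by linarith
  thus "exp (V b - V n) <= exp (4 * c0) * exp (site_pot e b - site_pot e n)"
   unfolding exp_add[symmetric] by simp
 qed
 finally have "walk_op e u (%n i. if n \<in> N then 1 else 0) b i
   <= 2 * D / \<epsilon>^2 * (SUM n:N. exp (4 * c0) * exp (site_pot e b - site_pot e n))"
  using D_ge1 eps_pos by (smt (verit) divide_nonneg_nonneg mult_left_mono zero_le_power2)
 thus ?thesis by (simp add: sum_distrib_left[symmetric] mult.assoc)
qed

lemma D_nonneg: "0 <= D"
proof -
 obtain \<mu> where "box_measure e \<epsilon> D 0 1 \<mu>" using box_measure_obtain[of 0 1] by auto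
 then interpret box_measure e \<epsilon> D 0 1 \<mu> .
 show ?thesis using D_ge1 by simp
qed

text \<open>The summands belong to the three ways of failing in
  \<open>quenched_localization\<close>: \<open>1 / \<epsilon>\<close> to leaving through
  \<open>a\<close>, \<open>D / \<epsilon>^2 + D / \<epsilon>^3\<close> to surviving too long, and
  \<open>14 = 2 * 7\<close> to moving away from the bottom. The factor \<open>exp (6 * c0)\<close>
  converts \<open>pot\<close> into \<open>site_pot\<close>.\<close>

definition "KQ = (1 / \<epsilon> + D / \<epsilon>^2 + D / \<epsilon>^3 + 14 * (D / \<epsilon>^2)) * exp (6 * c0)"

lemma KQ_nonneg: "0 <= KQ"
 unfolding KQ_def using eps_pos D_nonneg by simp

text \<open>
  In a valley \<open>{a..c}\<close> with bottom \<open>b\<close> whose walls are higher than \<open>T = ln t\<close>, whereas on the way from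
  \<open>a\<close> to \<open>b\<close> there is no ascent of height \<open>T\<close>, the walk started at \<open>0\<close> is near \<open>b\<close> at time \<open>t\<close>.
\<close>

lemma quenched_localization:
 assumes abc: "a < 0" "0 <= b" "b < c" and t: "0 < t" and T: "T = ln (real t)"
  and wall: "site_pot e b + T + w <= site_pot e a" "site_pot e b + T + w <= site_pot e c"
  and rise: "!!i j. a <= i ==> i <= j ==> j <= b ==> site_pot e j - site_pot e i <= T - w"
  and left: "!!j. 0 <= j ==> j <= b ==> site_pot e j + w <= site_pot e a"
  and far: "!!n. a <= n ==> n <= c ==> r < abs(n - b) ==> site_pot e b + w <= site_pot e n"
 shows "walk_op e t (%n i. if r < abs(n - b) then 1 else 0) 0 i <= KQ * (real_of_int (c - a))^2 * exp (- w)"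
proof -
 let ?f = "%n (i::'m). if r < abs(n - b) then 1 else (0::real)"
 define M where "M = real_of_int (c - a)"
 have M2: "2 <= M" unfolding M_def using abc by linarith
 hence M1: "1 <= M" "M <= M^2" "1 <= M^2" by (auto simp: power2_eq_square) (smt (verit) mult_le_cancel_left1)+
 define C where "C = exp (6 * c0)"
 have C1: "1 <= C" unfolding C_def using c0_nonneg by simp
 have wT: "w <= T" using rise[of 0 0] abc by simp
 have eT: "exp T = real t" "exp (-T) = 1 / real t" using T t by (simp_all add: exp_minus inverse_eq_divide)
 define W where "W = exp (- w)"
 have W: "0 < W" "1 / real t <= W" unfolding W_def eT(2)[symmetric] using wT by auto
 have f01: "\<forall>n i. 0 <= ?f n i & ?f n i <= 1" by auto
 have cardI: "real (card {a<..<b}) <= M" "real (card {0..<b}) <= M" unfolding M_def using abc by auto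
 have surv: "surv e a b t 0 i <= (D / \<epsilon>^2 + D / \<epsilon>^3) * C * M^2 * W"
 \<comment> \<open>If the bottom is the starting layer, the walk does not start in the open interval
   and nothing survives.\<close>
 proof (cases "b = 0")
  case True
  hence "surv e a b t 0 i = 0" by (cases t) auto
  thus ?thesis using D_nonneg eps_pos C1 W by simp
 next
  case False
  \<comment> \<open>No ascent on the way to \<open>b\<close> exceeds \<open>T - w\<close>, so up to
    powers of \<open>M\<close> the mean exit time is at most of order \<open>exp (T - w)\<close>,
    which is \<open>t * exp (- w)\<close>.\<close>
  have one: "D / (\<epsilon>^2 * exit_up e k b (k+1) undefined) <= D / \<epsilon>^2 * (1 + M * (C * exp (T - w)) / \<epsilon>)"
   if k: "k \<in> {a<..<b}" for k
  proof -
   have "exp (pot e k (j+1)) <= C * exp (T - w)" if "j \<in> {k+1..<b}" for j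
   proof -
    have "site_pot e j - site_pot e k <= T - w" by (rule rise) (use that k in auto)
    hence "pot e k (j+1) <= 6 * c0 + (T - w)" using site_pot_diff[of k "j+1"] that by simp
    thus ?thesis unfolding C_def exp_add[symmetric] by simp
   qed
   hence "(SUM j:{k+1..<b}. exp (pot e k (j+1))) <= (SUM j:{k+1..<b}. C * exp (T - w))" by (rule sum_mono)
   also have "... <= M * (C * exp (T - w))" using k abc C1 unfolding M_def by (auto intro!: mult_right_mono)
   finally have "1 / exit_up e k b (k+1) undefined <= 1 + M * (C * exp (T - w)) / \<epsilon>"
    using inverse_exit_up_le[of k b] k eps_pos
    by (smt (verit) divide_right_mono greaterThanLessThan_iff)
   hence "D / \<epsilon>^2 * (1 / exit_up e k b (k+1) undefined) <= D / \<epsilon>^2 * (1 + M * (C * exp (T - w)) / \<epsilon>)"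
    using D_nonneg by (intro mult_left_mono) auto
   thus ?thesis by simp
  qed
  have "real t * surv e a b t 0 i <= (SUM k:{a<..<b}. D / \<epsilon>^2 * (1 + M * (C * exp (T - w)) / \<epsilon>))"
   by (rule order_trans[OF surv_bound sum_mono]) (use abc one in auto)
  also have "... <= M * (D / \<epsilon>^2 * (1 + M * (C * exp (T - w)) / \<epsilon>))"
   unfolding sum_constant using D_nonneg eps_pos M1 C1 cardI by (intro mult_right_mono) auto
  finally have "surv e a b t 0 i <= M * (D / \<epsilon>^2 * (1 + M * (C * exp (T - w)) / \<epsilon>)) / real t"
   by (subst pos_le_divide_eq) (use t in \<open>simp_all only: mult.commute of_nat_0_less_iff\<close>)
  also have "... = M * (D / \<epsilon>^2 * (1 / real t + M * (C * (exp (T - w) / real t)) / \<epsilon>))"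
   using t eps_pos by (simp add: field_simps)
  also have "exp (T - w) / real t = W" using t eT unfolding W_def by (simp add: exp_diff exp_minus field_simps)
  also have "M * (D / \<epsilon>^2 * (1 / real t + M * (C * W) / \<epsilon>)) <= M * (D / \<epsilon>^2 * (M * (C * W) + M * (C * W) / \<epsilon>))"
  proof -
   have "1 * 1 <= M * C" using M1 C1 by (intro mult_mono) auto
   hence "1 / real t <= M * (C * W)" using W mult_right_mono[of 1 "M * C" W] unfolding mult.assoc by linarith
   thus ?thesis using M1 D_nonneg eps_pos by (intro mult_left_mono add_mono) auto
  qed
  also have "... = (D / \<epsilon>^2 + D / \<epsilon>^3) * C * M^2 * W"
   using eps_pos by (simp add: field_simps power2_eq_square power3_eq_cube)
  finally show ?thesis .
 qed
 have wrong: "1 - exit_up e a b 0 i <= 1 / \<epsilon> * C * M^2 * W"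
 proof -
  have "1 - exit_up e a b 0 i <= (SUM k:{0..<b}. exp (pot e a (k+1))) / \<epsilon>"
   by (rule exit_down_le) (use abc in auto)
  also have "... <= (SUM k:{0..<b}. C * W) / \<epsilon>"
  proof (intro divide_right_mono sum_mono)
   fix k assume k: "k \<in> {0..<b}"
   have "site_pot e k + w <= site_pot e a" using left[of k] k by simp
   hence "pot e a (k+1) <= 6 * c0 + (- w)" using site_pot_diff[of a "k+1"] k abc by simp
   thus "exp (pot e a (k+1)) <= C * W" unfolding C_def W_def exp_add[symmetric] by simp
  qed (use eps_pos in simp)
  also have "... <= (M^2 * (C * W)) / \<epsilon>"
   unfolding sum_constant using cardI M1 C1 W eps_pos by (intro divide_right_mono mult_right_mono) auto
  finally show ?thesis by (simp add: mult_ac)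
 qed
 define X where "X = 2 * D / \<epsilon>^2 * exp (4 * c0)"
 have X: "0 <= X" "X <= 2 * D / \<epsilon>^2 * C" unfolding X_def C_def using D_nonneg eps_pos c0_nonneg
  by (auto intro!: mult_left_mono divide_right_mono)
 have stay: "walk_op e s ?f b i' <= X * (7 * M^2 * W)" if s: "s <= t" for s i'
 proof -
  let ?N = "{n\<in>{a..c}. r < abs(n - b)}"
  have 1: "walk_op e s (%n i. if n \<in> ?N then 1 else 0) b i' <= X * ((M + 1) * W)"
  proof -
   have "(SUM n:?N. exp (site_pot e b - site_pot e n)) <= (SUM n:?N. W)"
    unfolding W_def by (intro sum_mono) (use far in \<open>auto simp: algebra_simps\<close>)
   also have "... <= (M + 1) * W"
   proof -
    have "card ?N <= card {a..c}" by (intro card_mono) auto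
    hence "real (card ?N) <= M + 1" unfolding M_def using abc by auto
    thus ?thesis using W by simp
   qed
   finally have "X * (SUM n:?N. exp (site_pot e b - site_pot e n)) <= X * ((M + 1) * W)"
    using X(1) by (intro mult_left_mono)
   moreover have "finite ?N" by (rule finite_subset[of _ "{a..c}"]) auto
   ultimately show ?thesis using layers_bound[of ?N s b i'] unfolding X_def[symmetric] by linarith
  qed
  \<comment> \<open>The additional height \<open>T\<close> of the walls gives the factor
    \<open>1 / t\<close>, which pays for the at most \<open>t + 1\<close> times in
    \<open>leave_bound\<close>.\<close>
  have 2: "walk_op e u (%n i. if n = a \<or> n = c then 1 else 0) b i' <= X * (2 * (W / real t))" for u
  proof -
   have "exp (site_pot e b - site_pot e n) <= W / real t" if "n \<in> {a, c}" for n
   proof -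
    have "site_pot e b - site_pot e n <= - w - T" using wall that by auto
    hence "exp (site_pot e b - site_pot e n) <= exp (- w - T)" by simp
    thus ?thesis using eT t unfolding W_def by (simp add: exp_diff)
   qed
   hence "(SUM n:{a, c}. exp (site_pot e b - site_pot e n)) <= (SUM n:{a, c}. W / real t)" by (rule sum_mono)
   also have "... = 2 * (W / real t)" using abc by simp
   finally have "X * (SUM n:{a, c}. exp (site_pot e b - site_pot e n)) <= X * (2 * (W / real t))"
    using X by (intro mult_left_mono)
   thus ?thesis using layers_bound[of "{a,c}" u b i'] unfolding X_def[symmetric] by simp
  qed
  have "walk_op e s ?f b i' <= walk_op e s (%n i. if a <= n & n <= c then ?f n i else 0) b i'
   + (SUM u<=s. walk_op e u (%n i. if n = a \<or> n = c then 1 else 0) b i')"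
   by (rule leave_bound[OF trip f01]) (use abc in auto)
  also have "(%n (i::'m). if a <= n & n <= c then ?f n i else 0) = (%n i. if n \<in> ?N then 1 else 0)"
   by (auto simp: fun_eq_iff)
  also have "(SUM u<=s. walk_op e u (%n i. if n = a \<or> n = c then 1 else 0) b i') <= (SUM u<=s. X * (2 * (W / real t)))"
   by (intro sum_mono 2)
  also have "... <= (2 * real t) * (X * (2 * (W / real t)))"
   unfolding sum_constant card_atMost using s t X W by (intro mult_right_mono) auto
  also have "... = X * (4 * W)" using t by simp
  finally have "walk_op e s ?f b i' <= X * ((M + 1) * W) + X * (4 * W)" using 1 by linarith
  also have "... = X * ((M + 5) * W)" by (simp add: algebra_simps)
  also have "... <= X * (7 * M^2 * W)" using M1 X W by (intro mult_left_mono mult_right_mono) auto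
  finally show ?thesis .
 qed
 have "walk_op e t ?f 0 i <= surv e a b t 0 i + (1 - exit_up e a b 0 i) + X * (7 * M^2 * W)"
  by (rule first_passage_bound[OF trip f01]) (use abc X W M1 stay in auto)
 also have "X * (7 * M^2 * W) <= 2 * D / \<epsilon>^2 * C * (7 * M^2 * W)" using X W by (intro mult_right_mono) auto
 also have "... = 14 * (D / \<epsilon>^2) * (C * (M^2 * W))" by simp
 also have "surv e a b t 0 i + (1 - exit_up e a b 0 i) + 14 * (D / \<epsilon>^2) * (C * (M^2 * W))
   <= (D / \<epsilon>^2 + D / \<epsilon>^3) * (C * (M^2 * W)) + 1 / \<epsilon> * (C * (M^2 * W)) + 14 * (D / \<epsilon>^2) * (C * (M^2 * W))"
  using surv wrong unfolding mult.assoc by (intro add_mono) auto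
 also have "... = KQ * M^2 * W"
  unfolding KQ_def C_def[symmetric] distrib_right by (simp only: mult_ac add_ac)
 finally show ?thesis unfolding M_def W_def by simp
qed

end

section \<open>From the law of the walk to the transition operator\<close>

lemma nn_integral_step:
 fixes w :: "'m::finite env"
 assumes "valid w" "!!x. 0 <= g x"
 shows "(\<integral>\<^sup>+x. ennreal (g x) \<partial>measure_pmf (step w s)) = ennreal (step_op w (%n i. g (n, i)) (fst s) (snd s))"
proof -
 obtain n i where s: "s = (n, i)" by (cases s)
 obtain P Q R where PQR: "w n = (P, Q, R)" by (cases "w n")
 have tr: "!!n. w n \<in> triples" using assms(1) by (simp add: valid_def)
 have nn: "0 <= P $ i $ j" "0 <= Q $ i $ j" "0 <= R $ i $ j" for j
  using tr[of n] by (auto simp: PQR triples_def less_eq_vec_def)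
 have pos: "0 <= trans_prob w s u" for u
  by (cases u) (auto simp: s PQR nn)
 let ?A = "{n - 1, n, n + 1} \<times> (UNIV :: 'm set)"
 have "(\<integral>\<^sup>+x. ennreal (g x) \<partial>measure_pmf (step w s))
   = (\<integral>\<^sup>+x. ennreal (trans_prob w s x * g x) \<partial>count_space UNIV)"
  by (simp add: nn_integral_measure_pmf pmf_step[OF tr] ennreal_mult pos assms(2))
 also have "... = (SUM u:?A. ennreal (trans_prob w s u * g u))"
  by (rule nn_integral_count_space') (auto simp: s PQR split: if_splits)
 also have "... = ennreal (SUM u:?A. trans_prob w s u * g u)"
  by (rule sum_ennreal) (simp add: pos assms(2))
 also have "(SUM u:?A. trans_prob w s u * g u)
   = (SUM k:{n - 1, n, n + 1}. SUM j:UNIV. trans_prob w s (k, j) * g (k, j))"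
  by (subst sum.cartesian_product) (simp add: case_prod_unfold)
 also have "... = step_op w (%n i. g (n, i)) n i"
  by (simp add: s PQR step_op_def sum.distrib)
 finally show ?thesis by (simp add: s)
qed

text \<open>One step of the walk killed on arrival at a forbidden site. The starting site is not
  tested, in agreement with returns at times \<open>t > 0\<close>.\<close>

definition taboo_op :: "'m::finite env => ('m site => bool) => (int => 'm => real) => int => 'm => real" where
 "taboo_op w ok f = step_op w (%n i. if ok (n, i) then f n i else 0)"

text \<open>The law of the trajectory is peeled from its last coordinate: integrating it out
  replaces \<open>f\<close> by \<open>taboo_op w ok f\<close> and shortens the path. The induction
  on \<open>t\<close> therefore allows an arbitrary iterate in place of \<open>g\<close>.\<close>

lemma nn_integral_walk_law:
 fixes w :: "'m::finite env" and g :: "int => 'm => real"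
 assumes v: "valid w" and g: "!!n i. 0 <= g n i"
 shows "(\<integral>\<^sup>+\<xi>. (if \<forall>k\<in>{0<..t}. ok (\<xi> k) then ennreal (g (fst (\<xi> t)) (snd (\<xi> t))) else 0) \<partial>walk_law w z)
  = ennreal ((taboo_op w ok ^^ t) g (fst z) (snd z))"
proof -
 interpret IT: Ionescu_Tulcea "walk_kernel w z" "%_. count_space UNIV :: 'm site measure"
  by (rule Ionescu_Tulcea_walk)
 let ?M = "%_::nat. count_space UNIV :: 'm site measure"
 let ?u = "%_. undefined :: 'm site"
 have u: "?u \<in> space (Pi\<^sub>M {0..<0} ?M)" by (simp add: space_PiM)
 define F where "F n f h = (if \<forall>k\<in>{0<..n}. ok (h k) then ennreal (f (fst (h n)) (snd (h n))) else 0)"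
  for n :: nat and f :: "int => 'm => real" and h :: "nat => 'm site"
 have F_alt: "F n f h = (\<Prod>k\<in>{0<..n}. if ok (h k) then 1 else 0) * ennreal (f (fst (h n)) (snd (h n)))" for n f h
  unfolding F_def by (auto simp: prod_zero_iff)
 have F_meas[measurable]: "F n f \<in> borel_measurable (Pi\<^sub>M {0..<Suc n} ?M)" for n f
  unfolding F_alt[abs_def]
 proof (intro borel_measurable_times_ennreal borel_measurable_prod_ennreal)
  show "(%h. if ok (h k) then 1 else 0) \<in> borel_measurable (Pi\<^sub>M {0..<Suc n} ?M)" if "k \<in> {0<..n}" for k
   by (rule measurable_compose[of "%h. h k" _ "count_space UNIV" "%s. if ok s then 1 else 0"])
    (use that in \<open>auto intro: measurable_component_singleton\<close>)
  show "(%h. ennreal (f (fst (h n)) (snd (h n)))) \<in> borel_measurable (Pi\<^sub>M {0..<Suc n} ?M)"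
   by (rule measurable_compose[of "%h. h n" _ "count_space UNIV" "%s. ennreal (f (fst s) (snd s))"])
    (auto intro: measurable_component_singleton)
 qed
 have to_C: "(\<integral>\<^sup>+\<xi>. F n f \<xi> \<partial>walk_law w z) = (\<integral>\<^sup>+h. F n f h \<partial>IT.C 0 (Suc n) ?u)" for n f
 proof -
  have "IT.CI {0..<Suc n} = distr (walk_law w z) (Pi\<^sub>M {0..<Suc n} ?M) (%x. restrict x {0..<Suc n})"
   unfolding walk_law_def by (rule IT.distr_lim[symmetric]) simp
  hence "(\<integral>\<^sup>+h. F n f h \<partial>IT.CI {0..<Suc n}) = (\<integral>\<^sup>+\<xi>. F n f (restrict \<xi> {0..<Suc n}) \<partial>walk_law w z)"
   by (simp add: nn_integral_distr cong: measurable_cong_sets[OF sets_walk_law refl] del: atLeastLessThanSuc_atLeastAtMost)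
  also have "... = (\<integral>\<^sup>+\<xi>. F n f \<xi> \<partial>walk_law w z)"
   by (intro nn_integral_cong) (simp add: F_def restrict_def)
  also have "IT.CI {0..<Suc n} = IT.C 0 (Suc n) ?u"
  proof (rule measure_eqI)
   show "sets (IT.CI {0..<Suc n}) = sets (IT.C 0 (Suc n) ?u)" using IT.sets_C[OF u, of "Suc n"] unfolding IT.CI_def sets_distr by (simp only: add_0)
   fix X assume "X \<in> sets (IT.CI {0..<Suc n})"
   hence X: "X \<in> sets (Pi\<^sub>M {0..<Suc n} ?M)" unfolding IT.CI_def sets_distr .
   have "X \<subseteq> space (Pi\<^sub>M {0..<Suc n} ?M)" using X by (rule sets.sets_into_space)
   thus "emeasure (IT.CI {0..<Suc n}) X = emeasure (IT.C 0 (Suc n) ?u) X"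
    by (subst IT.emeasure_CI[OF order_refl X]) (subst prod_emb_id, auto simp: space_PiM)
  qed
  finally show ?thesis by simp
 qed
 have rec: "(\<integral>\<^sup>+h. F (Suc n) f h \<partial>IT.C 0 (Suc (Suc n)) ?u) = (\<integral>\<^sup>+h. F n (taboo_op w ok f) h \<partial>IT.C 0 (Suc n) ?u)"
  if f: "!!n i. 0 <= f n i" for n f
 proof -
  have "(\<integral>\<^sup>+h. F (Suc n) f h \<partial>IT.C 0 (Suc (Suc n)) ?u) = (\<integral>\<^sup>+h. (\<integral>\<^sup>+h'. F (Suc n) f h' \<partial>IT.eP (Suc n) h) \<partial>IT.C 0 (Suc n) ?u)"
   using IT.measurable_eP[of "Suc n"] IT.sets_C[OF u, of "Suc n"]
   by (subst IT.C.simps(2), subst nn_integral_bind[where B="Pi\<^sub>M {0..<Suc (Suc n)} ?M"])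
    (auto cong: measurable_cong_sets)
  also have "... = (\<integral>\<^sup>+h. F n (taboo_op w ok f) h \<partial>IT.C 0 (Suc n) ?u)"
  proof (rule nn_integral_cong)
   fix h assume "h \<in> space (IT.C 0 (Suc n) ?u)"
   hence h: "h \<in> space (Pi\<^sub>M {0..<Suc n} ?M)" using IT.space_C[OF u, of "Suc n"] by simp
   let ?f = "%s. if ok s then f (fst s) (snd s) else 0"
   have "(\<integral>\<^sup>+h'. F (Suc n) f h' \<partial>IT.eP (Suc n) h) = (\<integral>\<^sup>+x. F (Suc n) f (h(Suc n := x)) \<partial>measure_pmf (step w (h n)))"
    by (subst IT.nn_integral_eP[OF h]) (auto simp: walk_kernel_def)
   also have "... = (\<integral>\<^sup>+x. (if \<forall>k\<in>{0<..n}. ok (h k) then 1 else 0) * ennreal (?f x) \<partial>measure_pmf (step w (h n)))"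
   proof (rule nn_integral_cong)
    fix x
    have "(\<forall>k\<in>{0<..Suc n}. ok ((h(Suc n := x)) k)) \<longleftrightarrow> (\<forall>k\<in>{0<..n}. ok (h k)) & ok x"
     by (auto simp: le_Suc_eq)
    thus "F (Suc n) f (h(Suc n := x)) = (if \<forall>k\<in>{0<..n}. ok (h k) then 1 else 0) * ennreal (?f x)"
     unfolding F_def by simp
   qed
   also have "... = (if \<forall>k\<in>{0<..n}. ok (h k) then 1 else 0) * ennreal (step_op w (%n i. ?f (n,i)) (fst (h n)) (snd (h n)))"
    by (subst nn_integral_cmult) (auto simp: nn_integral_step[OF v] f cong: if_cong)
   also have "... = F n (taboo_op w ok f) h"
    unfolding F_def taboo_op_def fst_conv snd_conv by simp
   finally show "(\<integral>\<^sup>+h'. F (Suc n) f h' \<partial>IT.eP (Suc n) h) = F n (taboo_op w ok f) h" .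
  qed
  finally show ?thesis .
 qed
 have base: "(\<integral>\<^sup>+h. F 0 f h \<partial>IT.C 0 (Suc 0) ?u) = ennreal (f (fst z) (snd z))" for f
 proof -
  have "(\<integral>\<^sup>+h. F 0 f h \<partial>IT.C 0 (Suc 0) ?u) = (\<integral>\<^sup>+h. (\<integral>\<^sup>+h'. F 0 f h' \<partial>IT.eP 0 h) \<partial>return (Pi\<^sub>M {0..<0} ?M) ?u)"
   unfolding IT.C.simps add_0
   by (rule nn_integral_bind[where B="Pi\<^sub>M {0..<Suc 0} ?M"])
    (use IT.measurable_eP[of 0] F_meas[of 0 f] in \<open>auto cong: measurable_cong_sets\<close>)
  also have "... = (\<integral>\<^sup>+h'. F 0 f h' \<partial>IT.eP 0 ?u)"
   by (rule nn_integral_return[OF u]) (use IT.measurable_eP[of 0] F_meas[of 0 f] in measurable)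
  also have "... = (\<integral>\<^sup>+x. F 0 f (?u(0 := x)) \<partial>return_pmf z)"
   unfolding IT.nn_integral_eP[OF u F_meas] by (simp add: walk_kernel_def)
  finally show ?thesis by (simp add: F_def)
 qed
 have pos: "0 <= (taboo_op w ok ^^ k) g n i" for k n i
  by (induction k arbitrary: n i) (auto simp: g taboo_op_def intro!: step_op_nonneg[OF v])
 have "(\<integral>\<^sup>+h. F t ((taboo_op w ok ^^ k) g) h \<partial>IT.C 0 (Suc t) ?u) = ennreal ((taboo_op w ok ^^ (t + k)) g (fst z) (snd z))" for k
 proof (induction t arbitrary: k)
  case 0 show ?case using base by simp
 next
  case (Suc t)
  have "(\<integral>\<^sup>+h. F (Suc t) ((taboo_op w ok ^^ k) g) h \<partial>IT.C 0 (Suc (Suc t)) ?u)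
    = (\<integral>\<^sup>+h. F t ((taboo_op w ok ^^ Suc k) g) h \<partial>IT.C 0 (Suc t) ?u)"
   using rec[of "(taboo_op w ok ^^ k) g" t] pos by simp
  thus ?case using Suc[of "Suc k"] by simp
 qed
 from this[of 0] have "(\<integral>\<^sup>+\<xi>. F t g \<xi> \<partial>walk_law w z) = ennreal ((taboo_op w ok ^^ t) g (fst z) (snd z))"
  unfolding to_C by (simp del: IT.C.simps)
 thus ?thesis by (simp add: F_def)
qed

lemma sets_walk_law_coord: "{\<xi>. \<xi> t \<in> A} \<in> sets (walk_law w z)"
proof -
 have "(%\<xi>. \<xi> t) -` A \<inter> space (walk_law w z) \<in> sets (walk_law w z)"
  by (rule measurable_sets[of _ _ "count_space UNIV"])
   (auto simp: measurable_cong_sets[OF sets_walk_law refl] intro: measurable_component_singleton)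
 thus ?thesis by (simp add: space_walk_law vimage_def)
qed

lemma measure_walk_law:
 assumes v: "valid w"
 shows "measure (walk_law w z) {\<xi>. \<xi> t \<in> A} = walk_op w t (%n i. indicator A (n, i)) (fst z) (snd z)"
proof -
 have *: "taboo_op w (%_. True) = step_op w" by (simp add: taboo_op_def fun_eq_iff)
 have "emeasure (walk_law w z) {\<xi>. \<xi> t \<in> A} = (\<integral>\<^sup>+\<xi>. indicator {\<xi>. \<xi> t \<in> A} \<xi> \<partial>walk_law w z)"
  by (rule nn_integral_indicator[OF sets_walk_law_coord, symmetric])
 also have "... = (\<integral>\<^sup>+\<xi>. (if \<forall>k\<in>{0<..t}. True then ennreal (indicator A (fst (\<xi> t), snd (\<xi> t))) else 0) \<partial>walk_law w z)"
  by (intro nn_integral_cong) (auto simp: indicator_def)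
 also have "... = ennreal (walk_op w t (%n i. indicator A (n, i)) (fst z) (snd z))"
  using nn_integral_walk_law[OF v, where g="%n i. indicator A (n, i)" and t=t and ok="%_. True" and z=z] by (simp add: *)
 finally show ?thesis using walk_op_bounds[OF v, of "%n i. indicator A (n, i)"]
  by (simp add: measure_def)
qed

section \<open>Recurrence and the potential\<close>

lemma recurrent_taboo:
 assumes v: "valid w" and "recurrent w"
 shows "(%t. (taboo_op w (%s. s \<noteq> z) ^^ t) (%_ _. 1) (fst z) (snd z)) \<longlonglongrightarrow> 0"
proof -
 let ?a = "%t. (taboo_op w (%s. s \<noteq> z) ^^ t) (%_ _. 1) (fst z) (snd z)"
 let ?W = "walk_law w z"
 have set: "{\<xi>. \<forall>k\<in>{0<..t}. \<xi> k \<noteq> z} \<in> sets ?W" for t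
 proof -
  have "{\<xi>. \<forall>k\<in>{0<..t}. \<xi> k \<noteq> z} = space ?W - (\<Union>k\<in>{0<..t}. {\<xi>. \<xi> k \<in> {z}})" by (auto simp: space_walk_law)
  thus ?thesis by (simp only: sets.compl_sets sets.finite_UN finite_greaterThanAtMost sets_walk_law_coord)
 qed
 have em: "emeasure ?W {\<xi>. \<forall>k\<in>{0<..t}. \<xi> k \<noteq> z} = ennreal (?a t)" for t
 proof -
  have "emeasure ?W {\<xi>. \<forall>k\<in>{0<..t}. \<xi> k \<noteq> z} = (\<integral>\<^sup>+\<xi>. indicator {\<xi>. \<forall>k\<in>{0<..t}. \<xi> k \<noteq> z} \<xi> \<partial>?W)"
   using set by simp
  also have "... = (\<integral>\<^sup>+\<xi>. (if \<forall>k\<in>{0<..t}. \<xi> k \<noteq> z then ennreal 1 else 0) \<partial>?W)"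
   by (intro nn_integral_cong) (auto simp: indicator_def)
  finally show ?thesis using nn_integral_walk_law[OF v, where g="%_ _. 1" and t=t and ok="%s. s \<noteq> z" and z=z] by simp
 qed
 have a0: "0 <= ?a t" for t
 proof -
  have "0 <= (taboo_op w (%s. s \<noteq> z) ^^ t) (%_ _. 1) n i" for n i
   by (induction t arbitrary: n i) (auto simp: taboo_op_def intro!: step_op_nonneg[OF v])
  thus ?thesis .
 qed
 have m: "measure ?W {\<xi>. \<forall>k\<in>{0<..t}. \<xi> k \<noteq> z} = ?a t" for t using em[of t] a0[of t] by (simp add: measure_def)
 have one: "emeasure ?W (space ?W) = 1"
  using em[of 0] by (simp add: space_walk_law)
 interpret W: prob_space ?W by (rule prob_spaceI) (rule one)
 have "(%t. measure ?W {\<xi>. \<forall>k\<in>{0<..t}. \<xi> k \<noteq> z}) \<longlonglongrightarrow> measure ?W (\<Inter>t. {\<xi>. \<forall>k\<in>{0<..t}. \<xi> k \<noteq> z})"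
  by (rule W.finite_Lim_measure_decseq) (use set in \<open>auto simp: decseq_def\<close>)
 also have "(\<Inter>t. {\<xi>. \<forall>k\<in>{0<..t}. \<xi> k \<noteq> z}) = space ?W - {\<xi> \<in> space ?W. \<exists>t>0. \<xi> t = z}"
  by (auto simp: space_walk_law) (metis greaterThanAtMost_iff order_refl)
 also have "measure ?W ... = 1 - measure ?W {\<xi> \<in> space ?W. \<exists>t>0. \<xi> t = z}"
 proof (rule W.prob_compl)
  have "{\<xi> \<in> space ?W. \<exists>t>0. \<xi> t = z} = (\<Union>t\<in>{0<..}. {\<xi>. \<xi> t \<in> {z}})" by (auto simp: space_walk_law)
  also have "... \<in> sets ?W" by (rule sets.countable_UN') (use sets_walk_law_coord in blast)+
  finally show "{\<xi> \<in> space ?W. \<exists>t>0. \<xi> t = z} \<in> sets ?W" .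
 qed
 also have "... = 0" using assms(2)[unfolded recurrent_def, THEN spec, of z] by simp
 finally show ?thesis unfolding m .
qed

text \<open>Recurrence without the path measure and for all starting sites at once, so that it
  passes to the reflected strip.\<close>

definition taboo_recurrent :: "'m::finite env => bool" where
 "taboo_recurrent e \<longleftrightarrow> (\<forall>z. (%t. (taboo_op e (%s. s \<noteq> z) ^^ t) (%_ _. 1) (fst z) (snd z)) \<longlonglongrightarrow> 0)"

lemma taboo_recurrent_mirror:
 assumes "taboo_recurrent e" shows "taboo_recurrent (mirror e)"
proof -
 have "(taboo_op (mirror e) (%s. s \<noteq> (m, j)) ^^ t) (%_ _. 1) n i
   = (taboo_op e (%s. s \<noteq> (-m, j)) ^^ t) (%_ _. 1) (-n) i" for m j t n i
 proof (induction t arbitrary: n i)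
  case (Suc t)
  have "(%k j'. if (- k, j') \<noteq> (m, j) then (taboo_op (mirror e) (%s. s \<noteq> (m, j)) ^^ t) (%_ _. 1) (- k) j' else 0)
   = (%k j'. if (k, j') \<noteq> (- m, j) then (taboo_op e (%s. s \<noteq> (- m, j)) ^^ t) (%_ _. 1) k j' else 0)"
   by (intro ext) (simp only: Suc minus_minus, auto)
  thus ?case unfolding funpow.simps comp_def
   unfolding taboo_op_def[of "mirror e" _ "(taboo_op _ _ ^^ t) _"] taboo_op_def[of "e" _ "(taboo_op _ _ ^^ t) _"] step_op_mirror by (rule arg_cong)
 qed simp
 from this[where m="fst z" and j="snd z" and n="fst z" and i="snd z" for z] show ?thesis
  using assms unfolding taboo_recurrent_def by (simp del: funpow.simps)
qed

context elliptic_env begin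

text \<open>The probabilities \<open>av t\<close> of avoiding \<open>(0, i0)\<close> decrease to a
  non-negative harmonic function, which by recurrence is zero at \<open>(0, i0)\<close> and hence on
  layer 1. If the series converged, the walk from layer 1 would reach every \<open>b\<close> before
  layer 0 with probability at least \<open>1 / Z\<close>, and the limit would be positive
  there.\<close>

lemma recurrent_not_summable:
 assumes rec: "taboo_recurrent e"
 shows "~ summable (%n. exp (pot e 0 (int n)))"
proof
 assume sm: "summable (%n. exp (pot e 0 (int n)))"
 obtain i0 :: 'm where True by simp
 let ?ok = "%s. s \<noteq> (0::int, i0)"
 define av where "av t = (taboo_op e ?ok ^^ t) (%_ _. 1)" for t
 have av_Suc: "av (Suc t) n i = step_op e (%n i. if ?ok (n,i) then av t n i else 0) n i" for t n i
  unfolding av_def funpow.simps comp_def taboo_op_def[of e ?ok "(taboo_op _ _ ^^ t) _"] by simp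
 have av01: "0 <= av t n i & av t n i <= 1" for t n i
 proof (induction t arbitrary: n i)
  case (Suc t)
  let ?g = "%n i. if ?ok (n,i) then av t n i else 0"
  have "0 <= ?g n i" "?g n i <= 1" for n i using Suc by auto
  thus ?case unfolding av_Suc using step_op_nonneg[OF trip, of ?g] step_op_le1[OF trip, of ?g 1] by blast
 qed (simp add: av_def)
 have dec: "av (Suc t) n i <= av t n i" for t n i
 proof (induction t arbitrary: n i)
  case 0 show ?case using av01[of 1 n i] by (simp add: av_def)
 next
  case (Suc t)
  have "step_op e (%n i. if ?ok (n,i) then av (Suc t) n i else 0) n i <= step_op e (%n i. if ?ok (n,i) then av t n i else 0) n i"
   by (rule step_op_mono[OF trip]) (use Suc in auto)
  thus ?case using av_Suc[of "Suc t" n i] av_Suc[of t n i] by linarith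
 qed
 have "\<exists>w. (%t. av t n i) \<longlonglongrightarrow> w" for n i
 proof -
  have "decseq (%t. av t n i)" by (rule decseq_SucI) (rule dec)
  moreover have "\<forall>t. 0 <= av t n i" using av01 by simp
  ultimately show ?thesis by (rule decseq_convergent) auto
 qed
 then obtain w where w: "!!n i. (%t. av t n i) \<longlonglongrightarrow> w n i" by metis
 have "(%t. av t 0 i0) \<longlonglongrightarrow> 0"
  using rec[unfolded taboo_recurrent_def, THEN spec, of "(0, i0)"] by (simp add: av_def)
 hence w0: "w 0 i0 = 0" using LIMSEQ_unique[OF w] by simp
 have w_nonneg: "0 <= w n i" for n i by (rule LIMSEQ_le_const[OF w]) (use av01 in auto)
 have harm: "w n i = step_op e w n i" for n i
 proof -
  have "(%t. if ?ok (n,i) then av t n i else 0) \<longlonglongrightarrow> w n i" for n i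
   by (cases "(n, i) = (0, i0)") (use w[of n i] w0 in auto)
  hence "(%t. av (Suc t) n i) \<longlonglongrightarrow> step_op e w n i" unfolding av_Suc by (rule step_op_tendsto)
  thus ?thesis using LIMSEQ_unique[OF LIMSEQ_Suc[OF w[of n i]]] by simp
 qed
 have spread: "w (n+1) j = 0" "w (n-1) j = 0" if "w n i = 0" for n i j
 proof -
  have "(SUM j:UNIV. A n i j * w (n+1) j + B n i j * w (n-1) j) = 0"
   using emb_eq[of w n i] harm that by (simp add: emb_def)
  hence "A n i j * w (n+1) j + B n i j * w (n-1) j = 0"
   by (subst (asm) sum_nonneg_eq_0_iff) (auto simp: A_nonneg B_nonneg w_nonneg)
  moreover have "0 < A n i j" "0 < B n i j" using G(3,4)[of n i j] eps_pos by auto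
  ultimately show "w (n+1) j = 0" "w (n-1) j = 0" using w_nonneg[of "n+1" j] w_nonneg[of "n-1" j]
   by (smt (verit) mult_pos_pos mult_nonneg_nonneg)+
 qed
 have w1: "w 1 i = 0" for i using spread(1)[OF w0, of i] by simp
 \<comment> \<open>Reaching \<open>b\<close> takes more than \<open>t\<close> steps, and a walk that
   reaches \<open>b\<close> before layer 0 has avoided \<open>(0, i0)\<close> until then.\<close>
 have lower: "exit_up e 0 b n i <= av t n i" if "n + int t < b" "0 < b" for t n i b
  using that(1)
 proof (induction t arbitrary: n i)
  case 0 thus ?case using exit_up_bounds(2)[OF trip that(2), of n i] by (simp add: av_def)
 next
  case (Suc t)
  show ?case
  proof (cases "0 < n")
   case True
   have "step_op e (exit_up e 0 b) n i <= av (Suc t) n i" unfolding av_Suc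
   proof (rule step_op_mono[OF trip])
    show "exit_up e 0 b (n+1) j <= (if ?ok (n+1,j) then av t (n+1) j else 0)" for j using Suc True by auto
    show "exit_up e 0 b n j <= (if ?ok (n,j) then av t n j else 0)" for j using Suc True by auto
    show "exit_up e 0 b (n-1) j <= (if ?ok (n-1,j) then av t (n-1) j else 0)" for j
     using Suc True that(2) av01 by (cases "n = 1") (auto simp: exit_up_below)
   qed
   thus ?thesis using exit_up_harmonic[OF trip True, of b i] Suc.prems by simp
  next
   case False thus ?thesis using av01 that(2) by (simp add: exit_up_below)
  qed
 qed
 define Z where "Z = 1 + (\<Sum>n. exp (pot e 0 (int n))) / \<epsilon>"
 have low2: "1 / Z <= exit_up e 0 b 1 undefined" if "0 < b" for b
 proof -
  have "(SUM k:{0+1..<b}. exp (pot e 0 (k+1))) = (SUM n:{2..<nat b + 1}. exp (pot e 0 (int n)))"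
   by (rule sum.reindex_bij_witness[of _ "%n. int n - 1" "%k. nat (k + 1)"]) auto
  also have "... <= (\<Sum>n. exp (pot e 0 (int n)))" by (rule sum_le_suminf[OF sm]) auto
  finally have "(SUM k:{0+1..<b}. exp (pot e 0 (k+1))) / \<epsilon> <= (\<Sum>n. exp (pot e 0 (int n))) / \<epsilon>"
   using eps_pos by (simp add: divide_right_mono)
  hence le: "1 / exit_up e 0 b (0+1) undefined <= Z"
   using inverse_exit_up_le[OF that] unfolding Z_def by linarith
  have pos: "0 < exit_up e 0 b (0+1) undefined" using that by (intro exit_up_pos) auto
  hence "0 < Z" using le by (meson less_le_trans zero_less_divide_1_iff)
  thus ?thesis using le pos by (simp add: divide_le_eq le_divide_eq mult.commute)
 qed
 have "1 / Z <= av t 1 undefined" for t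
  using low2[of "int t + 3"] lower[of 1 t "int t + 3" undefined] by simp
 hence "1 / Z <= w 1 undefined" by (intro LIMSEQ_le_const[OF w]) auto
 moreover have "Z > 0" unfolding Z_def using eps_pos suminf_nonneg[OF sm] by (simp add: add_pos_nonneg)
 ultimately show False using w1[of undefined] by simp
qed

end

section \<open>Functionals of independent identically distributed variables\<close>

lemma blocks_ordered:
 fixes L :: int
 assumes "i \<noteq> j" "0 <= L"
 shows "(i + 1) * L <= j * L \<or> (j + 1) * L <= i * L"
proof -
 have "i + 1 <= j \<or> j + 1 <= i" using assms by linarith
 thus ?thesis using assms(2) by (auto intro!: mult_right_mono)
qed

definition depends :: "'i set => (('i => 'e) => 'c) => bool" where
 "depends K X \<longleftrightarrow> (\<forall>w w'. (\<forall>k\<in>K. w k = w' k) --> X w = X w')"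

lemma dependsD: "depends K X ==> (!!k. k \<in> K ==> w k = w' k) ==> X w = X w'"
 unfolding depends_def by blast

lemma depends_mono: "depends K X ==> K \<subseteq> L ==> depends L X"
 unfolding depends_def by blast

lemma depends_comp: "depends K X ==> depends K (%w. f (X w))"
 unfolding depends_def by metis

locale iid = N: prob_space N for N :: "'e measure"
begin

sublocale prod: product_prob_space "%_. N" "UNIV :: int set"
 by unfold_locales

abbreviation "M \<equiv> Pi\<^sub>M (UNIV :: int set) (%_. N)"

lemma indep_coords: "prod.indep_vars (%_. N) (%i w. w i) UNIV"
proof (subst prod.indep_vars_iff_distr_eq_PiM')
 have "distr M N (%x. x i) = N" for i :: int
  using distr_PiM_component[of UNIV "%_. N" i] N.prob_space_axioms by simp
 moreover have "distr M M (%x. x) = M" using distr_id2[of M M] by simp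
 ultimately show "distr M M (%x. \<lambda>i\<in>UNIV. x i) = Pi\<^sub>M UNIV (%i. distr M N (%x. x i))"
  by (simp add: restrict_def)
qed auto

text \<open>Coordinates outside \<open>K j\<close> are filled with a fixed point \<open>c\<close> of
  the space, which exhibits \<open>X j\<close> as a measurable function of the restriction to
  \<open>K j\<close>.\<close>

lemma indep_vars_depends:
 assumes X: "!!j. j \<in> J ==> X j \<in> borel_measurable M" "!!j. j \<in> J ==> depends (K j) (X j)"
  and disj: "disjoint_family_on K J"
 shows "prod.indep_vars (%_. borel) (X :: _ => _ => real) J"
proof -
 obtain c where c: "c \<in> space N" using N.not_empty by blast
 define ext where "ext j x = (%i. if i \<in> K j then x i else c)" for j and x :: "int => 'e"
 have extm: "ext j \<in> Pi\<^sub>M (K j) (%_. N) \<rightarrow>\<^sub>M M" for j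
 proof -
  have "(%x. ext j x i) \<in> Pi\<^sub>M (K j) (%_. N) \<rightarrow>\<^sub>M N" for i
   unfolding ext_def using c by (cases "i \<in> K j") (auto intro: measurable_component_singleton)
  thus ?thesis
   by (intro measurable_PiM_single') (use c in \<open>auto simp: ext_def space_PiM PiE_iff\<close>)
 qed
 have "prod.indep_vars (%j. Pi\<^sub>M (K j) (%_. N)) (%j w. restrict (%i. w i) (K j)) J"
  by (rule prod.indep_vars_restrict[OF indep_coords]) (use disj in auto)
 hence "prod.indep_vars (%_. borel) (%j w. X j (ext j (restrict (%i. w i) (K j)))) J"
  by (rule prod.indep_vars_compose2) (use X(1) extm in \<open>auto intro: measurable_compose\<close>)
 also have "?this \<longleftrightarrow> prod.indep_vars (%_. borel) X J"
 proof (intro prod.indep_vars_cong refl ext)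
  fix j w assume "j \<in> J"
  thus "X j (ext j (restrict (%i. w i) (K j))) = X j w"
   by (intro dependsD[OF X(2)]) (auto simp: ext_def)
 qed
 finally show ?thesis .
qed

lemma indep_var_depends:
 assumes "X \<in> borel_measurable M" "Y \<in> borel_measurable M" "depends K X" "depends L Y" "K \<inter> L = {}"
 shows "prod.indep_var borel (X :: _ => real) borel (Y :: _ => real)"
proof -
 have "prod.indep_vars (%_. borel) (case_bool X Y) UNIV"
  by (rule indep_vars_depends[where K="case_bool K L"])
   (use assms in \<open>auto simp: disjoint_family_on_def split: bool.split\<close>)
 moreover have "(%b. case_bool borel borel b) = (%_. borel :: real measure)" by (auto split: bool.split)
 ultimately show ?thesis unfolding prod.indep_var_def by simp
qed

lemma distr_shift: "distr M M (%w n. w (n + k)) = M"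
proof -
 have "distr M M (%w. \<lambda>n\<in>UNIV. w (n + k)) = M"
  using distr_PiM_reindex[of UNIV "%_. N" "%n. n + k" UNIV] N.prob_space_axioms by (simp add: inj_on_def)
 thus ?thesis by (simp add: restrict_def)
qed

lemma shift_measurable: "(%w n. w (n + k)) \<in> M \<rightarrow>\<^sub>M M"
 by (rule measurable_PiM_single') (auto simp: space_PiM)

lemma distr_comp_shift:
 assumes "X \<in> borel_measurable M"
 shows "distr M borel (%w. X (%n. w (n + k))) = distr M borel (X :: _ => real)"
proof -
 have "distr M borel X = distr (distr M M (%w n. w (n + k))) borel X" by (simp only: distr_shift)
 also have "... = distr M borel (%w. X (%n. w (n + k)))"
  using distr_distr[OF assms shift_measurable, of k] by (simp add: comp_def)
 finally show ?thesis by simp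
qed

text \<open>The bounded difference inequality, one coordinate at a time: averaging over a coordinate
  preserves the bounded differences in the others, and Hoeffding's lemma on an interval of length
  \<open>2 * d\<close> costs \<open>s^2 * d^2 / 2\<close>.\<close>

lemma bounded_differences_exp:
 fixes f :: "(int => 'e) => real"
 assumes "finite K" "f \<in> borel_measurable (Pi\<^sub>M K (%_. N))"
  and "!!x. x \<in> space (Pi\<^sub>M K (%_. N)) ==> abs(f x) <= b"
  and "!!x i y. x \<in> space (Pi\<^sub>M K (%_. N)) ==> i \<in> K ==> y \<in> space N ==> abs(f (x(i := y)) - f x) <= d"
  and s: "0 < s"
 shows "(\<integral>x. exp (s * f x) \<partial>Pi\<^sub>M K (%_. N)) <= exp (s * (\<integral>x. f x \<partial>Pi\<^sub>M K (%_. N)) + s^2 * d^2 / 2 * real (card K))"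
 using assms(1-4)
proof (induction K arbitrary: f rule: finite_induct)
 case empty
 interpret E: prob_space "Pi\<^sub>M {} (%_::int. N)" by (intro prob_space_PiM N.prob_space_axioms)
 have "space (Pi\<^sub>M {} (%_::int. N)) = {%_. undefined}" by (simp add: space_PiM)
 hence "(\<integral>x. g x \<partial>Pi\<^sub>M {} (%_::int. N)) = g (%_. undefined)" for g :: "_ => real"
  using Bochner_Integration.integral_cong[of "Pi\<^sub>M {} (%_::int. N)" "Pi\<^sub>M {} (%_::int. N)" g "%_. g (%_. undefined)"] E.prob_space by simp
 thus ?case by simp
next
 case (insert i K)
 interpret K: prob_space "Pi\<^sub>M K (%_::int. N)" by (intro prob_space_PiM N.prob_space_axioms)
 interpret I: prob_space "Pi\<^sub>M (insert i K) (%_::int. N)" by (intro prob_space_PiM N.prob_space_axioms)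
 have upd: "(%(x, y). x(i := y)) \<in> Pi\<^sub>M K (%_. N) \<Otimes>\<^sub>M N \<rightarrow>\<^sub>M Pi\<^sub>M (insert i K) (%_. N)"
  by (rule measurable_add_dim)
 have sp: "x(i := y) \<in> space (Pi\<^sub>M (insert i K) (%_. N))" if "x \<in> space (Pi\<^sub>M K (%_. N))" "y \<in> space N" for x y
  using that by (auto simp: space_PiM PiE_iff extensional_def)
 have fm: "(%(x, y). f (x(i := y))) \<in> borel_measurable (Pi\<^sub>M K (%_. N) \<Otimes>\<^sub>M N)"
  using measurable_compose[OF upd insert.prems(1)] by (simp add: case_prod_unfold fun_upd_def)
 have fy: "(%y. f (x(i := y))) \<in> borel_measurable N" if "x \<in> space (Pi\<^sub>M K (%_. N))" for x
  using measurable_compose[OF measurable_Pair1'[OF that] fm] by simp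
 define g where "g x = (LINT y|N. f (x(i := y)))" for x
 have gm: "g \<in> borel_measurable (Pi\<^sub>M K (%_. N))" unfolding g_def
  by (rule N.borel_measurable_lebesgue_integral) (rule fm)
 have fint: "integrable N (%y. f (x(i := y)))" if "x \<in> space (Pi\<^sub>M K (%_. N))" for x
  by (rule N.integrable_const_bound[of _ b]) (use insert.prems(2) sp that fy in auto)
 obtain x0 where "x0 \<in> space (Pi\<^sub>M (insert i K) (%_. N))" using I.not_empty by blast
 hence b0: "0 <= b" using insert.prems(2)[of x0] by linarith
 have gb: "abs(g x) <= b" if "x \<in> space (Pi\<^sub>M K (%_. N))" for x
 proof -
  have "abs(g x) <= (LINT y|N. abs(f (x(i := y))))" unfolding g_def by (rule integral_abs_bound)
  also have "... <= (LINT y|N. b)" by (intro integral_mono integrable_abs fint that) (use insert.prems(2) sp that in auto)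
  finally show ?thesis by (simp add: N.prob_space)
 qed
 have gd: "abs(g (x(j := y)) - g x) <= d" if x: "x \<in> space (Pi\<^sub>M K (%_. N))" and j: "j \<in> K" and y: "y \<in> space N" for x j y
 proof -
  have x': "x(j := y) \<in> space (Pi\<^sub>M K (%_. N))" using x j y by (auto simp: space_PiM PiE_iff extensional_def)
  have ij: "i \<noteq> j" using j insert.hyps by auto
  have "g (x(j := y)) - g x = (LINT z|N. f ((x(i := z))(j := y)) - f (x(i := z)))"
   unfolding g_def fun_upd_twist[OF ij] using fint[OF x] fint[OF x'] by simp
  also have "abs(...) <= (LINT z|N. abs(f ((x(i := z))(j := y)) - f (x(i := z))))" by (rule integral_abs_bound)
  also have "... <= (LINT z|N. d)"
  proof (intro integral_mono integrable_abs Bochner_Integration.integrable_diff fint x)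
   show "integrable N (%z. f ((x(i := z))(j := y)))" unfolding fun_upd_twist[OF ij] by (rule fint[OF x'])
   show "abs(f ((x(i := z))(j := y)) - f (x(i := z))) <= d" if "z \<in> space N" for z
    by (rule insert.prems(3)) (use sp[OF x that] y j in \<open>auto simp: fun_upd_def\<close>)
  qed auto
  finally show ?thesis by (simp add: N.prob_space)
 qed
 have hoeff: "(LINT y|N. exp (s * f (x(i := y)))) <= exp (s * g x + s^2 * d^2 / 2)" if x: "x \<in> space (Pi\<^sub>M K (%_. N))" for x
 proof -
  obtain c where c: "c \<in> space N" using N.not_empty by blast
  define h where "h = (%y. f (x(i := y)))"
  have hm: "h \<in> borel_measurable N" unfolding h_def by (rule fy[OF x])
  let ?a = "h c - d" and ?b = "h c + d"
  have "abs(h y - h c) <= d" if "y \<in> space N" for y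
   using insert.prems(3)[OF sp[OF x c], of i y] that unfolding h_def by (simp add: fun_upd_def if_distrib cong: if_cong)
  hence "h y \<in> {?a..?b}" if "y \<in> space N" for y using that by (fastforce simp: abs_le_iff)
  then interpret H: interval_bounded_random_variable N h ?a ?b
   by unfold_locales (use hm in auto)
  have gx: "g x = (LINT y|N. h y)" unfolding g_def h_def ..
  have "(\<integral>\<^sup>+y. exp (s * (h y - g x)) \<partial>N) <= ennreal (exp (s^2 * (?b - ?a)^2 / 8))"
   using H.Hoeffdings_lemma_nn_integral[OF s] unfolding gx .
  also have "s^2 * (?b - ?a)^2 / 8 = s^2 * d^2 / 2" by (simp add: power2_eq_square)
  finally have "(LINT y|N. exp (s * (h y - g x))) <= exp (s^2 * d^2 / 2)"
   using hm by (subst integral_eq_nn_integral) (auto intro!: enn2real_leI)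
  moreover have "(LINT y|N. exp (s * h y)) = exp (s * g x) * (LINT y|N. exp (s * (h y - g x)))"
   by (subst integral_mult_right_zero[symmetric]) (simp add: exp_add[symmetric] algebra_simps)
  ultimately have "(LINT y|N. exp (s * h y)) <= exp (s * g x + s^2 * d^2 / 2)" by (simp add: exp_add mult_left_mono)
  thus ?thesis unfolding h_def .
 qed
 have eint: "integrable (Pi\<^sub>M J (%_. N)) (%x. exp (s * h x))"
  if "h \<in> borel_measurable (Pi\<^sub>M J (%_. N))" "!!x. x \<in> space (Pi\<^sub>M J (%_. N)) ==> abs(h x) <= b" for J :: "int set" and h
 proof -
  interpret J: prob_space "Pi\<^sub>M J (%_::int. N)" by (intro prob_space_PiM N.prob_space_axioms)
  show ?thesis
  proof (rule J.integrable_const_bound[of _ "exp (s * b)"])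
   show "AE x in Pi\<^sub>M J (%_. N). norm (exp (s * h x)) <= exp (s * b)"
    using that(2) s by (intro AE_I2) (auto simp: abs_le_iff)
  qed (use that in measurable)
 qed
 have "(\<integral>x. exp (s * f x) \<partial>Pi\<^sub>M (insert i K) (%_. N)) = (\<integral>x. (LINT y|N. exp (s * f (x(i := y)))) \<partial>Pi\<^sub>M K (%_. N))"
  by (rule prod.product_integral_insert) (use insert eint in auto)
 also have "... <= (\<integral>x. exp (s * g x + s^2 * d^2 / 2) \<partial>Pi\<^sub>M K (%_. N))"
 proof (rule integral_mono_AE)
  show "integrable (Pi\<^sub>M K (%_. N)) (%x. exp (s * g x + s^2 * d^2 / 2))"
   unfolding exp_add using eint[OF gm gb] by simp
  show "integrable (Pi\<^sub>M K (%_. N)) (%x. \<integral>y. exp (s * f (x(i := y))) \<partial>N)"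
  proof (rule Bochner_Integration.integrable_bound[of _ "%x. exp (s * g x + s^2 * d^2 / 2)"])
   show "integrable (Pi\<^sub>M K (%_. N)) (%x. exp (s * g x + s^2 * d^2 / 2))"
    unfolding exp_add using eint[OF gm gb] by simp
   show "(%x. \<integral>y. exp (s * f (x(i := y))) \<partial>N) \<in> borel_measurable (Pi\<^sub>M K (%_. N))"
    by (rule N.borel_measurable_lebesgue_integral) (use fm in \<open>simp add: case_prod_unfold\<close>)
   show "AE x in Pi\<^sub>M K (%_. N). norm (LINT y|N. exp (s * f (x(i := y)))) <= norm (exp (s * g x + s^2 * d^2 / 2))"
    proof (intro AE_I2)
    fix x assume x: "x \<in> space (Pi\<^sub>M K (%_. N))"
    have "0 <= (LINT y|N. exp (s * f (x(i := y))))" by (rule Bochner_Integration.integral_nonneg) simp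
    thus "norm (LINT y|N. exp (s * f (x(i := y)))) <= norm (exp (s * g x + s^2 * d^2 / 2))"
     using hoeff[OF x] unfolding real_norm_def by (simp only: abs_of_nonneg abs_exp_cancel)
   qed
  qed
  show "AE x in Pi\<^sub>M K (%_. N). (LINT y|N. exp (s * f (x(i := y)))) <= exp (s * g x + s^2 * d^2 / 2)"
   using hoeff by (intro AE_I2) auto
 qed
 also have "... = exp (s^2 * d^2 / 2) * (\<integral>x. exp (s * g x) \<partial>Pi\<^sub>M K (%_. N))"
  by (simp add: exp_add)
 also have "... <= exp (s^2 * d^2 / 2) * exp (s * (\<integral>x. g x \<partial>Pi\<^sub>M K (%_. N)) + s^2 * d^2 / 2 * real (card K))"
  by (intro mult_left_mono insert.IH) (use gm gb gd in \<open>auto simp: fun_upd_def\<close>)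
 also have "(\<integral>x. g x \<partial>Pi\<^sub>M K (%_. N)) = (\<integral>x. f x \<partial>Pi\<^sub>M (insert i K) (%_. N))"
  unfolding g_def
 proof (rule prod.product_integral_insert[symmetric])
  show "integrable (Pi\<^sub>M (insert i K) (%_. N)) f"
   by (rule I.integrable_const_bound[of _ b]) (use insert.prems in auto)
 qed (use insert in auto)
 finally show ?case using insert.hyps by (simp add: exp_add[symmetric] algebra_simps add_divide_distrib)
qed

lemma bounded_differences_exp':
 fixes f :: "(int => 'e) => real"
 assumes K: "finite K" and f: "f \<in> borel_measurable M" "depends K f" and b: "!!x. abs(f x) <= b"
  and d: "!!x i y. abs(f (x(i := y)) - f x) <= d" and s: "0 < s"
 shows "(LINT x|M. exp (s * f x)) <= exp (s * (LINT x|M. f x) + s^2 * d^2 / 2 * real (card K))"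
proof -
 obtain c where c: "c \<in> space N" using N.not_empty by blast
 define ext where "ext x = (%i. if i \<in> K then x i else c)" for x :: "int => 'e"
 have ext: "ext \<in> Pi\<^sub>M K (%_. N) \<rightarrow>\<^sub>M M"
 proof (rule measurable_PiM_single')
  show "(%x. ext x i) \<in> Pi\<^sub>M K (%_. N) \<rightarrow>\<^sub>M N" for i
   unfolding ext_def using c by (cases "i \<in> K") (auto intro: measurable_component_singleton)
 qed (use c in \<open>auto simp: ext_def space_PiM PiE_iff\<close>)
 have fe: "(%x. f (ext x)) \<in> borel_measurable (Pi\<^sub>M K (%_. N))"
  using f(1) ext by (rule measurable_compose[rotated])
 have tr: "(\<integral>x. h (f (ext x)) \<partial>Pi\<^sub>M K (%_. N)) = (LINT x|M. h (f x))" if "h \<in> borel_measurable borel" for h :: "real => real"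
 proof -
  have "(\<integral>x. h (f (ext x)) \<partial>Pi\<^sub>M K (%_. N)) = (\<integral>x. h (f (ext x)) \<partial>distr M (Pi\<^sub>M K (%_. N)) (%x. restrict x K))"
   using prod.distr_PiM_restrict_finite[OF K] by simp
  also have "... = (LINT x|M. h (f (ext (restrict x K))))"
   by (rule integral_distr) (use fe that in \<open>auto intro: measurable_restrict_subset measurable_compose\<close>)
  also have "... = (LINT x|M. h (f x))"
   by (intro Bochner_Integration.integral_cong refl arg_cong[where f=h] dependsD[OF f(2)]) (auto simp: ext_def)
  finally show ?thesis .
 qed
 have "(\<integral>x. exp (s * f (ext x)) \<partial>Pi\<^sub>M K (%_. N)) <= exp (s * (\<integral>x. f (ext x) \<partial>Pi\<^sub>M K (%_. N)) + s^2 * d^2 / 2 * real (card K))"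
 proof (rule bounded_differences_exp[OF K fe b _ s])
  fix x i y assume "i \<in> K"
  hence "ext (x(i := y)) = (ext x)(i := y)" by (auto simp: ext_def)
  thus "abs(f (ext (x(i := y))) - f (ext x)) <= d" using d by simp
 qed
 thus ?thesis using tr[of "%x. exp (s * x)"] tr[of "%x. x"] by simp
qed

end

section \<open>Quasi-additive functionals\<close>

locale quasi_additive = iid N for N :: "'e measure" +
 fixes U :: "int => int => (int => 'e) => real" and C :: real
 assumes C_pos: "0 < C"
  and U_meas [measurable]: "U a b \<in> borel_measurable M"
  and U_depends: "depends {a<..<b} (U a b)"
  and U_shift: "U (a + k) (b + k) w = U a b (%n. w (n + k))"
  and U_unit: "U a (a + 1) w = 0"
  and U_qadd: "a < b ==> b < c ==> abs(U a c w - U a b w - U b c w) <= C"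
begin

lemma U_bound: assumes "a < b" shows "abs(U a b w) <= C * of_int (b - a)"
proof -
 have "a + 1 <= b" using assms by simp
 thus ?thesis
 proof (induction b rule: int_ge_induct)
  case base thus ?case using C_pos by (simp add: U_unit)
 next
  case (step b)
  thus ?case using U_qadd[of a b "b+1" w] U_unit[of b w] by (simp add: algebra_simps)
 qed
qed

text \<open>Cutting at the changed coordinate \<open>k\<close> leaves two functionals that ignore
  \<open>k\<close>, because they depend on open intervals; only two cutting errors remain.\<close>

lemma U_diff: "abs(U a b (fun_upd w k x) - U a b w) <= 2 * C"
proof (cases "a < k & k < b")
 case True
 have "U a k (fun_upd w k x) = U a k w" "U k b (fun_upd w k x) = U k b w"
  by (rule dependsD[OF U_depends]; simp)+
 thus ?thesis using U_qadd[of a k b w] U_qadd[of a k b "(fun_upd w k x)"] True by linarith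
next
 case False
 have "U a b (fun_upd w k x) = U a b w" by (rule dependsD[OF U_depends]) (use False in auto)
 thus ?thesis using C_pos by simp
qed

lemma U_distr: "distr M borel (U (a + k) (b + k)) = distr M borel (U a b)"
 using distr_comp_shift[OF U_meas, where k=k and a1=a and b1=b] by (simp add: U_shift[abs_def])

lemma U_int_shift:
 assumes "h \<in> borel_measurable borel"
 shows "(LINT w|M. h (U (a + k) (b + k) w)) = (\<integral>w. h (U a b w) \<partial>M :: real)"
 using integral_distr[OF U_meas assms, of a b] integral_distr[OF U_meas assms, of "a+k" "b+k"] U_distr[of a k b] by simp

lemma integrable_bdd:
 assumes "X \<in> borel_measurable M" "!!w. abs(X w) <= (b::real)"
 shows "integrable M X"
 by (rule prod.integrable_const_bound[of _ b]) (use assms in auto)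

lemma U_integrable: "integrable M (U a b)"
proof (cases "a < b")
 case True thus ?thesis by (intro integrable_bdd[of _ "C * of_int (b - a)"] U_meas U_bound)
next
 case False
 have "U a b w = U a b (%_. undefined)" for w by (rule dependsD[OF U_depends]) (use False in auto)
 hence "U a b = (%_. U a b (%_. undefined))" by blast
 thus ?thesis using prod.integrable_const by metis
qed

definition u :: "nat => real" where "u n = (LINT w|M. U 0 (int n) w)"

lemma U_mean: "(LINT w|M. U a (a + int n) w) = u n"
 using U_int_shift[of "%x. x" 0 a "int n"] by (simp add: u_def add.commute)

lemma integral_diff_le:
 assumes "integrable M X" "integrable M Y" "!!w. abs(X w - Y w) <= (b::real)"
 shows "abs((LINT w|M. X w) - (LINT w|M. Y w)) <= b"
proof -
 have "abs((LINT w|M. X w) - (LINT w|M. Y w)) = abs(LINT w|M. X w - Y w)" using assms by simp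
 also have "... <= (LINT w|M. abs(X w - Y w))" by (rule integral_abs_bound)
 also have "... <= (LINT w|M. b)" by (intro integral_mono integrable_abs Bochner_Integration.integrable_diff assms) auto
 finally show ?thesis by (simp add: prod.P.prob_space)
qed

lemma u_qadd: assumes "0 < m" "0 < n" shows "abs(u (m + n) - u m - u n) <= C"
proof -
 have "abs((LINT w|M. U 0 (int (m + n)) w) - (LINT w|M. U 0 (int m) w + U (int m) (int m + int n) w)) <= C"
  by (rule integral_diff_le) (use U_integrable U_qadd[of 0 "int m" "int m + int n"] assms in \<open>auto simp: diff_diff_eq\<close>)
 thus ?thesis using U_integrable U_mean by (simp add: u_def)
qed

lemma U_exp:
 assumes "0 < s" "a < b" "r = 1 \<or> r = -1"
 shows "(LINT w|M. exp (s * (r * U a b w))) <= exp (s * (r * u (nat (b - a))) + 2 * s^2 * C^2 * of_int (b - a))"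
proof -
 have "(LINT w|M. exp (s * (r * U a b w))) <= exp (s * (LINT w|M. r * U a b w) + s^2 * (2 * C)^2 / 2 * real (card {a<..<b}))"
 proof (rule bounded_differences_exp'[where b = "C * of_int (b - a)"])
  show "abs(r * U a b x) <= C * of_int (b - a)" for x using U_bound[OF assms(2), of x] assms(3) by auto
  show "abs(r * U a b (x(i := y)) - r * U a b x) <= 2 * C" for x i y using U_diff[of a b x i y] assms(3) by auto
  show "depends {a<..<b} (%w. r * U a b w)" by (rule depends_comp[OF U_depends])
 qed (use assms in auto)
 also have "(LINT w|M. r * U a b w) = r * u (nat (b - a))" using U_mean[of a "nat (b - a)"] assms(2) by simp
 also have "s^2 * (2 * C)^2 / 2 * real (card {a<..<b}) <= 2 * s^2 * C^2 * of_int (b - a)"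
 proof -
  have "real (card {a<..<b}) <= of_int (b - a)" using assms(2) by simp
  hence "s^2 * (2 * C)^2 / 2 * real (card {a<..<b}) <= s^2 * (2 * C)^2 / 2 * of_int (b - a)"
   by (intro mult_left_mono) auto
  thus ?thesis by (simp add: power_mult_distrib mult_ac)
 qed
 finally show ?thesis by simp
qed

text \<open>For \<open>s\<close> so small that the Gaussian term takes at most half of the drift,
  the means of \<open>exp (s * X n)\<close> decay geometrically. Since \<open>s <= 1\<close>,
  eventually \<open>exp (X n)\<close> is at most \<open>exp (s * X n)\<close>.\<close>

lemma summable_exp_of_drift:
 fixes X :: "nat => (int => 'e) => real"
 assumes X: "!!n. X n \<in> borel_measurable M" and \<theta>: "0 < \<theta>"
  and ex: "!!s n. 0 < s ==> 0 < n ==> integrable M (%w. exp (s * X n w)) & (LINT w|M. exp (s * X n w)) <= exp (s * (B - \<theta> * real n) + 2 * s^2 * C^2 * real n)"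
 shows "AE w in M. summable (%n. exp (X n w))"
proof -
 define s where "s = min 1 (\<theta> / (4 * C^2))"
 have s: "0 < s" "s <= 1" "s * (4 * C^2) <= \<theta>" unfolding s_def using \<theta> C_pos
  by (auto simp: min_def field_simps)
 define q where "q = exp (- (s * \<theta> / 2))"
 have q: "0 < q" "q < 1" unfolding q_def using s \<theta> by auto
 have bound: "(LINT w|M. exp (s * X n w)) <= exp (s * B) * q ^ n" if "0 < n" for n
 proof -
  have "2 * s^2 * C^2 * real n = s * real n / 2 * (s * (4 * C^2))" by (simp add: power2_eq_square)
  also have "... <= s * real n / 2 * \<theta>" using s by (intro mult_left_mono) auto
  finally have "s * (B - \<theta> * real n) + 2 * s^2 * C^2 * real n <= s * B + real n * (- (s * \<theta> / 2))" by (simp add: algebra_simps)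
  hence "exp (s * (B - \<theta> * real n) + 2 * s^2 * C^2 * real n) <= exp (s * B) * q ^ n"
   unfolding q_def exp_of_nat_mult[symmetric] exp_add[symmetric] by simp
  thus ?thesis using ex[OF s(1) that] by linarith
 qed
 have "(\<integral>\<^sup>+w. (\<Sum>n. ennreal (exp (s * X (Suc n) w))) \<partial>M) = (\<Sum>n. \<integral>\<^sup>+w. ennreal (exp (s * X (Suc n) w)) \<partial>M)"
  by (rule nn_integral_suminf) (use X in measurable)
 also have "... <= (\<Sum>n. ennreal (exp (s * B) * q ^ Suc n))"
 proof (intro suminf_le)
  fix n
  have "(\<integral>\<^sup>+w. ennreal (exp (s * X (Suc n) w)) \<partial>M) = ennreal (LINT w|M. exp (s * X (Suc n) w))"
   by (rule nn_integral_eq_integral) (use ex[OF s(1), of "Suc n"] in auto)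
  thus "(\<integral>\<^sup>+w. ennreal (exp (s * X (Suc n) w)) \<partial>M) <= ennreal (exp (s * B) * q ^ Suc n)"
   using bound[of "Suc n"] by (simp add: ennreal_leI)
 qed auto
 also have "... < \<infinity>"
 proof -
  have "summable (%n. exp (s * B) * q ^ Suc n)" using q by (auto intro!: summable_mult summable_geometric)
  thus ?thesis using q by (subst suminf_ennreal2) (auto simp: ennreal_less_top)
 qed
 finally have "AE w in M. (\<Sum>n. ennreal (exp (s * X (Suc n) w))) \<noteq> \<infinity>"
  by (intro nn_integral_PInf_AE) (use X in \<open>auto\<close>)
 thus ?thesis
 proof (eventually_elim)
  fix w assume "(\<Sum>n. ennreal (exp (s * X (Suc n) w))) \<noteq> \<infinity>"
  hence sm: "summable (%n. exp (s * X (Suc n) w))" by (intro summable_suminf_not_top) auto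
  hence "(%n. exp (s * X (Suc n) w)) \<longlonglongrightarrow> 0" by (rule summable_LIMSEQ_zero)
  hence "eventually (%n. exp (s * X (Suc n) w) < 1) sequentially" by (rule order_tendstoD) simp
  hence "eventually (%n. norm (exp (X (Suc n) w)) <= exp (s * X (Suc n) w)) sequentially"
  proof eventually_elim
   case (elim n)
   hence "X (Suc n) w < 0" using s by (simp add: mult_less_0_iff)
   hence "X (Suc n) w <= s * X (Suc n) w" using s(2) mult_right_mono_neg[of s 1 "X (Suc n) w"] by simp
   thus ?case by simp
  qed
  hence "summable (%n. exp (X (Suc n) w))" using sm by (rule summable_comparison_test_ev)
  thus "summable (%n. exp (X n w))" using summable_Suc_iff[of "%n. exp (X n w)"] by simp
 qed
qed

text \<open>Subadditivity turns a single mean below \<open>- C\<close> into a linear drift.\<close>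

lemma u_drift:
 assumes r: "r = 1 \<or> r = -1" and L: "0 < L" "r * u L < - C"
 shows "\<exists>\<theta>>0. \<exists>B. \<forall>n>0. r * u n <= B - \<theta> * real n"
proof -
 define \<theta> where "\<theta> = - (r * u L) - C"
 have \<theta>: "0 < \<theta>" unfolding \<theta>_def using L by simp
 have qa: "r * u (m + n) <= r * u m + r * u n + C" if "0 < m" "0 < n" for m n
  using u_qadd[OF that] r by (auto simp: abs_le_iff)
 define B where "B = (SUM k<=L. abs(u k)) + C + \<theta>"
 have small: "r * u k <= (SUM k<=L. abs(u k))" if "k <= L" for k
 proof -
  have "r * u k <= abs(u k)" using r by auto
  also have "... <= (SUM k<=L. abs(u k))" using that by (intro member_le_sum) auto
  finally show ?thesis .
 qed
 have "r * u (k * L + j) <= (SUM k<=L. abs(u k)) - \<theta> * real k" if "0 < j" "j <= L" for k j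
 proof (induction k)
  case 0 thus ?case using small that by simp
 next
  case (Suc k)
  have "r * u (L + (k * L + j)) <= r * u L + r * u (k * L + j) + C" by (rule qa) (use L that in auto)
  thus ?case using Suc by (simp add: \<theta>_def algebra_simps)
 qed
 note main = this
 have "r * u n <= B - \<theta> / real L * real n" if "0 < n" for n
 proof -
  \<comment> \<open>The remainder \<open>j\<close> runs through \<open>1..L\<close> because
    quasi-additivity needs both pieces to be non-empty.\<close>
  define k j where "k = (n - 1) div L" and "j = (n - 1) mod L + 1"
  have nkj: "n = k * L + j" unfolding k_def j_def using that by simp
  have j: "0 < j" "j <= L" unfolding j_def using L by (auto simp: Suc_leI)
  have "real n <= real L * (real k + 1)" using nkj j by (simp add: algebra_simps flip: of_nat_mult of_nat_add)
  hence "real n / real L <= real k + 1" using L by (simp add: field_simps)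
  hence "\<theta> * (real n / real L) <= \<theta> * (real k + 1)" using \<theta> by (intro mult_left_mono) auto
  thus ?thesis using main[OF j, of k] C_pos unfolding nkj[symmetric] B_def by (simp add: algebra_simps)
 qed
 moreover have "0 < \<theta> / real L" using \<theta> L by simp
 ultimately show ?thesis by blast
qed

lemma exp_integrable: "a < b ==> integrable M (%w. exp (s * U a b w))"
proof (rule integrable_bdd[where b="exp (abs(s) * (C * of_int (b - a)))"])
 fix w assume "a < b"
 have "s * U a b w <= abs(s) * abs(U a b w)" by (metis abs_ge_self abs_mult)
 also have "... <= abs(s) * (C * of_int (b - a))" using U_bound[OF \<open>a < b\<close>] by (intro mult_left_mono) auto
 finally show "abs(exp (s * U a b w)) <= exp (abs(s) * (C * of_int (b - a)))" by simp
qed measurable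

text \<open>A mean beyond \<open>C\<close> in absolute value forces a linear drift. A downward drift
  makes the first series converge; an upward drift does so for the series of the left
  half-line.\<close>

lemma mean_bounded:
 assumes "AE w in M. ~ summable (%n. exp (U 0 (int n) w))"
  and "AE w in M. ~ summable (%n. exp (- U (- int n) 0 w))" and L: "0 < L"
 shows "abs(u L) <= C"
proof (rule ccontr)
 assume "~ abs(u L) <= C"
 then obtain r :: real where r: "r = 1 \<or> r = -1" "r * u L < - C"
  by (cases "u L < 0") (auto intro: that[of 1] that[of "-1"])
 obtain \<theta> B where \<theta>: "0 < \<theta>" "!!n. 0 < n ==> r * u n <= B - \<theta> * real n"
  using u_drift[OF r(1) L r(2)] by blast
 define X where "X n w = (if r = 1 then U 0 (int n) w else - U (- int n) 0 w)" for n w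
 have "AE w in M. summable (%n. exp (X n w))"
 proof (rule summable_exp_of_drift[OF _ \<theta>(1)])
  show "X n \<in> borel_measurable M" for n unfolding X_def by simp
  fix s :: real and n :: nat assume sn: "0 < s" "0 < n"
  have Xr: "X n w = r * U (if r = 1 then 0 else - int n) (if r = 1 then int n else 0) w" for w
   using r by (auto simp: X_def)
  have ab: "(if r = 1 then 0 else - int n) < (if r = 1 then int n else 0)"
   "(if r = 1 then int n else 0) - (if r = 1 then 0 else - int n) = int n" using sn by auto
  have "integrable M (%w. exp (s * X n w))"
   using exp_integrable[OF ab(1), of "s * r"] unfolding Xr by (simp add: mult.assoc)
  moreover have "(LINT w|M. exp (s * X n w)) <= exp (s * (r * u n) + 2 * s^2 * C^2 * real n)"
   using U_exp[OF sn(1) ab(1) r(1)] unfolding Xr ab(2) by simp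
  moreover have "exp (s * (r * u n) + 2 * s^2 * C^2 * real n) <= exp (s * (B - \<theta> * real n) + 2 * s^2 * C^2 * real n)"
   using \<theta>(2)[OF sn(2)] sn by (simp add: mult_left_mono)
  ultimately show "integrable M (%w. exp (s * X n w)) & (LINT w|M. exp (s * X n w)) <= exp (s * (B - \<theta> * real n) + 2 * s^2 * C^2 * real n)"
   by linarith
 qed
 moreover have "AE w in M. ~ summable (%n. exp (X n w))" using assms r unfolding X_def by auto
 ultimately have "AE w in M. False" by eventually_elim simp
 thus False by simp
qed

end

text \<open>The functional is centred up to a constant, as it is for recurrent environments.\<close>

locale centred = quasi_additive +
 assumes u_le: "0 < n ==> abs(u n) <= C"
begin

text \<open>Exponential moments at \<open>s = 1 / sqrt l\<close> are bounded uniformly in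
  \<open>l\<close>, and \<open>y ^ 4 <= 24 * exp y\<close> is one term of the exponential
  series.\<close>

lemma fourth_moment:
 assumes "a < b"
 shows "integrable M (%w. U a b w ^ 4)" "(LINT w|M. U a b w ^ 4) <= 48 * exp (C + 2 * C^2) * (of_int (b - a))^2"
proof -
 define l :: real where "l = of_int (b - a)"
 have l: "1 <= l" unfolding l_def using assms by simp
 define s where "s = 1 / sqrt l"
 have s: "0 < s" "s <= 1" "s^2 = 1 / l" unfolding s_def using l by (auto simp: power_divide)
 have pt: "(s * x) ^ 4 <= 24 * (exp (s * x) + exp (s * (- x)))" for x
 proof -
  have "y ^ 4 <= 24 * exp y" if "0 <= y" for y :: real
  proof -
   have "(SUM n:{4}. y ^ n /\<^sub>R fact n) <= (\<Sum>n. y ^ n /\<^sub>R fact n)"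
    by (rule sum_le_suminf[OF summable_exp_generic]) (use that in auto)
   thus ?thesis by (simp add: exp_def fact_numeral)
  qed
  from this[of "abs(s * x)"] have "(s * x) ^ 4 <= 24 * exp \<bar>s * x\<bar>" by (simp add: power_even_abs_numeral)
  also have "exp \<bar>s * x\<bar> <= exp (s * x) + exp (s * (- x))" by (cases "0 <= s * x") (auto simp: abs_if)
  finally show ?thesis by simp
 qed
 show int4: "integrable M (%w. U a b w ^ 4)"
 proof (rule integrable_bdd)
  fix w
  have "abs(U a b w) ^ 4 <= (C * l) ^ 4" using U_bound[OF assms, of w] unfolding l_def by (intro power_mono) auto
  thus "abs(U a b w ^ 4) <= (C * l) ^ 4" by (simp only: power_abs)
 qed measurable
 have "s ^ 4 * (LINT w|M. U a b w ^ 4) = (LINT w|M. (s * U a b w) ^ 4)" by (simp add: power_mult_distrib)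
 also have "... <= (LINT w|M. 24 * (exp (s * U a b w) + exp (s * (- U a b w))))"
  by (intro integral_mono pt) (use int4 exp_integrable[OF assms, of s] exp_integrable[OF assms, of "-s"] in \<open>auto simp: power_mult_distrib\<close>)
 also have "... = 24 * ((LINT w|M. exp (s * U a b w)) + (LINT w|M. exp (s * (- U a b w))))"
  using exp_integrable[OF assms, of s] exp_integrable[OF assms, of "-s"] by simp
 also have "... <= 24 * (exp (C + 2 * C^2) + exp (C + 2 * C^2))"
 proof -
  have un: "abs(u (nat (b - a))) <= C" using u_le assms by simp
  have key: "s * (r * u (nat (b - a))) + 2 * s^2 * C^2 * of_int (b - a) <= C + 2 * C^2" if "r = 1 \<or> r = -1" for r
  proof -
   have "s * (r * u (nat (b - a))) <= s * C" using un that s by (intro mult_left_mono) auto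
   also have "... <= C" using s C_pos by (simp add: mult_left_le_one_le)
   finally show ?thesis using s l unfolding l_def[symmetric] by simp
  qed
  have "(LINT w|M. exp (s * (r * U a b w))) <= exp (C + 2 * C^2)" if "r = 1 \<or> r = -1" for r
   by (rule order_trans[OF U_exp[OF s(1) assms that]]) (use key[OF that] in simp)
  from this[of 1] this[of "-1"] show ?thesis by simp
 qed
 finally have "s ^ 4 * (LINT w|M. U a b w ^ 4) <= 48 * exp (C + 2 * C^2)" by simp
 moreover have "s ^ 4 = 1 / l^2" using s(3) power_mult[of s 2 2] by (simp add: power_divide)
 ultimately show "(LINT w|M. U a b w ^ 4) <= 48 * exp (C + 2 * C^2) * (of_int (b - a))^2"
  unfolding l_def[symmetric] using l by (simp add: field_simps)
qed

end

context centred begin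

definition W :: "int => int => (int => 'a) => real" where
 "W a b w = U a b w - u (nat (b - a))"

lemma W_meas [measurable]: "W a b \<in> borel_measurable M" unfolding W_def[abs_def] by measurable

lemma W_depends: "depends {a<..<b} (W a b)" unfolding W_def[abs_def] by (rule depends_comp[OF U_depends])

lemma W_U: "a < b ==> abs(W a b w - U a b w) <= C" unfolding W_def using u_le[of "nat (b - a)"] by simp

lemma W_bound: assumes "a < b" shows "abs(W a b w) <= C * of_int (b - a) + C"
 using U_bound[OF assms, of w] W_U[OF assms, of w] by linarith

lemma W_integrable: "integrable M (W a b)" unfolding W_def[abs_def] using U_integrable by simp

lemma W_mean: "a < b ==> (LINT w|M. W a b w) = 0"
 unfolding W_def using U_integrable U_mean[of a "nat (b - a)"] by (simp add: prod.P.prob_space)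

lemma W_qadd: "a < b ==> b < c ==> abs(W a c w - W a b w - W b c w) <= 2 * C"
 using U_qadd[of a b c w] u_qadd[of "nat (b - a)" "nat (c - b)"] unfolding W_def
 by (simp add: nat_add_distrib[symmetric] abs_le_iff)

lemma W_int_shift:
 assumes "h \<in> borel_measurable borel"
 shows "(LINT w|M. h (W (a + k) (b + k) w)) = (\<integral>w. h (W a b w) \<partial>M :: real)"
 using U_int_shift[of "%x. h (x - u (nat (b - a)))" a k b] assms unfolding W_def by simp

lemma W_distr: "distr M borel (W (a + k) (b + k)) = distr M borel (W a b)"
proof -
 have "distr M borel (W (a + k) (b + k)) = distr (distr M borel (U (a+k) (b+k))) borel (%x. x - u (nat (b - a)))"
  by (subst distr_distr) (auto simp: comp_def W_def[abs_def])
 also have "... = distr M borel (W a b)"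
  unfolding U_distr by (subst distr_distr) (auto simp: comp_def W_def[abs_def])
 finally show ?thesis .
qed

lemma W_pow_integrable: assumes "a < b" shows "integrable M (%w. abs(W a b w) ^ k)" "integrable M (%w. W a b w ^ k)"
 by (rule integrable_bdd[of _ "(C * of_int (b - a) + C) ^ k"];
   use W_bound[OF assms] in \<open>auto simp: power_abs intro!: power_mono\<close>)+

definition K4 :: real where "K4 = 8 * (48 * exp (C + 2 * C^2)) + 8 * C ^ 4"

lemma K4_pos: "0 < K4" unfolding K4_def using C_pos by (intro add_pos_pos) auto

lemma W_fourth: assumes "a < b" shows "(LINT w|M. W a b w ^ 4) <= K4 * (of_int (b - a))^2"
proof -
 have pt: "(x - y) ^ 4 <= 8 * x ^ 4 + 8 * y ^ 4" for x y :: real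
 proof -
  have "(x - y)^2 <= 2 * (x^2 + y^2)" using zero_le_power2[of "x + y"] by (simp add: power2_eq_square algebra_simps)
  hence "((x - y)^2)^2 <= (2 * (x^2 + y^2))^2" by (intro power_mono) auto
  also have "... <= 8 * (x^2)^2 + 8 * (y^2)^2" using zero_le_power2[of "x^2 - y^2"] by (simp add: power2_eq_square algebra_simps)
  finally show ?thesis by (simp add: power_mult[symmetric])
 qed
 let ?u = "u (nat (b - a))"
 have "?u ^ 4 <= C ^ 4"
 proof -
  have "abs(?u) ^ 4 <= C ^ 4" using u_le assms by (intro power_mono) auto
  thus ?thesis by (simp add: power_even_abs_numeral)
 qed
 have "(LINT w|M. W a b w ^ 4) <= (LINT w|M. 8 * U a b w ^ 4 + 8 * C ^ 4)"
 proof (rule integral_mono)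
  show "W a b w ^ 4 <= 8 * U a b w ^ 4 + 8 * C ^ 4" for w
   using pt[of "U a b w" ?u] \<open>?u ^ 4 <= C ^ 4\<close> unfolding W_def by linarith
 qed (use fourth_moment(1)[OF assms] W_pow_integrable[OF assms] in auto)
 also have "... = 8 * (LINT w|M. U a b w ^ 4) + 8 * C ^ 4" using fourth_moment(1)[OF assms] by (simp add: prod.P.prob_space)
 also have "... <= 8 * (48 * exp (C + 2 * C^2)) * (of_int (b - a))^2 + 8 * C ^ 4 * (of_int (b - a))^2"
 proof (intro add_mono)
  have "1 <= real_of_int (b - a)" using assms by simp
  hence "1 <= (real_of_int (b - a))^2" by (rule one_le_power)
  hence "8 * C ^ 4 * 1 <= 8 * C ^ 4 * (real_of_int (b - a))^2" by (rule mult_left_mono) simp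
  thus "8 * C ^ 4 <= 8 * C ^ 4 * (of_int (b - a))^2" by simp
 qed (use fourth_moment(2)[OF assms] in \<open>simp add: mult_ac\<close>)
 finally show ?thesis unfolding K4_def by (simp add: algebra_simps)
qed

subsection \<open>Asymptotics of the variance\<close>

definition L2 :: "((int => 'a) => real) => real" where "L2 X = sqrt (LINT w|M. (X w)^2)"

lemma L2_nonneg: "0 <= L2 X" unfolding L2_def by simp

lemma abs_le_L2:
 assumes [measurable]: "X \<in> borel_measurable M" and b: "!!w. abs(X w) <= b"
 shows "(LINT w|M. abs(X w)) <= L2 X"
proof -
 have X2: "integrable M (%w. (X w)^2)"
 proof (rule integrable_bdd[of _ "b^2"])
  show "abs((X w)^2) <= b^2" for w using b[of w] by (simp add: abs_le_square_iff[symmetric])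
 qed measurable
 have X1: "integrable M (%w. abs(X w))" by (rule integrable_bdd[of _ b]) (use b in auto)
 have "0 <= (LINT w|M. (abs(X w) - (LINT w|M. abs(X w)))^2)" by (rule integral_nonneg_AE) auto
 also have "... = (LINT w|M. (X w)^2) - (LINT w|M. abs(X w))^2"
  using prod.P.variance_eq[OF X1] X2 by simp
 finally have "(LINT w|M. abs(X w))^2 <= (LINT w|M. (X w)^2)" by simp
 thus ?thesis unfolding L2_def by (rule real_le_rsqrt)
qed

lemma L2_le:
 assumes [measurable]: "X \<in> borel_measurable M" "Y \<in> borel_measurable M"
  and b: "!!w. abs(Y w) <= b" and d: "!!w. abs(X w - Y w) <= d"
 shows "L2 X <= L2 Y + d"
proof -
 have d0: "0 <= d" using d[of undefined] by linarith
 have iY: "integrable M (%w. (Y w)^2)"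
 proof (rule integrable_bdd[of _ "b^2"])
  show "abs((Y w)^2) <= b^2" for w using b[of w] by (simp add: abs_le_square_iff[symmetric])
 qed measurable
 have iY1: "integrable M (%w. abs(Y w))" by (rule integrable_bdd[of _ b]) (use b in auto)
 have pt: "(X w)^2 <= (Y w)^2 + 2 * d * abs(Y w) + d^2" for w
 proof -
  have "abs(X w) <= abs(Y w) + d" using d[of w] by linarith
  hence "abs(X w)^2 <= (abs(Y w) + d)^2" by (intro power_mono) auto
  thus ?thesis by (simp add: power2_sum algebra_simps)
 qed
 have iX: "integrable M (%w. (X w)^2)"
  by (rule Bochner_Integration.integrable_bound[of _ "%w. (Y w)^2 + 2 * d * abs(Y w) + d^2"])
   (use iY iY1 pt d0 in \<open>auto intro!: AE_I2 simp: abs_of_nonneg\<close>)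
 have "(LINT w|M. (X w)^2) <= (LINT w|M. (Y w)^2 + 2 * d * abs(Y w) + d^2)"
  by (intro integral_mono pt iX) (use iY iY1 in auto)
 also have "... = (LINT w|M. (Y w)^2) + 2 * d * (LINT w|M. abs(Y w)) + d^2"
  using iY iY1 by (simp add: prod.P.prob_space)
 also have "... <= (L2 Y)^2 + 2 * d * L2 Y + d^2"
  using abs_le_L2[OF assms(2) b] d0 by (intro add_mono mult_left_mono) (auto simp: L2_def integral_nonneg_AE)
 also have "... = (L2 Y + d)^2" by (simp add: power2_sum)
 finally show ?thesis unfolding L2_def[of X] by (rule real_le_lsqrt[rotated -1]) (use d0 L2_nonneg[of Y] in \<open>auto intro: integral_nonneg_AE\<close>)
qed

definition sd :: "nat => real" where "sd n = L2 (W 0 (int n))"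

lemma sd_sq: "(sd n)^2 = (LINT w|M. (W 0 (int n) w)^2)"
 unfolding sd_def L2_def by (simp add: integral_nonneg_AE)

lemma sd_nonneg: "0 <= sd n" unfolding sd_def by (rule L2_nonneg)

text \<open>Adjacent blocks are independent and centred, so standard deviations add like orthogonal
  lengths, up to the cutting error.\<close>

lemma sd_add: assumes "0 < m" "0 < n" shows "abs(sd (m + n) - sqrt ((sd m)^2 + (sd n)^2)) <= 2 * C"
proof -
 let ?X = "W 0 (int (m + n))" and ?A = "W 0 (int m)" and ?B = "W (int m) (int m + int n)"
 let ?Y = "%w. ?A w + ?B w"
 have d: "abs(?X w - ?Y w) <= 2 * C" for w using W_qadd[of 0 "int m" "int m + int n" w] assms by (simp add: diff_diff_eq)
 have bX: "abs(?X w) <= C * of_int (int (m + n)) + C" for w using W_bound[of 0 "int (m + n)" w] assms by simp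
 have bY: "abs(?Y w) <= C * of_int (int (m + n)) + C + 2 * C" for w using bX[of w] d[of w] by linarith
 have ind: "prod.indep_var borel ?A borel ?B"
  by (rule indep_var_depends[OF _ _ W_depends W_depends]) auto
 have AB: "(LINT w|M. ?A w * ?B w) = 0" "integrable M (%w. ?A w * ?B w)"
  using prod.indep_var_lebesgue_integral[OF ind W_integrable W_integrable] prod.indep_var_integrable[OF ind W_integrable W_integrable]
   W_mean[of 0 "int m"] assms by auto
 have "(LINT w|M. (?Y w)^2) = (LINT w|M. (?A w)^2 + (?B w)^2 + 2 * (?A w * ?B w))"
  by (simp add: power2_sum mult.assoc)
 also have "... = (sd m)^2 + (sd n)^2"
  using AB W_pow_integrable(2)[of 0 "int m" 2] W_pow_integrable(2)[of "int m" "int m + int n" 2] assms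
   W_int_shift[of "%x. x^2" 0 "int m" "int n"] by (simp add: sd_sq add.commute)
 finally have Y: "L2 ?Y = sqrt ((sd m)^2 + (sd n)^2)" by (simp add: L2_def)
 have "L2 ?X <= L2 ?Y + 2 * C" by (rule L2_le[OF _ _ bY d]) auto
 moreover have "L2 ?Y <= L2 ?X + 2 * C" by (rule L2_le[OF _ _ bX]) (use d in \<open>auto simp: abs_minus_commute\<close>)
 ultimately show ?thesis unfolding Y sd_def by simp
qed

lemma sqrt_lip: "abs(sqrt (x^2 + z^2) - sqrt (y^2 + z^2)) <= abs(x - y)"
proof -
 have "sqrt (x^2 + z^2) <= sqrt (y^2 + z^2) + abs(x - y)" for x y
  using real_sqrt_sum_squares_triangle_ineq[of y "x - y" z 0] by simp
 from this[of x y] this[of y x] show ?thesis by linarith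
qed

text \<open>Induction by halving. The constant 10 is such that \<open>10 * (sqrt 2 - 1)\<close>, at
  least 4 by \<open>two\<close>, absorbs the errors \<open>2 * C\<close> of a doubling and of a
  following odd step.\<close>

lemma sd_mult: assumes "0 < m" "0 < q" shows "abs(sd (q * m) - sqrt (real q) * sd m) <= 10 * C * (sqrt (real q) - 1)"
 using assms(2)
proof (induction q rule: less_induct)
 case (less q)
 have two: "7 / 5 <= sqrt 2" by (rule real_le_rsqrt) (simp add: power2_eq_square)
 have double: "abs(sd (2 * k * m) - sqrt (2 * real k) * sd m) <= 10 * C * (sqrt (2 * real k) - sqrt 2) + 2 * C"
  if k: "0 < k" "k < q" for k
 proof -
  have "abs(sd (k * m + k * m) - sqrt ((sd (k * m))^2 + (sd (k * m))^2)) <= 2 * C" using sd_add[of "k * m" "k * m"] k assms by simp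
  moreover have "sqrt ((sd (k * m))^2 + (sd (k * m))^2) = sqrt 2 * sd (k * m)"
   using sd_nonneg[of "k * m"] by (simp add: real_sqrt_mult flip: mult_2)
  moreover have "k * m + k * m = 2 * k * m" by simp
  ultimately have 1: "abs(sd (2 * k * m) - sqrt 2 * sd (k * m)) <= 2 * C" by simp
  have "abs(sqrt 2 * sd (k * m) - sqrt 2 * (sqrt (real k) * sd m)) <= sqrt 2 * (10 * C * (sqrt (real k) - 1))"
   using less.IH[OF k(2,1)] by (simp add: abs_mult flip: right_diff_distrib)
  thus ?thesis using 1 by (simp add: real_sqrt_mult algebra_simps)
 qed
 have "q = 1 \<or> (\<exists>k>0. q = 2 * k) \<or> (\<exists>k>0. q = 2 * k + 1)" using less.prems by presburger
 then consider "q = 1" | k where "0 < k" "q = 2 * k" | k where "0 < k" "q = 2 * k + 1" by blast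
 thus ?case
 proof cases
  case 1 thus ?thesis by simp
 next
  case 2
  have "10 * C * (6 / 5) <= 10 * C * sqrt 2" using two C_pos by (intro mult_left_mono) auto
  thus ?thesis using double[of k] 2 by (simp add: algebra_simps)
 next
  case 3
  have qm: "q * m = 2 * k * m + m" using 3 by (simp add: algebra_simps)
  have "abs(sd (q * m) - sqrt ((sd (2 * k * m))^2 + (sd m)^2)) <= 2 * C"
   unfolding qm by (rule sd_add) (use 3 assms in auto)
  moreover have "abs(sqrt ((sd (2 * k * m))^2 + (sd m)^2) - sqrt ((sqrt (2 * real k) * sd m)^2 + (sd m)^2)) <= abs(sd (2 * k * m) - sqrt (2 * real k) * sd m)"
   by (rule sqrt_lip)
  moreover have "sqrt ((sqrt (2 * real k) * sd m)^2 + (sd m)^2) = sqrt (real q) * sd m"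
  proof -
   have "(sqrt (2 * real k) * sd m)^2 + (sd m)^2 = real q * (sd m)^2" using 3 by (simp add: power_mult_distrib algebra_simps)
   thus ?thesis using sd_nonneg[of m] by (simp add: real_sqrt_mult)
  qed
  moreover have "10 * C * (sqrt (2 * real k) - sqrt 2) + 4 * C <= 10 * C * (sqrt (real q) - 1)"
  proof -
   have "sqrt (2 * real k) <= sqrt (real q)" using 3 by simp
   hence "10 * C * (7 / 5 + sqrt (2 * real k)) <= 10 * C * (sqrt 2 + sqrt (real q))"
    by (rule mult_left_mono[OF add_mono[OF two]]) (use C_pos in simp)
   thus ?thesis by (simp add: algebra_simps)
  qed
  ultimately show ?thesis using double[of k] 3 by linarith
 qed
qed

lemma sd_ratio: assumes "0 < m" "0 < q" shows "abs(sd (q * m) / sqrt (real (q * m)) - sd m / sqrt (real m)) <= 10 * C / sqrt (real m)"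
proof -
 have "sd (q * m) / sqrt (real (q * m)) - sd m / sqrt (real m) = (sd (q * m) - sqrt (real q) * sd m) / (sqrt (real q) * sqrt (real m))"
  using assms by (simp add: real_sqrt_mult diff_divide_distrib)
 hence "abs(sd (q * m) / sqrt (real (q * m)) - sd m / sqrt (real m)) = abs(sd (q * m) - sqrt (real q) * sd m) / (sqrt (real q) * sqrt (real m))"
  by (simp add: abs_mult)
 also have "... <= (10 * C * sqrt (real q)) / (sqrt (real q) * sqrt (real m))"
 proof (intro divide_right_mono)
  have "10 * C * (sqrt (real q) - 1) <= 10 * C * sqrt (real q)" using C_pos by simp
  thus "abs(sd (q * m) - sqrt (real q) * sd m) <= 10 * C * sqrt (real q)" using sd_mult[OF assms] by linarith
 qed auto
 finally show ?thesis using assms by simp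
qed

text \<open>Lengths \<open>m\<close> and \<open>n\<close> are compared through their common multiple
  \<open>m * n\<close>.\<close>

lemma sd_limit_exists: "\<exists>\<sigma>\<ge>0. (%n. sd n / sqrt (real n)) \<longlonglongrightarrow> \<sigma>"
proof -
 let ?f = "%n. sd n / sqrt (real n)"
 have pair: "abs(?f m - ?f n) <= 10 * C / sqrt (real m) + 10 * C / sqrt (real n)" if "0 < m" "0 < n" for m n
  using sd_ratio[of m n] sd_ratio[of n m] that by (simp add: mult.commute)
 have "Cauchy ?f"
 proof (rule metric_CauchyI)
  fix e :: real assume "0 < e"
  have "(%n. 10 * C / sqrt (real n)) \<longlonglongrightarrow> 0" by real_asymp
  hence "eventually (%n. 10 * C / sqrt (real n) < e / 2) sequentially" using \<open>0 < e\<close> by (intro order_tendstoD) auto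
  then obtain n0 where n0: "!!n. n0 <= n ==> 10 * C / sqrt (real n) < e / 2" by (auto simp: eventually_sequentially)
  show "\<exists>M. \<forall>m\<ge>M. \<forall>n\<ge>M. dist (?f m) (?f n) < e"
  proof (intro exI[of _ "max n0 1"] allI impI)
   fix m n assume "max n0 1 <= m" "max n0 1 <= n"
   thus "dist (?f m) (?f n) < e" using pair[of m n] n0[of m] n0[of n] by (simp add: dist_real_def)
  qed
 qed
 then obtain \<sigma> where "?f \<longlonglongrightarrow> \<sigma>" using Cauchy_convergent convergent_def by blast
 moreover have "0 <= \<sigma>" by (rule LIMSEQ_le_const[OF calculation]) (auto simp: sd_nonneg)
 ultimately show ?thesis by blast
qed

definition \<sigma> :: real where "\<sigma> = (SOME s. 0 <= s & (%n. sd n / sqrt (real n)) \<longlonglongrightarrow> s)"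

lemma sigma: "0 <= \<sigma>" "(%n. sd n / sqrt (real n)) \<longlonglongrightarrow> \<sigma>"
proof -
 have "0 <= \<sigma> & (%n. sd n / sqrt (real n)) \<longlonglongrightarrow> \<sigma>"
  unfolding \<sigma>_def by (rule someI_ex[OF sd_limit_exists])
 thus "0 <= \<sigma>" "(%n. sd n / sqrt (real n)) \<longlonglongrightarrow> \<sigma>" by auto
qed

text \<open>
  The variance grows linearly as soon as some increment exceeds \<open>6 * C\<close> with positive probability:
  it dominates the covariance with the sum of the centred indicators of these events.
\<close>

lemma sigma_pos:
 assumes L: "0 < L" and r: "r = 1 \<or> r = -1" and p: "0 < measure M {w \<in> space M. 6 * C <= r * U 0 (int L) w}"
 shows "0 < \<sigma>"
proof -
 define p where "p = measure M {w \<in> space M. 6 * C <= r * U 0 (int L) w}"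
 have p: "0 < p" "p <= 1" using assms(3) unfolding p_def by auto
 define v where "v j w = (if 6 * C <= r * U (int j * L) (int j * L + L) w then 1 else 0) - p" for j :: nat and w
 have wm[measurable]: "v j \<in> borel_measurable M" for j unfolding v_def by measurable
 have w1: "abs(v j w) <= 1" for j w unfolding v_def using p by auto
 have wi: "integrable M (v j)" for j by (rule integrable_bdd[OF wm w1])
 have wdep: "depends {int j * L<..<int j * L + L} (v j)" for j unfolding v_def[abs_def] by (rule depends_comp[OF U_depends])
 have Ej: "(LINT w|M. (if 6 * C <= r * U (int j * L) (int j * L + L) w then 1 else 0)) = p" for j
 proof -
  have "(LINT w|M. (if 6 * C <= r * U (0 + int j * L) (int L + int j * L) w then 1 else 0))
    = (LINT w|M. (if 6 * C <= r * U 0 (int L) w then 1 else 0 :: real))"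
   by (rule U_int_shift[of "%x. if 6 * C <= r * x then 1 else 0"]) measurable
  also have "... = (\<integral>w. indicator {w \<in> space M. 6 * C <= r * U 0 (int L) w} w \<partial>M)"
   by (intro Bochner_Integration.integral_cong) (auto simp: indicator_def)
  finally show ?thesis unfolding p_def by (simp add: add.commute)
 qed
 have Ew: "(LINT w|M. v j w) = 0" for j
 proof -
  have "integrable M (%w. if 6 * C <= r * U (int j * L) (int j * L + L) w then 1 else 0 :: real)"
   by (rule integrable_bdd[of _ 1]) auto
  thus ?thesis unfolding v_def by (simp add: Ej prod.P.prob_space)
 qed
 have Eaw: "(LINT w|M. abs(v j w)) <= 2 * p" and Ew2: "(LINT w|M. (v j w)^2) <= p" for j
 proof -
  let ?I = "%w. if 6 * C <= r * U (int j * L) (int j * L + L) w then 1 else 0 :: real"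
  have I: "integrable M ?I" by (rule integrable_bdd[of _ 1]) auto
  have "(LINT w|M. abs(v j w)) <= (LINT w|M. ?I w + p)"
   by (intro integral_mono integrable_abs wi) (use I p in \<open>auto simp: v_def\<close>)
  thus "(LINT w|M. abs(v j w)) <= 2 * p" using I by (simp add: Ej prod.P.prob_space)
  have "(LINT w|M. (v j w)^2) = (LINT w|M. ?I w * (1 - 2 * p) + p^2)"
   by (intro Bochner_Integration.integral_cong) (auto simp: v_def power2_eq_square algebra_simps)
  also have "... = p * (1 - 2 * p) + p^2" using I by (simp add: Ej prod.P.prob_space)
  also have "... <= p" using p by (simp add: power2_eq_square algebra_simps)
  finally show "(LINT w|M. (v j w)^2) <= p" .
 qed
 \<comment> \<open>Two additional blocks keep a non-empty interval on both sides of each of the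
   blocks \<open>1..J\<close>, as cutting requires.\<close>
 have main: "p * C^2 * real J <= (sd ((J + 2) * L))^2" for J
 proof (cases "J = 0")
  case False
  define Tn where "Tn = (J + 2) * L"
  let ?X = "W 0 (int Tn)"
  have T0: "0 < int Tn" unfolding Tn_def using L by (simp del: of_nat_mult of_nat_add)
  define S where "S w = (SUM j:{1..J}. v j w)" for w
  have Sm[measurable]: "S \<in> borel_measurable M" unfolding S_def by measurable
  have XW: "integrable M (%w. ?X w * v j w)" for j
  proof (rule integrable_bdd[of _ "(C * of_int (int Tn - 0) + C) * 1"])
   show "abs(?X w * v j w) <= (C * of_int (int Tn - 0) + C) * 1" for w
    unfolding abs_mult using W_bound[OF T0, of w] w1[of j w] by (intro mult_mono) auto
  qed measurable
  \<comment> \<open>The account: \<open>6 * C * p\<close> from the exceedances, minus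
    \<open>C * p\<close> for the mean of the increment, minus \<open>4 * C * p\<close> for the
    cutting errors.\<close>
  have cov: "p * C <= r * (LINT w|M. ?X w * v j w)" if j: "j \<in> {1..J}" for j
  proof -
   define a b where "a = int j * L" and "b = int j * L + L"
   have ab: "0 < a" "a < b" "b < int Tn" "b = a + int L"
   proof -
    have "int j * L + L = int (j + 1) * L" by (simp add: algebra_simps)
    also have "... < int (J + 2) * L" using j L by (intro mult_strict_right_mono) auto
    finally show "b < int Tn" by (simp add: b_def Tn_def algebra_simps)
   qed (use j L in \<open>auto simp: a_def b_def\<close>)
   define E where "E w = U 0 (int Tn) w - U 0 a w - U a b w - U b (int Tn) w" for w
   have Ebd: "abs(E w) <= 2 * C" for w
    unfolding E_def using U_qadd[of 0 a "int Tn" w] U_qadd[of a b "int Tn" w] ab by linarith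
   have Em[measurable]: "E \<in> borel_measurable M" unfolding E_def by measurable
   have int0: "integrable M (%w. U x y w * v j w)" if "x < y" for x y
   proof (rule integrable_bdd[of _ "(C * of_int (y - x)) * 1"])
    show "abs(U x y w * v j w) <= (C * of_int (y - x)) * 1" for w
     unfolding abs_mult using U_bound[OF that, of w] w1[of j w] by (intro mult_mono) auto
   qed measurable
   have ind0: "(LINT w|M. U x y w * v j w) = 0" if "{x<..<y} \<inter> {a<..<b} = {}" for x y
   proof -
    have "prod.indep_var borel (U x y) borel (v j)"
     by (rule indep_var_depends[OF _ _ U_depends wdep]) (use that in \<open>auto simp: a_def b_def\<close>)
    thus ?thesis using prod.indep_var_lebesgue_integral[OF _ U_integrable wi] Ew by simp
   qed
   have EW: "integrable M (%w. E w * v j w)"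
   proof (rule integrable_bdd[of _ "(2 * C) * 1"])
    show "abs(E w * v j w) <= (2 * C) * 1" for w
     unfolding abs_mult using Ebd[of w] w1[of j w] by (intro mult_mono) auto
   qed measurable
   have err: "abs(LINT w|M. E w * v j w) <= 4 * C * p"
   proof -
    have "abs(LINT w|M. E w * v j w) <= (LINT w|M. abs(E w * v j w))" by (rule integral_abs_bound)
    also have "... <= (LINT w|M. 2 * C * abs(v j w))"
    proof (intro integral_mono integrable_abs EW)
     show "abs(E w * v j w) <= 2 * C * abs(v j w)" for w
      unfolding abs_mult using Ebd[of w] by (intro mult_right_mono) auto
    qed (use wi in auto)
    also have "... <= 2 * C * (2 * p)" using Eaw[of j] C_pos by simp
    finally show ?thesis by simp
   qed
   have Uw: "5 * C * p <= r * (LINT w|M. U a b w * v j w)"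
   proof -
    let ?I = "%w. if 6 * C <= r * U a b w then 1 else 0 :: real"
    have I: "integrable M ?I" by (rule integrable_bdd[of _ 1]) auto
    have "(LINT w|M. 6 * C * ?I w - p * (r * U a b w)) <= (LINT w|M. r * (U a b w * v j w))"
    proof (rule integral_mono)
     show "6 * C * ?I w - p * (r * U a b w) <= r * (U a b w * v j w)" for w
      by (auto simp: v_def a_def b_def algebra_simps)
    qed (use I U_integrable int0[OF ab(2)] in auto)
    also have "(LINT w|M. 6 * C * ?I w - p * (r * U a b w)) = 6 * C * p - p * (r * u L)"
     using I U_integrable Ej[of j] U_mean[of a L] by (simp add: ab(4) a_def b_def)
    finally have "6 * C * p - p * (r * u L) <= r * (LINT w|M. U a b w * v j w)" by simp
    moreover have "p * (r * u L) <= p * C" using u_le[OF L] r p by (intro mult_left_mono) auto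
    ultimately show ?thesis by (simp add: algebra_simps)
   qed
   have "(LINT w|M. ?X w * v j w) = (LINT w|M. U 0 a w * v j w + U a b w * v j w + U b (int Tn) w * v j w + E w * v j w - u Tn * v j w)"
    by (intro Bochner_Integration.integral_cong) (auto simp: E_def W_def algebra_simps)
   also have "... = (LINT w|M. U a b w * v j w) + (LINT w|M. E w * v j w)"
    using int0 ab EW wi Ew ind0[of 0 a] ind0[of b "int Tn"] by simp
   finally show ?thesis using Uw err r by (auto simp: algebra_simps abs_le_iff)
  qed
  have "p * C * real J = (SUM j:{1..J}. p * C)" by simp
  also have "... <= (SUM j:{1..J}. r * (LINT w|M. ?X w * v j w))" by (intro sum_mono cov)
  also have "... = r * (LINT w|M. ?X w * S w)"
   unfolding S_def sum_distrib_left[symmetric] using XW by (simp add: sum_distrib_left[of "W _ _ _"] Bochner_Integration.integral_sum)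
  finally have lower: "p * C * real J <= r * (LINT w|M. ?X w * S w)" .
  have S2: "(LINT w|M. (S w)^2) <= real J * p"
  proof -
   have ww: "integrable M (%w. v i w * v j w)" for i j
   proof (rule integrable_bdd[of _ "1 * 1"])
    show "abs(v i w * v j w) <= 1 * 1" for w unfolding abs_mult using w1 by (intro mult_mono) auto
   qed measurable
   have wij: "(LINT w|M. v i w * v j w) = 0" if "i \<noteq> j" for i j
   proof -
    have "{int i * L<..<int i * L + L} \<inter> {int j * L<..<int j * L + L} = {}"
     using blocks_ordered[of "int i" "int j" "int L"] that by (auto simp: distrib_right)
    hence "prod.indep_var borel (v i) borel (v j)" by (intro indep_var_depends[OF _ _ wdep wdep]) auto
    thus ?thesis using prod.indep_var_lebesgue_integral[OF _ wi wi] Ew by simp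
   qed
   have "(LINT w|M. (S w)^2) = (SUM i:{1..J}. SUM j:{1..J}. \<integral>w. v i w * v j w \<partial>M)"
    unfolding S_def power2_eq_square sum_product using ww by (simp add: Bochner_Integration.integral_sum)
   also have "... = (SUM i:{1..J}. \<integral>w. v i w * v i w \<partial>M)"
   proof (rule sum.cong[OF refl])
    fix i assume "i \<in> {1..J}"
    thus "(SUM j:{1..J}. \<integral>w. v i w * v j w \<partial>M) = (LINT w|M. v i w * v i w)"
     using wij by (subst sum.remove[of _ i]) (auto intro!: sum.neutral)
   qed
   also have "... <= (SUM i:{1..J}. p)" using Ew2 by (intro sum_mono) (simp add: power2_eq_square)
   finally show ?thesis by simp
  qed
  have SJ: "abs(S w) <= real J" for w
  proof -
   have "abs(S w) <= (SUM j:{1..J}. abs(v j w))" unfolding S_def by (rule sum_abs)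
   also have "... <= (SUM j:{1..J}. 1)" by (intro sum_mono w1)
   finally show ?thesis by simp
  qed
  have S2i: "integrable M (%w. (S w)^2)"
   by (rule integrable_bdd[of _ "(real J)^2"]) (use SJ in \<open>auto simp: abs_le_square_iff[symmetric]\<close>)
  have XSi: "integrable M (%w. ?X w * S w)"
   unfolding S_def sum_distrib_left using XW by auto
  have X2i: "integrable M (%w. (?X w)^2)" by (rule W_pow_integrable(2)[OF T0])
  text \<open>Completing the square instead of invoking Cauchy-Schwarz.\<close>
  have "0 <= (LINT w|M. (?X w - r * C * S w)^2)" by (rule integral_nonneg_AE) auto
  also have "... = (LINT w|M. (?X w)^2 - 2 * C * r * (?X w * S w) + C^2 * (S w)^2)"
   using r by (intro Bochner_Integration.integral_cong) (auto simp: power2_eq_square algebra_simps)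
  also have "... = (sd Tn)^2 - 2 * C * (r * (LINT w|M. ?X w * S w)) + C^2 * (LINT w|M. (S w)^2)"
   using X2i XSi S2i by (simp add: sd_sq)
  also have "... <= (sd Tn)^2 - 2 * C * (p * C * real J) + C^2 * (real J * p)"
   using lower S2 C_pos by (intro add_mono diff_mono mult_left_mono) auto
  finally show ?thesis unfolding Tn_def by (simp add: power2_eq_square algebra_simps)
 qed simp
 \<comment> \<open>\<open>main\<close> is used with \<open>J + 1\<close> blocks on the length
   \<open>(J + 3) * L\<close>, and \<open>J + 3 <= 3 * (J + 1)\<close>; hence the divisor 3.\<close>
 define c where "c = p * C^2 / (3 * real L)"
 have c: "0 < c" unfolding c_def using p C_pos L by simp
 have "sqrt c <= \<sigma>"
 proof (rule LIMSEQ_le_const[OF LIMSEQ_subseq_LIMSEQ[OF sigma(2), of "%J. (J + 3) * L"]])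
  show "strict_mono (%J. (J + 3) * L)" using L by (auto simp: strict_mono_def)
  show "\<exists>N. \<forall>n\<ge>N. sqrt c <= ((%n. sd n / sqrt (real n)) \<circ> (%J. (J + 3) * L)) n"
  proof (intro exI[of _ 0] allI impI)
   fix J :: nat
   let ?n = "(J + 3) * L"
   have n0: "0 < real ?n" using L by simp
   have "c * real ?n <= p * C^2 * real (J + 1)"
   proof -
    have "real (J + 3) <= 3 * real (J + 1)" by simp
    hence "p * C^2 * real (J + 3) <= p * C^2 * (3 * real (J + 1))" using p by (intro mult_left_mono) auto
    moreover have "c * real ?n = p * C^2 * real (J + 3) / 3" using L by (simp add: c_def)
    ultimately show ?thesis by linarith
   qed
   also have "... <= (sd ?n)^2" using main[of "J + 1"] by (simp add: add.commute numeral_3_eq_3)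
   finally have "sqrt (c * real ?n) <= sd ?n" using sd_nonneg by (intro real_le_lsqrt) auto
   thus "sqrt c <= ((%n. sd n / sqrt (real n)) \<circ> (%J. (J + 3) * L)) J"
    using n0 by (simp add: real_sqrt_mult le_divide_eq del: of_nat_mult)
  qed
 qed
 thus ?thesis using c by (meson less_le_trans real_sqrt_gt_zero)
qed

end

subsection \<open>Central limit theorem\<close>

context centred begin

lemma iexp_lip: "cmod (iexp x - iexp y) <= abs(x - y)"
proof -
 have "iexp x - iexp y = iexp y * (iexp (x - y) - 1)" by (simp add: exp_add[symmetric] algebra_simps)
 hence "cmod (iexp x - iexp y) = cmod (iexp (x - y) - 1)" by (simp add: norm_mult)
 thus ?thesis using iexp_approx1[of "x - y" 0] by simp
qed

lemma char_distr_close: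
 assumes [measurable]: "X \<in> borel_measurable M" "Y \<in> borel_measurable M" and d: "!!w. abs(X w - Y w) <= d"
 shows "cmod (char (distr M borel X) t - char (distr M borel Y) t) <= abs(t) * d"
proof -
 have i: "integrable M (%w. iexp (t * Z w))" if [measurable]: "Z \<in> borel_measurable M" for Z
  by (rule prod.integrable_const_bound[of _ 1]) auto
 have "char (distr M borel X) t - char (distr M borel Y) t = (CLINT w|M. iexp (t * X w) - iexp (t * Y w))"
  unfolding char_def Bochner_Integration.integral_diff[OF i[OF assms(1)] i[OF assms(2)]]
  by (intro arg_cong2[where f="(-)"] integral_distr) auto
 also have "cmod ... <= (LINT w|M. cmod (iexp (t * X w) - iexp (t * Y w)))" by (rule integral_norm_bound)
 also have "... <= (LINT w|M. abs(t) * d)"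
 proof (intro integral_mono)
  show "cmod (iexp (t * X w) - iexp (t * Y w)) <= abs(t) * d" for w
  proof -
   have "cmod (iexp (t * X w) - iexp (t * Y w)) <= abs(t) * abs(X w - Y w)"
    using iexp_lip[of "t * X w" "t * Y w"] by (simp add: right_diff_distrib[symmetric] abs_mult)
   also have "... <= abs(t) * d" using d by (intro mult_left_mono) auto
   finally show ?thesis .
  qed
  show "integrable M (%w. cmod (iexp (t * X w) - iexp (t * Y w)))"
   by (intro integrable_norm Bochner_Integration.integrable_diff i) auto
 qed simp
 finally show ?thesis by (simp add: prod.P.prob_space)
qed

lemma block_sum_close:
 assumes l: "0 < l" and k: "0 < k"
 shows "abs(W 0 (int (k * l)) w - (SUM j<k. W (int (j * l)) (int (j * l) + int l) w)) <= 2 * C * real k"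
 using k
proof (induction k rule: nat_induct_non_zero)
 case 1 thus ?case using C_pos by simp
next
 case (Suc k)
 have "abs(W 0 (int (k * l) + int l) w - W 0 (int (k * l)) w - W (int (k * l)) (int (k * l) + int l) w) <= 2 * C"
  by (rule W_qadd) (use Suc l in \<open>auto simp del: of_nat_mult\<close>)
 moreover have "int (k * l) + int l = int (Suc k * l)" by simp
 moreover have "2 * C * real (Suc k) = 2 * C * real k + 2 * C" by (simp add: algebra_simps)
 ultimately show ?case using Suc.IH unfolding sum.lessThan_Suc by (smt (verit))
qed

lemma block_sum_close':
 assumes l: "0 < l" and k: "0 < k" and r: "r < k"
 shows "abs(W 0 (int (k * l + r)) w - (SUM j<k. W (int (j * l)) (int (j * l) + int l) w)) <= 6 * C * real k"
proof (cases "r = 0")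
 case True
 have "2 * C * real k <= 6 * C * real k" using C_pos by simp
 thus ?thesis using block_sum_close[OF l k, of w] True by simp
next
 case False
 have "abs(W 0 (int (k * l) + int r) w - W 0 (int (k * l)) w - W (int (k * l)) (int (k * l) + int r) w) <= 2 * C"
  by (rule W_qadd) (use l k False in \<open>auto simp del: of_nat_mult\<close>)
 moreover have "abs(W (int (k * l)) (int (k * l) + int r) w) <= C * real r + C"
  using W_bound[of "int (k * l)" "int (k * l) + int r" w] False by simp
 moreover have "C * real r + 3 * C <= 4 * C * real k"
 proof -
  have "C * (real r + 3) <= C * (4 * real k)" using r C_pos by (intro mult_left_mono) auto
  thus ?thesis by (simp add: algebra_simps)
 qed
 ultimately show ?thesis using block_sum_close[OF l k, of w] by simp
qed

definition \<phi> :: "nat => real => complex" where "\<phi> n t = char (distr M borel (W 0 (int n))) t"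

text \<open>Arithmetic-geometric inequalities at the scale of \<open>l\<close> bound the second
  moment by the fourth, and the third by the second and the fourth.\<close>

lemma third_moment:
 assumes "0 < l"
 shows "(sd l)^2 <= (1 + K4) * real l" "(LINT w|M. abs(W 0 (int l) w) ^ 3) <= (1 + K4) * (real l * sqrt (real l))"
proof -
 let ?X = "W 0 (int l)"
 have l: "0 < real l" and lp: "0 < int l" using assms by auto
 note i = W_pow_integrable[OF lp]
 have F: "(LINT w|M. ?X w ^ 4) <= K4 * (real l)^2" using W_fourth[OF lp] by simp
 have "x^2 <= real l / 2 + x ^ 4 / (2 * real l)" for x :: real
  using zero_le_power2[of "x^2 - real l"] l by (simp add: field_simps power2_eq_square power4_eq_xxxx)
 hence "(LINT w|M. (?X w)^2) <= (LINT w|M. real l / 2 + ?X w ^ 4 / (2 * real l))" using i by (intro integral_mono) auto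
 also have "... = real l / 2 + (LINT w|M. ?X w ^ 4) / (2 * real l)" using i by (simp add: prod.P.prob_space)
 also have "... <= real l / 2 + K4 * (real l)^2 / (2 * real l)" using F l by (intro add_left_mono divide_right_mono) auto
 also have "... = (1 + K4) / 2 * real l" using l by (simp add: field_simps power2_eq_square)
 finally have v: "(sd l)^2 <= (1 + K4) / 2 * real l" by (simp add: sd_sq)
 have "0 <= (1 + K4) / 2 * real l" using K4_pos by simp
 moreover have "(1 + K4) * real l = 2 * ((1 + K4) / 2 * real l)" by simp
 ultimately show "(sd l)^2 <= (1 + K4) * real l" using v by linarith
 have s: "0 < sqrt (real l)" "sqrt (real l) * sqrt (real l) = real l" using l by auto
 have "abs(x) ^ 3 <= sqrt (real l) / 2 * x^2 + x ^ 4 / (2 * sqrt (real l))" for x :: real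
 proof -
  define y z where "y = abs(x)" and "z = sqrt (real l)"
  have z: "0 < z" unfolding z_def by (rule s(1))
  have "0 <= y^2 * (y - z)^2" by simp
  also have "... = y ^ 4 - 2 * z * y ^ 3 + z^2 * y^2" by (simp add: power2_eq_square power4_eq_xxxx power3_eq_cube algebra_simps)
  finally have "2 * z * y ^ 3 <= y ^ 4 + z^2 * y^2" by simp
  hence "2 * z * y ^ 3 / (2 * z) <= (y ^ 4 + z^2 * y^2) / (2 * z)" using z by (intro divide_right_mono) auto
  also have "2 * z * y ^ 3 / (2 * z) = y ^ 3" using z by simp
  also have "(y ^ 4 + z^2 * y^2) / (2 * z) = z / 2 * y^2 + y ^ 4 / (2 * z)" using z by (simp add: add_divide_distrib power2_eq_square)
  finally show ?thesis unfolding y_def z_def by (simp add: power_even_abs_numeral)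
 qed
 hence "(LINT w|M. abs(?X w) ^ 3) <= (LINT w|M. sqrt (real l) / 2 * (?X w)^2 + ?X w ^ 4 / (2 * sqrt (real l)))" using i by (intro integral_mono) auto
 also have "... = sqrt (real l) / 2 * (sd l)^2 + (LINT w|M. ?X w ^ 4) / (2 * sqrt (real l))" using i by (simp add: sd_sq)
 also have "... <= sqrt (real l) / 2 * ((1 + K4) / 2 * real l) + K4 * (real l)^2 / (2 * sqrt (real l))"
  using F v s by (intro add_mono mult_left_mono divide_right_mono) auto
 also have "K4 * (real l)^2 / (2 * sqrt (real l)) = K4 / 2 * (real l * sqrt (real l))"
  using s l by (simp add: divide_simps power2_eq_square)
 also have "sqrt (real l) / 2 * ((1 + K4) / 2 * real l) + K4 / 2 * (real l * sqrt (real l)) = ((1 + K4) / 4 + K4 / 2) * (real l * sqrt (real l))"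
  by (simp add: algebra_simps)
 also have "... <= (1 + K4) * (real l * sqrt (real l))"
 proof (rule mult_right_mono)
  show "(1 + K4) / 4 + K4 / 2 <= 1 + K4" using K4_pos by (simp add: field_simps)
 qed simp
 finally show "(LINT w|M. abs(?X w) ^ 3) <= (1 + K4) * (real l * sqrt (real l))" .
qed

lemma char_approx_W:
 assumes l: "0 < l"
 shows "cmod (\<phi> l t - (1 - t^2 * (sd l)^2 / 2)) <= abs(t) ^ 3 * ((1 + K4) * (real l * sqrt (real l)))"
proof -
 have lp: "0 < int l" using l by simp
 note i = W_pow_integrable[OF lp]
 have "cmod (\<phi> l t - (1 - t^2 * (sd l)^2 / 2)) <= (t^2 / 6) * (LINT w|M. min (6 * (W 0 (int l) w)^2) (abs(t) * abs(W 0 (int l) w) ^ 3))"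
  unfolding \<phi>_def
  by (rule prod.char_approx3') (use i W_integrable W_mean[OF lp] in \<open>auto simp: sd_sq\<close>)
 also have "... <= (t^2 / 6) * (LINT w|M. abs(t) * abs(W 0 (int l) w) ^ 3)"
 proof (intro mult_left_mono integral_mono)
  show "integrable M (%w. min (6 * (W 0 (int l) w)^2) (abs(t) * abs(W 0 (int l) w) ^ 3))"
   by (intro integrable_min) (use i in auto)
 qed (use i in auto)
 also have "... = abs(t) ^ 3 / 6 * (LINT w|M. abs(W 0 (int l) w) ^ 3)" by (simp add: power3_eq_cube power2_eq_square flip: abs_mult)
 also have "... <= abs(t) ^ 3 / 6 * ((1 + K4) * (real l * sqrt (real l)))" using third_moment(2)[OF l] by (intro mult_left_mono) auto
 also have "... <= abs(t) ^ 3 * ((1 + K4) * (real l * sqrt (real l)))" using K4_pos by (intro mult_right_mono) auto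
 finally show ?thesis .
qed

text \<open>The number \<open>k\<close> of blocks is meant to stay fixed while their length
  \<open>l\<close> grows. The cutting error and the remainder \<open>r\<close> are then of order
  \<open>k\<close> and disappear after multiplication by \<open>t\<close>, which is of order
  \<open>1 / sqrt n\<close> in the application.\<close>

lemma char_block_approx:
 assumes l: "0 < l" and k: "0 < k" and r: "r < k" and small: "t^2 * (sd l)^2 <= 4"
 shows "cmod (char (distr M borel (U 0 (int (k * l + r)))) t - (complex_of_real (1 - t^2 * (sd l)^2 / 2)) ^ k)
   <= abs(t) * (7 * C * real k) + real k * (abs(t) ^ 3 * ((1 + K4) * (real l * sqrt (real l))))"
proof -
 let ?n = "k * l + r"
 let ?S = "%w. SUM j<k. W (int (j * l)) (int (j * l) + int l) w"
 have n0: "0 < int ?n" using l k by (simp del: of_nat_mult of_nat_add)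
 have "abs(U 0 (int ?n) w - ?S w) <= 7 * C * real k" for w
 proof -
  have "C <= C * real k" using k C_pos by simp
  thus ?thesis using block_sum_close'[OF l k r, of w] W_U[OF n0, of w] by linarith
 qed
 hence 1: "cmod (char (distr M borel (U 0 (int ?n))) t - char (distr M borel ?S) t) <= abs(t) * (7 * C * real k)"
  by (intro char_distr_close) auto
 have "prod.indep_vars (%_. borel) (%j. W (int (j * l)) (int (j * l) + int l)) {..<k}"
 proof (rule indep_vars_depends[OF W_meas W_depends])
  show "disjoint_family_on (%j. {int (j * l)<..<int (j * l) + int l}) {..<k}"
   unfolding disjoint_family_on_def
  proof (intro ballI impI)
   fix i j assume "i \<noteq> (j::nat)"
   thus "{int (i * l)<..<int (i * l) + int l} \<inter> {int (j * l)<..<int (j * l) + int l} = {}"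
    using blocks_ordered[of "int i" "int j" "int l"] by (auto simp: distrib_right)
  qed
 qed
 hence "char (distr M borel ?S) t = (\<Prod>j<k. char (distr M borel (W (int (j * l)) (int (j * l) + int l))) t)"
  by (rule prod.char_distr_sum)
 also have "... = (\<Prod>j<k. \<phi> l t)"
  using W_distr[of 0 "int (j * l)" "int l" for j] by (intro prod.cong) (auto simp: \<phi>_def add.commute)
 also have "... = \<phi> l t ^ k" by simp
 finally have 2: "char (distr M borel ?S) t = \<phi> l t ^ k" .
 interpret D: real_distribution "distr M borel (W 0 (int l))" by (rule prod.real_distribution_distr) simp
 have "cmod (\<phi> l t ^ k - (complex_of_real (1 - t^2 * (sd l)^2 / 2)) ^ k) <= real k * cmod (\<phi> l t - complex_of_real (1 - t^2 * (sd l)^2 / 2))"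
 proof (rule norm_power_diff)
  show "cmod (\<phi> l t) <= 1" unfolding \<phi>_def by (rule D.cmod_char_le_1)
  have "abs(1 - t^2 * (sd l)^2 / 2) <= 1" using small by (simp add: abs_le_iff)
  thus "cmod (complex_of_real (1 - t^2 * (sd l)^2 / 2)) <= 1" by (simp only: norm_of_real)
 qed
 also have "... <= real k * (abs(t) ^ 3 * ((1 + K4) * (real l * sqrt (real l))))"
  using char_approx_W[OF l, of t] by (intro mult_left_mono) auto
 finally show ?thesis using 1 unfolding 2 by (smt (verit) norm_triangle_sub norm_diff_triangle_le)
qed

lemma div_asymp:
 assumes "0 < k"
 shows "(%n. real (n div k) / real n) \<longlonglongrightarrow> 1 / real k"
proof (rule tendsto_sandwich)
 show "(%n. 1 / real k - 1 / real n) \<longlonglongrightarrow> 1 / real k" by real_asymp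
 show "(%n. 1 / real k) \<longlonglongrightarrow> 1 / real k" by simp
 show "eventually (%n. 1 / real k - 1 / real n <= real (n div k) / real n) sequentially"
 proof (rule eventually_sequentiallyI[of 1])
  fix n :: nat assume n: "1 <= n"
  have "n <= k * (n div k) + k" using mod_less_divisor[OF assms, of n] mult_div_mod_eq[of k n] by linarith
  hence "real n <= real k * real (n div k) + real k" by (metis of_nat_add of_nat_le_iff of_nat_mult)
  hence "real n / real k <= real (n div k) + 1" using assms by (simp add: field_simps)
  hence "real n / real k / real n <= (real (n div k) + 1) / real n" by (rule divide_right_mono) simp
  thus "1 / real k - 1 / real n <= real (n div k) / real n" using n by (simp add: add_divide_distrib)
 qed
 show "eventually (%n. real (n div k) / real n <= 1 / real k) sequentially"
 proof (rule eventually_sequentiallyI[of 1])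
  fix n :: nat assume n: "1 <= n"
  have "real (n div k) * real k <= real n" by (metis div_times_less_eq_dividend of_nat_le_iff of_nat_mult)
  thus "real (n div k) / real n <= 1 / real k" using n assms by (simp add: field_simps)
 qed
qed

text \<open>\<open>k\<close> is chosen first, so large that the error \<open>B / sqrt k\<close> from
  third moments is small and the \<open>k\<close>-th power is close to its exponential limit; then
  the length tends to infinity.\<close>

theorem clt:
 assumes \<sigma>0: "0 < \<sigma>"
 shows "weak_conv_m (%n. distr M borel (%w. U 0 (int n) w / (\<sigma> * sqrt (real n)))) std_normal_distribution"
proof (rule levy_continuity)
 show "real_distribution (distr M borel (%w. U 0 (int n) w / (\<sigma> * sqrt (real n))))" for n
  by (rule prod.real_distribution_distr) simp
 show "real_distribution std_normal_distribution" by (rule real_dist_normal_dist)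
 fix \<theta> :: real
 define t where "t n = \<theta> / (\<sigma> * sqrt (real n))" for n :: nat
 have ch: "char (distr M borel (%w. U 0 (int n) w / (\<sigma> * sqrt (real n)))) \<theta> = char (distr M borel (U 0 (int n))) (t n)" for n
  unfolding char_def t_def by (simp add: integral_distr)
 have rs: "(%n. x / sqrt (real n)) \<longlonglongrightarrow> 0" for x
 proof -
  have "(%n. 1 / sqrt (real n)) \<longlonglongrightarrow> 0" by real_asymp
  from tendsto_mult_right_zero[OF this, of x] show ?thesis by simp
 qed
 have lim0: "(%n. t n) \<longlonglongrightarrow> 0" using rs[of "\<theta> / \<sigma>"] by (simp add: t_def[abs_def])
 show "(%n. char (distr M borel (%w. U 0 (int n) w / (\<sigma> * sqrt (real n)))) \<theta>) \<longlonglongrightarrow> char std_normal_distribution \<theta>"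
  unfolding ch char_std_normal_distribution
 proof (rule metric_LIMSEQ_I)
  fix e :: real assume e: "0 < e"
  define B where "B = (abs(\<theta>) / \<sigma>) ^ 3 * (1 + K4)"
  have l1: "(%k. B / sqrt (real k)) \<longlonglongrightarrow> 0" by (rule rs)
  have l2: "(%k. (1 + (- \<theta>\<^sup>2 / 2) / real k) ^ k) \<longlonglongrightarrow> exp (- \<theta>\<^sup>2 / 2)" by (rule tendsto_exp_limit_sequentially)
  have e1: "eventually (%k. B / sqrt (real k) < e / 4) sequentially" by (rule order_tendstoD(2)[OF l1]) (use e in simp)
  have e2: "eventually (%k. dist ((1 + (- \<theta>\<^sup>2 / 2) / real k) ^ k) (exp (- \<theta>\<^sup>2 / 2)) < e / 4) sequentially"
   by (rule tendstoD[OF l2]) (use e in simp)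
  have e3: "eventually (%k. \<theta>^2 <= real k) sequentially"
   by (rule eventually_sequentiallyI[of "nat \<lceil>\<theta>\<^sup>2\<rceil>"]) (simp add: nat_ceiling_le_eq)
  have "eventually (%k. B / sqrt (real k) < e / 4 & dist ((1 + (- \<theta>\<^sup>2 / 2) / real k) ^ k) (exp (- \<theta>\<^sup>2 / 2)) < e / 4 & \<theta>^2 <= real k & 0 < k) sequentially"
   by (intro eventually_conj e1 e2 e3 eventually_gt_at_top)
  then obtain k where k: "B / sqrt (real k) < e / 4" "dist ((1 + (- \<theta>\<^sup>2 / 2) / real k) ^ k) (exp (- \<theta>\<^sup>2 / 2)) < e / 4" "\<theta>^2 <= real k" "0 < k"
   by (auto simp: eventually_sequentially)
  define l where "l n = n div k" for n
  have l_top: "filterlim l at_top sequentially"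
   unfolding l_def filterlim_at_top
  proof
   fix Z show "eventually (%n. Z <= n div k) sequentially"
    by (rule eventually_sequentiallyI[of "Z * k"]) (use k(4) in \<open>simp add: less_eq_div_iff_mult_less_eq\<close>)
  qed
  have vl: "(%n. (t n)^2 * (sd (l n))^2) \<longlonglongrightarrow> \<theta>\<^sup>2 / real k"
  proof -
   have "(%n. sd (l n) / sqrt (real (l n))) \<longlonglongrightarrow> \<sigma>" using filterlim_compose[OF sigma(2) l_top] .
   hence lim: "(%n. (\<theta> / \<sigma>)^2 * ((sd (l n) / sqrt (real (l n)))^2 * (real (l n) / real n))) \<longlonglongrightarrow> (\<theta> / \<sigma>)\<^sup>2 * (\<sigma>^2 * (1 / real k))"
    using div_asymp[OF k(4)] unfolding l_def by (intro tendsto_mult tendsto_const tendsto_power)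
   have val: "(\<theta> / \<sigma>)^2 * (\<sigma>^2 * (1 / real k)) = \<theta>^2 / real k" using \<sigma>0 by (simp add: power_divide)
   have ev: "eventually (%n. (\<theta> / \<sigma>)^2 * ((sd (l n) / sqrt (real (l n)))^2 * (real (l n) / real n)) = (t n)^2 * (sd (l n))^2) sequentially"
    using eventually_ge_at_top[of k]
   proof eventually_elim
    case (elim n)
    hence "0 < l n" unfolding l_def using k(4) by (simp add: div_greater_zero_iff)
    thus ?case unfolding t_def by (simp add: power_divide power_mult_distrib)
   qed
   show ?thesis by (rule Lim_transform_eventually[OF lim[unfolded val] ev])
  qed
  have vl1: "\<theta>^2 / real k < 4" using k by (simp add: field_simps)
  have pw: "(%n. complex_of_real (1 - (t n)^2 * (sd (l n))^2 / 2) ^ k) \<longlonglongrightarrow> complex_of_real (1 - (\<theta>^2 / real k) / 2) ^ k"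
   by (intro tendsto_intros vl) simp
  have t1: "(%n. abs(t n) * (7 * C * real k)) \<longlonglongrightarrow> 0" using lim0 by (intro tendsto_mult_left_zero tendsto_rabs_zero)
  have "eventually (%n. (t n)^2 * (sd (l n))^2 < 4) sequentially" by (rule order_tendstoD(2)[OF vl vl1])
  moreover have "eventually (%n. dist (complex_of_real (1 - (t n)^2 * (sd (l n))^2 / 2) ^ k) (complex_of_real (1 - (\<theta>^2 / real k) / 2) ^ k) < e / 4) sequentially"
   using tendstoD[OF pw, of "e / 4"] e by simp
  moreover have "eventually (%n. abs(t n) * (7 * C * real k) < e / 4) sequentially" using order_tendstoD(2)[OF t1, of "e / 4"] e by simp
  ultimately have "eventually (%n. dist (char (distr M borel (U 0 (int n))) (t n)) (complex_of_real (exp (- (\<theta>^2) / 2))) < e) sequentially"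
   using eventually_ge_at_top[of k]
  proof eventually_elim
   case (elim n)
   have l0: "0 < l n" unfolding l_def using k(4) elim by (simp add: div_greater_zero_iff)
   have n: "k * l n + n mod k = n" unfolding l_def by simp
   have n0: "0 < real n" using elim k by simp
   have A: "cmod (char (distr M borel (U 0 (int n))) (t n) - complex_of_real (1 - (t n)^2 * (sd (l n))^2 / 2) ^ k)
     <= abs(t n) * (7 * C * real k) + real k * (abs(t n) ^ 3 * ((1 + K4) * (real (l n) * sqrt (real (l n)))))"
    using char_block_approx[OF l0 k(4) mod_less_divisor[OF k(4)], of "t n" n] elim unfolding n by simp
   have "real k * (abs(t n) ^ 3 * ((1 + K4) * (real (l n) * sqrt (real (l n))))) <= B / sqrt (real k)"
   proof -
    define x where "x = real (l n) / real n"
    have x: "0 <= x" "x <= 1 / real k"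
    proof -
     have "real (l n) * real k <= real n" unfolding l_def by (metis div_times_less_eq_dividend of_nat_le_iff of_nat_mult)
     thus "x <= 1 / real k" unfolding x_def using n0 k(4) by (simp add: field_simps)
    qed (simp add: x_def)
    have "abs(t n) ^ 3 * (real (l n) * sqrt (real (l n))) = (abs(\<theta>) / \<sigma>) ^ 3 * (x * sqrt x)"
     unfolding t_def x_def using \<sigma>0 n0 by (simp add: power_divide power_mult_distrib abs_mult real_sqrt_divide power3_eq_cube)
    hence "real k * (abs(t n) ^ 3 * ((1 + K4) * (real (l n) * sqrt (real (l n))))) = B * (real k * (x * sqrt x))"
     unfolding B_def by (simp add: mult_ac)
    also have "... <= B * (real k * (1 / real k * sqrt (1 / real k)))"
     using x K4_pos \<sigma>0 unfolding B_def by (intro mult_left_mono mult_mono) auto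
    also have "... = B / sqrt (real k)" using k(4) by (simp add: real_sqrt_divide)
    finally show ?thesis .
   qed
   moreover have "cmod (complex_of_real (1 - (\<theta>^2 / real k) / 2) ^ k - complex_of_real (exp (- (\<theta>^2) / 2))) < e / 4"
   proof -
    have "1 - (\<theta>^2 / real k) / 2 = 1 + (- \<theta>\<^sup>2 / 2) / real k" by simp
    hence "complex_of_real (1 - (\<theta>^2 / real k) / 2) ^ k - complex_of_real (exp (- (\<theta>^2) / 2))
      = complex_of_real ((1 + (- \<theta>\<^sup>2 / 2) / real k) ^ k - exp (- \<theta>\<^sup>2 / 2))" by (simp only: of_real_diff of_real_power)
    thus ?thesis using k(2) unfolding dist_real_def by (simp only: norm_of_real)
   qed
   moreover have "dist x v < e" if "dist x y <= p1 + p2" "dist y z < e / 4" "dist z v < e / 4" "p1 < e / 4" "p2 < e / 4"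
    for x y z v :: complex and p1 p2
    using dist_triangle[of x v y] dist_triangle[of y v z] that by linarith
   ultimately show ?case using A elim(2,3) k(1) unfolding dist_norm by (meson order_le_less_trans)
  qed
  thus "\<exists>no. \<forall>n\<ge>no. dist (char (distr M borel (U 0 (int n))) (t n)) (complex_of_real (exp (- (\<theta>^2) / 2))) < e"
   by (simp add: eventually_sequentially)
 qed
qed

end

section \<open>Valleys of a path\<close>

text \<open>
  \<open>m I\<close> and \<open>M I\<close> stand for the minimum and the maximum of a path over the \<open>I\<close>-th block; the path
  starts at the left end of block \<open>0\<close>. A valley has walls \<open>A\<close> and \<open>W\<close> and bottom \<open>B\<close>.
\<close>

definition right_valley :: "real => (int => real) => (int => real) => int => int => int => bool" where
 "right_valley h m M A B W \<longleftrightarrow> A <= -1 & 0 <= B & B < W &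
   1 + h <= M A - m B & 1 + h <= M W - m B &
   (\<forall>I J. A <= I --> I <= J --> J <= B --> M J - m I <= 1 - h) &
   (\<forall>J. 0 <= J --> J <= B --> M J + h <= M A) &
   (\<forall>I. A <= I --> I <= W --> 2 <= abs(I - B) --> m B + h <= m I)"

definition left_valley :: "real => (int => real) => (int => real) => int => int => int => bool" where
 "left_valley h m M A B W \<longleftrightarrow> A < B & B <= -1 & 1 <= W &
   1 + h <= M A - m B & 1 + h <= M W - m B &
   (\<forall>I J. B <= J --> J <= I --> I <= W --> M J - m I <= 1 - h) &
   (\<forall>J. B <= J --> J <= 0 --> M J + h <= M W) &
   (\<forall>I. A <= I --> I <= W --> 2 <= abs(I - B) --> m B + h <= m I)"

lemma arg_min_int:
 fixes f :: "int => real" assumes "a <= b"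
 shows "\<exists>k. a <= k & k <= b & (\<forall>j. a <= j --> j <= b --> f k <= f j)"
proof -
 have "finite (f ` {a..b})" "f ` {a..b} \<noteq> {}" using assms by auto
 hence "Min (f ` {a..b}) \<in> f ` {a..b}" "!!j. a <= j ==> j <= b ==> Min (f ` {a..b}) <= f j" by auto
 then obtain k where "a <= k" "k <= b" "f k = Min (f ` {a..b})" by auto
 thus ?thesis using \<open>!!j. a <= j ==> j <= b ==> Min (f ` {a..b}) <= f j\<close> by auto
qed

lemma arg_max_int:
 fixes f :: "int => real" assumes "a <= b"
 shows "\<exists>k. a <= k & k <= b & (\<forall>j. a <= j --> j <= b --> f j <= f k)"
 using arg_min_int[OF assms, of "%k. - f k"] by auto

text \<open>The tie conditions are silent about neighbouring blocks. Oscillation below 1/2 decides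
  comparisons with height 1 there, and \<open>J1\<close> settles block 0, which may be adjacent to a
  wall: the path exceeds its values on block 0 by \<open>h\<close> while still oscillating by less
  than 1/2.\<close>

locale block_path =
 fixes m M :: "int => real" and K J1 :: int and h :: real
 assumes h: "0 < h" "h <= 1 / 2"
  and osc: "!!I J. -K <= I ==> I < K ==> -K <= J ==> J < K ==> abs(I - J) <= 1 ==> M I - m J < 1 / 2"
  and tie_rise: "!!I J. -K <= I ==> I < K ==> -K <= J ==> J < K ==> 2 <= abs(I - J) ==> h < abs(M I - m J - 1)"
  and tie_max: "!!I J. -K <= I ==> I < K ==> -K <= J ==> J < K ==> 2 <= abs(I - J) ==> h < abs(M I - M J)"
  and tie_min: "!!I J. -K <= I ==> I < K ==> -K <= J ==> J < K ==> 2 <= abs(I - J) ==> h < abs(m I - m J)"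
  and rise_right: "\<exists>I J. 0 <= I & I <= J & J < K & 1 <= M J - m I"
  and rise_left: "\<exists>I J. -K <= J & J <= I & I <= -1 & 1 <= M J - m I"
  and J1: "1 <= J1" "J1 < K" "M 0 + h <= M J1"
  and osc1: "!!I J. 0 <= I ==> I <= J1 ==> 0 <= J ==> J <= J1 ==> M I - m J < 1 / 2"
begin

abbreviation "rng I \<equiv> -K <= I & I < K"

lemma ge1: "rng I ==> rng J ==> 1 <= M I - m J ==> 1 + h <= M I - m J & 2 <= abs(I - J)"
 using osc[of I J] tie_rise[of I J] h by fastforce

lemma lt1: "rng I ==> rng J ==> M I - m J < 1 ==> M I - m J <= 1 - h"
 using osc[of I J] tie_rise[of I J] h by fastforce

lemma min_far: "rng I ==> rng J ==> 2 <= abs(I - J) ==> m J <= m I ==> m J + h <= m I"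
 using tie_min[of I J] by fastforce

lemma max_far: "rng I ==> rng J ==> 2 <= abs(I - J) ==> M J <= M I ==> M J + h <= M I"
 using tie_max[of I J] by fastforce

text \<open>\<open>W0\<close> and \<open>A0\<close> are the first blocks where the path has risen by
  1 to the right and to the left, \<open>BR\<close> and \<open>BL\<close> the lowest blocks before
  them, \<open>X\<close> the height of the barrier between these. If the barrier stands at least 1
  above the bottom on the other side of the origin, its summit serves as a wall of the valley around
  that bottom; otherwise the two sides merge and the lower bottom wins.\<close>

lemma valley_exists:
 "\<exists>A B W. -K <= A & W < K & (right_valley h m M A B W \<or> left_valley h m M A B W)"
proof -
 define PR where "PR n \<longleftrightarrow> int n < K & (\<exists>I. 0 <= I & I <= int n & 1 <= M (int n) - m I)" for n
 obtain I0 J0 where IJ0: "0 <= I0" "I0 <= J0" "J0 < K" "1 <= M J0 - m I0" using rise_right by blast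
 have "PR (nat J0)" unfolding PR_def using IJ0 by auto
 define W0 where "W0 = int (LEAST n. PR n)"
 have W0: "0 <= W0" "W0 < K" "\<exists>I. 0 <= I & I <= W0 & 1 <= M W0 - m I"
  using LeastI[of PR, OF \<open>PR (nat J0)\<close>] unfolding W0_def PR_def by auto
 have Rlt: "M J - m I < 1" if "0 <= I" "I <= J" "J < W0" for I J
 proof (rule ccontr)
  assume "~ ?thesis"
  hence "PR (nat J)" unfolding PR_def using that W0 by auto
  hence "(LEAST n. PR n) <= nat J" by (rule Least_le)
  thus False using that unfolding W0_def by simp
 qed
 define PL where "PL n \<longleftrightarrow> int n <= K & 1 <= n & (\<exists>I. - int n <= I & I <= -1 & 1 <= M (- int n) - m I)" for n
 obtain I1 J2 where IJ1: "-K <= J2" "J2 <= I1" "I1 <= -1" "1 <= M J2 - m I1" using rise_left by blast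
 have "PL (nat (- J2))" unfolding PL_def using IJ1 by auto
 define A0 where "A0 = - int (LEAST n. PL n)"
 have A0: "A0 <= -1" "-K <= A0" "\<exists>I. A0 <= I & I <= -1 & 1 <= M A0 - m I"
  using LeastI[of PL, OF \<open>PL (nat (- J2))\<close>] unfolding A0_def PL_def by auto
 have Llt: "M J - m I < 1" if "A0 < J" "J <= I" "I <= -1" for I J
 proof (rule ccontr)
  assume "~ ?thesis"
  hence "PL (nat (- J))" unfolding PL_def using that A0 by (auto intro!: exI[of _ I])
  hence "(LEAST n. PL n) <= nat (- J)" by (rule Least_le)
  thus False using that unfolding A0_def by simp
 qed
 obtain BR where BR: "0 <= BR" "BR <= W0" "!!I. 0 <= I ==> I <= W0 ==> m BR <= m I"
  using arg_min_int[OF W0(1), of m] by auto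
 obtain BL where BL: "A0 <= BL" "BL <= -1" "!!I. A0 <= I ==> I <= -1 ==> m BL <= m I"
  using arg_min_int[OF A0(1), of m] by auto
 have W1: "1 <= M W0 - m BR" using W0(3) BR(3) by (meson diff_left_mono order_trans)
 have A1: "1 <= M A0 - m BL" using A0(3) BL(3) by (meson diff_left_mono order_trans)
 have K: "0 < K" using J1 by simp
 have W2: "1 + h <= M W0 - m BR" "BR + 2 <= W0" using ge1[of W0 BR] W1 BR W0 K by auto
 have A2: "1 + h <= M A0 - m BL" "A0 + 2 <= BL" using ge1[of A0 BL] A1 BL A0 K by auto
 \<comment> \<open>The range extends to \<open>J1\<close> so that the maximum lies strictly above
   block 0, even if the bottom \<open>BR\<close> is block 0 itself.\<close>
 obtain XR where XR: "0 <= XR" "XR <= max BR J1" "!!J. 0 <= J ==> J <= max BR J1 ==> M J <= M XR"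
 proof -
  have "0 <= max BR J1" using BR by simp
  from arg_max_int[OF this, of M] show ?thesis using that by auto
 qed
 obtain XL where XL: "BL <= XL" "XL <= -1" "!!J. BL <= J ==> J <= -1 ==> M J <= M XL"
  using arg_max_int[OF BL(2), of M] by auto
 have XR0: "M 0 + h <= M XR" using XR(3)[of J1] J1 by simp
 have XR1: "1 <= XR" using XR0 h XR(1) by (cases "XR = 0") auto
 have XRK: "XR < K" using XR(2) J1 BR W0 W2 by auto
 have XRW: "XR < W0"
 proof (cases "XR <= BR")
  case True thus ?thesis using W2 by simp
 next
  case False
  hence "XR <= J1" "BR <= J1" using XR(2) by auto
  have "~ W0 <= J1"
  proof
   assume "W0 <= J1"
   hence "M W0 - m BR < 1 / 2" by (intro osc1) (use W0 BR \<open>BR <= J1\<close> in auto)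
   thus False using W1 by linarith
  qed
  thus ?thesis using \<open>XR <= J1\<close> by linarith
 qed
 have XRb: "M J <= M XR" if "0 <= J" "J <= BR \<or> J <= XR" for J
  by (rule XR(3)) (use that XR(2) in auto)
 define X where "X = max (M XL) (M XR)"
 have X: "M XL <= X" "M XR <= X" "X = M XL \<or> X = M XR" unfolding X_def by auto
 consider "M XR <= M XL" "1 <= M XL - m BR" | "M XL <= M XR" "1 <= M XR - m BL"
  | "m BR <= m BL" "X - m BL < 1" | "m BL <= m BR" "X - m BR < 1"
  using X by linarith
 then show ?thesis
 proof cases
  case 1
  have XLn: "rng XL" "rng BR" "rng W0" using XL BL A0 BR W0 W2 K by auto
  have up: "M J - m I < 1" if IJ: "XL <= I" "I <= J" "J <= BR" for I J
  proof (cases "0 <= I")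
   case True thus ?thesis using Rlt[of I J] IJ W2 by simp
  next
   case False
   have "M J <= M XL" using XL(3)[of J] XRb[of J] 1(1) IJ XL(1) by (cases "J <= -1") auto
   moreover have "M XL - m I < 1" using Llt[of XL I] False IJ XL A2 by simp
   ultimately show ?thesis by simp
  qed
  have "right_valley h m M XL BR W0"
   unfolding right_valley_def
  proof (intro conjI allI impI)
   show "1 + h <= M XL - m BR" using ge1[of XL BR] XLn 1 by simp
   show "M J - m I <= 1 - h" if "XL <= I" "I <= J" "J <= BR" for I J
    by (rule lt1) (use up[OF that] that XLn in auto)
   show "M J + h <= M XL" if J: "0 <= J" "J <= BR" for J
   proof (cases "J = 0")
    case True thus ?thesis using XR0 1 by simp
   next
    case False
    have "M J <= M XL" using XRb[of J] J 1 by simp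
    thus ?thesis using max_far[of XL J] False J XL XLn by auto
   qed
   show "m BR + h <= m I" if I: "XL <= I" "I <= W0" "2 <= abs(I - BR)" for I
   proof (rule min_far)
    show "m BR <= m I"
    proof (cases "0 <= I")
     case True thus ?thesis using BR I by simp
    next
     case False
     hence "M XL - m I < 1" using Llt[of XL I] I XL A2 by simp
     thus ?thesis using 1 by simp
    qed
   qed (use I XLn in auto)
  qed (use XL BR W2 in auto)
  thus ?thesis using XLn by blast
 next
  case 2
  have rn: "rng XR" "rng BL" "rng A0" using XR1 XRK BL A0 K by auto
  have up: "M J - m I < 1" if IJ: "BL <= J" "J <= I" "I <= XR" for I J
  proof (cases "I <= -1")
   case True thus ?thesis using Llt[of J I] IJ A2 by simp
  next
   case False
   have "M J <= M XR" using XL(3)[of J] XRb[of J] 2(1) IJ XR(2) by (cases "J <= -1") auto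
   moreover have "M XR - m I < 1" using Rlt[of I XR] False IJ XRW by simp
   ultimately show ?thesis by simp
  qed
  have "left_valley h m M A0 BL XR"
   unfolding left_valley_def
  proof (intro conjI allI impI)
   show "1 + h <= M XR - m BL" using ge1[of XR BL] rn 2 by simp
   show "M J - m I <= 1 - h" if "BL <= J" "J <= I" "I <= XR" for I J
    by (rule lt1) (use up[OF that] that rn in auto)
   show "M J + h <= M XR" if J: "BL <= J" "J <= 0" for J
   proof (cases "J = 0")
    case True thus ?thesis using XR0 by simp
   next
    case False
    have "M J <= M XR" using XL(3)[of J] J 2 False by simp
    thus ?thesis using max_far[of XR J] False J XR1 rn by auto
   qed
   show "m BL + h <= m I" if I: "A0 <= I" "I <= XR" "2 <= abs(I - BL)" for I
   proof (rule min_far)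
    show "m BL <= m I"
    proof (cases "I <= -1")
     case True thus ?thesis using BL I by simp
    next
     case False
     hence "M XR - m I < 1" using Rlt[of I XR] I XRW by simp
     thus ?thesis using 2 by simp
    qed
   qed (use I rn in auto)
  qed (use BL XR1 A2 in auto)
  thus ?thesis using rn by blast
 next
  case v: 3
  have rn: "rng BR" "rng BL" "rng A0" "rng W0" using BR BL A0 W0 W2 A2 K by auto
  have up: "M J - m I < 1" if IJ: "A0 <= I" "I <= J" "J <= BR" for I J
  proof -
   consider "0 <= I" | "I <= -1" "BL <= J" | "A0 < J" "J < BL" | "J = A0" "I = A0" using IJ BL by linarith
   thus ?thesis
   proof cases
    case 1 thus ?thesis using Rlt[of I J] IJ W2 by simp
   next
    case c: 2
    have "M J <= X" using XL(3)[of J] XRb[of J] X IJ c by (cases "J <= -1") auto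
    moreover have "m BL <= m I" using BL(3)[of I] c IJ by simp
    ultimately show ?thesis using v(2) by linarith
   next
    case 3
    have "M J - m BL < 1" using Llt[of J BL] 3 BL by simp
    moreover have "m BL <= m I" using BL(3)[of I] IJ 3 BL by simp
    ultimately show ?thesis by linarith
   next
    case 4 thus ?thesis using osc[of A0 A0] rn by simp
   qed
  qed
  have "right_valley h m M A0 BR W0"
   unfolding right_valley_def
  proof (intro conjI allI impI)
   show "1 + h <= M A0 - m BR" using A2 v(1) by linarith
   show "M J - m I <= 1 - h" if "A0 <= I" "I <= J" "J <= BR" for I J
    by (rule lt1) (use up[OF that] that rn in auto)
   show "M J + h <= M A0" if J: "0 <= J" "J <= BR" for J
   proof (rule max_far)
    show "M J <= M A0" using XRb[of J] J X v A1 by linarith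
   qed (use J rn A2 BL in auto)
   show "m BR + h <= m I" if I: "A0 <= I" "I <= W0" "2 <= abs(I - BR)" for I
   proof (rule min_far)
    show "m BR <= m I" using BR(3)[of I] BL(3)[of I] v(1) I by (cases "0 <= I") auto
   qed (use I rn in auto)
  qed (use A0 BR W2 in auto)
  thus ?thesis using rn by blast
 next
  case v: 4
  have rn: "rng BR" "rng BL" "rng A0" "rng W0" using BR BL A0 W0 W2 A2 K by auto
  have up: "M J - m I < 1" if IJ: "BL <= J" "J <= I" "I <= W0" for I J
  proof -
   consider "I <= -1" | "0 <= I" "J <= BR" | "BR < J" "J < W0" | "J = W0" "I = W0" using IJ by linarith
   thus ?thesis
   proof cases
    case 1 thus ?thesis using Llt[of J I] IJ A2 by simp
   next
    case c: 2
    have "M J <= X" using XL(3)[of J] XRb[of J] X IJ c by (cases "J <= -1") auto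
    moreover have "m BR <= m I" using BR(3)[of I] c IJ by simp
    ultimately show ?thesis using v(2) by linarith
   next
    case 3
    have "M J - m BR < 1" using Rlt[of BR J] 3 BR by simp
    moreover have "m BR <= m I" using BR(3)[of I] IJ 3 BR by simp
    ultimately show ?thesis by linarith
   next
    case 4 thus ?thesis using osc[of W0 W0] rn by simp
   qed
  qed
  have "left_valley h m M A0 BL W0"
   unfolding left_valley_def
  proof (intro conjI allI impI)
   show "1 + h <= M W0 - m BL" using W2 v(1) by linarith
   show "M J - m I <= 1 - h" if "BL <= J" "J <= I" "I <= W0" for I J
    by (rule lt1) (use up[OF that] that rn in auto)
   show "M J + h <= M W0" if J: "BL <= J" "J <= 0" for J
   proof (rule max_far)
    have "M J <= X" using XL(3)[of J] XRb[of J] J X BR by (cases "J = 0") auto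
    thus "M J <= M W0" using v W1 by linarith
   qed (use J rn W2 BR in auto)
   show "m BL + h <= m I" if I: "A0 <= I" "I <= W0" "2 <= abs(I - BL)" for I
   proof (rule min_far)
    show "m BL <= m I" using BR(3)[of I] BL(3)[of I] v(1) I by (cases "0 <= I") auto
   qed (use I rn in auto)
  qed (use A2 BL W2 BR in auto)
  thus ?thesis using rn by blast
 qed
qed

end

section \<open>Ottaviani's inequality\<close>

context iid
begin

lemma indep_prob:
 fixes X Y :: "(int => 'e) => real"
 assumes [measurable]: "X \<in> borel_measurable M" "Y \<in> borel_measurable M"
  and "depends K X" "depends L Y" "K \<inter> L = {}" and AB: "A \<in> sets borel" "B \<in> sets borel"
 shows "measure M {w \<in> space M. X w \<in> A & Y w \<in> B}
    = measure M {w \<in> space M. X w \<in> A} * measure M {w \<in> space M. Y w \<in> B}"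
proof -
 have "prod.indep_var borel X borel Y" by (rule indep_var_depends) fact+
 from prod.indep_varD[OF this AB] show ?thesis
  by (simp add: vimage_def Int_def conj_commute)
qed

lemma indep_trials:
 fixes X :: "'j => (int => 'e) => real"
 assumes J: "finite J" and X: "!!j. j \<in> J ==> X j \<in> borel_measurable M" "!!j. j \<in> J ==> depends (K j) (X j)"
  and disj: "disjoint_family_on K J" and A: "!!j. j \<in> J ==> A j \<in> sets borel"
  and p: "!!j. j \<in> J ==> p <= measure M {w \<in> space M. X j w \<in> A j}"
 shows "measure M {w \<in> space M. \<forall>j\<in>J. X j w \<notin> A j} <= (1 - p) ^ card J"
proof (cases "J = {}")
 case True thus ?thesis by (simp add: prod.P.prob_space)
next
 case False
 have q: "measure M {w \<in> space M. X j w \<notin> A j} <= 1 - p" if j: "j \<in> J" for j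
 proof -
  have e: "{w \<in> space M. X j w \<in> A j} \<in> sets M"
   using measurable_sets[OF X(1)[OF j] A[OF j]] by (simp add: vimage_def Int_def conj_commute)
  have "{w \<in> space M. X j w \<notin> A j} = space M - {w \<in> space M. X j w \<in> A j}" by auto
  thus ?thesis using p[OF j] prod.P.prob_compl[OF e] by simp
 qed
 have ind: "prod.indep_vars (%_. borel) X J" by (rule indep_vars_depends[OF X disj])
 have "measure M {w \<in> space M. \<forall>j\<in>J. X j w \<notin> A j} = measure M (\<Inter>j\<in>J. X j -` (- A j) \<inter> space M)"
  using False by (intro arg_cong[where f="measure M"]) auto
 also have "... = (\<Prod>j\<in>J. measure M (X j -` (- A j) \<inter> space M))"
  by (rule prod.indep_varsD[OF ind]) (use J False A in auto)
 also have "... <= (\<Prod>j\<in>J. 1 - p)"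
 proof (intro prod_mono conjI measure_nonneg)
  fix j assume "j \<in> J"
  have "X j -` (- A j) \<inter> space M = {w \<in> space M. X j w \<notin> A j}" by auto
  thus "measure M (X j -` (- A j) \<inter> space M) <= 1 - p" using q[OF \<open>j \<in> J\<close>] by simp
 qed
 also have "... = (1 - p) ^ card J" by simp
 finally show ?thesis .
qed

text \<open>Stop at the first \<open>j\<close> with a value beyond \<open>3 * x\<close>.
  Independently, the rest of the path moves by at most \<open>x\<close> with probability at least
  1/2, and cutting costs another \<open>x\<close>, so the final value is still beyond
  \<open>x\<close>.\<close>

lemma ottaviani:
 fixes V :: "int => int => (int => 'e) => real"
 assumes V [measurable]: "!!a b. V a b \<in> borel_measurable M" and dep: "!!a b. depends {a..<b} (V a b)"
  and qa: "!!j w. 0 < j ==> j < n ==> abs(V a (a + n) w - V a (a + j) w - V (a + j) (a + n) w) <= x"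
  and half: "!!j. 0 < j ==> j < n ==> measure M {w \<in> space M. x < abs(V (a + j) (a + n) w)} <= 1 / 2"
  and x: "0 <= x"
 shows "measure M {w \<in> space M. \<exists>j\<in>{1..n}. 3 * x < abs(V a (a + j) w)}
    <= 2 * measure M {w \<in> space M. x < abs(V a (a + n) w)}"
proof -
 define F where "F j w \<longleftrightarrow> 3 * x < abs(V a (a + j) w) & (\<forall>i\<in>{1..<j}. abs(V a (a + i) w) <= 3 * x)" for j w
 define I where "I j w = (if F j w then 1 else 0 :: real)" for j w
 have Fm [measurable]: "Measurable.pred M (F j)" for j unfolding F_def[abs_def] by measurable
 have Im [measurable]: "I j \<in> borel_measurable M" for j unfolding I_def[abs_def] by measurable
 define A where "A j = {w \<in> space M. F j w}" for j
 have Am [measurable]: "A j \<in> sets M" for j unfolding A_def by measurable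
 have Idep: "depends {a..<a+j} (I j)" for j unfolding depends_def
 proof (intro allI impI)
  fix w w' :: "int => 'e" assume eq: "\<forall>k\<in>{a..<a + j}. w k = w' k"
  have "V a (a + i) w = V a (a + i) w'" if "i <= j" for i
   by (rule dependsD[OF dep]) (use that eq in auto)
  thus "I j w = I j w'" unfolding I_def F_def by simp
 qed
 define E where "E = {w \<in> space M. x < abs(V a (a + n) w)}"
 have Em [measurable]: "E \<in> sets M" unfolding E_def by measurable
 have half': "measure M (A j) <= 2 * measure M (A j \<inter> E)" if j: "j \<in> {1..n}" for j
 proof (cases "j = n")
  case True
  hence "A j \<subseteq> E" unfolding A_def E_def F_def using x by auto
  hence "A j \<inter> E = A j" by auto
  thus ?thesis by simp
 next
  case False
  let ?G = "{w \<in> space M. V (a + j) (a + n) w \<in> {-x..x}}"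
  have "?G = space M - {w \<in> space M. x < abs(V (a + j) (a + n) w)}" by auto
  hence G: "1 / 2 <= measure M ?G" using half[of j] j False by (simp add: prod.P.prob_compl)
  have "measure M (A j) / 2 <= measure M (A j) * measure M ?G"
   using mult_left_mono[OF G, of "measure M (A j)"] by simp
  also have "... = measure M {w \<in> space M. I j w \<in> {1}} * measure M ?G"
   unfolding A_def I_def by (intro arg_cong2[where f="(*)"] arg_cong[where f="measure M"] refl) auto
  also have "... = measure M {w \<in> space M. I j w \<in> {1} & V (a + j) (a + n) w \<in> {-x..x}}"
   by (rule indep_prob[OF _ _ Idep dep, symmetric]) auto
  also have "... <= measure M (A j \<inter> E)"
  proof (rule prod.P.finite_measure_mono)
   show "{w \<in> space M. I j w \<in> {1} & V (a + j) (a + n) w \<in> {-x..x}} \<subseteq> A j \<inter> E"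
   proof
    fix w assume v: "w \<in> {w \<in> space M. I j w \<in> {1} & V (a + j) (a + n) w \<in> {-x..x}}"
    hence "F j w" by (auto simp: I_def split: if_splits)
    moreover have "x < abs(V a (a + n) w)"
     using qa[of j w] v \<open>F j w\<close> j False unfolding F_def by auto
    ultimately show "w \<in> A j \<inter> E" using v unfolding A_def E_def by auto
   qed
  qed measurable
  finally show ?thesis by simp
 qed
 have disj: "disjoint_family_on A {1..n}" unfolding disjoint_family_on_def
 proof (intro ballI impI)
  have *: "A i \<inter> A j = {}" if "i \<in> {1..n}" "i < j" for i j
  proof (rule equals0I)
   fix w assume "w \<in> A i \<inter> A j"
   hence "3 * x < abs(V a (a + i) w)" and *: "\<forall>i\<in>{1..<j}. abs(V a (a + i) w) <= 3 * x" unfolding A_def F_def by auto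
   moreover have "abs(V a (a + i) w) <= 3 * x" by (rule bspec[OF *]) (use that in simp)
   ultimately show False by linarith
  qed
  fix i j assume "i \<in> {1..n}" "j \<in> {1..n}" "i \<noteq> j"
  thus "A i \<inter> A j = {}" using *[of i j] *[of j i] by (cases "i < j") auto
 qed
 have "{w \<in> space M. \<exists>j\<in>{1..n}. 3 * x < abs(V a (a + j) w)} \<subseteq> (\<Union>j\<in>{1..n}. A j)"
 proof
  fix w assume "w \<in> {w \<in> space M. \<exists>j\<in>{1..n}. 3 * x < abs(V a (a + j) w)}"
  then obtain j where j: "j \<in> {1..n}" "3 * x < abs(V a (a + j) w)" and v: "w \<in> space M" by auto
  define P where "P k \<longleftrightarrow> 1 <= k & int k <= n & 3 * x < abs(V a (a + int k) w)" for k
  have P: "P (nat j)" using j unfolding P_def by auto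
  define k0 where "k0 = (LEAST k. P k)"
  have "P k0" unfolding k0_def by (rule LeastI[of P, OF P])
  hence l: "1 <= k0" "int k0 <= n" "3 * x < abs(V a (a + int k0) w)" unfolding P_def by auto
  have "F (int k0) w" unfolding F_def
  proof (intro conjI ballI l)
   fix i assume i: "i \<in> {1..<int k0}"
   have "~ P (nat i)" by (rule not_less_Least) (use i in \<open>auto simp: k0_def\<close>)
   thus "abs(V a (a + i) w) <= 3 * x" using i l unfolding P_def by auto
  qed
  thus "w \<in> (\<Union>j\<in>{1..n}. A j)" using l v unfolding A_def by (intro UN_I[of "int k0"]) auto
 qed
 hence "measure M {w \<in> space M. \<exists>j\<in>{1..n}. 3 * x < abs(V a (a + j) w)} <= measure M (\<Union>j\<in>{1..n}. A j)"
  by (rule prod.P.finite_measure_mono) measurable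
 also have "... = (SUM j:{1..n}. measure M (A j))"
  by (rule prod.P.finite_measure_finite_Union) (use disj in auto)
 also have "... <= (SUM j:{1..n}. 2 * measure M (A j \<inter> E))" by (intro sum_mono half')
 also have "... = 2 * measure M (\<Union>j\<in>{1..n}. A j \<inter> E)"
  unfolding sum_distrib_left[symmetric]
  by (subst prod.P.finite_measure_finite_Union) (use disj in \<open>auto simp: disjoint_family_on_def\<close>)
 also have "... <= 2 * measure M E" by (intro mult_left_mono prod.P.finite_measure_mono) auto
 finally show ?thesis unfolding E_def .
qed

end

section \<open>The Gaussian random walk\<close>

definition psum :: "(int => real) => int => real" where
 "psum y k = (if 0 <= k then SUM j:{0..<k}. y j else - (SUM j:{k..<0}. y j))"

lemma psum_diff: assumes "a <= b" shows "psum y b - psum y a = (SUM j:{a..<b}. y j)"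
proof -
 have *: "sum y {a..<c} = sum y {a..<b} + sum y {b..<c}" if "a <= b" "b <= c" for a b c
  using that by (subst sum.union_disjoint[symmetric]) (auto intro: sum.cong simp: ivl_disj_un)
 show ?thesis unfolding psum_def using *[of 0 a b] *[of a 0 b] *[of a b 0] assms by auto
qed

lemma psum_cong: "(!!j. (0 <= j & j < k) \<or> (k <= j & j < 0) ==> y j = y' j) ==> psum y k = psum y' k"
 unfolding psum_def by (auto intro!: sum.cong)

interpretation gauss: iid std_normal_distribution
 unfolding iid_def by (rule prob_space_normal_density) simp

abbreviation "GM \<equiv> Pi\<^sub>M (UNIV :: int set) (%_. std_normal_distribution)"

lemma space_GM [simp]: "space GM = UNIV" by (simp add: space_PiM)

lemma coord_GM [measurable]: "(%y. y j) \<in> borel_measurable GM"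
proof -
 have "(%y. y j) \<in> GM \<rightarrow>\<^sub>M std_normal_distribution" by (rule measurable_component_singleton) simp
 thus ?thesis by simp
qed

lemma psum_meas [measurable]: "(%y. psum y k) \<in> borel_measurable GM"
 unfolding psum_def by (cases "0 <= k") auto

lemma sets_GM_I: "Measurable.pred GM P ==> {y. P y} \<in> sets GM"
 unfolding pred_def by simp

lemma isum_depends: "depends {a..<b} (%y. SUM j:{a..<b}. y j :: real)"
 unfolding depends_def by (intro allI impI sum.cong) auto

lemma gauss_sum_distributed:
 assumes "a < b"
 shows "distributed GM lborel (%y. SUM j:{a..<b}. y j) (normal_density 0 (sqrt (of_int (b - a))))"
proof -
 have "distributed GM lborel (%y. SUM j:{a..<b}. y j) (normal_density (SUM j:{a..<b}. 0) (sqrt (SUM j:{a..<b}. 1^2)))"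
 proof (rule gauss.prod.P.sum_indep_normal)
  have "gauss.prod.indep_vars (%_. borel) (%i y. y i) UNIV"
   by (rule gauss.indep_vars_depends[where K="%i. {i}"]) (auto simp: depends_def disjoint_family_on_def)
  thus "gauss.prod.indep_vars (%_. borel) (%i y. y i) {a..<b}" by (rule gauss.prod.P.indep_vars_subset) simp
  fix i
  have "distr GM std_normal_distribution (%y. y i) = std_normal_distribution"
   using distr_PiM_component[of UNIV "%_. std_normal_distribution" i] gauss.N.prob_space_axioms by simp
  moreover have "distr GM std_normal_distribution (%y. y i) = distr GM lborel (%y. y i)"
   by (rule distr_cong) auto
  ultimately show "distributed GM lborel (%y. y i) (normal_density 0 1)"
   unfolding distributed_def by simp
 qed (use assms in auto)
 thus ?thesis using assms by simp
qed

lemma gauss_sum_std: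
 assumes "a < b"
 shows "distr GM borel (%y. (SUM j:{a..<b}. y j) / sqrt (of_int (b - a))) = std_normal_distribution"
proof -
 have "distributed GM lborel (%y. ((SUM j:{a..<b}. y j) - 0) / sqrt (of_int (b - a))) std_normal_density"
  by (subst gauss.prod.P.normal_standard_normal_convert[symmetric]) (use gauss_sum_distributed[OF assms] assms in simp_all)
 hence "distr GM lborel (%y. (SUM j:{a..<b}. y j) / sqrt (of_int (b - a))) = std_normal_distribution"
  unfolding distributed_def by simp
 moreover have "distr GM lborel (%y. (SUM j:{a..<b}. y j) / sqrt (of_int (b - a)))
  = distr GM borel (%y. (SUM j:{a..<b}. y j) / sqrt (of_int (b - a)))" by (rule distr_cong) auto
 ultimately show ?thesis by simp
qed

lemma gauss_sum_prob:
 assumes "a < b" "A \<in> sets borel"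
 shows "measure GM {y. (SUM j:{a..<b}. y j) / sqrt (of_int (b - a)) \<in> A} = measure std_normal_distribution A"
proof -
 have "measure (distr GM borel (%y. (SUM j:{a..<b}. y j) / sqrt (of_int (b - a)))) A
  = measure GM {y. (SUM j:{a..<b}. y j) / sqrt (of_int (b - a)) \<in> A}"
  by (subst measure_distr) (use assms in \<open>auto simp: vimage_def\<close>)
 thus ?thesis unfolding gauss_sum_std[OF assms(1)] by (rule sym)
qed

lemma gauss_sum_tail:
 assumes "a < b" "0 < x"
 shows "measure GM {y. x < abs(SUM j:{a..<b}. y j)} <= 3 * (of_int (b - a))^2 / x ^ 4"
proof -
 let ?n = "of_int (b - a) :: real"
 have n: "0 < ?n" using assms by simp
 have m4: "has_bochner_integral lborel (%y. std_normal_density y * y ^ 4) 3"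
  using std_normal_moment_even[of 2] by (simp add: fact_numeral)
 have "integrable std_normal_distribution (%y. y ^ 4)" "(\<integral>y. y ^ 4 \<partial>std_normal_distribution) = 3"
  using m4 by (simp_all add: integrable_density integral_density has_bochner_integral_iff)
 note m = this
 have "measure GM {y. x < abs(SUM j:{a..<b}. y j)}
   <= measure GM {y. (SUM j:{a..<b}. y j) / sqrt ?n \<in> {y. x ^ 4 / ?n^2 <= y ^ 4}}"
 proof (rule gauss.prod.P.finite_measure_mono)
  show "{y. x < abs(SUM j:{a..<b}. y j)} \<subseteq> {y. (SUM j:{a..<b}. y j) / sqrt ?n \<in> {y. x ^ 4 / ?n^2 <= y ^ 4}}"
  proof clarify
   fix y :: "int => real" let ?s = "SUM j:{a..<b}. y j"
   assume "x < abs(?s)"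
   hence "x ^ 4 <= abs(?s) ^ 4" using assms by (intro power_mono) auto
   moreover have "sqrt ?n ^ 4 = ?n^2" using n power_mult[of "sqrt ?n" 2 2] by simp
   ultimately show "x ^ 4 / ?n^2 <= (?s / sqrt ?n) ^ 4"
    by (simp add: power_divide divide_right_mono)
  qed
  show "{y. (SUM j:{a..<b}. y j) / sqrt ?n \<in> {y. x ^ 4 / ?n^2 <= y ^ 4}} \<in> sets GM"
   by (rule sets_GM_I) measurable
 qed
 also have "... = measure std_normal_distribution {y. x ^ 4 / ?n^2 <= y ^ 4}"
  by (rule gauss_sum_prob[OF assms(1)]) measurable
 also have "... <= (\<integral>y. y ^ 4 \<partial>std_normal_distribution) / (x ^ 4 / ?n^2)"
  using integral_Markov_inequality_measure[OF m(1), of "{}" "x ^ 4 / ?n^2"] n assms by simp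
 finally show ?thesis using m(2) by simp
qed

text \<open>The standard normal density is at most 1/2, and the normalised sum has to fall into an
  interval of length 2h / sqrt (b - a).\<close>

lemma gauss_anticoncentration:
 assumes "a < b" "0 <= h"
 shows "measure GM {y. abs((SUM j:{a..<b}. y j) + w) <= h} <= h / sqrt (of_int (b - a))"
proof -
 let ?n = "sqrt (of_int (b - a)) :: real"
 have n: "0 < ?n" using assms by simp
 have "{y. abs((SUM j:{a..<b}. y j) + w) <= h} = {y. (SUM j:{a..<b}. y j) / ?n \<in> {(-w - h) / ?n..(- w + h) / ?n}}"
  using n by (auto simp: divide_le_cancel abs_le_iff)
 hence "measure GM {y. abs((SUM j:{a..<b}. y j) + w) <= h} = measure std_normal_distribution {(-w - h) / ?n..(- w + h) / ?n}"
  using gauss_sum_prob[OF assms(1), of "{(-w - h) / ?n..(- w + h) / ?n}"] by (simp only: borel_closed[OF closed_atLeastAtMost])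
 also have "... <= h / ?n"
 proof -
  have "emeasure std_normal_distribution {(-w - h) / ?n..(- w + h) / ?n}
    = (\<integral>\<^sup>+y\<in>{(-w - h) / ?n..(- w + h) / ?n}. ennreal (std_normal_density y) \<partial>lborel)"
   by (subst emeasure_density) auto
  also have "... <= (\<integral>\<^sup>+y. ennreal (1/2) * indicator {(-w - h) / ?n..(- w + h) / ?n} y \<partial>lborel)"
  proof (intro nn_integral_mono mult_right_mono ennreal_leI)
   fix y :: real
   have "2 <= sqrt (2 * pi)" using pi_ge_two by (intro real_le_rsqrt) auto
   hence "1 / sqrt (2 * pi) <= 1 / 2" by (intro divide_left_mono) auto
   moreover have "exp (- y\<^sup>2 / 2) <= 1" by simp
   ultimately have "1 / sqrt (2 * pi) * exp (- y\<^sup>2 / 2) <= 1 / 2 * 1" by (intro mult_mono) auto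
   thus "std_normal_density y <= 1 / 2" by (simp add: std_normal_density_def)
  qed auto
  also have "... = ennreal (1/2) * emeasure lborel {(-w - h) / ?n..(- w + h) / ?n}"
   by (rule nn_integral_cmult_indicator) simp
  also have "emeasure lborel {(-w - h) / ?n..(- w + h) / ?n} = ennreal (2 * h / ?n)"
   using n assms(2) by (subst emeasure_lborel_Icc) (auto intro!: divide_right_mono simp: diff_divide_distrib[symmetric])
  also have "ennreal (1/2) * ennreal (2 * h / ?n) = ennreal (1 / 2 * (2 * h / ?n))"
   using n assms(2) by (intro ennreal_mult[symmetric]) auto
  also have "1 / 2 * (2 * h / ?n) = h / ?n" by simp
  finally show ?thesis unfolding measure_def using n assms(2) by (intro enn2real_leI) auto
 qed
 finally show ?thesis .
qed

lemma std_normal_interval_pos: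
 assumes "- 2 <= c" "c <= 1"
 shows "0 < measure std_normal_distribution {c..c + 1}"
proof -
 have "0 < emeasure std_normal_distribution {c..c+1}"
 proof (subst emeasure_density)
  have "ennreal (std_normal_density 2) = (\<integral>\<^sup>+y. ennreal (std_normal_density 2) * indicator {c..c+1} y \<partial>lborel)"
   by (simp add: nn_integral_cmult)
  also have "... <= (\<integral>\<^sup>+y\<in>{c..c+1}. ennreal (std_normal_density y) \<partial>lborel)"
  proof (intro nn_integral_mono)
   fix y :: real
   have "std_normal_density 2 <= std_normal_density y" if "c <= y" "y <= c + 1"
   proof -
    have "abs(y)^2 <= 2^2" using that assms by (intro power_mono) auto
    thus ?thesis by (simp add: std_normal_density_def divide_right_mono)
   qed
   thus "ennreal (std_normal_density 2) * indicator {c..c+1} y <= ennreal (std_normal_density y) * indicator {c..c+1} y"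
    by (auto simp: indicator_def intro!: ennreal_leI)
  qed
  finally show "0 < (\<integral>\<^sup>+y\<in>{c..c+1}. ennreal (std_normal_density y) \<partial>lborel)"
   using normal_density_pos[of 1 0 2] by (metis ennreal_less_zero_iff less_le_trans zero_less_one)
 qed auto
 thus ?thesis by (simp add: gauss.N.emeasure_eq_measure)
qed

text \<open>A lower bound for the chance that a Gaussian sum of any length rises, or falls, by its
  standard deviation; the success probability of the independent trials below.\<close>

definition p0 :: real where
 "p0 = min (measure std_normal_distribution {1..}) (measure std_normal_distribution {..-1})"

lemma p0: "0 < p0" "p0 <= 1"
proof -
 have "measure std_normal_distribution {1..1+1} <= measure std_normal_distribution {1..}"
  "measure std_normal_distribution {-2..-2+1} <= measure std_normal_distribution {..-1}"
  by (rule gauss.N.finite_measure_mono; simp)+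
 thus "0 < p0" using std_normal_interval_pos[of 1] std_normal_interval_pos[of "-2"] unfolding p0_def by linarith
 show "p0 <= 1" unfolding p0_def by (simp add: min.coboundedI1)
qed

lemma gauss_rise: "a < b ==> p0 <= measure GM {y. sqrt (of_int (b - a)) <= (SUM j:{a..<b}. y j)}"
 using gauss_sum_prob[of a b "{1..}"] unfolding p0_def by (simp add: le_divide_eq)

lemma gauss_fall: "a < b ==> p0 <= measure GM {y. (SUM j:{a..<b}. y j) <= - sqrt (of_int (b - a))}"
 using gauss_sum_prob[of a b "{..-1}"] unfolding p0_def by (simp add: divide_le_eq)

text \<open>Ottaviani's inequality at level \<open>x / 3\<close> with the fourth moment 3 of the
  normal law, so \<open>486 = 2 * 3 * 3^4\<close>. A bound of at least 1 is trivial; a smaller one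
  supplies the probability 1/2 that the inequality asks for.\<close>

lemma gauss_maximal:
 assumes "0 < x"
 shows "measure GM {y. \<exists>j\<in>{0..n}. x < abs(psum y (a + j) - psum y a)} <= 486 * (of_int n)^2 / x ^ 4"
proof (cases "n <= 0 \<or> 1 <= 486 * (of_int n)^2 / x ^ 4")
 case True
 thus ?thesis
 proof
  assume n: "n <= 0"
  have "{y. \<exists>j\<in>{0..n}. x < abs(psum y (a + j) - psum y a)} = {}"
  proof (intro equals0I)
   fix y assume "y \<in> {y. \<exists>j\<in>{0..n}. x < abs(psum y (a + j) - psum y a)}"
   then obtain j where "j \<in> {0..n}" "x < abs(psum y (a + j) - psum y a)" by blast
   moreover have "j = 0" using \<open>j \<in> {0..n}\<close> n by simp
   ultimately show False using assms by simp
  qed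
  thus ?thesis using assms by simp
 qed (use gauss.prod.P.prob_le_1 order_trans in blast)
next
 case False
 let ?V = "%a b y. SUM j:{a..<b::int}. y j :: real"
 have sm: "486 * (of_int n)^2 / x ^ 4 < 1" and n: "0 < n" using False by auto
 have tail: "measure GM {y. x / 3 < abs(?V (a + j) (a + n) y)} <= 243 * (of_int n)^2 / x ^ 4" if "0 <= j" "j < n" for j
 proof -
  have "measure GM {y. x / 3 < abs(?V (a + j) (a + n) y)} <= 3 * (of_int (a + n - (a + j)))^2 / (x / 3) ^ 4"
   by (rule gauss_sum_tail) (use that assms in auto)
  also have "... <= 3 * (of_int n)^2 / (x / 3) ^ 4"
   by (intro divide_right_mono mult_left_mono power_mono) (use that assms in auto)
  finally show ?thesis by (simp add: power_divide)
 qed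
 have "measure GM {y \<in> space GM. \<exists>j\<in>{1..n}. 3 * (x / 3) < abs(?V a (a + j) y)} <= 2 * measure GM {y \<in> space GM. x / 3 < abs(?V a (a + n) y)}"
 proof (rule gauss.ottaviani[where V="?V"])
  show "abs(?V a (a + n) y - ?V a (a + j) y - ?V (a + j) (a + n) y) <= x / 3" if "0 < j" "j < n" for j y
   using psum_diff[of a "a + n" y] psum_diff[of a "a + j" y] psum_diff[of "a + j" "a + n" y] that assms by simp
  show "measure GM {y \<in> space GM. x / 3 < abs(?V (a + j) (a + n) y)} <= 1 / 2" if "0 < j" "j < n" for j
   using tail[of j] that sm by simp
 qed (use assms isum_depends in auto)
 moreover have "{y \<in> space GM. \<exists>j\<in>{1..n}. 3 * (x / 3) < abs(?V a (a + j) y)} = {y. \<exists>j\<in>{0..n}. x < abs(psum y (a + j) - psum y a)}"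
 proof -
  have *: "?V a (a + j) y = psum y (a + j) - psum y a" if "0 <= j" for j y using psum_diff[of a "a + j" y] that by simp
  have "(\<exists>j\<in>{1..n}. x < abs(?V a (a + j) y)) \<longleftrightarrow> (\<exists>j\<in>{0..n}. x < abs(psum y (a + j) - psum y a))" for y
  proof
   assume "\<exists>j\<in>{1..n}. x < abs(?V a (a + j) y)"
   then obtain j where "j \<in> {1..n}" "x < abs(?V a (a + j) y)" by blast
   thus "\<exists>j\<in>{0..n}. x < abs(psum y (a + j) - psum y a)" using *[of j y] by (intro bexI[of _ j]) auto
  next
   assume "\<exists>j\<in>{0..n}. x < abs(psum y (a + j) - psum y a)"
   then obtain j where j: "j \<in> {0..n}" "x < abs(psum y (a + j) - psum y a)" by blast
   hence "j \<noteq> 0" using assms by auto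
   thus "\<exists>j\<in>{1..n}. x < abs(?V a (a + j) y)" using *[of j y] j by (intro bexI[of _ j]) auto
  qed
  thus ?thesis by simp
 qed
 ultimately show ?thesis using tail[of 0] n by simp
qed

section \<open>Valleys of the Gaussian random walk\<close>

text \<open>Heights are in units of \<open>ln t\<close>: walls above 1, barriers on the way to the
  bottom below 1, all with a margin \<open>\<eta>\<close> that later perturbations consume.
  \<open>r\<close> is the uncertainty of the bottom and \<open>d\<close> bounds the extent.\<close>

definition valley_right :: "real => int => int => (int => real) => int => int => int => bool" where
 "valley_right \<eta> r d s a q c \<longleftrightarrow> -d <= a & a < 0 & 0 <= q & q < c & c <= d &
   s q + 1 + \<eta> <= s a & s q + 1 + \<eta> <= s c &
   (\<forall>i j. a <= i --> i <= j --> j <= q --> s j - s i <= 1 - \<eta>) &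
   (\<forall>j. 0 <= j --> j <= q --> s j + \<eta> <= s a) &
   (\<forall>i. a <= i --> i <= c --> r < abs(i - q) --> s q + \<eta> <= s i)"

text \<open>The second alternative is a valley of the reversed path; its bottom \<open>q\<close> is
  not to the right of the origin.\<close>

definition valley :: "real => int => int => (int => real) => int => bool" where
 "valley \<eta> r d s q \<longleftrightarrow>
   (\<exists>a c. valley_right \<eta> r d s a q c \<or> valley_right \<eta> r d (%k. s (- k)) (- c) (- q) (- a))"

definition bmin :: "int => int => (int => real) => real" where "bmin B I s = Min (s ` {I*B..<(I+1)*B})"
definition bmax :: "int => int => (int => real) => real" where "bmax B I s = Max (s ` {I*B..<(I+1)*B})"

context
 fixes B :: int assumes B: "1 <= B"
begin

lemma block_ne: "{I*B..<(I+1)*B} \<noteq> {}"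
 using B by (simp add: distrib_right)

lemma bmin_le: "I*B <= k ==> k < (I+1)*B ==> bmin B I s <= s k"
 unfolding bmin_def by (intro Min_le) auto

lemma le_bmax: "I*B <= k ==> k < (I+1)*B ==> s k <= bmax B I s"
 unfolding bmax_def by (intro Max_ge) auto

lemma bmin_attained: "\<exists>k. I*B <= k & k < (I+1)*B & s k = bmin B I s"
proof -
 have "bmin B I s \<in> s ` {I*B..<(I+1)*B}" unfolding bmin_def by (intro Min_in) (use block_ne in auto)
 thus ?thesis by auto
qed

lemma bmax_attained: "\<exists>k. I*B <= k & k < (I+1)*B & s k = bmax B I s"
proof -
 have "bmax B I s \<in> s ` {I*B..<(I+1)*B}" unfolding bmax_def by (intro Max_in) (use block_ne in auto)
 thus ?thesis by auto
qed

lemma bmin_add: "(!!k. I*B <= k ==> k < (I+1)*B ==> s k = s' k + c) ==> bmin B I s = bmin B I s' + c"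
proof -
 assume *: "!!k. I*B <= k ==> k < (I+1)*B ==> s k = s' k + c"
 obtain k where k: "I*B <= k" "k < (I+1)*B" "s k = bmin B I s" using bmin_attained by blast
 obtain l where l: "I*B <= l" "l < (I+1)*B" "s' l = bmin B I s'" using bmin_attained by blast
 show ?thesis using *[OF k(1,2)] *[OF l(1,2)] bmin_le[OF k(1,2), of s'] bmin_le[OF l(1,2), of s] k(3) l(3) by linarith
qed

lemma bmax_add: "(!!k. I*B <= k ==> k < (I+1)*B ==> s k = s' k + c) ==> bmax B I s = bmax B I s' + c"
proof -
 assume *: "!!k. I*B <= k ==> k < (I+1)*B ==> s k = s' k + c"
 obtain k where k: "I*B <= k" "k < (I+1)*B" "s k = bmax B I s" using bmax_attained by blast
 obtain l where l: "I*B <= l" "l < (I+1)*B" "s' l = bmax B I s'" using bmax_attained by blast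
 show ?thesis using *[OF k(1,2)] *[OF l(1,2)] le_bmax[OF k(1,2), of s'] le_bmax[OF l(1,2), of s] k(3) l(3) by linarith
qed

lemma in_block: "(k div B) * B <= k" "k < (k div B + 1) * B"
 unfolding distrib_right using B pos_mod_bound[of B k] pos_mod_sign[of B k] div_mult_mod_eq[of k B] by linarith+

lemma div_ge: assumes "I * B <= k" shows "I <= k div B"
proof -
 have "I * B < (k div B + 1) * B" using in_block(2)[of k] assms by linarith
 thus ?thesis using B mult_right_mono[of "k div B + 1" I B] by linarith
qed

lemma div_le: assumes "k < (I + 1) * B" shows "k div B <= I"
proof -
 have "(k div B) * B < (I + 1) * B" using in_block(1)[of k] assms by linarith
 thus ?thesis using B mult_right_mono[of "I + 1" "k div B" B] by linarith
qed

text \<open>Block minima and maxima are attained at sites, and sites more than \<open>2 * B\<close>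
  apart lie in blocks at distance at least 2.\<close>

lemma block_valley_imp:
 assumes v: "right_valley h (%I. bmin B I s) (%I. bmax B I s) A b W \<or> left_valley h (%I. bmin B I s) (%I. bmax B I s) A b W"
  and K: "-K <= A" "W < K"
 shows "\<exists>q. valley h (2 * B) (K * B) s q"
proof -
 obtain a where a: "A*B <= a" "a < (A+1)*B" "s a = bmax B A s" using bmax_attained by blast
 obtain q where q: "b*B <= q" "q < (b+1)*B" "s q = bmin B b s" using bmin_attained by blast
 obtain c where c: "W*B <= c" "c < (W+1)*B" "s c = bmax B W s" using bmax_attained by blast
 have lo: "bmin B (k div B) s <= s k" for k by (rule bmin_le[OF in_block])
 have up: "s k <= bmax B (k div B) s" for k by (rule le_bmax[OF in_block])
 have db: "I <= k div B" if "I * B <= l" "l <= k" for I k l by (rule div_ge) (use that in linarith)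
 have dt: "k div B <= I" if "l < (I+1) * B" "k <= l" for I k l by (rule div_le) (use that in linarith)
 have dm: "k div B <= l div B" if "k <= l" for k l using that B by (intro zdiv_mono1) auto
 have mono: "I * B <= J * B" if "I <= J" for I J using that B by (intro mult_right_mono) auto
 have far: "2 <= abs(i div B - b)" if r: "2 * B < abs(i - q)" for i
 proof (rule ccontr)
  assume "~ ?thesis"
  hence "b - 1 <= i div B" "i div B <= b + 1" by auto
  hence "(b - 1) * B <= (i div B) * B" "(i div B + 1) * B <= (b + 2) * B" by (auto intro!: mono)
  thus False using q in_block[of i] r by (simp add: algebra_simps)
 qed
 from v show ?thesis
 proof
  assume v: "right_valley h (%I. bmin B I s) (%I. bmax B I s) A b W"
  note v = v[unfolded right_valley_def]
  have "valley_right h (2 * B) (K * B) s a q c" unfolding valley_right_def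
  proof (intro conjI allI impI)
   show "- (K * B) <= a" using mono[OF K(1)] a by simp
   show "a < 0" using mono[of "A + 1" 0] v a by simp
   show "0 <= q" using mono[of 0 b] v q by simp
   show "q < c" using mono[of "b + 1" W] v q c by simp
   show "c <= K * B" using mono[of "W + 1" K] K c by simp
   show "s q + 1 + h <= s a" "s q + 1 + h <= s c" using v a q c by linarith+
   show "s j - s i <= 1 - h" if ij: "a <= i" "i <= j" "j <= q" for i j
   proof -
    have "bmax B (j div B) s - bmin B (i div B) s <= 1 - h"
     using v db[OF a(1) ij(1)] dm[OF ij(2)] dt[OF q(2) ij(3)] by blast
    thus ?thesis using lo[of i] up[of j] by linarith
   qed
   show "s j + h <= s a" if j: "0 <= j" "j <= q" for j
   proof -
    have "bmax B (j div B) s + h <= bmax B A s" using v db[of 0 0 j] j dt[OF q(2) j(2)] by auto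
    thus ?thesis using up[of j] a by linarith
   qed
   show "s q + h <= s i" if i: "a <= i" "i <= c" "2 * B < abs(i - q)" for i
   proof -
    have "bmin B b s + h <= bmin B (i div B) s" using v db[OF a(1) i(1)] dt[OF c(2) i(2)] far[OF i(3)] by blast
    thus ?thesis using lo[of i] q by linarith
   qed
  qed
  thus ?thesis unfolding valley_def by blast
 next
  assume v: "left_valley h (%I. bmin B I s) (%I. bmax B I s) A b W"
  note v = v[unfolded left_valley_def]
  have "valley_right h (2 * B) (K * B) (%k. s (- k)) (- c) (- q) (- a)" unfolding valley_right_def minus_minus
  proof (intro conjI allI impI)
   show "- (K * B) <= - c" using mono[of "W + 1" K] K c by simp
   have "1 * B <= W * B" by (rule mono) (use v in blast)
   thus "- c < 0" using c B by linarith
   show "0 <= - q" using mono[of "b + 1" 0] v q by simp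
   show "- q < - a" using mono[of "A + 1" b] v q a by simp
   show "- a <= K * B" using mono[OF K(1)] a by simp
   show "s q + 1 + h <= s a" "s q + 1 + h <= s c" using v a q c by linarith+
   show "s (- j) - s (- i) <= 1 - h" if ij: "- c <= i" "i <= j" "j <= - q" for i j
   proof -
    have "q <= - j" "- j <= - i" "- i <= c" using ij by auto
    hence "bmax B ((-j) div B) s - bmin B ((-i) div B) s <= 1 - h"
     using v db[OF q(1), of "-j"] dm[of "-j" "-i"] dt[OF c(2), of "-i"] by blast
    thus ?thesis using lo[of "-i"] up[of "-j"] by linarith
   qed
   show "s (- j) + h <= s c" if j: "0 <= j" "j <= - q" for j
   proof -
    have "q <= - j" "- j <= 0" using j by auto
    hence "bmax B ((-j) div B) s + h <= bmax B W s" using v db[OF q(1), of "-j"] dt[of 0 0 "-j"] B by auto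
    thus ?thesis using up[of "-j"] c by linarith
   qed
   show "s q + h <= s (- i)" if i: "- c <= i" "i <= - a" "2 * B < abs(i - (- q))" for i
   proof -
    have "a <= - i" "- i <= c" "2 * B < abs(- i - q)" using i by auto
    hence "bmin B b s + h <= bmin B ((-i) div B) s" using v db[OF a(1), of "-i"] dt[OF c(2), of "-i"] far[of "-i"] by blast
    thus ?thesis using lo[of "-i"] q by linarith
   qed
  qed
  thus ?thesis unfolding valley_def by blast
 qed
qed

end

subsection \<open>Ties\<close>

definition blank :: "int => int => (int => real) => int => real" where
 "blank a b y j = (if a <= j & j < b then 0 else y j)"

lemma blank_measurable [measurable]: "blank a b \<in> GM \<rightarrow>\<^sub>M GM"
proof (rule measurable_PiM_single')
 show "(%y. blank a b y j) \<in> GM \<rightarrow>\<^sub>M std_normal_distribution" for j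
  using coord_GM[of j] unfolding blank_def by (cases "a <= j & j < b") auto
qed (simp add: space_PiM)

text \<open>The path is pinned at the origin, so erasing a stretch of increments shifts rigidly the
  side away from the origin and leaves the other side unchanged.\<close>

lemma psum_blank:
 assumes "a <= b" "b <= 0 \<or> 0 <= a"
 shows "k <= a ==> psum y k = psum (blank a b y) k - (if b <= 0 then SUM j:{a..<b}. y j else 0)"
  and "b <= k ==> psum y k = psum (blank a b y) k + (if b <= 0 then 0 else SUM j:{a..<b}. y j)"
proof -
 have 0: "psum z 0 = 0" for z unfolding psum_def by simp
 have s0: "(SUM j:{a..<b}. blank a b y j) = 0" by (rule sum.neutral) (simp add: blank_def)
 have e: "(SUM j:{u..<v}. blank a b y j) = (SUM j:{u..<v}. y j)" if "v <= a \<or> b <= u" for u v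
  by (rule sum.cong) (use that in \<open>auto simp: blank_def\<close>)
 show "psum y k = psum (blank a b y) k - (if b <= 0 then SUM j:{a..<b}. y j else 0)" if k: "k <= a"
 proof (cases "b <= 0")
  case True
  have "psum z k = - (SUM j:{k..<a}. z j) - (SUM j:{a..<b}. z j) - (SUM j:{b..<0}. z j)" for z
   using psum_diff[of k a z] psum_diff[of a b z] psum_diff[of b 0 z] True k assms 0 by simp
  from this[of y] this[of "blank a b y"] show ?thesis using True s0 e[of a k] e[of 0 b] by simp
 next
  case False
  have "psum (blank a b y) k = psum y k" by (rule psum_cong) (use False k assms in \<open>auto simp: blank_def\<close>)
  thus ?thesis using False by simp
 qed
 show "psum y k = psum (blank a b y) k + (if b <= 0 then 0 else SUM j:{a..<b}. y j)" if k: "b <= k"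
 proof (cases "b <= 0")
  case False
  have a: "0 <= a" using False assms by simp
  have "psum z k = (SUM j:{0..<a}. z j) + (SUM j:{a..<b}. z j) + (SUM j:{b..<k}. z j)" for z
   using psum_diff[of 0 a z] psum_diff[of a b z] psum_diff[of b k z] a k assms 0 by simp
  from this[of y] this[of "blank a b y"] show ?thesis using False s0 e[of a 0] e[of k b] by simp
 next
  case True
  have "psum (blank a b y) k = psum y k" by (rule psum_cong) (use True k assms in \<open>auto simp: blank_def\<close>)
  thus ?thesis using True by simp
 qed
qed

text \<open>Fubini for the independent pair of the sum and \<open>W\<close>, then anticoncentration
  at each fixed value of \<open>W\<close>.\<close>

lemma gauss_tie:
 assumes ab: "a < b" "0 <= h" and W [measurable]: "W \<in> borel_measurable GM" and dep: "depends (- {a..<b}) W"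
 shows "measure GM {y. abs((SUM j:{a..<b}. y j) + W y) <= h} <= h / sqrt (of_int (b - a))"
proof -
 let ?Z = "%y. SUM j:{a..<b}. y j :: real"
 let ?E = "{(z, w). abs(z + w) <= h} :: (real \<times> real) set"
 interpret Z: prob_space "distr GM borel ?Z" by (rule gauss.prod.P.prob_space_distr) simp
 interpret W: prob_space "distr GM borel W" by (rule gauss.prod.P.prob_space_distr) simp
 interpret ZW: pair_prob_space "distr GM borel ?Z" "distr GM borel W" ..
 have "?E = {p \<in> space (borel \<Otimes>\<^sub>M borel). abs(fst p + snd p) <= h}" by (auto simp: space_pair_measure)
 moreover have "... \<in> sets (borel \<Otimes>\<^sub>M borel)" by measurable
 ultimately have E: "?E \<in> sets (borel \<Otimes>\<^sub>M borel)" by simp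
 have "gauss.prod.indep_var borel ?Z borel W"
  by (rule gauss.indep_var_depends[OF _ W isum_depends dep]) auto
 hence d: "distr GM borel ?Z \<Otimes>\<^sub>M distr GM borel W = distr GM (borel \<Otimes>\<^sub>M borel) (%y. (?Z y, W y))"
  using gauss.prod.P.indep_var_distribution_eq by blast
 have "emeasure GM {y. abs(?Z y + W y) <= h} = emeasure (distr GM (borel \<Otimes>\<^sub>M borel) (%y. (?Z y, W y))) ?E"
 proof (subst emeasure_distr[OF _ E])
  show "(%y. (?Z y, W y)) \<in> GM \<rightarrow>\<^sub>M borel \<Otimes>\<^sub>M borel" by measurable
 qed (simp add: vimage_def)
 also have "... = (\<integral>\<^sup>+w. emeasure (distr GM borel ?Z) ((%z. (z, w)) -` ?E) \<partial>distr GM borel W)"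
  unfolding d[symmetric]
 proof (rule ZW.emeasure_pair_measure_alt2)
  have "sets (distr GM borel ?Z \<Otimes>\<^sub>M distr GM borel W) = sets (borel \<Otimes>\<^sub>M borel)"
   by (intro sets_pair_measure_cong) auto
  thus "?E \<in> sets (distr GM borel ?Z \<Otimes>\<^sub>M distr GM borel W)" using E by (simp only:)
 qed
 also have "... <= (\<integral>\<^sup>+w. ennreal (h / sqrt (of_int (b - a))) \<partial>distr GM borel W)"
 proof (rule nn_integral_mono)
  fix w
  have "emeasure (distr GM borel ?Z) ((%z. (z, w)) -` ?E) = emeasure GM {y. abs(?Z y + w) <= h}"
   by (subst emeasure_distr) (auto simp: vimage_def)
  also have "... = ennreal (measure GM {y. abs(?Z y + w) <= h})" by (rule gauss.prod.P.emeasure_eq_measure)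
  also have "... <= ennreal (h / sqrt (of_int (b - a)))" by (intro ennreal_leI gauss_anticoncentration ab)
  finally show "emeasure (distr GM borel ?Z) ((%z. (z, w)) -` ?E) <= ennreal (h / sqrt (of_int (b - a)))" .
 qed
 also have "... = ennreal (h / sqrt (of_int (b - a)))" using W.emeasure_space_1 by simp
 finally show ?thesis unfolding measure_def using ab by (intro enn2real_leI) auto
qed

text \<open>Block \<open>I + 1\<close> separates the two. Its increments enter the difference of
  \<open>F\<close> and \<open>G\<close> only through their sum, as a rigid shift of one side; this
  is why the blocks are at distance at least 2 and the functionals commute with adding
  constants.\<close>

lemma block_tie:
 fixes F G :: "(int => real) => real"
 assumes B: "1 <= B" and N: "0 < N" and h: "0 <= h" and IJ: "I + 2 <= J"
  and F: "!!s s' c. (!!k. I*B <= k ==> k < (I+1)*B ==> s k = s' k + c) ==> F s = F s' + c"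
  and G: "!!s s' c. (!!k. J*B <= k ==> k < (J+1)*B ==> s k = s' k + c) ==> G s = G s' + c"
  and Fm: "(%y. F (%k. psum y k / N)) \<in> borel_measurable GM"
  and Gm: "(%y. G (%k. psum y k / N)) \<in> borel_measurable GM"
 shows "measure GM {y. abs(F (%k. psum y k / N) - G (%k. psum y k / N) + x) <= h} <= h * N / sqrt (of_int B)"
proof -
 let ?a = "(I+1)*B" and ?b = "(I+2)*B"
 let ?Z = "%y. SUM j:{?a..<?b}. y j :: real"
 define D where "D y = F (%k. psum y k / N) - G (%k. psum y k / N)" for y
 define W where "W y = - (D (blank ?a ?b y) + x) * N" for y
 have Dm: "D \<in> borel_measurable GM" unfolding D_def using Fm Gm by (intro borel_measurable_diff)
 have Wm: "W \<in> borel_measurable GM" unfolding W_def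
  using measurable_compose[OF blank_measurable Dm] by measurable
 have Wd: "depends (- {?a..<?b}) W" unfolding depends_def
 proof (intro allI impI)
  fix y y' :: "int => real" assume "\<forall>k\<in>- {?a..<?b}. y k = y' k"
  hence "blank ?a ?b y = blank ?a ?b y'" unfolding blank_def by (intro HOL.ext) auto
  thus "W y = W y'" unfolding W_def by simp
 qed
 have ab: "?a < ?b" using B by (simp add: distrib_right)
 have ba: "?b - ?a = B" by (simp add: algebra_simps)
 have ab0: "?b <= 0 \<or> 0 <= ?a"
 proof (cases "I + 2 <= 0")
  case True thus ?thesis using B by (simp add: mult_nonpos_nonneg)
 next
  case False thus ?thesis using B by simp
 qed
 have bJ: "?b <= J * B" using IJ B by (intro mult_right_mono) auto
 have D: "D y = D (blank ?a ?b y) - ?Z y / N" for y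
 proof -
  let ?p = "%k. psum (blank ?a ?b y) k / N"
  have "F (%k. psum y k / N) = F ?p + (- (if ?b <= 0 then ?Z y else 0) / N)"
   by (rule F) (use psum_blank(1)[OF less_imp_le[OF ab] ab0, of _ y] in \<open>auto simp: diff_divide_distrib\<close>)
  moreover have "G (%k. psum y k / N) = G ?p + (if ?b <= 0 then 0 else ?Z y) / N"
   by (rule G) (use psum_blank(2)[OF less_imp_le[OF ab] ab0, of _ y] bJ in \<open>auto simp: add_divide_distrib\<close>)
  ultimately show ?thesis unfolding D_def by (auto split: if_splits)
 qed
 have "{y. abs(D y + x) <= h} = {y. abs(?Z y + W y) <= h * N}"
 proof (intro Collect_cong)
  fix y
  have "abs(?Z y + W y) = abs(D y + x) * N"
  proof -
   have "?Z y + W y = - ((D y + x) * N)" unfolding W_def D[of y] using N by (simp add: field_simps)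
   thus ?thesis using N by (simp add: abs_mult)
  qed
  thus "abs(D y + x) <= h \<longleftrightarrow> abs(?Z y + W y) <= h * N" using N by simp
 qed
 hence "measure GM {y. abs(D y + x) <= h} <= h * N / sqrt (of_int (?b - ?a))"
  using gauss_tie[OF ab _ Wm Wd, of "h * N"] h N by simp
 thus ?thesis unfolding D_def ba by simp
qed

lemma bmin_measurable [measurable]:
 assumes [measurable]: "!!k. (%y. s y k) \<in> borel_measurable N" and B: "1 <= B"
 shows "(%y. bmin B I (s y)) \<in> borel_measurable N"
 unfolding bmin_def using block_ne[OF B, of I] by (intro borel_measurable_Min) auto

lemma bmax_measurable [measurable]:
 assumes [measurable]: "!!k. (%y. s y k) \<in> borel_measurable N" and B: "1 <= B"
 shows "(%y. bmax B I (s y)) \<in> borel_measurable N"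
 unfolding bmax_def using block_ne[OF B, of I] by (intro borel_measurable_Max) auto

subsection \<open>Existence of a valley with high probability\<close>

lemma valley_right_measurable:
 assumes [measurable]: "!!k. (%y. s y k) \<in> borel_measurable N"
 shows "Measurable.pred N (%y. valley_right \<eta> r d (s y) a q c)"
 unfolding valley_right_def by (intro pred_intros_logic pred_intros_countable pred_intros_imp') measurable

lemma valley_measurable:
 assumes [measurable]: "!!k. (%y. s y k) \<in> borel_measurable N"
 shows "Measurable.pred N (%y. valley \<eta> r d (s y) q)"
 unfolding valley_def by (intro pred_intros_logic pred_intros_countable valley_right_measurable) measurable

lemma psum_0 [simp]: "psum y 0 = 0" unfolding psum_def by simp

lemma gauss_trials_rise:
 fixes f g :: "'j => int"
 assumes J: "finite J" and fg: "!!j. j \<in> J ==> f j < g j"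
  and disj: "disjoint_family_on (%j. {f j..<g j}) J"
 shows "measure GM {y. \<forall>j\<in>J. (SUM k:{f j..<g j}. y k) < sqrt (of_int (g j - f j))} <= (1 - p0) ^ card J"
  and "measure GM {y. \<forall>j\<in>J. - sqrt (of_int (g j - f j)) < (SUM k:{f j..<g j}. y k)} <= (1 - p0) ^ card J"
proof -
 have "measure GM {y \<in> space GM. \<forall>j\<in>J. (SUM k:{f j..<g j}. y k) \<notin> {sqrt (of_int (g j - f j))..}} <= (1 - p0) ^ card J"
  by (rule gauss.indep_trials[OF J _ isum_depends disj]) (use gauss_rise fg in auto)
 thus "measure GM {y. \<forall>j\<in>J. (SUM k:{f j..<g j}. y k) < sqrt (of_int (g j - f j))} <= (1 - p0) ^ card J"
  by (simp add: not_le)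
 have "measure GM {y \<in> space GM. \<forall>j\<in>J. (SUM k:{f j..<g j}. y k) \<notin> {..- sqrt (of_int (g j - f j))}} <= (1 - p0) ^ card J"
  by (rule gauss.indep_trials[OF J _ isum_depends disj]) (use gauss_fall fg in auto)
 thus "measure GM {y. \<forall>j\<in>J. - sqrt (of_int (g j - f j)) < (SUM k:{f j..<g j}. y k)} <= (1 - p0) ^ card J"
  by (simp add: not_le)
qed

definition osc_event :: "int => int => real => (int => real) set" where
 "osc_event a n x = {y. \<exists>j\<in>{0..n}. x < abs(psum y (a + j) - psum y a)}"

lemma osc_event_sets [measurable]: "osc_event a n x \<in> sets GM"
 unfolding osc_event_def by (rule sets_GM_I) measurable

lemma osc_event_prob: "0 < x ==> measure GM (osc_event a n x) <= 486 * (of_int n)^2 / x ^ 4"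
 unfolding osc_event_def by (rule gauss_maximal)

lemma osc_eventD: "y \<notin> osc_event a n x ==> a <= k ==> k <= a + n ==> abs(psum y k - psum y a) <= x"
 unfolding osc_event_def by (auto dest!: bspec[of _ _ "k - a"])

section \<open>Bad events for the existence of a valley\<close>

context
 fixes B p R :: int and \<rho> :: int and \<kappa> :: nat and h :: real
 assumes B: "1 <= B" and p: "1 <= p" and R: "1 <= R" and \<rho>: "4 <= \<rho>" "\<rho> ^ \<kappa> < p" and \<kappa>: "1 <= \<kappa>"
  and h: "0 < h" "h <= 1 / 2" "h * sqrt (of_int p) <= 1 / 4"
begin

abbreviation (input) "NN \<equiv> p * B"
abbreviation (input) "sN \<equiv> sqrt (of_int (p * B))"
abbreviation (input) "KK \<equiv> (R + 1) * p"
abbreviation (input) "bm y I \<equiv> bmin B I (%k. psum y k / sN)"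
abbreviation (input) "bM y I \<equiv> bmax B I (%k. psum y k / sN)"
abbreviation (input) "lv j \<equiv> \<rho> ^ j * B"

text \<open>The parameters: a block has \<open>B\<close> steps, \<open>p\<close> blocks form the
  stretch over which the path moves by order 1 after division by \<open>sN\<close>, \<open>R\<close>
  such stretches are tried on either side, and the initial scales \<open>lv j\<close> grow by the
  factor \<open>\<rho>\<close> up to \<open>lv \<kappa>\<close>, which is still shorter than one
  stretch.\<close>

definition "bad_tie = (\<Union>I\<in>{-KK..<KK}. \<Union>J\<in>{-KK..<KK}. {y. 2 <= abs(I - J) &
 (abs(bm y I - bm y J) <= h \<or> abs(bM y I - bM y J) <= h \<or> abs(bM y I - bm y J - 1) <= h)})"

definition "bad_osc = (\<Union>I\<in>{-KK..<KK}. osc_event (I*B) (2*B) (sN / 5))"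

definition "bad_right = {y. \<forall>i\<in>{0..<R}. (SUM k:{i*NN..<(i+1)*NN}. y k) < sqrt (of_int ((i+1)*NN - i*NN))}"

definition "bad_left = {y. \<forall>i\<in>{1..R}. - sqrt (of_int (-i*NN - (-(i+1)*NN))) < (SUM k:{-(i+1)*NN..<-i*NN}. y k)}"

definition "bad_start = osc_event 0 (lv \<kappa> + B) (sN / 5)"

definition "bad_small = (\<Union>j\<in>{1..\<kappa>}. osc_event 0 (lv (j - 1)) (sqrt (of_int (lv j)) / 4))"

text \<open>Off this event the path rises by a standard deviation between two successive scales. Off
  \<open>bad_small\<close> what came before is at most a quarter of the new scale, so the path gets
  above block 0; off \<open>bad_start\<close> it has not yet oscillated by 1/2. This provides
  \<open>J1\<close> in \<open>block_path\<close>.\<close>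

definition "bad_exit = {y. \<forall>j\<in>{1..\<kappa>}. (SUM k:{lv (j-1)..<lv j}. y k) < sqrt (of_int (lv j - lv (j-1)))}"

lemmas bad_defs = bad_tie_def bad_osc_def bad_right_def bad_left_def bad_start_def bad_small_def bad_exit_def

lemma NN: "1 <= NN" "0 < sN"
proof -
 show "1 <= NN" using mult_mono[of 1 p 1 B] p B by simp
 hence "0 < real_of_int NN" by (subst of_int_0_less_iff) linarith
 thus "0 < sN" by (rule real_sqrt_gt_zero)
qed

lemma sN4: "(sN / 5) ^ 4 = (of_int p)^2 * (of_int B)^2 / 625"
proof -
 have "sN ^ 4 = (sN^2)^2" unfolding power_mult[symmetric] by simp
 also have "sN^2 = of_int NN" by (rule real_sqrt_pow2) (use NN(2) in simp)
 finally show ?thesis by (simp add: power_divide power_mult_distrib)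
qed

lemma bm_measurable [measurable]: "(%y. bm y I) \<in> borel_measurable GM" "(%y. bM y I) \<in> borel_measurable GM"
 by (rule bmin_measurable[OF _ B] bmax_measurable[OF _ B]; measurable)+

lemma lv_mono: "i <= j ==> lv i <= lv j"
 using B \<rho> by (intro mult_right_mono power_increasing) auto

lemma lv_ge: "B <= lv j" using lv_mono[of 0 j] by simp

lemma lv_less: assumes "1 <= j" shows "lv (j - 1) < lv j"
proof -
 have "lv j = \<rho> * lv (j - 1)" using assms by (cases j) auto
 moreover have "2 * lv (j - 1) <= \<rho> * lv (j - 1)" using \<rho> B by (intro mult_right_mono) auto
 ultimately show ?thesis using lv_ge[of "j - 1"] B by linarith
qed

lemma bad_sets: "bad_tie \<in> sets GM" "bad_osc \<in> sets GM" "bad_right \<in> sets GM" "bad_left \<in> sets GM"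
 "bad_start \<in> sets GM" "bad_small \<in> sets GM" "bad_exit \<in> sets GM"
proof -
 show "bad_tie \<in> sets GM" unfolding bad_tie_def
  by (intro sets.finite_UN finite_atLeastLessThan_int sets_GM_I) measurable
 show "bad_right \<in> sets GM" "bad_left \<in> sets GM" "bad_exit \<in> sets GM" unfolding bad_defs
  by (rule sets_GM_I; measurable)+
 show "bad_osc \<in> sets GM" "bad_start \<in> sets GM" "bad_small \<in> sets GM" unfolding bad_defs by measurable
qed

lemma good_valley:
 assumes "y \<notin> bad_tie" "y \<notin> bad_osc" "y \<notin> bad_right" "y \<notin> bad_left" "y \<notin> bad_start" "y \<notin> bad_small" "y \<notin> bad_exit"
 shows "\<exists>q. valley h (2 * B) (KK * B) (%k. psum y k / sN) q"
proof -
 let ?s = "%k. psum y k / sN"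
 have sN: "0 < sN" by (rule NN)
 have s_le: "abs(?s k - ?s a) <= x" if "abs(psum y k - psum y a) <= x * sN" for k a x
  using that sN by (simp add: diff_divide_distrib[symmetric] abs_divide divide_le_eq)
 have KR: "R * p < KK" "p <= KK" using p R mult_mono[of 1 R p p] by (auto simp: distrib_right)
 have blk: "I * B <= I' * B" if "I <= I'" for I I' using that B by (intro mult_right_mono) auto
 have osc: "bM y I - bm y J < 1 / 2" if IJ: "-KK <= I" "I < KK" "-KK <= J" "J < KK" "abs(I - J) <= 1" for I J
 proof -
  obtain k where k: "I*B <= k" "k < (I+1)*B" "?s k = bM y I" using bmax_attained[OF B, of I ?s] by blast
  obtain l where l: "J*B <= l" "l < (J+1)*B" "?s l = bm y J" using bmin_attained[OF B, of J ?s] by blast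
  define a where "a = min I J"
  have a: "-KK <= a" "a < KK" "a <= I" "a <= J" "I <= a + 1" "J <= a + 1" unfolding a_def using IJ by auto
  have "y \<notin> osc_event (a*B) (2*B) (sN / 5)" using assms(2) a unfolding bad_osc_def by auto
  moreover have "a*B <= k" "k <= a*B + 2*B" "a*B <= l" "l <= a*B + 2*B"
   using blk[OF a(3)] blk[OF a(4)] blk[OF a(5)] blk[OF a(6)] k(1,2) l(1,2) unfolding distrib_right by linarith+
  ultimately have "abs(psum y k - psum y (a*B)) <= 1/5 * sN" "abs(psum y l - psum y (a*B)) <= 1/5 * sN"
   using osc_eventD[of y "a*B" "2*B" "sN/5"] by auto
  from this[THEN s_le] show ?thesis using k(3) l(3) by linarith
 qed
 have tie: "h < abs(bm y I - bm y J)" "h < abs(bM y I - bM y J)" "h < abs(bM y I - bm y J - 1)"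
  if IJ: "-KK <= I" "I < KK" "-KK <= J" "J < KK" "2 <= abs(I - J)" for I J
 proof -
  have "I \<in> {-KK..<KK}" "J \<in> {-KK..<KK}" using IJ by auto
  hence "~ (2 <= abs(I - J) & (abs(bm y I - bm y J) <= h \<or> abs(bM y I - bM y J) <= h \<or> abs(bM y I - bm y J - 1) <= h))"
   using assms(1) unfolding bad_tie_def by blast
  thus "h < abs(bm y I - bm y J)" "h < abs(bM y I - bM y J)" "h < abs(bM y I - bm y J - 1)" using IJ(5) by linarith+
 qed
 have pnt: "?s (I * B) <= bM y I" "bm y I <= ?s (I * B)" for I
  by (rule le_bmax[OF B] bmin_le[OF B]; use B in \<open>simp add: distrib_right\<close>)+
 have right: "\<exists>I J. 0 <= I & I <= J & J < KK & 1 <= bM y J - bm y I"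
 proof -
  obtain i where i: "0 <= i" "i < R" "sqrt (of_int ((i+1)*NN - i*NN)) <= (SUM k:{i*NN..<(i+1)*NN}. y k)"
   using assms(3) unfolding bad_right_def by (auto simp: not_less)
  have "i * NN <= (i+1) * NN" using NN by (intro mult_right_mono) auto
  hence "sN <= psum y ((i+1)*NN) - psum y (i*NN)" using i(3) psum_diff[of "i*NN" "(i+1)*NN" y] by (simp add: algebra_simps)
  hence "1 <= ?s (((i+1)*p)*B) - ?s ((i*p)*B)" using sN by (simp add: diff_divide_distrib[symmetric] le_divide_eq mult.assoc)
  hence "1 <= bM y ((i+1)*p) - bm y (i*p)" using pnt(1)[of "(i+1)*p"] pnt(2)[of "i*p"] by linarith
  moreover have "(i+1)*p <= R * p" using i p by (intro mult_right_mono) auto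
  moreover have "0 <= i * p" "i * p <= (i+1)*p" using i p by (auto simp: distrib_right)
  ultimately show ?thesis using KR by (intro exI[of _ "i*p"] exI[of _ "(i+1)*p"]) auto
 qed
 have left: "\<exists>I J. -KK <= J & J <= I & I <= -1 & 1 <= bM y J - bm y I"
 proof -
  obtain i where i: "1 <= i" "i <= R" "(SUM k:{-(i+1)*NN..<-i*NN}. y k) <= - sqrt (of_int (-i*NN - (-(i+1)*NN)))"
   using assms(4) unfolding bad_left_def by (auto simp: not_less)
  have e: "-i*NN - (-(i+1)*NN) = NN" by (simp add: algebra_simps)
  have "-(i+1) * NN <= -i * NN" using NN e by linarith
  hence "psum y (-i*NN) - psum y (-(i+1)*NN) <= - sN" using i(3) psum_diff[of "-(i+1)*NN" "-i*NN" y] unfolding e by simp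
  hence "1 <= ?s ((-(i+1)*p)*B) - ?s ((-i*p)*B)" using sN by (simp add: diff_divide_distrib[symmetric] le_divide_eq mult.assoc)
  hence "1 <= bM y (-(i+1)*p) - bm y (-i*p)" using pnt(1)[of "-(i+1)*p"] pnt(2)[of "-i*p"] by linarith
  moreover have "(i+1)*p <= KK" using i p by (intro mult_right_mono) auto
  moreover have "1 * 1 <= i * p" by (rule mult_mono) (use i p in auto)
  moreover have "-(i+1)*p = - ((i+1)*p)" "-i*p = - (i*p)" "(i+1)*p = i*p + p" by (simp_all add: algebra_simps)
  ultimately have "-KK <= -(i+1)*p & -(i+1)*p <= -i*p & -i*p <= -1 & 1 <= bM y (-(i+1)*p) - bm y (-i*p)"
   using p by linarith
  thus ?thesis by blast
 qed
 obtain j where j: "1 <= j" "j <= \<kappa>" "sqrt (of_int (lv j - lv (j-1))) <= (SUM k:{lv (j-1)..<lv j}. y k)"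
  using assms(7) unfolding bad_exit_def by (auto simp: not_less)
 have J1: "1 <= \<rho> ^ j" "\<rho> ^ j < KK"
 proof -
  show "1 <= \<rho> ^ j" using \<rho> by (intro one_le_power) auto
  have "\<rho> ^ j <= \<rho> ^ \<kappa>" using \<rho> j by (intro power_increasing) auto
  thus "\<rho> ^ j < KK" using \<rho> KR by linarith
 qed
 have exit: "bM y 0 + h <= bM y (\<rho> ^ j)"
 proof -
  let ?r = "sqrt (of_int (lv j))"
  have small: "y \<notin> osc_event 0 (lv (i - 1)) (sqrt (of_int (lv i)) / 4)" if "1 <= i" "i <= \<kappa>" for i
   using assms(6) that unfolding bad_small_def by auto
  have a: "abs(psum y (lv (j-1))) <= ?r / 4"
   using osc_eventD[OF small[OF j(1,2)], of "lv (j-1)"] lv_ge[of "j-1"] B by simp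
  obtain k where k: "0*B <= k" "k < (0+1)*B" "?s k = bM y 0" using bmax_attained[OF B, of 0 ?s] by blast
  have "abs(psum y k) <= sqrt (of_int (lv 1)) / 4"
   using osc_eventD[OF small[of 1], of k] k \<kappa> by simp
  also have "sqrt (of_int (lv 1)) <= ?r" using lv_mono[OF j(1)] by (subst real_sqrt_le_iff, subst of_int_le_iff) simp
  finally have b: "abs(psum y k) <= ?r / 4" by simp
  \<comment> \<open>As \<open>\<rho> >= 4\<close>, the rise between the scales is at least three
    quarters of \<open>?r\<close>. Taking off \<open>?r / 4\<close> for the earlier scale and
    \<open>?r / 4\<close> for block 0 leaves \<open>?r / 4\<close>, which exceeds
    \<open>h * sN\<close>.\<close>
  have c: "3 / 4 * ?r <= sqrt (of_int (lv j - lv (j-1)))"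
  proof (rule real_le_rsqrt)
   have "lv j = \<rho> * lv (j - 1)" using j(1) by (cases j) auto
   moreover have "4 * lv (j - 1) <= \<rho> * lv (j - 1)" using \<rho> B by (intro mult_right_mono) auto
   ultimately have "4 * lv (j - 1) <= lv j" by linarith
   hence "4 * real_of_int (lv (j - 1)) <= real_of_int (lv j)" by (metis of_int_le_iff of_int_mult of_int_numeral)
   moreover have l0: "0 <= real_of_int (lv j)" using lv_ge[of j] B by (subst of_int_0_le_iff) linarith
   moreover have "(3 / 4 * ?r)^2 = 9 / 16 * real_of_int (lv j)"
    unfolding power_mult_distrib real_sqrt_pow2[OF l0] by (simp add: power2_eq_square)
   ultimately show "(3 / 4 * ?r)^2 <= of_int (lv j - lv (j-1))" unfolding of_int_diff by linarith
  qed
  have "psum y (lv j) - psum y (lv (j-1)) = (SUM k:{lv (j-1)..<lv j}. y k)"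
   by (rule psum_diff) (use lv_mono[of "j-1" j] in simp)
  hence "psum y (lv j) >= ?r / 2" using a c j(3) by linarith
  hence "psum y k + ?r / 4 <= psum y (lv j)" using b by linarith
  moreover have "h * sN <= ?r / 4"
  proof -
   have "h * sN = (h * sqrt (of_int p)) * sqrt (of_int B)" by (simp add: real_sqrt_mult)
   also have "... <= 1 / 4 * sqrt (of_int B)" using h(3) B by (intro mult_right_mono) auto
   also have "sqrt (of_int B) <= ?r" using lv_ge[of j] by (subst real_sqrt_le_iff, subst of_int_le_iff) simp
   finally show ?thesis by simp
  qed
  ultimately have "psum y k + h * sN <= psum y (lv j)" by linarith
  moreover have "?s k + h = (psum y k + h * sN) / sN"
   unfolding add_divide_distrib by (subst nonzero_mult_div_cancel_right) (use sN in linarith, rule refl)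
  ultimately have "?s k + h <= ?s (lv j)" using divide_right_mono[of _ _ sN] sN by simp
  thus ?thesis using k(3) pnt(1)[of "\<rho> ^ j"] by linarith
 qed
 have osc1: "bM y I - bm y J < 1 / 2" if IJ: "0 <= I" "I <= \<rho> ^ j" "0 <= J" "J <= \<rho> ^ j" for I J
 proof -
  obtain k where k: "I*B <= k" "k < (I+1)*B" "?s k = bM y I" using bmax_attained[OF B, of I ?s] by blast
  obtain l where l: "J*B <= l" "l < (J+1)*B" "?s l = bm y J" using bmin_attained[OF B, of J ?s] by blast
  have b: "0 <= k" "k <= lv \<kappa> + B" "0 <= l" "l <= lv \<kappa> + B"
   using blk[OF IJ(1)] blk[OF IJ(2)] blk[OF IJ(3)] blk[OF IJ(4)] k(1,2) l(1,2) lv_mono[OF j(2)] unfolding distrib_right by linarith+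
  have "abs(psum y k - psum y 0) <= 1/5 * sN" "abs(psum y l - psum y 0) <= 1/5 * sN"
   using osc_eventD[of y 0 "lv \<kappa> + B" "sN/5"] b assms(5) unfolding bad_start_def by auto
  from this[THEN s_le] show ?thesis using k(3) l(3) by linarith
 qed
 interpret block_path "%I. bm y I" "%I. bM y I" KK "\<rho> ^ j" h
  by unfold_locales (use h osc tie right left J1 exit osc1 in blast)+
 obtain A b W where "-KK <= A" "W < KK" "right_valley h (%I. bm y I) (%I. bM y I) A b W \<or> left_valley h (%I. bm y I) (%I. bM y I) A b W"
  using valley_exists by blast
 thus ?thesis using block_valley_imp[OF B] by blast
qed

lemma bad_tie_prob: "measure GM bad_tie <= (2 * of_int KK)^2 * (3 * (h * sqrt (of_int p)))"
proof -
 let ?I = "{-KK..<KK}"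
 define E where "E I J = {y. 2 <= abs(I - J) &
  (abs(bm y I - bm y J) <= h \<or> abs(bM y I - bM y J) <= h \<or> abs(bM y I - bm y J - 1) <= h)}" for I J
 have Em: "E I J \<in> sets GM" for I J unfolding E_def by (rule sets_GM_I) measurable
 have r: "h * sN / sqrt (of_int B) = h * sqrt (of_int p)" using B by (simp add: real_sqrt_mult)
 have t: "measure GM {y. abs(F I (%k. psum y k / sN) - G J (%k. psum y k / sN) + x) <= h} <= h * sqrt (of_int p)"
  if IJ: "I + 2 <= J" and FG: "F = bmin B \<or> F = bmax B" "G = bmin B \<or> G = bmax B" for F G x I J
  unfolding r[symmetric]
 proof (rule block_tie[OF B NN(2) less_imp_le[OF h(1)] IJ])
  show "F I s = F I s' + c" if "!!k. I * B <= k ==> k < (I + 1) * B ==> s k = s' k + c" for s s' c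
   using FG(1) bmin_add[OF B, of I s s' c] bmax_add[OF B, of I s s' c] that by auto
  show "G J s = G J s' + c" if "!!k. J * B <= k ==> k < (J + 1) * B ==> s k = s' k + c" for s s' c
   using FG(2) bmin_add[OF B, of J s s' c] bmax_add[OF B, of J s s' c] that by auto
  show "(%y. F I (%k. psum y k / sN)) \<in> borel_measurable GM" "(%y. G J (%k. psum y k / sN)) \<in> borel_measurable GM"
   using FG bm_measurable by blast+
 qed
 have E: "measure GM (E I J) <= 3 * (h * sqrt (of_int p))" for I J
 proof -
  have one: "measure GM {y. 2 <= abs(I - J) & abs(F I (%k. psum y k / sN) - G J (%k. psum y k / sN) - c) <= h} <= h * sqrt (of_int p)"
   if FG: "F = bmin B \<or> F = bmax B" "G = bmin B \<or> G = bmax B" for F G c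
  proof -
   let ?F = "%y. F I (%k. psum y k / sN)" and ?G = "%y. G J (%k. psum y k / sN)"
   consider "I + 2 <= J" | "J + 2 <= I" | "abs(I - J) < 2" by linarith
   thus ?thesis
   proof cases
    case 1
    have "{y. 2 <= abs(I - J) & abs(?F y - ?G y - c) <= h} = {y. abs(?F y - ?G y + (- c)) <= h}" using 1 by auto
    thus ?thesis using t[OF 1 FG, of "- c"] by simp
   next
    case 2
    have "{y. 2 <= abs(I - J) & abs(?F y - ?G y - c) <= h} = {y. abs(?G y - ?F y + c) <= h}" using 2 by (intro Collect_cong) linarith
    thus ?thesis using t[OF 2 FG(2,1), of c] by simp
   next
    case 3
    hence e: "{y. 2 <= abs(I - J) & abs(?F y - ?G y - c) <= h} = {}" by auto
    show ?thesis unfolding e using h p by simp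
   qed
  qed
  let ?A = "{y. 2 <= abs(I - J) & abs(bm y I - bm y J - 0) <= h}"
  let ?B = "{y. 2 <= abs(I - J) & abs(bM y I - bM y J - 0) <= h}"
  let ?C = "{y. 2 <= abs(I - J) & abs(bM y I - bm y J - 1) <= h}"
  have m: "?A \<in> sets GM" "?B \<in> sets GM" "?C \<in> sets GM" by (rule sets_GM_I; measurable)+
  have "E I J = ?A \<union> (?B \<union> ?C)" unfolding E_def by auto
  hence "measure GM (E I J) <= measure GM ?A + (measure GM ?B + measure GM ?C)"
   using measure_Un_le[OF m(1) sets.Un[OF m(2,3)]] measure_Un_le[OF m(2,3)] by simp
  thus ?thesis using one[of "bmin B" "bmin B" 0] one[of "bmax B" "bmax B" 0]
    one[of "bmax B" "bmin B" 1] by simp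
 qed
 have "bad_tie = (\<Union>(I, J)\<in>?I \<times> ?I. E I J)" unfolding bad_tie_def E_def by auto
 hence "measure GM bad_tie <= (\<Sum>(I, J)\<in>?I \<times> ?I. measure GM (E I J))"
  using gauss.prod.P.finite_measure_subadditive_finite[of "?I \<times> ?I" "%(I, J). E I J"] Em by (auto simp: case_prod_unfold)
 also have "... <= (\<Sum>(I, J)\<in>?I \<times> ?I. 3 * (h * sqrt (of_int p)))" by (intro sum_mono) (use E in auto)
 also have "... = (2 * of_int KK)^2 * (3 * (h * sqrt (of_int p)))"
  using p R by (simp add: card_cartesian_product power2_eq_square)
 finally show ?thesis .
qed

text \<open>The constants of this and the next two bounds are 486 from \<open>gauss_maximal\<close>
  times \<open>5^4 = 625\<close> or \<open>4^4 = 256\<close>; here the square of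
  \<open>2 * B\<close> contributes another 4.\<close>

lemma bad_osc_prob: "measure GM bad_osc <= 2 * of_int KK * (1215000 / (of_int p)^2)"
proof -
 have "measure GM bad_osc <= (SUM I:{-KK..<KK}. measure GM (osc_event (I*B) (2*B) (sN / 5)))"
  unfolding bad_osc_def by (rule gauss.prod.P.finite_measure_subadditive_finite) auto
 also have "... <= (SUM I:{-KK..<KK}. 1215000 / (of_int p)^2)"
 proof (rule sum_mono)
  fix I
  have "measure GM (osc_event (I*B) (2*B) (sN / 5)) <= 486 * (of_int (2*B))^2 / (sN / 5) ^ 4"
   by (rule osc_event_prob) (use NN in simp)
  also have "(sN / 5) ^ 4 = (of_int p)^2 * (of_int B)^2 / 625" by (rule sN4)
  also have "486 * (of_int (2*B))^2 / ((of_int p)^2 * (of_int B)^2 / 625) = 1215000 / (of_int p :: real)^2"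
   using B p by (simp add: field_simps)
  finally show "measure GM (osc_event (I*B) (2*B) (sN / 5)) <= 1215000 / (of_int p)^2" .
 qed
 also have "... = 2 * of_int KK * (1215000 / (of_int p)^2)" using p R by simp
 finally show ?thesis .
qed

lemma bad_start_prob: "measure GM bad_start <= 303750 * ((of_int (\<rho> ^ \<kappa>) + 1) / of_int p)^2"
proof -
 have "measure GM bad_start <= 486 * (of_int (lv \<kappa> + B))^2 / (sN / 5) ^ 4"
  unfolding bad_start_def by (rule osc_event_prob) (use NN in simp)
 also have "(sN / 5) ^ 4 = (of_int p)^2 * (of_int B)^2 / 625" by (rule sN4)
 also have "of_int (lv \<kappa> + B) = (of_int (\<rho> ^ \<kappa>) + 1) * (of_int B :: real)" by (simp add: algebra_simps)
 also have "486 * ((of_int (\<rho> ^ \<kappa>) + 1) * of_int B)^2 / ((of_int p)^2 * (of_int B)^2 / 625)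
   = 303750 * ((of_int (\<rho> ^ \<kappa>) + 1) / (of_int p :: real))^2"
  using B p by (simp add: power_mult_distrib power_divide)
 finally show ?thesis .
qed

lemma bad_small_prob: "measure GM bad_small <= real \<kappa> * (124416 / (of_int \<rho>)^2)"
proof -
 have "measure GM bad_small <= (SUM j:{1..\<kappa>}. measure GM (osc_event 0 (lv (j - 1)) (sqrt (of_int (lv j)) / 4)))"
  unfolding bad_small_def by (rule gauss.prod.P.finite_measure_subadditive_finite) auto
 also have "... <= (SUM j:{1..\<kappa>}. 124416 / (of_int \<rho>)^2)"
 proof (rule sum_mono)
  fix j assume "j \<in> {1..\<kappa>}"
  hence lj: "lv j = \<rho> * lv (j - 1)" by (cases j) auto
  let ?l = "of_int (lv (j - 1)) :: real"
  have l: "0 < ?l" using lv_ge[of "j - 1"] B by (subst of_int_0_less_iff) linarith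
  have r: "0 < real_of_int \<rho>" using \<rho> by simp
  have e: "real_of_int (lv j) = of_int \<rho> * ?l" unfolding lj by simp
  have "measure GM (osc_event 0 (lv (j - 1)) (sqrt (of_int (lv j)) / 4)) <= 486 * ?l^2 / (sqrt (of_int (lv j)) / 4) ^ 4"
   by (rule osc_event_prob) (unfold e, use l r in simp)
  also have "(sqrt (of_int (lv j)) / 4) ^ 4 = (of_int \<rho>)^2 * ?l^2 / 256"
  proof -
   have "0 <= of_int \<rho> * ?l" using l r by simp
   hence "(sqrt (of_int \<rho> * ?l))^2 = of_int \<rho> * ?l" by (rule real_sqrt_pow2)
   hence "sqrt (of_int \<rho> * ?l) ^ 4 = (of_int \<rho> * ?l)^2" using power_mult[of "sqrt (of_int \<rho> * ?l)" 2 2] by simp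
   thus ?thesis unfolding e by (simp add: power_divide power_mult_distrib)
  qed
  also have "486 * ?l^2 / ((of_int \<rho>)^2 * ?l^2 / 256) = 124416 / (of_int \<rho>)^2" using l r B by (simp add: field_simps)
  finally show "measure GM (osc_event 0 (lv (j - 1)) (sqrt (of_int (lv j)) / 4)) <= 124416 / (of_int \<rho>)^2" .
 qed
 also have "... = real \<kappa> * (124416 / (of_int \<rho>)^2)" by simp
 finally show ?thesis .
qed

lemma bad_trial_prob: "measure GM bad_right <= (1 - p0) ^ nat R" "measure GM bad_left <= (1 - p0) ^ nat R"
 "measure GM bad_exit <= (1 - p0) ^ \<kappa>"
proof -
 have *: "i * NN < (i+1) * NN" for i using NN by (simp add: distrib_right)
 have m: "i * NN <= j * NN" if "i <= j" for i j using that NN by (intro mult_right_mono) auto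
 have d: "disjoint_family_on (%i. {i*NN..<(i+1)*NN}) J" for J unfolding disjoint_family_on_def
 proof (intro ballI impI)
  fix i j :: int assume "i \<noteq> j"
  hence "i + 1 <= j \<or> j + 1 <= i" by linarith
  thus "{i*NN..<(i+1)*NN} \<inter> {j*NN..<(j+1)*NN} = {}" using m[of "i+1" j] m[of "j+1" i] by fastforce
 qed
 show "measure GM bad_right <= (1 - p0) ^ nat R"
  using gauss_trials_rise(1)[of "{0..<R}" "%i. i*NN" "%i. (i+1)*NN", OF _ * d] unfolding bad_right_def by simp
 have d': "disjoint_family_on (%i. {-(i+1)*NN..<-i*NN}) {1..R}" unfolding disjoint_family_on_def
 proof (intro ballI impI)
  fix i j :: int assume "i \<noteq> j"
  hence "-i <= -(j+1) \<or> -j <= -(i+1)" by linarith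
  thus "{-(i+1)*NN..<-i*NN} \<inter> {-(j+1)*NN..<-j*NN} = {}" using m[of "-i" "-(j+1)"] m[of "-j" "-(i+1)"] by fastforce
 qed
 have *: "-(i+1) * NN < -i * NN" for i using NN by (simp add: algebra_simps)
 show "measure GM bad_left <= (1 - p0) ^ nat R"
  using gauss_trials_rise(2)[of "{1..R}" "%i. -(i+1)*NN" "%i. -i*NN", OF _ * d'] unfolding bad_left_def by simp
 have d'': "disjoint_family_on (%j. {lv (j-1)..<lv j}) {1..\<kappa>}" unfolding disjoint_family_on_def
 proof (intro ballI impI)
  fix i j assume "i \<in> {1..\<kappa>}" "j \<in> {1..\<kappa>}" "i \<noteq> j"
  hence "i <= j - 1 \<or> j <= i - 1" by auto
  thus "{lv (i-1)..<lv i} \<inter> {lv (j-1)..<lv j} = {}" using lv_mono[of i "j-1"] lv_mono[of j "i-1"] by fastforce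
 qed
 show "measure GM bad_exit <= (1 - p0) ^ \<kappa>"
  using gauss_trials_rise(1)[of "{1..\<kappa>}" "%j. lv (j-1)" lv, OF _ lv_less d''] unfolding bad_exit_def by simp
qed

end

lemma power_small: assumes "0 <= x" "x < 1" "0 < b" shows "\<exists>n\<ge>1. x ^ n <= (b :: real)"
proof -
 have "(%n. x ^ n) \<longlonglongrightarrow> 0" by (rule LIMSEQ_realpow_zero) (use assms in auto)
 hence "eventually (%n. x ^ n < b) sequentially" using assms by (simp add: order_tendsto_iff)
 hence "eventually (%n. 1 <= n & x ^ n < b) sequentially" by (intro eventually_conj eventually_ge_at_top)
 thus ?thesis using eventually_happens[of _ sequentially] by force
qed

text \<open>The order of choice matters: first the numbers of trials \<open>\<kappa>\<close> and
  \<open>R\<close>, then \<open>\<rho>\<close> to make \<open>\<kappa> / \<rho>^2\<close> small,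
  then \<open>p\<close> against oscillations of blocks and of the start, last \<open>h\<close>
  against ties, whose number is of order \<open>K^2\<close>. None of them depends on
  \<open>B\<close>, which stays free for the comparison with the potential.\<close>

theorem gauss_valley:
 fixes r \<beta> :: real
 assumes "0 < r" "0 < \<beta>"
 shows "\<exists>p K h. 0 < p & 2 / of_int p <= r & 0 < K & 0 < h & h <= 1 / 2 &
  (\<forall>B\<ge>1. 1 - \<beta> <= measure GM {y. \<exists>q. valley h (2 * B) (K * B) (%k. psum y k / sqrt (of_int (p * B))) q})"
proof -
 define b where "b = \<beta> / 7"
 have b: "0 < b" unfolding b_def using assms by simp
 obtain \<kappa> where \<kappa>: "1 <= \<kappa>" "(1 - p0) ^ \<kappa> <= b" using power_small[of "1 - p0" b] p0 b by auto
 define R where "R = int \<kappa>"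
 have R: "1 <= R" unfolding R_def using \<kappa> by simp
 obtain c where c: "real \<kappa> * 124416 / b < real c" using reals_Archimedean2 by blast
 define \<rho> where "\<rho> = int c + 4"
 have \<rho>: "4 <= \<rho>" unfolding \<rho>_def by simp
 have \<rho>b: "real \<kappa> * (124416 / (of_int \<rho>)^2) <= b"
 proof -
  have "real \<kappa> * 124416 / b <= real_of_int \<rho>" using c unfolding \<rho>_def by simp
  also have "... <= (real_of_int \<rho>)^2" using \<rho> by (intro self_le_power) auto
  finally show ?thesis using b \<rho> by (simp add: field_simps)
 qed
 define X where "X = of_int (\<rho> ^ \<kappa>) + 2 / r + 2430000 * (of_int R + 1) / b + 303750 * (of_int (\<rho> ^ \<kappa>) + 1)^2 / b"
 obtain n where n: "X < real n" using reals_Archimedean2 by blast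
 define p where "p = int n + 1"
 have p: "1 <= p" and pX: "X <= of_int p" using n unfolding p_def by auto
 have pos: "0 <= real_of_int (\<rho> ^ \<kappa>)" "0 <= 2 / r" "0 <= 2430000 * (of_int R + 1) / b" "0 <= 303750 * (of_int (\<rho> ^ \<kappa>) + 1)^2 / b"
  using \<rho> assms(1) R b by auto
 have le: "2 / r <= of_int p" "2430000 * (of_int R + 1) / b <= of_int p" "303750 * (of_int (\<rho> ^ \<kappa>) + 1)^2 / b <= of_int p"
  using pX pos unfolding X_def by linarith+
 have "real_of_int (\<rho> ^ \<kappa>) < of_int p"
  using pX pos n unfolding X_def p_def of_int_add of_int_of_nat_eq of_int_1 by linarith
 hence \<rho>p: "\<rho> ^ \<kappa> < p" by (simp only: of_int_less_iff)
 have p1: "0 < real_of_int p" using p by simp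
 define K where "K = (R + 1) * p"
 have K: "0 < K" unfolding K_def using R p by simp
 define Y where "Y = (2 * of_int K)^2 * (3 * sqrt (of_int p))"
 have Y: "0 < Y" unfolding Y_def using K p by simp
 define h where "h = min (1 / 2) (min (1 / (4 * sqrt (of_int p))) (b / Y))"
 have h: "0 < h" "h <= 1 / 2" "h * sqrt (of_int p) <= 1 / 4" "h * Y <= b"
 proof -
  show "0 < h" unfolding h_def using p b Y by auto
  show "h <= 1 / 2" unfolding h_def by (rule min.cobounded1)
  have "h <= 1 / (4 * sqrt (of_int p))" "h <= b / Y" unfolding h_def by auto
  thus "h * sqrt (of_int p) <= 1 / 4" "h * Y <= b" using p Y by (simp_all add: field_simps)
 qed
 have main: "1 - \<beta> <= measure GM {y. \<exists>q. valley h (2 * B) (K * B) (%k. psum y k / sqrt (of_int (p * B))) q}" (is "_ <= measure GM ?G")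
  if B: "1 <= B" for B
 proof -
  note a = B p R \<rho> \<rho>p \<kappa>(1) h(1-3)
  note sets = bad_sets[OF a]
  have G: "?G \<in> sets GM" by (intro sets_GM_I pred_intros_countable valley_measurable) measurable
  let ?b = "bad_tie B p R h \<union> bad_osc B p R \<union> bad_right B p R \<union> bad_left B p R \<union> bad_start B p \<rho> \<kappa> \<union> bad_small B \<rho> \<kappa> \<union> bad_exit B \<rho> \<kappa>"
  have "- ?G \<subseteq> ?b" using good_valley[OF a] unfolding K_def by blast
  hence "measure GM (- ?G) <= measure GM ?b"
   by (intro gauss.prod.P.finite_measure_mono sets.Un sets)
  also have "... <= measure GM (bad_tie B p R h) + measure GM (bad_osc B p R) + measure GM (bad_right B p R) +
   measure GM (bad_left B p R) + measure GM (bad_start B p \<rho> \<kappa>) + measure GM (bad_small B \<rho> \<kappa>) + measure GM (bad_exit B \<rho> \<kappa>)"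
   by (intro order_trans[OF measure_Un_le] add_mono order_refl sets.Un sets)
  also have "... <= b + b + b + b + b + b + b"
  proof (intro add_mono)
   have "(2 * of_int ((R + 1) * p))^2 * (3 * (h * sqrt (of_int p))) = h * Y" unfolding Y_def K_def by (simp only: mult_ac)
   thus "measure GM (bad_tie B p R h) <= b" using bad_tie_prob[OF a] h(4) by linarith
   have "2 * of_int ((R + 1) * p) * (1215000 / (of_int p)^2) = 2430000 * (of_int R + 1) / (of_int p :: real)"
    using p by (simp add: power2_eq_square field_simps)
   also have "... <= b" using le(2) b p1 by (simp add: field_simps)
   finally show "measure GM (bad_osc B p R) <= b" using bad_osc_prob[OF a] by linarith
   show "measure GM (bad_right B p R) <= b" "measure GM (bad_left B p R) <= b" "measure GM (bad_exit B \<rho> \<kappa>) <= b"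
    using bad_trial_prob[OF a] \<kappa>(2) unfolding R_def by auto
   have "303750 * ((of_int (\<rho> ^ \<kappa>) + 1) / of_int p)^2 = 303750 * (of_int (\<rho> ^ \<kappa>) + 1)^2 / (of_int p :: real)^2"
    by (simp add: power_divide)
   also have "... <= 303750 * (of_int (\<rho> ^ \<kappa>) + 1)^2 / (of_int p :: real)"
    by (intro divide_left_mono self_le_power) (use p in auto)
   also have "... <= b" using le(3) b p1 by (simp add: pos_divide_le_eq mult.commute)
   finally show "measure GM (bad_start B p \<rho> \<kappa>) <= b" using bad_start_prob[OF a] by linarith
   show "measure GM (bad_small B \<rho> \<kappa>) <= b" using bad_small_prob[OF a] \<rho>b by linarith
  qed
  also have "... = \<beta>" unfolding b_def by simp
  finally have "measure GM (- ?G) <= \<beta>" .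
  moreover have "measure GM (- ?G) = 1 - measure GM ?G"
   using gauss.prod.P.prob_compl[OF G] by (simp add: Compl_eq_Diff_UNIV)
  ultimately show ?thesis by linarith
 qed
 have "2 / of_int p <= r" using le(1) assms(1) p1 by (simp add: field_simps)
 thus ?thesis using main p K h by (intro exI[of _ p] exI[of _ K] exI[of _ h]) auto
qed

section \<open>Comparison of the potential with the Gaussian random walk\<close>

lemma indep_joint_distr:
 fixes X :: "int => 'w => real"
 assumes "prob_space P" and X: "!!k. X k \<in> borel_measurable P" and ind: "prob_space.indep_vars P (%_. borel) X UNIV"
  and D: "!!k. distr P borel (X k) = D"
 shows "distr P (Pi\<^sub>M UNIV (%_. borel)) (%w k. X k w) = Pi\<^sub>M UNIV (%_. D)"
proof -
 interpret prob_space P by fact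
 have "distr P (Pi\<^sub>M UNIV (%_. borel)) (%w. \<lambda>k\<in>UNIV. X k w) = Pi\<^sub>M UNIV (%k. distr P borel (X k))"
  using indep_vars_iff_distr_eq_PiM[where I=UNIV and M'="%_. borel" and X=X] X ind by simp
 thus ?thesis unfolding D by (simp add: restrict_def)
qed

lemma conv_in_prob:
 fixes Y :: "nat => 'w => real"
 assumes "prob_space P" and Y [measurable]: "!!t. Y t \<in> borel_measurable P" "Z \<in> borel_measurable P"
  and lim: "!!x. x \<in> space P ==> (%t. Y t x) \<longlonglongrightarrow> Z x" and \<delta>: "0 < \<delta>"
 shows "(%t. measure P {x \<in> space P. \<delta> < abs(Y t x - Z x)}) \<longlonglongrightarrow> 0"
proof -
 interpret prob_space P by fact
 have "(%t. \<integral>x. indicator {x \<in> space P. \<delta> < abs(Y t x - Z x)} x \<partial>P) \<longlonglongrightarrow> (\<integral>x. 0 \<partial>P :: real)"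
 proof (rule integral_dominated_convergence[where w="%_. 1"])
  show "AE x in P. (%t. indicator {x \<in> space P. \<delta> < abs(Y t x - Z x)} x :: real) \<longlonglongrightarrow> 0"
  proof (rule AE_I2)
   fix x assume x: "x \<in> space P"
   have "eventually (%t. dist (Y t x) (Z x) < \<delta>) sequentially" using lim[OF x] \<delta> by (rule tendstoD)
   thus "(%t. indicator {x \<in> space P. \<delta> < abs(Y t x - Z x)} x :: real) \<longlonglongrightarrow> 0"
    by (intro tendsto_eventually) (auto elim!: eventually_mono simp: dist_real_def indicator_def)
  qed
 qed (auto simp: indicator_def)
 thus ?thesis by simp
qed

lemma sets_GM: "sets GM = sets (Pi\<^sub>M (UNIV :: int set) (%_. borel :: real measure))"
 by (intro sets_PiM_cong) auto

text \<open>
  Sequences of laws converging to the normal law are realised by almost surely convergent variables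
  on one space; a product of copies of that space carries all increments simultaneously.
\<close>

definition transfers :: "(int => real) measure => int set => real => real => bool" where
 "transfers N J \<delta> \<beta> \<longleftrightarrow> (\<forall>E E'. E \<in> sets GM --> E' \<in> sets GM -->
  (\<forall>y y'. (\<forall>k\<in>J. abs(y k - y' k) <= \<delta>) --> y \<in> E --> y' \<in> E') -->
  measure N E <= measure GM E' + \<beta> & measure GM E <= measure N E' + \<beta>)"

text \<open>Only the finitely many coordinates in \<open>J\<close> are compared, so a union bound
  over them suffices; \<open>c\<close> accommodates a normalisation that is correct only in the
  limit.\<close>

lemma iid_transfer:
 fixes \<mu> :: "nat => real measure" and c :: "nat => real"
 assumes \<mu>: "!!t. real_distribution (\<mu> t)" "weak_conv_m \<mu> std_normal_distribution" and c: "c \<longlonglongrightarrow> 1"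
  and J: "finite J" and \<delta>: "0 < \<delta>" and \<beta>: "0 < \<beta>"
 shows "\<forall>\<^sub>F t in sequentially. transfers (Pi\<^sub>M UNIV (%_. distr (\<mu> t) borel (%x. c t * x))) J \<delta> \<beta>"
proof -
 from Skorohod[OF \<mu>(1) real_dist_normal_dist \<mu>(2)]
 obtain \<Omega> :: "real measure" and Y Z where \<Omega>: "prob_space \<Omega>" and sk: "\<forall>t. Y t \<in> borel_measurable \<Omega>"
  "\<forall>t. distr \<Omega> borel (Y t) = \<mu> t" "Z \<in> measurable \<Omega> lborel" and Zd: "distr \<Omega> borel Z = std_normal_distribution"
  and lim: "\<forall>x\<in>space \<Omega>. (%t. Y t x) \<longlonglongrightarrow> Z x"
  by (elim exE conjE) (rule that)
 have Y: "Y t \<in> borel_measurable \<Omega>" and Yd: "distr \<Omega> borel (Y t) = \<mu> t" for t using sk by blast+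
 have Z: "Z \<in> borel_measurable \<Omega>" using sk(3) by simp
 interpret Q: iid \<Omega> using \<Omega> unfolding iid_def .
 let ?Q = "Pi\<^sub>M (UNIV :: int set) (%_. \<Omega>)"
 let ?B = "Pi\<^sub>M (UNIV :: int set) (%_. borel :: real measure)"
 have law: "distr ?Q ?B (%w k. V (w k)) = Pi\<^sub>M UNIV (%_. distr \<Omega> borel V)" and Vm: "(%w k. V (w k)) \<in> ?Q \<rightarrow>\<^sub>M ?B"
  if V: "V \<in> borel_measurable \<Omega>" for V :: "real => real"
 proof -
  have m: "(%w. V (w k)) \<in> borel_measurable ?Q" for k by (rule measurable_compose[OF _ V], rule measurable_component_singleton) simp
  show "(%w k. V (w k)) \<in> ?Q \<rightarrow>\<^sub>M ?B" by (rule measurable_PiM_single') (use m in auto)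
  show "distr ?Q ?B (%w k. V (w k)) = Pi\<^sub>M UNIV (%_. distr \<Omega> borel V)"
  proof (rule indep_joint_distr[OF Q.prod.P.prob_space_axioms m])
   show "Q.prod.P.indep_vars (%_. borel) (%k w. V (w k)) UNIV"
    by (rule Q.indep_vars_depends[where K="%k. {k}"]) (use m in \<open>auto simp: depends_def disjoint_family_on_def\<close>)
   fix k
   have "distr ?Q borel (%w. V (w k)) = distr (distr ?Q \<Omega> (%w. w k)) borel V"
    by (subst distr_distr[OF V]) (auto simp: comp_def)
   also have "distr ?Q \<Omega> (%w. w k) = \<Omega>"
    using distr_PiM_component[of UNIV "%_. \<Omega>" k] \<Omega> by simp
   finally show "distr ?Q borel (%w. V (w k)) = distr \<Omega> borel V" .
  qed
 qed
 have meas: "measure (Pi\<^sub>M UNIV (%_. distr \<Omega> borel V)) E = measure ?Q {w \<in> space ?Q. (%k. V (w k)) \<in> E}"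
  if V: "V \<in> borel_measurable \<Omega>" and E: "E \<in> sets ?B" for V E
  unfolding law[OF V, symmetric] using measure_distr[OF Vm[OF V] E] by (simp add: vimage_def Int_def conj_commute)
 have sets: "{w \<in> space ?Q. (%k. V (w k)) \<in> E} \<in> sets ?Q" if V: "V \<in> borel_measurable \<Omega>" and E: "E \<in> sets ?B" for V E
  using measurable_sets[OF Vm[OF V] E] by (simp add: vimage_def Int_def conj_commute)
 let ?Y = "%t x. c t * Y t x"
 have Ym: "?Y t \<in> borel_measurable \<Omega>" for t using Y by simp
 have Yd': "distr \<Omega> borel (?Y t) = distr (\<mu> t) borel (%x. c t * x)" for t
  unfolding Yd[symmetric] by (subst distr_distr) (use Y in \<open>auto simp: comp_def\<close>)
 define F where "F t = {x \<in> space \<Omega>. \<delta> < abs(?Y t x - Z x)}" for t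
 have Fm: "F t \<in> sets \<Omega>" for t unfolding F_def using Ym Z by measurable
 define G where "G t = {w \<in> space ?Q. \<exists>k\<in>J. w k \<in> F t}" for t
 have Gm: "G t \<in> sets ?Q" for t unfolding G_def using Fm J by measurable
 have "(%t. measure \<Omega> (F t)) \<longlonglongrightarrow> 0" unfolding F_def
 proof (rule conv_in_prob[OF \<Omega> Ym Z _ \<delta>])
  show "(%t. ?Y t x) \<longlonglongrightarrow> Z x" if "x \<in> space \<Omega>" for x using tendsto_mult[OF c bspec[OF lim that]] by simp
 qed
 hence "(%t. real (card J) * measure \<Omega> (F t)) \<longlonglongrightarrow> real (card J) * 0" by (rule tendsto_mult_left)
 hence "eventually (%t. real (card J) * measure \<Omega> (F t) < \<beta>) sequentially" using \<beta> by (simp add: order_tendsto_iff)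
 thus ?thesis
 proof eventually_elim
  case (elim t)
  have G: "measure ?Q (G t) <= \<beta>"
  proof -
   have "G t = (\<Union>k\<in>J. {w \<in> space ?Q. w k \<in> F t})" unfolding G_def by auto
   hence "measure ?Q (G t) <= (SUM k:J. measure ?Q {w \<in> space ?Q. w k \<in> F t})"
    using measure_UNION_le[OF J, of "%k. {w \<in> space ?Q. w k \<in> F t}" ?Q] Fm by simp
   also have "... = (SUM k:J. measure \<Omega> (F t))"
   proof (rule sum.cong)
    fix k
    have "distr ?Q \<Omega> (%w. w k) = \<Omega>" using distr_PiM_component[of UNIV "%_. \<Omega>" k] \<Omega> by simp
    moreover have "measure (distr ?Q \<Omega> (%w. w k)) (F t) = measure ?Q {w \<in> space ?Q. w k \<in> F t}"
     by (subst measure_distr) (use Fm in \<open>auto simp: vimage_def Int_def conj_commute\<close>)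
    ultimately show "measure ?Q {w \<in> space ?Q. w k \<in> F t} = measure \<Omega> (F t)" by simp
   qed simp
   finally show ?thesis using elim by simp
  qed
  have key: "measure (Pi\<^sub>M UNIV (%_. distr \<Omega> borel V)) E <= measure (Pi\<^sub>M UNIV (%_. distr \<Omega> borel V')) E' + \<beta>"
   if V: "V \<in> borel_measurable \<Omega>" "V' \<in> borel_measurable \<Omega>" and E: "E \<in> sets ?B" "E' \<in> sets ?B"
    and EE: "!!y y'. (\<forall>k\<in>J. abs(y k - y' k) <= \<delta>) ==> y \<in> E ==> y' \<in> E'"
    and VV: "!!x. x \<in> space \<Omega> ==> x \<notin> F t ==> abs(V x - V' x) <= \<delta>" for V V' E E'
  proof -
   have "{w \<in> space ?Q. (%k. V (w k)) \<in> E} \<subseteq> {w \<in> space ?Q. (%k. V' (w k)) \<in> E'} \<union> G t"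
   proof
    fix w assume w: "w \<in> {w \<in> space ?Q. (%k. V (w k)) \<in> E}"
    have "(%k. V' (w k)) \<in> E'" if "w \<notin> G t"
    proof (rule EE)
     show "(%k. V (w k)) \<in> E" using w by simp
     show "\<forall>k\<in>J. abs(V (w k) - V' (w k)) <= \<delta>"
      using that w VV unfolding G_def by (auto simp: space_PiM)
    qed
    thus "w \<in> {w \<in> space ?Q. (%k. V' (w k)) \<in> E'} \<union> G t" using w by auto
   qed
   hence "measure ?Q {w \<in> space ?Q. (%k. V (w k)) \<in> E} <= measure ?Q ({w \<in> space ?Q. (%k. V' (w k)) \<in> E'} \<union> G t)"
    by (intro Q.prod.P.finite_measure_mono sets.Un Gm sets V E)
   also have "... <= measure ?Q {w \<in> space ?Q. (%k. V' (w k)) \<in> E'} + measure ?Q (G t)"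
    by (intro measure_Un_le Gm sets V E)
   finally show ?thesis using G unfolding meas[OF V(1) E(1)] meas[OF V(2) E(2)] by linarith
  qed
  have VV: "abs(?Y t x - Z x) <= \<delta>" "abs(Z x - ?Y t x) <= \<delta>" if "x \<in> space \<Omega>" "x \<notin> F t" for x
   using that unfolding F_def by (auto simp: not_less abs_minus_commute)
  show ?case unfolding transfers_def Yd'[symmetric] sets_GM
  proof (intro allI impI conjI)
   fix E E' assume E: "E \<in> sets ?B" "E' \<in> sets ?B" and EE: "\<forall>y y'. (\<forall>k\<in>J. abs(y k - y' k) <= \<delta>) --> y \<in> E --> y' \<in> E'"
   show "measure (Pi\<^sub>M UNIV (%_. distr \<Omega> borel (?Y t))) E <= measure GM E' + \<beta>"
    unfolding Zd[symmetric] by (rule key[OF Ym Z E _ VV(1)]) (use EE in blast)+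
   show "measure GM E <= measure (Pi\<^sub>M UNIV (%_. distr \<Omega> borel (?Y t))) E' + \<beta>"
    unfolding Zd[symmetric] by (rule key[OF Z Ym E _ VV(2)]) (use EE in blast)+
  qed
 qed
qed

section \<open>Coarse-graining of the potential at scale ln t\<close>

context centred
begin

text \<open>Chosen so that the potential over one mesh cell has standard deviation close to
  \<open>ln t / sqrt L\<close>; then \<open>L\<close> cells make one unit of height, and
  \<open>skel\<close> is nearly standard normal.\<close>

definition mesh :: "int => nat => int" where "mesh L t = \<lfloor>(ln (real t))\<^sup>2 / (\<sigma>^2 * of_int L)\<rfloor>"

definition skel :: "int => nat => (int => 'a) => int => real" where
 "skel L t w k = sqrt (of_int L) / ln (real t) * U (k * mesh L t) ((k + 1) * mesh L t) w"

lemma skel_measurable [measurable]: "(%w. skel L t w k) \<in> borel_measurable M"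
 unfolding skel_def by measurable

lemma mesh_lim:
 assumes "0 < \<sigma>" "0 < L"
 shows "filterlim (mesh L) at_top sequentially"
  and "(%t. \<sigma> * sqrt (of_int (L * mesh L t)) / ln (real t)) \<longlonglongrightarrow> 1"
proof -
 define a where "a = 1 / (\<sigma>^2 * of_int L)"
 have a: "0 < a" unfolding a_def using assms by simp
 have lb: "a * (ln (real t))^2 - 1 <= of_int (mesh L t)" "of_int (mesh L t) <= a * (ln (real t))^2" for t
  unfolding mesh_def a_def using floor_correct[of "(ln (real t))^2 / (\<sigma>^2 * of_int L)"] by (simp_all, linarith?)
 have at: "filterlim (%t. a * (ln (real t))^2 - 1) at_top sequentially" using a by real_asymp
 have "filterlim (%t. real_of_int (mesh L t)) at_top sequentially"
  by (rule filterlim_at_top_mono[OF at]) (use lb in simp)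
 thus "filterlim (mesh L) at_top sequentially"
  unfolding filterlim_at_top
 proof (intro allI)
  fix Z :: int assume "\<forall>Z. eventually (%t. Z <= real_of_int (mesh L t)) sequentially"
  hence "eventually (%t. real_of_int Z <= real_of_int (mesh L t)) sequentially" by blast
  thus "eventually (%t. Z <= mesh L t) sequentially" by eventually_elim simp
 qed
 have "(%t. of_int (mesh L t) / (a * (ln (real t))^2)) \<longlonglongrightarrow> 1"
 proof (rule tendsto_sandwich[of "%t. (a * (ln (real t))^2 - 1) / (a * (ln (real t))^2)" _ _ "%_. 1"])
  show "(%t. (a * (ln (real t))^2 - 1) / (a * (ln (real t))^2)) \<longlonglongrightarrow> 1" using a by real_asymp
  show "\<forall>\<^sub>F t in sequentially. (a * (ln (real t))^2 - 1) / (a * (ln (real t))^2) <= of_int (mesh L t) / (a * (ln (real t))^2)"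
   using lb a by (intro always_eventually allI divide_right_mono) auto
  show "\<forall>\<^sub>F t in sequentially. of_int (mesh L t) / (a * (ln (real t))^2) <= 1"
  proof (intro always_eventually allI)
   fix t show "of_int (mesh L t) / (a * (ln (real t))^2) <= 1"
    using lb(2)[of t] a by (cases "ln (real t) = 0") (auto simp: divide_le_eq)
  qed
 qed auto
 hence "(%t. sqrt (of_int (mesh L t) / (a * (ln (real t))^2))) \<longlonglongrightarrow> sqrt 1" by (rule tendsto_real_sqrt)
 hence lim: "(%t. sqrt (of_int (mesh L t) / (a * (ln (real t))^2))) \<longlonglongrightarrow> 1" by simp
 have eq: "sqrt (of_int (mesh L t) / (a * (ln (real t))^2)) = \<sigma> * sqrt (of_int (L * mesh L t)) / ln (real t)" if "2 <= t" for t
 proof -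
  have "of_int (mesh L t) / (a * (ln (real t))^2) = \<sigma>^2 * of_int (L * mesh L t) / (ln (real t))^2"
   unfolding a_def by simp
  thus ?thesis using assms that by (simp only: real_sqrt_divide real_sqrt_mult real_sqrt_abs) simp
 qed
 show "(%t. \<sigma> * sqrt (of_int (L * mesh L t)) / ln (real t)) \<longlonglongrightarrow> 1"
  by (rule Lim_transform_eventually[OF lim eventually_mono[OF eventually_ge_at_top[of 2] eq]])
qed

theorem transfer:
 assumes \<sigma>: "0 < \<sigma>" and L: "0 < L" and J: "finite J" and \<delta>: "0 < \<delta>" and \<beta>: "0 < \<beta>"
 shows "\<forall>\<^sub>F t in sequentially. transfers (distr M GM (skel L t)) J \<delta> \<beta>"
proof -
 define n where "n t = nat (mesh L t)" for t
 \<comment> \<open>The rounding factor between the normalisation by \<open>ln t\<close> in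
   \<open>skel\<close> and that by \<open>sqrt n\<close> in the central limit theorem.\<close>
 define c where "c t = \<sigma> * sqrt (of_int (L * mesh L t)) / ln (real t)" for t
 define \<mu> where "\<mu> t = distr M borel (%w. U 0 (int (n t)) w / (\<sigma> * sqrt (real (n t))))" for t
 have \<mu>: "real_distribution (\<mu> t)" for t unfolding \<mu>_def by (rule prod.P.real_distribution_distr) simp
 have nt: "filterlim n at_top sequentially" unfolding n_def
  by (rule filterlim_compose[OF filterlim_nat_sequentially mesh_lim(1)[OF \<sigma> L]])
 have v: "weak_conv_m \<mu> std_normal_distribution" unfolding weak_conv_m_def weak_conv_def
 proof (intro allI impI)
  fix x assume "isCont (cdf std_normal_distribution) x"
  hence "(%n. cdf (distr M borel (%w. U 0 (int n) w / (\<sigma> * sqrt (real n)))) x) \<longlonglongrightarrow> cdf std_normal_distribution x"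
   using clt[OF \<sigma>] unfolding weak_conv_m_def weak_conv_def by blast
  from filterlim_compose[OF this nt] show "(%t. cdf (\<mu> t) x) \<longlonglongrightarrow> cdf std_normal_distribution x" unfolding \<mu>_def .
 qed
 have "eventually (%t. 1 <= mesh L t) sequentially"
  using mesh_lim(1)[OF \<sigma> L] unfolding filterlim_at_top by blast
 thus ?thesis using iid_transfer[OF \<mu> v mesh_lim(2)[OF \<sigma> L, folded c_def] J \<delta> \<beta>]
 proof eventually_elim
  case (elim t)
  let ?m = "mesh L t"
  have X: "(%w. skel L t w k) \<in> borel_measurable M" for k by (rule skel_measurable)
  have law: "distr M borel (%w. skel L t w k) = distr (\<mu> t) borel (%x. c t * x)" for k
  proof -
   have "c t * (x / (\<sigma> * sqrt (real (n t)))) = sqrt (of_int L) / ln (real t) * x" for x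
    unfolding c_def n_def using \<sigma> elim(1) by (simp add: real_sqrt_mult)
   hence "distr (\<mu> t) borel (%x. c t * x) = distr M borel (%w. sqrt (of_int L) / ln (real t) * U 0 ?m w)"
    unfolding \<mu>_def using elim(1) by (subst distr_distr) (auto simp: comp_def n_def)
   also have "... = distr (distr M borel (U 0 ?m)) borel (%x. sqrt (of_int L) / ln (real t) * x)"
    by (subst distr_distr) (auto simp: comp_def)
   also have "distr M borel (U 0 ?m) = distr M borel (U (k * ?m) ((k + 1) * ?m))"
    using U_distr[of 0 "k * ?m" ?m] by (simp add: algebra_simps)
   also have "distr (distr M borel (U (k * ?m) ((k + 1) * ?m))) borel (%x. sqrt (of_int L) / ln (real t) * x) = distr M borel (%w. skel L t w k)"
    by (subst distr_distr) (auto simp: comp_def skel_def)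
   finally show ?thesis ..
  qed
  have "prod.indep_vars (%_. borel) (%k w. skel L t w k) UNIV"
  proof (rule indep_vars_depends[where K="%k. {k * ?m<..<(k + 1) * ?m}"])
   show "(%w. skel L t w k) \<in> borel_measurable M" for k by (rule X)
   show "depends {k * ?m<..<(k + 1) * ?m} (%w. skel L t w k)" for k
    unfolding skel_def by (rule depends_comp[OF U_depends])
   show "disjoint_family_on (%k. {k * ?m<..<(k + 1) * ?m}) UNIV" unfolding disjoint_family_on_def
   proof (intro ballI impI)
    fix i j :: int assume "i \<noteq> j"
    hence "(i + 1) * ?m <= j * ?m \<or> (j + 1) * ?m <= i * ?m" by (rule blocks_ordered) (use elim(1) in simp)
    thus "{i * ?m<..<(i + 1) * ?m} \<inter> {j * ?m<..<(j + 1) * ?m} = {}" by (auto simp del: mult_le_cancel_right)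
   qed
  qed
  note ind = this
  have joint: "distr M (Pi\<^sub>M UNIV (%_. borel)) (%w k. skel L t w k) = Pi\<^sub>M UNIV (%_. distr (\<mu> t) borel (%x. c t * x))"
  proof (rule indep_joint_distr[OF prod.P.prob_space_axioms])
   show "(%w. skel L t w k) \<in> borel_measurable M" for k by (rule X)
   show "distr M borel (%w. skel L t w k) = distr (\<mu> t) borel (%x. c t * x)" for k by (rule law)
  qed (rule ind)
  have "distr M GM (skel L t) = distr M (Pi\<^sub>M UNIV (%_. borel)) (%w k. skel L t w k)" by (intro distr_cong sets_GM) auto
  with elim(2) show ?case unfolding joint by simp
 qed
qed

lemma skel_GM [measurable]: "skel L t \<in> M \<rightarrow>\<^sub>M GM"
proof -
 have "(%w k. skel L t w k) \<in> M \<rightarrow>\<^sub>M Pi\<^sub>M UNIV (%_. borel)" by (rule measurable_PiM_single') auto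
 thus ?thesis using measurable_cong_sets[OF refl sets_GM] by blast
qed

end

subsection \<open>Valleys of the potential\<close>

text \<open>Every condition compares two values of the path, so a uniform error
  \<open>\<delta>\<close> costs \<open>2 * \<delta>\<close> of the margin.\<close>

lemma valley_right_perturb:
 assumes v: "valley_right \<eta> r d s a q c" and s: "!!k. -d <= k ==> k <= d ==> abs(s k - s' k) <= \<delta>" and \<eta>: "\<eta>' <= \<eta> - 2 * \<delta>"
 shows "valley_right \<eta>' r d s' a q c"
proof -
 note v = v[unfolded valley_right_def]
 have b: "-d <= a" "a < 0" "0 <= q" "q < c" "c <= d" using v by auto
 have s1: "s' j - s' i <= s j - s i + 2 * \<delta>" if "a <= i" "i <= c" "a <= j" "j <= c" for i j
  using s[of i] s[of j] that b by (auto simp: abs_le_iff)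
 show ?thesis unfolding valley_right_def
 proof (intro conjI allI impI b)
  show "s' q + 1 + \<eta>' <= s' a" using s1[of a q] v \<eta> b by linarith
  show "s' q + 1 + \<eta>' <= s' c" using s1[of c q] v \<eta> b by linarith
  show "s' j - s' i <= 1 - \<eta>'" if ij: "a <= i" "i <= j" "j <= q" for i j
  proof -
   have "s j - s i <= 1 - \<eta>" using v ij by blast
   thus ?thesis using s1[of i j] ij \<eta> b by linarith
  qed
  show "s' j + \<eta>' <= s' a" if j: "0 <= j" "j <= q" for j
  proof -
   have "s j + \<eta> <= s a" using v j by blast
   thus ?thesis using s1[of a j] j \<eta> b by linarith
  qed
  show "s' q + \<eta>' <= s' i" if i: "a <= i" "i <= c" "r < abs(i - q)" for i
  proof -
   have "s q + \<eta> <= s i" using v i by blast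
   thus ?thesis using s1[of i q] i \<eta> b by linarith
  qed
 qed
qed

lemma valley_perturb:
 assumes v: "valley \<eta> r d s q" and s: "!!k. -d <= k ==> k <= d ==> abs(s k - s' k) <= \<delta>" and \<eta>: "\<eta>' <= \<eta> - 2 * \<delta>"
 shows "valley \<eta>' r d s' q"
proof -
 have "abs(s (- k) - s' (- k)) <= \<delta>" if "-d <= k" "k <= d" for k using s[of "-k"] that by simp
 note s' = this
 from v obtain a c where "valley_right \<eta> r d s a q c \<or> valley_right \<eta> r d (%k. s (- k)) (- c) (- q) (- a)"
  unfolding valley_def by blast
 thus ?thesis
 proof
  assume "valley_right \<eta> r d s a q c"
  from valley_right_perturb[OF this s \<eta>] show ?thesis unfolding valley_def by blast
 next
  assume "valley_right \<eta> r d (%k. s (- k)) (- c) (- q) (- a)"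
  from valley_right_perturb[OF this s' \<eta>] show ?thesis unfolding valley_def by blast
 qed
qed

text \<open>Passes from a valley of the coarse path \<open>s\<close> to the potential
  \<open>S\<close> on all layers. The rounding \<open>f\<close> is abstract because reflection turns
  rounding down into rounding up; it widens the neighbourhood of the bottom by one cell.\<close>

lemma valley_lift:
 fixes f :: "int => int" and S s :: "int => real"
 assumes v: "valley_right \<eta> r d s a q c" and n: "1 <= n" and T: "0 < T"
  and f: "!!x y. x <= y ==> f x <= f y" "!!k. f (k * n) = k" "!!x. abs(x - f x * n) <= n"
  and err: "!!x. -d <= f x ==> f x <= d ==> abs(S x - T * s (f x)) <= \<kappa>" and w: "w <= T * \<eta> - 2 * \<kappa>"
 shows "a * n < 0" "0 <= q * n" "q * n < c * n" "c * n - a * n <= 2 * d * n"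
  and "S (q * n) + T + w <= S (a * n)" "S (q * n) + T + w <= S (c * n)"
  and "!!x y. a * n <= x ==> x <= y ==> y <= q * n ==> S y - S x <= T - w"
  and "!!y. 0 <= y ==> y <= q * n ==> S y + w <= S (a * n)"
  and "!!x. a * n <= x ==> x <= c * n ==> (r + 1) * n < abs(x - q * n) ==> S (q * n) + w <= S x"
proof -
 note v = v[unfolded valley_right_def]
 have b: "-d <= a" "a < 0" "0 <= q" "q < c" "c <= d" using v by auto
 show "a * n < 0" "0 <= q * n" "q * n < c * n" using b n by (auto simp: mult_neg_pos)
 have "(c - a) * n <= (2 * d) * n" using b n by (intro mult_right_mono) auto
 thus "c * n - a * n <= 2 * d * n" by (simp add: algebra_simps)
 have S1: "S y - S x <= T * (s (f y) - s (f x)) + 2 * \<kappa>" if "a <= f x" "f x <= c" "a <= f y" "f y <= c" for x y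
 proof -
  have "abs(S x - T * s (f x)) <= \<kappa>" "abs(S y - T * s (f y)) <= \<kappa>" by (rule err; use that b in linarith)+
  thus ?thesis unfolding right_diff_distrib by linarith
 qed
 have fa: "f (a * n) = a" "f (q * n) = q" "f (c * n) = c" "f 0 = 0" using f(2) f(2)[of 0] by auto
 have TM: "T * x <= T * y" if "x <= y" for x y using T that by simp
 show "S (q * n) + T + w <= S (a * n)"
  using S1[of "a*n" "q*n"] TM[of "s q - s a" "- 1 - \<eta>"] v w b unfolding fa by (simp add: algebra_simps)
 show "S (q * n) + T + w <= S (c * n)"
  using S1[of "c*n" "q*n"] TM[of "s q - s c" "- 1 - \<eta>"] v w b unfolding fa by (simp add: algebra_simps)
 show "S y - S x <= T - w" if xy: "a * n <= x" "x <= y" "y <= q * n" for x y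
 proof -
  have i: "a <= f x" "f x <= f y" "f y <= q" using f(1)[OF xy(1)] f(1)[OF xy(2)] f(1)[OF xy(3)] fa by auto
  hence "s (f y) - s (f x) <= 1 - \<eta>" using v by blast
  from TM[OF this] show ?thesis using S1[of x y] i b w by (simp add: algebra_simps)
 qed
 show "S y + w <= S (a * n)" if y: "0 <= y" "y <= q * n" for y
 proof -
  have i: "0 <= f y" "f y <= q" using f(1)[OF y(1)] f(1)[OF y(2)] fa by auto
  hence "s (f y) - s a <= - \<eta>" using v by force
  from TM[OF this] show ?thesis using S1[of "a*n" y] i b w fa by (simp add: algebra_simps)
 qed
 show "S (q * n) + w <= S x" if x: "a * n <= x" "x <= c * n" "(r + 1) * n < abs(x - q * n)" for x
 proof -
  have i: "a <= f x" "f x <= c" using f(1)[OF x(1)] f(1)[OF x(2)] fa by auto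
  have "r < abs(f x - q)"
  proof (rule ccontr)
   assume "~ ?thesis"
   hence "abs(f x - q) * n <= r * n" using n by (intro mult_right_mono) auto
   moreover have "abs(f x * n - q * n) = abs(f x - q) * n" using n by (simp add: left_diff_distrib[symmetric] abs_mult)
   ultimately show False using f(3)[of x] x(3) unfolding distrib_right by linarith
  qed
  hence "s q - s (f x) <= - \<eta>" using v i by force
  from TM[OF this] show ?thesis using S1[of x "q*n"] i b w fa by (simp add: algebra_simps)
 qed
qed

context centred
begin

definition pot_at :: "(int => 'a) => int => real" where
 "pot_at w x = (if 0 <= x then U 0 (x + 1) w else - U x 1 w)"

definition profile :: "int => nat => (int => 'a) => int => real" where
 "profile L t w k = psum (skel L t w) k / sqrt (of_int L)"

text \<open>Controls the potential inside the mesh cells, about which the coarse increments say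
  nothing.\<close>

definition smooth :: "int => int => real => nat => (int => 'a) => bool" where
 "smooth L d \<delta> t w \<longleftrightarrow>
   (\<forall>k\<in>{-d..d}. \<forall>j\<in>{1..mesh L t}. abs(U (k * mesh L t) (k * mesh L t + j) w) <= \<delta> * ln (real t))"

lemma U_sum:
 assumes "a < b" "0 < n"
 shows "abs(U (a * n) (b * n) w - (SUM i:{a..<b}. U (i * n) ((i + 1) * n) w)) <= C * of_int (b - a)"
proof -
 have "a + 1 <= b" using assms by simp
 thus ?thesis
 proof (induction b rule: int_ge_induct)
  case base
  have "{a..<a+1} = {a}" by auto
  thus ?case using C_pos by simp
 next
  case (step b)
  have "{a..<b+1} = insert b {a..<b}" using step.hyps by auto
  moreover have "abs(U (a * n) ((b + 1) * n) w - U (a * n) (b * n) w - U (b * n) ((b + 1) * n) w) <= C"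
   by (rule U_qadd) (use step.hyps assms in auto)
  moreover have "C * of_int (b + 1 - a) = C * of_int (b - a) + C" by (simp add: algebra_simps)
  ultimately show ?case using step.IH by simp
 qed
qed

text \<open>One \<open>\<delta> * ln t\<close> covers the cutting errors, at most
  \<open>d + 2\<close> in number, by \<open>big\<close>; the other covers the oscillation inside the
  cell of \<open>x\<close>.\<close>

lemma pot_profile:
 assumes sm: "smooth L d \<delta> t w" and n: "1 <= mesh L t" and L: "0 < L" and T: "0 < ln (real t)"
  and big: "C * (of_int d + 2) <= \<delta> * ln (real t)" and k: "-d <= x div mesh L t" "x div mesh L t <= d"
 shows "abs(pot_at w x - ln (real t) * profile L t w (x div mesh L t)) <= 2 * \<delta> * ln (real t)"
proof -
 define n where "n = mesh L t"
 define k where "k = x div n"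
 define j where "j = x mod n"
 have n0: "0 < n" using n unfolding n_def by simp
 have x: "x = k * n + j" and j: "0 <= j" "j < n" unfolding k_def j_def using n0 by auto
 have kd: "k \<in> {-d..d}" using k unfolding k_def n_def by simp
 have osc: "abs(U (k * n) (k * n + i) w) <= \<delta> * ln (real t)" if "1 <= i" "i <= n" for i
  using sm kd that unfolding smooth_def n_def[symmetric] by auto
 have pr: "ln (real t) * profile L t w k = (if 0 <= k then SUM i:{0..<k}. U (i * n) ((i + 1) * n) w else - (SUM i:{k..<0}. U (i * n) ((i + 1) * n) w))"
  unfolding profile_def psum_def skel_def n_def[symmetric] using T L
  by (simp add: sum_divide_distrib[symmetric] sum_distrib_left[symmetric])
 have Ck: "C * of_int \<bar>k\<bar> + 2 * C <= \<delta> * ln (real t)"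
 proof -
  have "real_of_int \<bar>k\<bar> <= of_int d" using kd by auto
  hence "C * (of_int \<bar>k\<bar> + 2) <= C * (of_int d + 2)" using C_pos by (intro mult_left_mono) auto
  thus ?thesis using big by (simp add: algebra_simps)
 qed
 have "abs(pot_at w x - ln (real t) * profile L t w k) <= 2 * \<delta> * ln (real t)"
 proof (cases "0 <= k")
  case True
  have x0: "0 <= x" using x True j n0 by simp
  show ?thesis
  proof (cases "k = 0")
   case True
   thus ?thesis using osc[of "x + 1"] x j x0 unfolding pr pot_at_def by simp
  next
   case False
   hence k0: "0 < k" using True by simp
   have "abs(U 0 (x + 1) w - U 0 (k * n) w - U (k * n) (k * n + (j + 1)) w) <= C"
    using U_qadd[of 0 "k * n" "x + 1" w] k0 n0 x j by (simp add: algebra_simps)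
   moreover have "abs(U (0 * n) (k * n) w - (SUM i:{0..<k}. U (i * n) ((i + 1) * n) w)) <= C * of_int (k - 0)"
    by (rule U_sum[OF k0 n0])
   ultimately show ?thesis using osc[of "j + 1"] j k0 Ck C_pos x0 unfolding pr pot_at_def by simp
  qed
 next
  case False
  hence k0: "k < 0" by simp
  have "(k + 1) * n <= 0" using k0 n0 by (simp add: mult_nonpos_nonneg)
  hence x0: "x < 0" using x j by (simp add: distrib_right)
  have kn: "k * n < 0" using k0 n0 by (simp add: mult_neg_pos)
  have 1: "abs(U (k * n) 1 w - U (k * n) 0 w) <= C" using U_qadd[of "k * n" 0 1 w] U_unit[of 0 w] kn by simp
  have 2: "abs(U (k * n) 1 w - U x 1 w) <= C + \<delta> * ln (real t)"
  proof (cases "j = 0")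
   case True
   have "0 <= \<delta> * ln (real t)" using Ck C_pos by (smt (verit) mult_nonneg_nonneg of_int_0_le_iff abs_ge_zero)
   thus ?thesis using True x C_pos by simp
  next
   case False
   thus ?thesis using U_qadd[of "k * n" x 1 w] x x0 j osc[of j] by simp
  qed
  have "abs(U (k * n) (0 * n) w - (SUM i:{k..<0}. U (i * n) ((i + 1) * n) w)) <= C * of_int (0 - k)"
   by (rule U_sum[OF k0 n0])
  thus ?thesis using 1 2 k0 Ck x0 unfolding pr pot_at_def by simp
 qed
 thus ?thesis unfolding k_def n_def .
qed

section \<open>Oscillation inside a mesh cell\<close>

lemma U_tail:
 assumes "a < b" "0 < x"
 shows "measure M {w \<in> space M. x < abs(U a b w)} <= 48 * exp (C + 2 * C^2) * (of_int (b - a))^2 / x ^ 4"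
proof -
 have "measure M {w \<in> space M. x < abs(U a b w)} <= measure M {w \<in> space M. x ^ 4 <= U a b w ^ 4}"
 proof (rule prod.P.finite_measure_mono)
  show "{w \<in> space M. x < abs(U a b w)} \<subseteq> {w \<in> space M. x ^ 4 <= U a b w ^ 4}"
  proof clarify
   fix w assume "x < abs(U a b w)"
   hence "x ^ 4 <= abs(U a b w) ^ 4" using assms by (intro power_mono) auto
   thus "x ^ 4 <= U a b w ^ 4" by simp
  qed
 qed measurable
 also have "... <= (LINT w|M. U a b w ^ 4) / x ^ 4"
  using integral_Markov_inequality_measure[OF fourth_moment(1)[OF assms(1)], of "{}" "x ^ 4"] assms by simp
 also have "... <= 48 * exp (C + 2 * C^2) * (of_int (b - a))^2 / x ^ 4"
  using fourth_moment(2)[OF assms(1)] by (intro divide_right_mono) auto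
 finally show ?thesis .
qed

text \<open>\<open>162 = 2 * 3^4\<close> from Ottaviani's inequality at a third of the level, the
  exponential factor from \<open>fourth_moment\<close>, and \<open>\<sigma> ^ 4\<close> from the
  squared length of a mesh cell.\<close>

definition K6 :: real where "K6 = 162 * (48 * exp (C + 2 * C^2)) / \<sigma> ^ 4"

lemma U_maximal:
 assumes \<sigma>: "0 < \<sigma>" and L: "0 < L" and \<delta>: "0 < \<delta>" and big: "3 * C <= \<delta> * ln (real t)" and t: "1 < t"
 shows "measure M {w \<in> space M. \<exists>j\<in>{1..mesh L t}. \<delta> * ln (real t) < abs(U a (a + j) w)} <= K6 / (\<delta> ^ 4 * (of_int L)^2)"
proof -
 define n where "n = mesh L t"
 define x where "x = \<delta> * ln (real t) / 3"
 define K where "K = 48 * exp (C + 2 * C^2)"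
 have K: "0 < K" unfolding K_def by simp
 have T: "0 < ln (real t)" using t by simp
 have x: "0 < x" "C <= x" unfolding x_def using T \<delta> big by auto
 have nb: "real_of_int n <= (ln (real t))^2 / (\<sigma>^2 * of_int L)" unfolding n_def mesh_def by linarith
 have tail: "measure M {w \<in> space M. x < abs(U (a + j) (a + n) w)} <= K6 / (\<delta> ^ 4 * (of_int L)^2) / 2" if j: "0 <= j" "j < n" for j
 proof -
  have "measure M {w \<in> space M. x < abs(U (a + j) (a + n) w)} <= K * (of_int (a + n - (a + j)))^2 / x ^ 4"
   unfolding K_def by (rule U_tail) (use j x in auto)
  also have "... <= K * ((ln (real t))^2 / (\<sigma>^2 * of_int L))^2 / x ^ 4"
   using j nb K x by (intro divide_right_mono mult_left_mono power_mono) auto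
  also have "... = K6 / (\<delta> ^ 4 * (of_int L)^2) / 2"
  proof -
   have "((ln (real t))^2)^2 = ln (real t) ^ 4" "(\<sigma>^2)^2 = \<sigma> ^ 4" by (simp_all add: power_mult[symmetric])
   thus ?thesis unfolding K6_def K_def[symmetric] x_def using T \<delta> \<sigma> L
    by (simp add: power_divide power_mult_distrib mult_ac)
  qed
  finally show ?thesis .
 qed
 have e: "{w \<in> space M. \<exists>j\<in>{1..n}. \<delta> * ln (real t) < abs(U a (a + j) w)} = {w \<in> space M. \<exists>j\<in>{1..n}. 3 * x < abs(U a (a + j) w)}"
  unfolding x_def by simp
 have "measure M {w \<in> space M. \<exists>j\<in>{1..n}. 3 * x < abs(U a (a + j) w)} <= K6 / (\<delta> ^ 4 * (of_int L)^2)"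
 proof (cases "n <= 0 \<or> 1 <= K6 / (\<delta> ^ 4 * (of_int L)^2)")
  case True
  thus ?thesis
  proof
   assume "n <= 0"
   hence "{1..n} = {}" by auto
   thus ?thesis unfolding K6_def using \<sigma> by simp
  qed (use prod.P.prob_le_1 order_trans in blast)
 next
  case False
  have "measure M {w \<in> space M. \<exists>j\<in>{1..n}. 3 * x < abs(U a (a + j) w)} <= 2 * measure M {w \<in> space M. x < abs(U a (a + n) w)}"
  proof (rule ottaviani)
   show "depends {a..<b} (U a b)" for a b by (rule depends_mono[OF U_depends]) auto
   show "abs(U a (a + n) w - U a (a + j) w - U (a + j) (a + n) w) <= x" if "0 < j" "j < n" for j w
    using U_qadd[of a "a + j" "a + n" w] that x by simp
   show "measure M {w \<in> space M. x < abs(U (a + j) (a + n) w)} <= 1 / 2" if "0 < j" "j < n" for j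
   proof (rule order_trans[OF tail[OF less_imp_le[OF that(1)] that(2)]])
    show "K6 / (\<delta> ^ 4 * (of_int L)^2) / 2 <= 1 / 2" by (rule divide_right_mono) (use False in auto)
   qed
  qed (use x in auto)
  thus ?thesis using tail[of 0] False by simp
 qed
 thus ?thesis using e unfolding n_def by simp
qed

lemma smooth_measurable [measurable]: "Measurable.pred M (smooth L d \<delta> t)"
 unfolding smooth_def[abs_def] by measurable

lemma rough_prob:
 assumes \<sigma>: "0 < \<sigma>" and L: "0 < L" and \<delta>: "0 < \<delta>" and big: "3 * C <= \<delta> * ln (real t)" and t: "1 < t" and d: "0 <= d"
 shows "measure M {w \<in> space M. ~ smooth L d \<delta> t w} <= (2 * of_int d + 1) * (K6 / (\<delta> ^ 4 * (of_int L)^2))"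
proof -
 let ?E = "%k. {w \<in> space M. \<exists>j\<in>{1..mesh L t}. \<delta> * ln (real t) < abs(U (k * mesh L t) (k * mesh L t + j) w)}"
 have "{w \<in> space M. ~ smooth L d \<delta> t w} = (\<Union>k\<in>{-d..d}. ?E k)" unfolding smooth_def by (auto simp: not_le)
 hence "measure M {w \<in> space M. ~ smooth L d \<delta> t w} <= (SUM k:{-d..d}. measure M (?E k))"
  using measure_UNION_le[of "{-d..d}" ?E M] by simp
 also have "... <= (SUM k:{-d..d}. K6 / (\<delta> ^ 4 * (of_int L)^2))"
  by (intro sum_mono U_maximal[OF \<sigma> L \<delta> big t])
 finally show ?thesis using d by (simp add: algebra_simps)
qed

end

lemma psum_close:
 assumes "!!k. -d <= k ==> k < d ==> abs(y k - y' k) <= \<delta>" "-d <= k" "k <= d" "0 <= \<delta>"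
 shows "abs(psum y k - psum y' k) <= of_int d * \<delta>"
proof -
 have *: "abs((SUM j:{a..<b}. y j) - (SUM j:{a..<b}. y' j)) <= of_int d * \<delta>" if "-d <= a" "b <= d" "a <= b" "b - a <= d" for a b
 proof -
  have "abs((SUM j:{a..<b}. y j) - (SUM j:{a..<b}. y' j)) = abs(SUM j:{a..<b}. y j - y' j)" by (simp add: sum_subtractf)
  also have "... <= (SUM j:{a..<b}. abs(y j - y' j))" by (rule sum_abs)
  also have "... <= (SUM j:{a..<b}. \<delta>)" by (intro sum_mono assms(1)) (use that in auto)
  also have "... = of_int (b - a) * \<delta>" using that by simp
  also have "... <= of_int d * \<delta>" using that assms(4) by (intro mult_right_mono) auto
  finally show ?thesis .
 qed
 show ?thesis
 proof (cases "0 <= k")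
  case True thus ?thesis using *[of 0 k] assms unfolding psum_def by simp
 next
  case False thus ?thesis using *[of k 0] assms unfolding psum_def by (simp add: abs_minus_commute)
 qed
qed

context centred
begin

lemma profile_measurable [measurable]: "(%w. profile L t w k) \<in> borel_measurable M"
 unfolding profile_def psum_def by (cases "0 <= k") auto

abbreviation "valley_prob L d \<rho> \<eta> t P \<equiv> measure M {w \<in> space M. \<exists>q. P q & valley \<eta> \<rho> d (profile L t w) q}"

text \<open>\<open>L = p * B\<close> and \<open>d = K * B\<close>, with \<open>B\<close> still free.
  A cell is rough with probability of order \<open>1 / B^2\<close> and there are of order
  \<open>B\<close> cells, so a large \<open>B\<close> makes all of them smooth. In the last clause
  both times are compared with one and the same Gaussian event.\<close>

theorem valley_probability:
 fixes r \<beta> :: real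
 assumes \<sigma>: "0 < \<sigma>" and r: "0 < r" and \<beta>: "0 < \<beta>"
 obtains L d \<rho> \<eta> t0 where "0 < L" "0 < d" "0 <= \<rho>" "0 < \<eta>" "of_int (\<rho> + 1) <= r * of_int L"
  "\<forall>\<^sub>F t in sequentially. 1 - \<beta> <= measure M {w \<in> space M. \<exists>q. valley \<eta> \<rho> d (profile L t w) q}"
  "\<forall>\<^sub>F t in sequentially. measure M {w \<in> space M. ~ smooth L d (\<eta> / 16) t w} <= \<beta>"
  "\<forall>t\<ge>t0. \<forall>t'\<ge>t0. \<forall>m. valley_prob L d \<rho> \<eta> t (%q. q <= m) <= valley_prob L d \<rho> (\<eta> / 2) t' (%q. q <= m) + \<beta>"
proof -
 \<comment> \<open>Asking for \<open>2 * r / 3\<close> leaves room for rounding: the radius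
   \<open>2 * B + 1\<close> is at most \<open>3 * B\<close>.\<close>
 obtain p K h where p: "0 < p" "2 / of_int p <= 2 * r / 3" and K: "0 < K" and h: "0 < h" "h <= 1 / 2" and
  gv: "!!B. 1 <= B ==> 1 - \<beta> / 2 <= measure GM {y. \<exists>q. valley h (2 * B) (K * B) (%k. psum y k / sqrt (of_int (p * B))) q}"
  using gauss_valley[of "2 * r / 3" "\<beta> / 2"] r \<beta> by auto
 \<comment> \<open>Each passage between the Gaussian walk and the skeleton costs
   \<open>h / 8\<close>. The value \<open>3 * h / 4\<close> is below \<open>h - h / 8\<close>, and
   half of it is below what is left of it after two further passages.\<close>
 define \<eta> where "\<eta> = 3 * h / 4"
 have \<eta>: "0 < \<eta>" unfolding \<eta>_def using h by simp
 define X where "X = K6 / (\<eta> / 16) ^ 4"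
 have X: "0 < X" unfolding X_def K6_def using \<eta> \<sigma> by simp
 obtain n where n: "3 * of_int K * X / \<beta> < real n" using reals_Archimedean2 by blast
 define B where "B = int n + 1"
 have B: "1 <= B" and nB: "3 * of_int K * X / \<beta> <= of_int B" using n unfolding B_def by auto
 define L where "L = p * B"
 define d where "d = K * B"
 define \<rho> where "\<rho> = 2 * B"
 have L: "0 < L" and d: "0 < d" and \<rho>: "0 <= \<rho>" unfolding L_def d_def \<rho>_def using p K B by auto
 have pre: "of_int (\<rho> + 1) <= r * of_int L"
 proof -
  have "3 <= r * of_int p" using p by (simp add: field_simps)
  hence "3 * of_int B <= r * of_int p * of_int B" using B by (intro mult_right_mono) auto
  moreover have "real_of_int (\<rho> + 1) <= 3 * of_int B" unfolding \<rho>_def using B by simp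
  ultimately show ?thesis unfolding L_def by (simp add: mult.assoc)
 qed
 let ?s = "%y k. psum y k / sqrt (of_int L)"
 define E where "E \<theta> P = {y. \<exists>q. P q & valley \<theta> \<rho> d (?s y) q}" for \<theta> P
 have Em: "E \<theta> P \<in> sets GM" for \<theta> P unfolding E_def
  by (intro sets_GM_I pred_intros_countable pred_intros_logic valley_measurable) measurable
 have skE: "measure (distr M GM (skel L t)) (E \<theta> P) = valley_prob L d \<rho> \<theta> t P" for \<theta> P t
  by (subst measure_distr[OF skel_GM Em]) (simp add: E_def profile_def[abs_def] vimage_def Int_def conj_commute)
 \<comment> \<open>At most \<open>d\<close> increments are summed and divided by
   \<open>sqrt L\<close>, so this error per increment moves the path by at most
   \<open>h / 16\<close>.\<close>
 define \<delta> where "\<delta> = h / 16 * sqrt (of_int L) / of_int d"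
 have \<delta>: "0 < \<delta>" unfolding \<delta>_def using h L d by simp
 have close: "y' \<in> E \<theta>' P"
  if yy: "\<forall>k\<in>{-d..<d}. abs(y k - y' k) <= \<delta>" and yE: "y \<in> E \<theta> P" and \<theta>: "\<theta>' <= \<theta> - h / 8" for y y' \<theta> \<theta>' P
 proof -
  obtain q where q: "P q" "valley \<theta> \<rho> d (?s y) q" using yE unfolding E_def by blast
  have "valley \<theta>' \<rho> d (?s y') q"
  proof (rule valley_perturb[OF q(2), of _ "h / 16"])
   fix k assume k: "-d <= k" "k <= d"
   have "abs(psum y k - psum y' k) <= of_int d * \<delta>"
    by (rule psum_close) (use yy k \<delta> in auto)
   also have "of_int d * \<delta> = h / 16 * sqrt (of_int L)" unfolding \<delta>_def using d by simp
   finally show "abs(?s y k - ?s y' k) <= h / 16"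
    using L by (simp add: diff_divide_distrib[symmetric] abs_divide divide_le_eq)
  qed (use \<theta> in simp)
  thus ?thesis using q(1) unfolding E_def by blast
 qed
 let ?T = "%t. \<forall>\<theta> \<theta>' P. \<theta>' <= \<theta> - h / 8 -->
  valley_prob L d \<rho> \<theta> t P <= measure GM (E \<theta>' P) + \<beta> / 2 &
  measure GM (E \<theta> P) <= valley_prob L d \<rho> \<theta>' t P + \<beta> / 2"
 have tr: "\<forall>\<^sub>F t in sequentially. ?T t"
 proof (rule eventually_mono[OF transfer[OF \<sigma> L finite_atLeastLessThan_int[of "-d" d] \<delta>, of "\<beta> / 2"]])
  show "0 < \<beta> / 2" using \<beta> by simp
  fix t assume T: "transfers (distr M GM (skel L t)) {-d..<d} \<delta> (\<beta> / 2)"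
  show "?T t"
  proof (intro allI impI)
   fix \<theta> \<theta>' :: real and P :: "int => bool" assume "\<theta>' <= \<theta> - h / 8"
   hence "\<forall>y y'. (\<forall>k\<in>{-d..<d}. abs(y k - y' k) <= \<delta>) --> y \<in> E \<theta> P --> y' \<in> E \<theta>' P" using close by blast
   with T[unfolded transfers_def, THEN spec, of "E \<theta> P", THEN spec, of "E \<theta>' P"] Em[of \<theta> P] Em[of \<theta>' P]
   have "measure (distr M GM (skel L t)) (E \<theta> P) <= measure GM (E \<theta>' P) + \<beta> / 2 &
    measure GM (E \<theta> P) <= measure (distr M GM (skel L t)) (E \<theta>' P) + \<beta> / 2" by blast
   thus "valley_prob L d \<rho> \<theta> t P <= measure GM (E \<theta>' P) + \<beta> / 2 &
    measure GM (E \<theta> P) <= valley_prob L d \<rho> \<theta>' t P + \<beta> / 2"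
    unfolding skE .
  qed
 qed
 have good: "\<forall>\<^sub>F t in sequentially. 1 - \<beta> <= measure M {w \<in> space M. \<exists>q. valley \<eta> \<rho> d (profile L t w) q}"
  using tr
 proof eventually_elim
  case (elim t)
  have "measure GM (E h (%_. True)) <= valley_prob L d \<rho> \<eta> t (%_. True) + \<beta> / 2"
   using elim[rule_format, of \<eta> h "%_. True"] h unfolding \<eta>_def by simp
  thus ?case using gv[OF B] unfolding E_def L_def d_def \<rho>_def by simp
 qed
 have smooth: "\<forall>\<^sub>F t in sequentially. measure M {w \<in> space M. ~ smooth L d (\<eta> / 16) t w} <= \<beta>"
 proof -
  have "filterlim (%t. \<eta> / 16 * ln (real t)) at_top sequentially" using \<eta> by real_asymp
  hence "\<forall>\<^sub>F t in sequentially. 3 * C <= \<eta> / 16 * ln (real t)" unfolding filterlim_at_top by blast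
  thus ?thesis using eventually_gt_at_top[of 1]
  proof eventually_elim
   case (elim t)
   have "measure M {w \<in> space M. ~ smooth L d (\<eta> / 16) t w} <= (2 * of_int d + 1) * (K6 / ((\<eta> / 16) ^ 4 * (of_int L)^2))"
    by (rule rough_prob[OF \<sigma> L _ elim]) (use \<eta> d in auto)
   also have "K6 / ((\<eta> / 16) ^ 4 * (of_int L)^2) = X / (of_int L)^2" unfolding X_def by simp
   also have "(2 * of_int d + 1) * (X / (of_int L)^2) <= (3 * of_int K * of_int B) * (X / (of_int B)^2)"
   proof (intro mult_mono divide_left_mono power_mono)
    have "1 <= d" using d by simp
    hence "2 * d + 1 <= 3 * d" by simp
    hence "real_of_int (2 * d + 1) <= real_of_int (3 * d)" by (simp only: of_int_le_iff)
    thus "2 * real_of_int d + 1 <= 3 * of_int K * of_int B" by (simp add: d_def)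
    have "B <= L" unfolding L_def using p B by (simp add: mult_le_cancel_right1)
    thus "real_of_int B <= of_int L" by simp
   qed (use X B K L in auto)
   also have "... = 3 * of_int K * X / of_int B" using B by (simp add: power2_eq_square)
   also have "... <= \<beta>" using nB \<beta> B by (simp add: field_simps)
   finally show ?case .
  qed
 qed
 obtain t0 where t0: "\<forall>t\<ge>t0. ?T t"
  using tr[unfolded eventually_sequentially] by (rule exE)
 have cmp: "valley_prob L d \<rho> \<eta> t (%q. q <= m)
   <= valley_prob L d \<rho> (\<eta> / 2) t' (%q. q <= m) + \<beta>" if "t0 <= t" "t0 <= t'" for t t' m
 proof -
  have "\<eta> - h / 8 <= \<eta> - h / 8" "\<eta> / 2 <= (\<eta> - h / 8) - h / 8" unfolding \<eta>_def using h by auto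
  with t0[THEN spec, of t, THEN mp, OF that(1), THEN spec, of \<eta>, THEN spec, of "\<eta> - h / 8", THEN spec, of "%q. q <= m"]
   t0[THEN spec, of t', THEN mp, OF that(2), THEN spec, of "\<eta> - h / 8", THEN spec, of "\<eta> / 2", THEN spec, of "%q. q <= m"]
  show ?thesis by linarith
 qed
 show ?thesis by (intro that[OF L d \<rho> \<eta> pre good smooth] allI impI cmp)
qed

end

section \<open>Consequences of the ellipticity condition\<close>

lemma matrix_power_Suc: "matrix_power R (Suc k) = R ** matrix_power R k"
 by (simp add: matrix_power_def)

lemma matrix_power_nonneg: "0 <= R ==> 0 <= matrix_power R k $ i $ j"
proof (induction k arbitrary: i j)
 case 0 thus ?case by (simp add: matrix_power_def mat_def)
next
 case (Suc k)
 thus ?case unfolding matrix_power_Suc matrix_matrix_mult_def by (auto intro!: sum_nonneg simp: less_eq_vec_def)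
qed

lemma matrix_power_vec: "matrix_power R k *v v = (((*v) R) ^^ k) v"
proof (induction k)
 case 0 thus ?case by (simp add: matrix_power_def)
next
 case (Suc k) thus ?case by (simp add: matrix_power_Suc matrix_vector_mul_assoc[symmetric])
qed

lemma matrix_norm_row: "(SUM j:UNIV. abs(A $ i $ j)) <= matrix_norm A"
 unfolding matrix_norm_def by (intro Max_ge) auto

context
 fixes R :: "real ^ 'm ^ 'm::finite" and \<epsilon> :: real and l :: nat
 assumes R: "0 <= R" "!!i. (R *v 1) $ i <= 1" and \<epsilon>: "0 < \<epsilon>" and norm: "matrix_norm (matrix_power R l) <= 1 - \<epsilon>"
begin

lemma R_mono: "(!!i. u $ i <= v $ i) ==> (R *v u) $ i <= (R *v v) $ i"
 unfolding matrix_vector_mult_def using R(1) by (auto intro!: sum_mono mult_left_mono simp: less_eq_vec_def)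

lemma row_sum: "(SUM j:UNIV. matrix_power R l $ i $ j) <= 1 - \<epsilon>"
 using matrix_norm_row[of "matrix_power R l" i] norm matrix_power_nonneg[OF R(1)] by simp

text \<open>At a minimum \<open>m\<close> of \<open>v\<close>, iterating \<open>R\<close> gives
  \<open>s * m <= m\<close> for a row sum \<open>s <= 1 - \<epsilon>\<close> of the
  \<open>l\<close>-th power, which excludes \<open>m < 0\<close>. Used for \<open>v\<close> and
  \<open>- v\<close> this yields injectivity of \<open>mat 1 - R\<close>, used for images under the
  inverse it yields positivity of the inverse.\<close>

lemma supersolution_nonneg:
 assumes v: "!!i. (R *v v) $ i <= v $ i"
 shows "0 <= v $ i"
proof -
 have it: "((((*v) R) ^^ k) v) $ i <= v $ i" for k i
 proof (induction k arbitrary: i)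
  case (Suc k) thus ?case using R_mono[of "(((*v) R) ^^ k) v" v] v by (force intro: order_trans)
 qed simp
 define m where "m = Min (range (%i. v $ i))"
 have m: "m <= v $ i" for i unfolding m_def by (intro Min_le) auto
 have "m \<in> range (%i. v $ i)" unfolding m_def by (intro Min_in) auto
 then obtain k where k: "m = v $ k" by blast
 have "m * (SUM j:UNIV. matrix_power R l $ k $ j) <= (SUM j:UNIV. matrix_power R l $ k $ j * v $ j)"
  unfolding sum_distrib_left by (rule sum_mono) (simp add: mult.commute[of m] mult_left_mono m matrix_power_nonneg R)
 also have "... = (matrix_power R l *v v) $ k" by (simp add: matrix_vector_mult_def)
 also have "... <= m" unfolding matrix_power_vec k by (rule it)
 finally have le: "m * (SUM j:UNIV. matrix_power R l $ k $ j) <= m" .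
 have "0 <= m"
 proof (rule ccontr)
  assume neg: "~ 0 <= m"
  have "m * (1 - \<epsilon>) <= m * (SUM j:UNIV. matrix_power R l $ k $ j)" using neg row_sum by (intro mult_left_mono_neg) auto
  hence "m * (1 - \<epsilon>) <= m" using le by linarith
  moreover have "m * (1 - \<epsilon>) = m - m * \<epsilon>" by (simp add: algebra_simps)
  moreover have "m * \<epsilon> < 0" using neg \<epsilon> by (intro mult_neg_pos) auto
  ultimately show False by linarith
 qed
 thus ?thesis using m[of i] by linarith
qed

lemma inverse_stay: "matrix_inv (mat 1 - R) ** (mat 1 - R) = mat 1" "(mat 1 - R) ** matrix_inv (mat 1 - R) = mat 1"
proof -
 have "v = 0" if "(mat 1 - R) *v v = 0" for v
 proof -
  have e: "R *v v = v" using that by (simp add: matrix_vector_mult_diff_rdistrib)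
  have "0 <= v $ i" for i by (rule supersolution_nonneg) (simp add: e)
  moreover have "0 <= (- v) $ i" for i
  proof (rule supersolution_nonneg)
   show "(R *v (- v)) $ i <= (- v) $ i" for i
    using arg_cong[OF e, of "%u. u $ i"] by (simp add: matrix_vector_mult_def sum_negf)
  qed
  ultimately show ?thesis by (simp add: vec_eq_iff eq_iff)
 qed
 hence "\<exists>B. B ** (mat 1 - R) = mat 1" using matrix_left_invertible_ker[of "mat 1 - R"] by blast
 hence "invertible (mat 1 - R)" by (simp add: invertible_left_inverse)
 thus "matrix_inv (mat 1 - R) ** (mat 1 - R) = mat 1" "(mat 1 - R) ** matrix_inv (mat 1 - R) = mat 1"
  unfolding invertible_def matrix_inv_def by (rule someI2_ex; blast)+
qed

lemma green_eq: "matrix_inv (mat 1 - R) *v u = R *v (matrix_inv (mat 1 - R) *v u) + u"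
proof -
 have "(mat 1 - R) *v (matrix_inv (mat 1 - R) *v u) = u" by (simp add: matrix_vector_mul_assoc inverse_stay)
 thus ?thesis by (simp add: matrix_vector_mult_diff_rdistrib algebra_simps)
qed

lemma green_nonneg: assumes "!!i. 0 <= u $ i" shows "0 <= (matrix_inv (mat 1 - R) *v u) $ i"
proof (rule supersolution_nonneg)
 fix i show "(R *v (matrix_inv (mat 1 - R) *v u)) $ i <= (matrix_inv (mat 1 - R) *v u) $ i"
  using arg_cong[OF green_eq[of u], of "%v. v $ i"] assms[of i] by simp
qed

lemma inverse_nonneg: "0 <= matrix_inv (mat 1 - R)"
proof -
 have "0 <= matrix_inv (mat 1 - R) $ i $ j" for i j
 proof -
  have "0 <= (matrix_inv (mat 1 - R) *v axis j 1) $ i" by (rule green_nonneg) (simp add: axis_def)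
  thus ?thesis by (simp add: matrix_vector_mult_basis column_def)
 qed
 thus ?thesis by (simp add: less_eq_vec_def)
qed

text \<open>Iterating \<open>v = R *v v + 1\<close> for \<open>l\<close> steps and evaluating at a
  maximum \<open>m\<close> of \<open>v\<close> gives
  \<open>m <= m * (1 - \<epsilon>) + l\<close>.\<close>

lemma green_one: "(matrix_inv (mat 1 - R) *v 1) $ i <= real l / \<epsilon>"
proof -
 define v where "v = matrix_inv (mat 1 - R) *v 1"
 have v: "v = R *v v + 1" unfolding v_def by (rule green_eq)
 have it: "v $ i <= ((((*v) R) ^^ k) v) $ i + real k" for k i
 proof (induction k arbitrary: i)
  case (Suc k)
  have "v $ i = (R *v v) $ i + 1" using arg_cong[OF v, of "%v. v $ i"] by simp
  also have "(R *v v) $ i <= (R *v ((((*v) R) ^^ k) v + real k *\<^sub>R 1)) $ i" by (rule R_mono) (use Suc in simp)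
  also have "... = ((((*v) R) ^^ Suc k) v) $ i + real k * (R *v 1) $ i"
   by (simp add: matrix_vector_right_distrib matrix_vector_mult_scaleR)
  also have "real k * (R *v 1) $ i <= real k" using R(2)[of i] by (simp add: mult_left_le)
  finally show ?case by simp
 qed simp
 define m where "m = Max (range (%i. v $ i))"
 have m: "v $ i <= m" for i unfolding m_def by (intro Max_ge) auto
 have "m \<in> range (%i. v $ i)" unfolding m_def by (intro Max_in) auto
 then obtain k where k: "m = v $ k" by blast
 have m0: "0 <= m" unfolding k v_def by (rule green_nonneg) simp
 have "m <= (matrix_power R l *v v) $ k + real l" unfolding matrix_power_vec k by (rule it)
 also have "(matrix_power R l *v v) $ k <= m * (SUM j:UNIV. matrix_power R l $ k $ j)"
  unfolding matrix_vector_mult_def sum_distrib_left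
  by simp (rule sum_mono, simp add: mult.commute[of m] mult_left_mono m matrix_power_nonneg R)
 also have "... <= m * (1 - \<epsilon>)" using m0 row_sum by (intro mult_left_mono)
 finally have "\<epsilon> * m <= real l" by (simp add: algebra_simps)
 hence "m <= real l / \<epsilon>" using \<epsilon> by (simp add: field_simps)
 thus ?thesis using m[of i] unfolding v_def by linarith
qed

end

lemma elliptic_triple:
 assumes t: "(P, Q, R) \<in> triples" and \<epsilon>: "0 < \<epsilon>" and norm: "matrix_norm (matrix_power R l) <= 1 - \<epsilon>"
  and PQ: "!!i j. \<epsilon> <= (matrix_inv (mat 1 - R) ** P) $ i $ j" "!!i j. \<epsilon> <= (matrix_inv (mat 1 - R) ** Q) $ i $ j"
 shows "elliptic \<epsilon> (real l / \<epsilon>) (P, Q, R)"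
proof -
 have nn: "0 <= P" "0 <= Q" "0 <= R" and one: "(P + Q + R) *v 1 = 1" using t by (auto simp: triples_def)
 have "(R *v 1) $ i <= 1" for i
 proof -
  have "(P *v 1) $ i + (Q *v 1) $ i + (R *v 1) $ i = 1" using arg_cong[OF one, of "%v. v $ i"]
   by (simp add: matrix_vector_mult_add_rdistrib)
  moreover have "0 <= (P *v 1) $ i" "0 <= (Q *v 1) $ i" using nn
   by (auto simp: matrix_vector_mult_def less_eq_vec_def intro!: sum_nonneg)
  ultimately show ?thesis by linarith
 qed
 note r = nn(3) this \<epsilon> norm
 show ?thesis unfolding elliptic_def
  using t inverse_nonneg[OF r] inverse_stay[OF r] PQ green_one[OF r] by auto
qed

section \<open>Non-degeneracy\<close>

context elliptic_env
begin

text \<open>The stationary masses of the layers \<open>1..n\<close> of a box are averaged into one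
  probability vector. In a constant environment its drift and its defect from stationarity telescope
  to layers at the two ends. A bounded potential makes all flows comparable, so the total mass is at
  least of order \<open>n\<close> times one flow. Four boundary masses give
  \<open>8 * D / \<epsilon>\<close>, two flows give the summand 2.\<close>

lemma const_almost_stationary:
 assumes const: "!!k. e k = (P, Q, R)" and bd: "!!k. 0 < k ==> abs(pot e 0 (int k)) <= K" and n: "1 <= n"
 shows "\<exists>p. 0 <= p & (SUM i:UNIV. p $ i) = 1 &
  (\<forall>v. (\<forall>i. abs(v $ i) <= 1) --> abs(p \<bullet> (v - (P + Q + R) *v v)) <= (8 * D / \<epsilon> + 2) * exp (2 * (K + 2 * c0)) / real n) &
  abs(p \<bullet> ((P - Q) *v 1)) <= (8 * D / \<epsilon> + 2) * exp (2 * (K + 2 * c0)) / real n"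
proof -
 obtain \<mu> where "box_measure e \<epsilon> D (-2) (int n + 3) \<mu>" using box_measure_obtain[of "-2" "int n + 3"] by auto
 then interpret X: box_measure e \<epsilon> D "-2" "int n + 3" \<mu> .
 let ?K = "K + 2 * c0"
 define E where "E = exp ?K"
 have K0: "0 <= K" using bd[of 1] by simp
 have E1: "1 <= E" unfolding E_def using K0 c0_nonneg by simp
 have E2: "exp (2 * ?K) = E^2" unfolding E_def by (simp add: power2_eq_square exp_add[symmetric])
 have inn: "X.be k = e k" if "-2 < k" "k < int n + 3" for k using boxed_inner[OF that] .
 have PQR: "up e k = P" "down e k = Q" "stay e k = R" for k using const by auto
 have nn: "0 <= P $ i $ j" "0 <= Q $ i $ j" "0 <= R $ i $ j" for i j
  using trip[unfolded valid_def, rule_format, of 0] const[of 0] by (auto simp: triples_def less_eq_vec_def)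
 have rs: "(SUM j:UNIV. P $ i $ j) + (SUM j:UNIV. Q $ i $ j) + (SUM j:UNIV. R $ i $ j) = 1" for i
  using triples_sum[of e 0 i] trip[unfolded valid_def, rule_format, of 0] const[of 0] by (simp add: sum.distrib)
 have \<kappa>pos: "0 < X.\<kappa> k" if "-2 <= k" "k < int n + 3" for k using X.kappa_pos that by simp
 have \<kappa>cmp: "X.\<kappa> k <= E * X.\<kappa> 0" "X.\<kappa> 0 <= E * X.\<kappa> k" if k: "0 <= k" "k <= int n + 1" for k
 proof -
  have "abs(X.V k - X.V 0) <= ?K" using X.V_pot[of 0 "k+1"] bd[of "nat (k + 1)"] k by simp
  hence "ln (X.\<kappa> k) <= ?K + ln (X.\<kappa> 0)" "ln (X.\<kappa> 0) <= ?K + ln (X.\<kappa> k)" unfolding X.V_def by linarith+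
  hence "exp (ln (X.\<kappa> k)) <= E * exp (ln (X.\<kappa> 0))" "exp (ln (X.\<kappa> 0)) <= E * exp (ln (X.\<kappa> k))"
   unfolding E_def exp_add[symmetric] by simp_all
  thus "X.\<kappa> k <= E * X.\<kappa> 0" "X.\<kappa> 0 <= E * X.\<kappa> k" using \<kappa>pos k by simp_all
 qed
 define s where "s i = (SUM k:{1..int n}. \<mu> k i)" for i
 define Z where "Z = (SUM i:UNIV. s i)"
 have mu0: "0 <= \<mu> k i" if "-2 <= k" "k <= int n + 3" for k i using X.mu_nonneg that by simp
 have s0: "0 <= s i" for i unfolding s_def by (intro sum_nonneg mu0) auto
 have \<kappa>P: "X.\<kappa> k = (SUM i:UNIV. \<mu> k i * (SUM j:UNIV. P $ i $ j))" if "-2 < k" "k < int n + 3" for k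
  unfolding X.\<kappa>_def inn[OF that] PQR ..
 have \<kappa>Q: "X.\<kappa> (k - 1) = (SUM i:UNIV. \<mu> k i * (SUM j:UNIV. Q $ i $ j))" if "-1 <= k" "k < int n + 3" for k
  using X.kappa_edge[of "k - 1"] inn[of k] that PQR by simp
 have Zk: "Z = (SUM k:{1..int n}. SUM i:UNIV. \<mu> k i)" unfolding Z_def s_def by (rule sum.swap)
 have Zge: "real n * (X.\<kappa> 0 / E) <= Z"
 proof -
  have "X.\<kappa> 0 / E <= (SUM i:UNIV. \<mu> k i)" if k: "k \<in> {1..int n}" for k
  proof -
   have "X.\<kappa> 0 / E <= X.\<kappa> k" using \<kappa>cmp(2)[of k] k E1 by (simp add: field_simps)
   also have "... <= (SUM i:UNIV. \<mu> k i * 1)" unfolding \<kappa>P[of k, OF _ , simplified]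
   proof (subst \<kappa>P)
    have "(SUM j:UNIV. P $ i $ j) <= 1" for i
    proof -
     have "0 <= (SUM j:UNIV. Q $ i $ j)" "0 <= (SUM j:UNIV. R $ i $ j)" by (intro sum_nonneg nn)+
     thus ?thesis using rs[of i] by linarith
    qed
    thus "(SUM i:UNIV. \<mu> k i * (SUM j:UNIV. P $ i $ j)) <= (SUM i:UNIV. \<mu> k i * 1)"
     using mu0 k by (intro sum_mono mult_left_mono) auto
   qed (use k in auto)
   finally show ?thesis by simp
  qed
  hence "(SUM k:{1..int n}. X.\<kappa> 0 / E) <= Z" unfolding Zk by (intro sum_mono)
  thus ?thesis by simp
 qed
 have Z0: "0 < Z"
 proof -
  have "0 < real n * (X.\<kappa> 0 / E)" using n E1 \<kappa>pos[of 0] by simp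
  thus ?thesis using Zge by linarith
 qed
 define p :: "real ^ 'm" where "p = (\<chi> i. s i / Z)"
 have p: "0 <= p" "(SUM i:UNIV. p $ i) = 1" unfolding p_def using s0 Z0
  by (auto simp: less_eq_vec_def sum_divide_distrib[symmetric] Z_def[symmetric])
 have small: "x / Z <= (8 * D / \<epsilon> + 2) * exp (2 * ?K) / real n" if x: "x <= (8 * D / \<epsilon> + 2) * E * X.\<kappa> 0" for x
 proof -
  have c: "0 <= (8 * D / \<epsilon> + 2) * E * X.\<kappa> 0" using X.D_ge1 eps_pos E1 \<kappa>pos[of 0] by (intro mult_nonneg_nonneg add_nonneg_nonneg) auto
  have "x / Z <= (8 * D / \<epsilon> + 2) * E * X.\<kappa> 0 / Z" using x Z0 by (intro divide_right_mono) auto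
  also have "... <= (8 * D / \<epsilon> + 2) * E * X.\<kappa> 0 / (real n * (X.\<kappa> 0 / E))"
   by (rule divide_left_mono[OF Zge c]) (use n E1 \<kappa>pos[of 0] Z0 in auto)
  also have "... = (8 * D / \<epsilon> + 2) * exp (2 * ?K) / real n" unfolding E2 using n E1 \<kappa>pos[of 0] by (simp add: field_simps power2_eq_square)
  finally show ?thesis .
 qed
 have pv: "p \<bullet> v = (SUM i:UNIV. s i * v $ i) / Z" for v
  unfolding p_def inner_vec_def by (simp add: sum_divide_distrib)
 have flux: "abs(p \<bullet> ((P - Q) *v 1)) <= (8 * D / \<epsilon> + 2) * exp (2 * ?K) / real n"
 proof -
  have "(SUM i:UNIV. s i * ((P - Q) *v 1) $ i) = (SUM k:{1..int n}. X.\<kappa> k - X.\<kappa> (k - 1))"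
  proof -
   have "(SUM i:UNIV. s i * ((P - Q) *v 1) $ i) = (SUM i:UNIV. SUM k:{1..int n}. \<mu> k i * ((SUM j:UNIV. P $ i $ j) - (SUM j:UNIV. Q $ i $ j)))"
    unfolding s_def sum_distrib_right by (simp add: matrix_vector_mult_def sum_subtractf)
   also have "... = (SUM k:{1..int n}. SUM i:UNIV. \<mu> k i * ((SUM j:UNIV. P $ i $ j) - (SUM j:UNIV. Q $ i $ j)))" by (rule sum.swap)
   also have "... = (SUM k:{1..int n}. X.\<kappa> k - X.\<kappa> (k - 1))"
   proof (intro sum.cong refl)
    fix k assume k: "k \<in> {1..int n}"
    have "X.\<kappa> k = (SUM i:UNIV. \<mu> k i * (SUM j:UNIV. P $ i $ j))" by (rule \<kappa>P) (use k in auto)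
    moreover have "X.\<kappa> (k - 1) = (SUM i:UNIV. \<mu> k i * (SUM j:UNIV. Q $ i $ j))" by (rule \<kappa>Q) (use k in auto)
    ultimately show "(SUM i:UNIV. \<mu> k i * ((SUM j:UNIV. P $ i $ j) - (SUM j:UNIV. Q $ i $ j))) = X.\<kappa> k - X.\<kappa> (k - 1)"
     by (simp only: right_diff_distrib sum_subtractf)
   qed
   finally show ?thesis .
  qed
  also have "... = X.\<kappa> (int n) - X.\<kappa> 0"
  proof -
   have "(SUM k:{1..int m}. X.\<kappa> k - X.\<kappa> (k - 1)) = X.\<kappa> (int m) - X.\<kappa> 0" for m
   proof (induction m)
    case (Suc m)
    have "{1..int (Suc m)} = insert (int (Suc m)) {1..int m}" by auto
    thus ?case using Suc by simp
   qed simp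
   thus ?thesis .
  qed
  finally have e: "(SUM i:UNIV. s i * ((P - Q) *v 1) $ i) = X.\<kappa> (int n) - X.\<kappa> 0" .
  have "abs(X.\<kappa> (int n) - X.\<kappa> 0) <= (8 * D / \<epsilon> + 2) * E * X.\<kappa> 0"
  proof -
   have b: "X.\<kappa> 0 <= E * X.\<kappa> 0" using E1 \<kappa>pos[of 0] by simp
   have "abs(X.\<kappa> (int n) - X.\<kappa> 0) <= 2 * (E * X.\<kappa> 0)"
    using \<kappa>cmp(1)[of "int n"] b \<kappa>pos[of 0] \<kappa>pos[of "int n"] unfolding abs_le_iff by linarith
   also have "... <= (8 * D / \<epsilon> + 2) * (E * X.\<kappa> 0)" using X.D_ge1 eps_pos E1 \<kappa>pos[of 0] by (intro mult_right_mono) auto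
   finally show ?thesis by (simp add: mult.assoc)
  qed
  from small[OF this] show ?thesis unfolding pv e using Z0 by (simp add: abs_divide)
 qed
 have inv: "abs(p \<bullet> (v - (P + Q + R) *v v)) <= (8 * D / \<epsilon> + 2) * exp (2 * ?K) / real n" if v: "!!i. abs(v $ i) <= 1" for v
 proof -
  define Pv where "Pv i = (SUM j:UNIV. P $ i $ j * v $ j)" for i
  define Qv where "Qv i = (SUM j:UNIV. Q $ i $ j * v $ j)" for i
  define Rv where "Rv i = (SUM j:UNIV. R $ i $ j * v $ j)" for i
  define m where "m k f = (SUM i:UNIV. \<mu> k i * f i)" for k and f :: "'m => real"
  have layer: "m k (%i. v $ i - Rv i) = m (k - 1) Pv + m (k + 1) Qv" if k: "k \<in> {1..int n}" for k
  proof -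
   have "m k (%i. v $ i - Rv i) = (SUM j:UNIV. X.\<rho> k j * v $ j)"
    unfolding m_def Rv_def using X.layer_balance[of k "%i. v $ i"] k PQR by simp
   also have "... = (SUM j:UNIV. SUM i:UNIV. \<mu> (k-1) i * (P $ i $ j * v $ j) + \<mu> (k+1) i * (Q $ i $ j * v $ j))"
   proof (rule sum.cong)
    fix j
    have "X.\<rho> k j = (SUM i:UNIV. \<mu> (k-1) i * P $ i $ j + \<mu> (k+1) i * Q $ i $ j)"
     unfolding X.\<rho>_def using inn[of "k - 1"] inn[of "k + 1"] k PQR by simp
    thus "X.\<rho> k j * v $ j = (SUM i:UNIV. \<mu> (k-1) i * (P $ i $ j * v $ j) + \<mu> (k+1) i * (Q $ i $ j * v $ j))"
     by (simp only: sum_distrib_right distrib_right mult.assoc)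
   qed simp
   also have "... = (SUM i:UNIV. SUM j:UNIV. \<mu> (k-1) i * (P $ i $ j * v $ j) + \<mu> (k+1) i * (Q $ i $ j * v $ j))" by (rule sum.swap)
   also have "... = m (k - 1) Pv + m (k + 1) Qv" unfolding m_def Pv_def Qv_def by (simp add: sum.distrib sum_distrib_left)
   finally show ?thesis .
  qed
  have tele: "(SUM k:{1..int m}. f k) - (SUM k:{1..int m}. f (k - 1)) = f (int m) - f 0" for m and f :: "int => real"
  proof (induction m)
   case (Suc m)
   have "{1..int (Suc m)} = insert (int (Suc m)) {1..int m}" by auto
   thus ?case using Suc by simp
  qed simp
  have tele2: "(SUM k:{1..int n}. f k) - (SUM k:{1..int n}. f (k + 1)) = f 1 - f (int n + 1)" for f :: "int => real"
   using tele[of "%k. f (k + 1)" n] by simp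
  have "(SUM i:UNIV. s i * (v - (P + Q + R) *v v) $ i) = (SUM k:{1..int n}. m k (%i. v $ i - Rv i)) - (SUM k:{1..int n}. m k Pv) - (SUM k:{1..int n}. m k Qv)"
  proof -
   have d: "(v - (P + Q + R) *v v) $ i = (v $ i - Rv i) - Pv i - Qv i" for i
    unfolding Pv_def Qv_def Rv_def by (simp add: matrix_vector_mult_def distrib_right sum.distrib)
   have "(SUM i:UNIV. s i * (v - (P + Q + R) *v v) $ i) = (SUM i:UNIV. SUM k:{1..int n}. \<mu> k i * (v $ i - Rv i) - \<mu> k i * Pv i - \<mu> k i * Qv i)"
    unfolding d by (simp only: s_def sum_distrib_right right_diff_distrib sum_subtractf)
   also have "... = (SUM k:{1..int n}. SUM i:UNIV. \<mu> k i * (v $ i - Rv i) - \<mu> k i * Pv i - \<mu> k i * Qv i)" by (rule sum.swap)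
   finally show ?thesis unfolding m_def by (simp only: sum_subtractf)
  qed
  also have "(SUM k:{1..int n}. m k (%i. v $ i - Rv i)) = (SUM k:{1..int n}. m (k - 1) Pv) + (SUM k:{1..int n}. m (k + 1) Qv)"
   using layer by (simp add: sum.distrib)
  finally have e: "(SUM i:UNIV. s i * (v - (P + Q + R) *v v) $ i) = m 0 Pv - m (int n) Pv + (m (int n + 1) Qv - m 1 Qv)"
   using tele[of "%k. m k Pv" n] tele2[of "%k. m k Qv"] by simp
  have bnd: "abs(m k f) <= 2 * D / \<epsilon> * (E * X.\<kappa> 0)" if k: "0 <= k" "k <= int n + 1" and f: "!!i. abs(f i) <= 1" for k f
  proof -
   have "abs(m k f) <= (SUM i:UNIV. abs(\<mu> k i * f i))" unfolding m_def by (rule sum_abs)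
   also have "... <= (SUM i:UNIV. \<mu> k i)" using f mu0 k by (intro sum_mono) (simp add: abs_mult mult_left_le)
   also have "... <= 2 * D / \<epsilon> * X.\<kappa> k" using X.mass_le'[of k] k by simp
   also have "... <= 2 * D / \<epsilon> * (E * X.\<kappa> 0)" using \<kappa>cmp(1)[OF k] X.D_ge1 eps_pos by (intro mult_left_mono) auto
   finally show ?thesis .
  qed
  have row: "abs(SUM j:UNIV. W j * v $ j) <= (SUM j:UNIV. W j)" if W: "!!j. 0 <= W j" for W :: "'m => real"
  proof -
   have "abs(SUM j:UNIV. W j * v $ j) <= (SUM j:UNIV. abs(W j * v $ j))" by (rule sum_abs)
   also have "... <= (SUM j:UNIV. W j)" using v W by (intro sum_mono) (simp add: abs_mult mult_left_le)
   finally show ?thesis .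
  qed
  have le1: "abs(Pv i) <= 1" "abs(Qv i) <= 1" for i
  proof -
   have "0 <= (SUM j:UNIV. Q $ i $ j)" "0 <= (SUM j:UNIV. R $ i $ j)" "0 <= (SUM j:UNIV. P $ i $ j)" by (intro sum_nonneg nn)+
   moreover have "abs(Pv i) <= (SUM j:UNIV. P $ i $ j)" unfolding Pv_def by (rule row) (rule nn)
   moreover have "abs(Qv i) <= (SUM j:UNIV. Q $ i $ j)" unfolding Qv_def by (rule row) (rule nn)
   ultimately show "abs(Pv i) <= 1" "abs(Qv i) <= 1" using rs[of i] by linarith+
  qed
  have "abs(m 0 Pv - m (int n) Pv + (m (int n + 1) Qv - m 1 Qv)) <= 4 * (2 * D / \<epsilon> * (E * X.\<kappa> 0))"
  proof -
   have "abs(m 0 Pv) <= 2 * D / \<epsilon> * (E * X.\<kappa> 0)" "abs(m (int n) Pv) <= 2 * D / \<epsilon> * (E * X.\<kappa> 0)"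
    "abs(m (int n + 1) Qv) <= 2 * D / \<epsilon> * (E * X.\<kappa> 0)" "abs(m 1 Qv) <= 2 * D / \<epsilon> * (E * X.\<kappa> 0)"
    by (rule bnd; use le1 n in auto)+
   thus ?thesis by linarith
  qed
  also have "... = (8 * D / \<epsilon>) * (E * X.\<kappa> 0)" by simp
  also have "... <= (8 * D / \<epsilon> + 2) * (E * X.\<kappa> 0)" using E1 \<kappa>pos[of 0] by (intro mult_right_mono) auto
  finally have "abs(m 0 Pv - m (int n) Pv + (m (int n + 1) Qv - m 1 Qv)) <= (8 * D / \<epsilon> + 2) * E * X.\<kappa> 0" by (simp add: mult.assoc)
  from small[OF this] show ?thesis unfolding pv e using Z0 by (simp add: abs_divide)
 qed
 show ?thesis using p inv flux by blast
qed

text \<open>If the potential were bounded, a limit point of the almost stationary vectors would be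
  stationary with zero drift.\<close>

lemma const_pot_unbounded:
 assumes const: "!!k. e k = x" and x: "x \<notin> algebraic_triples"
 shows "\<exists>k>0. K < abs(pot e 0 (int k))"
proof (rule ccontr)
 assume "~ ?thesis"
 hence "\<forall>k>0. abs(pot e 0 (int k)) <= K" by (meson not_less)
 hence bd: "abs(pot e 0 (int k)) <= K" if "0 < k" for k using that by blast
 obtain P Q R where xPQR: "x = (P, Q, R)" by (cases x)
 note const' = const[unfolded xPQR]
 define c where "c = (8 * D / \<epsilon> + 2) * exp (2 * (K + 2 * c0))"
 have "\<forall>n. \<exists>p. 0 <= p & (SUM i:UNIV. p $ i) = 1 &
  (\<forall>v. (\<forall>i. abs(v $ i) <= 1) --> abs(p \<bullet> (v - (P + Q + R) *v v)) <= c / real (Suc n)) & abs(p \<bullet> ((P - Q) *v 1)) <= c / real (Suc n)"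
  unfolding c_def by (intro allI const_almost_stationary[OF const' bd]) auto
 then obtain p where p: "!!n. 0 <= p n" "!!n. (SUM i:UNIV. p n $ i) = 1"
  "!!n v. (!!i. abs(v $ i) <= 1) ==> abs(p n \<bullet> (v - (P + Q + R) *v v)) <= c / real (Suc n)"
  "!!n. abs(p n \<bullet> ((P - Q) *v 1)) <= c / real (Suc n)"
  by metis
 let ?S = "{p :: real ^ 'm. (\<forall>i. 0 <= p $ i) & (SUM i:UNIV. p $ i) = 1}"
 have "compact ?S"
 proof (subst compact_eq_bounded_closed, intro conjI)
  have "norm q <= 1" if "q \<in> ?S" for q
   using norm_le_l1_cart[of q] that by simp
  thus "bounded ?S" unfolding bounded_iff by blast
  show "closed ?S" by (intro closed_Collect_conj closed_Collect_all closed_Collect_le closed_Collect_eq continuous_intros)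
 qed
 hence "seq_compact ?S" by (rule compact_imp_seq_compact)
 note sc = this[unfolded seq_compact_def, THEN spec, of p, THEN mp]
 have "\<forall>n. p n \<in> ?S" using p(1,2) by (auto simp: less_eq_vec_def)
 from sc[OF this] obtain q r where q: "q \<in> ?S" "strict_mono r" "(p \<circ> r) \<longlonglongrightarrow> q" by blast
 have zero: "q \<bullet> u = 0" if u: "!!n. abs(p n \<bullet> u) <= c / real (Suc n)" for u
 proof -
  have "(%n. c / real (Suc n)) \<longlonglongrightarrow> 0" by real_asymp
  hence "(%n. p n \<bullet> u) \<longlonglongrightarrow> 0" by (rule Lim_null_comparison[rotated]) (use u in simp)
  hence "((%n. p n \<bullet> u) \<circ> r) \<longlonglongrightarrow> 0" by (rule LIMSEQ_subseq_LIMSEQ[OF _ q(2)])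
  hence 1: "(%n. p (r n) \<bullet> u) \<longlonglongrightarrow> 0" unfolding comp_def .
  have "(%n. p (r n)) \<longlonglongrightarrow> q" using q(3) unfolding comp_def .
  from tendsto_inner[OF this tendsto_const[of u]] show ?thesis using LIMSEQ_unique[OF _ 1] by blast
 qed
 have "stationary q (P + Q + R)"
 proof -
  have "(q v* (P + Q + R)) $ j = q $ j" for j
  proof -
   have "q \<bullet> (axis j 1 - (P + Q + R) *v axis j 1) = 0"
    by (rule zero, rule p(3)) (simp add: axis_def)
   hence "q $ j = q \<bullet> ((P + Q + R) *v axis j 1)" by (simp add: inner_diff_right inner_axis)
   also have "... = (q v* (P + Q + R)) $ j"
    unfolding matrix_vector_mult_basis by (simp add: inner_vec_def column_def vector_matrix_mult_def mult.commute)
   finally show ?thesis ..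
  qed
  thus ?thesis using q(1) by (auto simp: stationary_def vec_eq_iff less_eq_vec_def)
 qed
 moreover have "q \<bullet> ((P - Q) *v 1) = 0" by (rule zero, rule p(4))
 moreover have "(P, Q, R) \<in> triples" using trip const'[of 0] unfolding valid_def by metis
 ultimately have "x \<in> algebraic_triples" unfolding algebraic_triples_def xPQR by blast
 thus False using x by contradiction
qed

end

section \<open>The potential of a random environment\<close>

lemma entry_measurable:
 assumes e: "(%w. e w n) \<in> borel_measurable N"
 shows "(%w. up (e w) n $ i $ j) \<in> borel_measurable N" "(%w. down (e w) n $ i $ j) \<in> borel_measurable N"
  "(%w. stay (e w) n $ i $ j) \<in> borel_measurable N"
 by (rule measurable_compose[OF e], rule borel_measurable_continuous_onI, intro continuous_intros)+

lemma step_op_measurable: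
 assumes e: "!!n. (%w. e w n) \<in> borel_measurable N" and f: "!!n i. (%w. f w n i) \<in> borel_measurable N"
 shows "(%w. step_op (e w) (f w) n i) \<in> borel_measurable N"
 unfolding step_op_def by (intro borel_measurable_sum borel_measurable_add borel_measurable_times entry_measurable e f)

lemma hit_measurable:
 assumes e: "!!n. (%w. e w n) \<in> borel_measurable N"
 shows "(%w. hit (e w) a b t n i) \<in> borel_measurable N"
proof (induction t arbitrary: n i)
 case (Suc t)
 have "(%w. step_op (e w) (hit (e w) a b t) n i) \<in> borel_measurable N" by (rule step_op_measurable[OF e Suc.IH])
 thus ?case by (cases "n <= a"; cases "b <= n") auto
qed auto

lemma pot_measurable:
 assumes e: "!!n. (%w. e w n) \<in> borel_measurable N"
 shows "(%w. pot (e w) a b) \<in> borel_measurable N"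
proof -
 have "(%w. exit_up (e w) a b n i) \<in> borel_measurable N" for n i
  unfolding exit_up_def by (intro borel_measurable_lim_metric hit_measurable e)
 note [measurable] = this
 show ?thesis unfolding pot_def by measurable
qed

lemma walk_op_measurable:
 assumes e: "!!n. (%w. e w n) \<in> borel_measurable N" and f: "!!n i. (%w. f w n i) \<in> borel_measurable N"
 shows "(%w. walk_op (e w) t (f w) n i) \<in> borel_measurable N"
proof (induction t arbitrary: n i)
 case 0 thus ?case by (simp add: f)
next
 case (Suc t)
 have "(%w. step_op (e w) (walk_op (e w) t (f w)) n i) \<in> borel_measurable N" by (rule step_op_measurable[OF e Suc.IH])
 thus ?case by simp
qed

subsection \<open>Continuity of the potential\<close>

lemma step_op_tendsto_env:
 assumes "(%k. es k n) \<longlonglongrightarrow> e n" "!!n i. (%k. f k n i) \<longlonglongrightarrow> g n i"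
 shows "(%k. step_op (es k) (f k) n i) \<longlonglongrightarrow> step_op e g n i"
 unfolding step_op_def by (intro tendsto_intros assms)

lemma hit_tendsto_env:
 assumes "!!n. (%k. es k n) \<longlonglongrightarrow> e n"
 shows "(%k. hit (es k) a b t n i) \<longlonglongrightarrow> hit e a b t n i"
proof (induction t arbitrary: n i)
 case (Suc t)
 have "(%k. step_op (es k) (hit (es k) a b t) n i) \<longlonglongrightarrow> step_op e (hit e a b t) n i"
  by (rule step_op_tendsto_env[OF assms Suc.IH])
 thus ?case by (cases "n <= a"; cases "b <= n") auto
qed auto

text \<open>An increasing limit of continuous functions of the environment is lower
  semicontinuous.\<close>

lemma exit_up_lsc:
 assumes ab: "a < b" and lim: "!!n. (%k. es k n) \<longlonglongrightarrow> e n" and v: "!!k. valid (es k)" "valid e" and y: "y < exit_up e a b n i"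
 shows "eventually (%k. y < exit_up (es k) a b n i) sequentially"
proof -
 have "(%t. hit e a b t n i) \<longlonglongrightarrow> exit_up e a b n i" by (rule exit_up_tendsto[OF v(2) ab])
 hence "eventually (%t. y < hit e a b t n i) sequentially" using y by (rule order_tendstoD)
 then obtain t where "y < hit e a b t n i" by (auto dest: eventually_happens)
 with hit_tendsto_env[OF lim] have "eventually (%k. y < hit (es k) a b t n i) sequentially" by (rule order_tendstoD)
 thus ?thesis
 proof eventually_elim
  case (elim k) thus ?case using hit_le_exit_up[OF v(1) ab, of k t n i] by linarith
 qed
qed

text \<open>Upper semicontinuity of an exit probability is lower semicontinuity on the reflected
  strip, since the two exit probabilities add up to 1.\<close>

lemma pot_tendsto_env:
 assumes ab: "a < b" and lim: "!!n. (%k. es k n) \<longlonglongrightarrow> e n" and E: "!!k. elliptic_env (es k) \<epsilon> D" "elliptic_env e \<epsilon> D"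
 shows "(%k. pot (es k) a b) \<longlonglongrightarrow> pot e a b"
proof -
 note v = elliptic_env.trip[OF E(1)] elliptic_env.trip[OF E(2)]
 note vm = elliptic_env.trip[OF elliptic_env.mirror_env[OF E(1)]] elliptic_env.trip[OF elliptic_env.mirror_env[OF E(2)]]
 have c: "(%k. exit_up (es k) a b n i) \<longlonglongrightarrow> exit_up e a b n i" for n i
 proof (rule order_tendstoI)
  fix y assume "y < exit_up e a b n i"
  thus "eventually (%k. y < exit_up (es k) a b n i) sequentially" by (rule exit_up_lsc[OF ab lim v])
 next
  fix y assume y: "exit_up e a b n i < y"
  have m: "exit_up (mirror e') (-b) (-a) (-n) i = 1 - exit_up e' a b n i" if "elliptic_env e' \<epsilon> D" for e'
   using elliptic_env.exit_up_mirror[OF that ab, of "-n" i] by simp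
  have lm: "(%k. mirror (es k) n) \<longlonglongrightarrow> mirror e n" for n
   unfolding mirror_def by (intro tendsto_intros lim)
  have "eventually (%k. 1 - y < exit_up (mirror (es k)) (-b) (-a) (-n) i) sequentially"
   by (rule exit_up_lsc[OF _ lm vm]) (use ab y m[OF E(2)] in auto)
  thus "eventually (%k. exit_up (es k) a b n i < y) sequentially"
   by eventually_elim (use m[OF E(1)] in simp)
 qed
 show ?thesis unfolding pot_def
  by (intro tendsto_intros c)
   (use elliptic_env.exit_up_pos[OF E(2), of a "a+1" b undefined] elliptic_env.exit_up_less1[OF E(2), of a "b-1" b undefined] ab in auto)
qed

lemma pot_symmetric_sum:
 assumes "~ summable (%n. f (Suc n) :: real)" "!!n. 0 < n ==> f n = g n"
 shows "~ summable g"
proof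
 assume "summable g"
 hence "summable (%n. g (Suc n))" by (simp add: summable_Suc_iff)
 thus False using assms by simp
qed

text \<open>\<open>\<phi>\<close> modifies triples on a null set so that every sample point, and not
  only almost every one, gives an elliptic environment \<open>clean w\<close>; the bounds of
  \<open>quasi_additive\<close> are required pointwise.\<close>

locale strip_law =
 fixes N :: "'m::finite triple measure" and \<epsilon> D :: real and \<phi> :: "'m triple => 'm triple" and x0 :: "'m triple"
 assumes N: "prob_space N" and sets_N: "sets N = sets triple_space"
  and \<phi>: "\<phi> \<in> borel_measurable N" and eps: "0 < \<epsilon>" and ell: "!!x. elliptic \<epsilon> D (\<phi> x)"
  and supp: "!!W. open W ==> x0 \<in> W ==> 0 < measure N {x \<in> space N. \<phi> x \<in> W}"
  and fix_AE: "AE x in N. \<phi> x = x"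
  and x0: "elliptic \<epsilon> D x0" "x0 \<notin> algebraic_triples"
  and rec: "AE w in Pi\<^sub>M (UNIV :: int set) (%_. N). taboo_recurrent (%n. \<phi> (w n))"
begin

definition clean :: "'m env => 'm env" where "clean w = (%n. \<phi> (w n))"

definition U :: "int => int => 'm env => real" where "U a b w = pot (clean w) a b"

lemma clean_env: "elliptic_env (clean w) \<epsilon> D"
 unfolding elliptic_env_def clean_def using eps ell by blast

lemma clean_measurable: "(%w. clean w n) \<in> borel_measurable (Pi\<^sub>M (UNIV :: int set) (%_. N))"
 unfolding clean_def by (rule measurable_compose[OF _ \<phi>], rule measurable_component_singleton) simp

text \<open>The summand 1 keeps the constant positive when \<open>\<epsilon> = 1\<close>.\<close>

sublocale quasi_additive N U "7 * ln (1 / \<epsilon>) + 1"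
proof (rule quasi_additive.intro)
 show "iid N" unfolding iid_def by (rule N)
 then interpret iid N .
 show "quasi_additive_axioms N U (7 * ln (1 / \<epsilon>) + 1)"
 proof
 interpret E: elliptic_env "clean w" \<epsilon> D for w by (rule clean_env)
 have c0: "elliptic_env.c0 \<epsilon> = ln (1 / \<epsilon>)" by (rule E.c0_def)
 show "0 < 7 * ln (1 / \<epsilon>) + 1" using E.c0_nonneg unfolding c0 by simp
 show "U a b \<in> borel_measurable (Pi\<^sub>M UNIV (%_. N))" for a b
  unfolding U_def[abs_def] by (rule pot_measurable[OF clean_measurable])
 show "depends {a<..<b} (U a b)" for a b
  unfolding depends_def U_def by (intro allI impI pot_cong) (simp add: clean_def)
 show "U (a + k) (b + k) w = U a b (%n. w (n + k))" for a b k w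
  unfolding U_def pot_shift by (simp add: clean_def)
 show "U a (a + 1) w = 0" for a w unfolding U_def by (rule pot_unit)
 show "abs(U a c w - U a b w - U b c w) <= 7 * ln (1 / \<epsilon>) + 1" if "a < b" "b < c" for a b c w
  unfolding U_def using E.pot_quasi_additive[OF that, of w] unfolding c0 by simp
 qed
qed

sublocale centred N U "7 * ln (1 / \<epsilon>) + 1"
proof unfold_locales
 fix n :: nat assume n: "0 < n"
 show "abs(u n) <= 7 * ln (1 / \<epsilon>) + 1"
 proof (rule mean_bounded[OF _ _ n])
  show "AE w in M. ~ summable (%n. exp (U 0 (int n) w))"
   using rec
  proof eventually_elim
   case (elim w)
   interpret E: elliptic_env "clean w" \<epsilon> D by (rule clean_env)
   show ?case using E.recurrent_not_summable elim unfolding U_def clean_def by blast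
  qed
  show "AE w in M. ~ summable (%n. exp (- U (- int n) 0 w))"
   using rec
  proof eventually_elim
   case (elim w)
   interpret E: elliptic_env "clean w" \<epsilon> D by (rule clean_env)
   interpret E': elliptic_env "mirror (clean w)" \<epsilon> D by (rule E.mirror_env)
   have "taboo_recurrent (mirror (clean w))" using elim taboo_recurrent_mirror unfolding clean_def by blast
   hence "~ summable (%n. exp (pot (mirror (clean w)) 0 (int n)))" by (rule E'.recurrent_not_summable)
   hence "~ summable (%n. exp (pot (mirror (clean w)) 0 (int (Suc n))))"
    by (subst (asm) summable_Suc_iff[symmetric])
   thus ?case
   proof (rule pot_symmetric_sum)
    show "exp (pot (mirror (clean w)) 0 (int n)) = exp (- U (- int n) 0 w)" if "0 < n" for n
     using E.pot_mirror[of "- int n" 0] that unfolding U_def by simp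
   qed
  qed
 qed
qed

text \<open>In the constant environment \<open>x0\<close> some potential exceeds 6 times the
  constant in absolute value. Environments close to it on finitely many layers have positive
  probability because \<open>x0\<close> is in the support, and the potential is continuous there; so
  the exceedance asked for by \<open>sigma_pos\<close> has positive probability.\<close>

lemma sigma_positive: "0 < \<sigma>"
proof -
 let ?C = "7 * ln (1 / \<epsilon>) + 1"
 interpret X: elliptic_env "%_. x0" \<epsilon> D unfolding elliptic_env_def using eps x0 by blast
 obtain L where L: "0 < L" "6 * ?C < abs(pot (%_. x0) 0 (int L))"
  using X.const_pot_unbounded[OF refl x0(2), of "6 * ?C"] by blast
 define r :: real where "r = (if 0 <= pot (%_. x0) 0 (int L) then 1 else -1)"
 have r: "r = 1 \<or> r = -1" and big: "6 * ?C < r * pot (%_. x0) 0 (int L)" using L(2) unfolding r_def by auto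
 show ?thesis
 proof (rule sigma_pos[OF L(1) r], rule ccontr)
  let ?E = "{w \<in> space M. 6 * ?C <= r * U 0 (int L) w}"
  have Em: "?E \<in> sets M" by measurable
  assume "~ 0 < measure M ?E"
  hence null: "measure M ?E = 0" using measure_nonneg[of M ?E] by linarith
  have "\<exists>e. (\<forall>n. elliptic \<epsilon> D (e n) & dist (e n) x0 < 1 / real (Suc k)) & r * pot e 0 (int L) < 6 * ?C" for k
  proof -
   define W where "W = {x \<in> space N. \<phi> x \<in> ball x0 (1 / real (Suc k))}"
   have W: "W \<in> sets N" using measurable_sets[OF \<phi> borel_open[OF open_ball]] unfolding W_def by (simp add: vimage_def Int_def conj_commute)
   let ?B = "{w \<in> space M. \<forall>n\<in>{1..<int L}. w n \<in> W}"
   have "emeasure M ?B = (\<Prod>n\<in>{1..<int L}. emeasure N W)"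
    by (rule prod.emeasure_PiM_Collect) (simp_all add: W)
   also have "... = emeasure N W ^ card {1..<int L}" by (rule prod_constant)
   also have "... = ennreal (measure N W ^ card {1..<int L})"
    unfolding N.emeasure_eq_measure by (rule ennreal_power) simp
   finally have B: "measure M ?B = measure N W ^ card {1..<int L}" unfolding measure_def[of M] by simp
   have "0 < measure N W" unfolding W_def by (rule supp) auto
   hence "0 < measure M ?B" unfolding B by simp
   moreover have "measure M ?B <= measure M ?E" if "?B \<subseteq> ?E" by (rule prod.P.finite_measure_mono[OF that Em])
   ultimately have "~ ?B \<subseteq> ?E" using null by linarith
   then obtain w where v: "w \<in> ?B" "w \<notin> ?E" by blast
   hence w: "w \<in> space M" "\<forall>n\<in>{1..<int L}. w n \<in> W" by simp_all
   have w3: "r * U 0 (int L) w < 6 * ?C" using v(2) w(1) unfolding mem_Collect_eq by (meson not_le)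
   define e where "e n = (if n \<in> {1..<int L} then clean w n else x0)" for n
   have "pot e 0 (int L) = pot (clean w) 0 (int L)" by (rule pot_cong) (simp add: e_def)
   hence "r * pot e 0 (int L) < 6 * ?C" using w3 unfolding U_def by simp
   moreover have "elliptic \<epsilon> D (e n) & dist (e n) x0 < 1 / real (Suc k)" for n
    using w(2) ell x0(1) unfolding e_def clean_def W_def by (auto simp: dist_commute)
   ultimately show ?thesis by blast
  qed
  then obtain es where es: "!!k n. elliptic \<epsilon> D (es k n)" "!!k n. dist (es k n) x0 < 1 / real (Suc k)"
   "!!k. r * pot (es k) 0 (int L) < 6 * ?C" by metis
  have "(%k. es k n) \<longlonglongrightarrow> x0" for n
  proof (rule tendstoI)
   fix d :: real assume "0 < d"
   moreover have "(%k. 1 / real (Suc k)) \<longlonglongrightarrow> 0" by real_asymp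
   ultimately have "eventually (%k. 1 / real (Suc k) < d) sequentially" by (simp add: order_tendsto_iff)
   thus "eventually (%k. dist (es k n) x0 < d) sequentially" by eventually_elim (use es(2) in \<open>auto intro: less_trans\<close>)
  qed
  hence "(%k. pot (es k) 0 (int L)) \<longlonglongrightarrow> pot (%_. x0) 0 (int L)"
   by (intro pot_tendsto_env[where \<epsilon>=\<epsilon> and D=D]) (use L es(1) eps x0(1) in \<open>auto simp: elliptic_env_def\<close>)
  hence "(%k. r * pot (es k) 0 (int L)) \<longlonglongrightarrow> r * pot (%_. x0) 0 (int L)" by (intro tendsto_intros)
  hence "r * pot (%_. x0) 0 (int L) <= 6 * ?C"
   by (rule LIMSEQ_le_const2) (use es(3) in \<open>auto intro: less_imp_le\<close>)
  thus False using big by linarith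
 qed
qed

end

section \<open>Convergence in law\<close>

lemma cdf_limit:
 assumes D: "real_distribution D" and x: "x < y" and conv: "weak_conv_m \<nu> D"
 shows "\<exists>c. x < c & c < y & (%k. cdf (\<nu> k) c) \<longlonglongrightarrow> cdf D c"
proof -
 interpret real_distribution D by fact
 have "mono (cdf D)" unfolding mono_def using cdf_nondecreasing by auto
 from open_minus_countable[OF mono_ctble_discont[OF this], of "{x<..<y}"] x
 obtain c where "c \<in> {x<..<y}" "isCont (cdf D) c" by auto
 thus ?thesis using conv unfolding weak_conv_m_def weak_conv_def by auto
qed

text \<open>The condition gives tightness, hence a subsequential limit \<open>D\<close>. At a
  continuity point \<open>x\<close> it then squeezes \<open>cdf (\<mu> t) x\<close> between values
  of \<open>cdf D\<close> just left and just right of \<open>x\<close>, without passing to a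
  subsequence.\<close>

lemma weak_conv_of_cauchy:
 fixes \<mu> :: "nat => real measure"
 assumes \<mu>: "!!t. real_distribution (\<mu> t)"
  and cauchy: "!!\<epsilon> \<beta>. 0 < \<epsilon> ==> 0 < \<beta> ==> \<exists>t0. \<forall>t\<ge>t0. \<forall>t'\<ge>t0. \<forall>x. cdf (\<mu> t) x <= cdf (\<mu> t') (x + \<epsilon>) + \<beta>"
 shows "\<exists>D. real_distribution D & weak_conv_m \<mu> D"
proof -
 interpret X: real_distribution "\<mu> t" for t by (rule \<mu>)
 have tight1: "\<exists>a b. a < b & 1 - \<beta> < measure (\<mu> t) {a<..b}" if "0 < \<beta>" for \<beta> t
 proof -
  have "eventually (%x. cdf (\<mu> t) x < \<beta> / 2) at_bot" "eventually (%x. 1 - \<beta> / 2 < cdf (\<mu> t) x) at_top"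
   using order_tendstoD(2)[OF X.cdf_lim_at_bot, of "\<beta> / 2" t] order_tendstoD(1)[OF X.cdf_lim_at_top_prob, of "1 - \<beta> / 2" t] that by auto
  then obtain a b where a: "!!x. x <= a ==> cdf (\<mu> t) x < \<beta> / 2" and b: "!!x. b <= x ==> 1 - \<beta> / 2 < cdf (\<mu> t) x"
   unfolding eventually_at_bot_linorder eventually_at_top_linorder by blast
  have "measure (\<mu> t) {min a b - 1<..b} = cdf (\<mu> t) b - cdf (\<mu> t) (min a b - 1)"
   by (rule X.cdf_diff_eq[symmetric]) auto
  moreover have "cdf (\<mu> t) (min a b - 1) < \<beta> / 2" by (rule a) simp
  moreover have "1 - \<beta> / 2 < cdf (\<mu> t) b" by (rule b) simp
  ultimately have "min a b - 1 < b & 1 - \<beta> < measure (\<mu> t) {min a b - 1<..b}" by linarith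
  thus ?thesis by blast
 qed
 have "tight \<mu>" unfolding tight_def
 proof (intro conjI allI impI \<mu>)
  fix \<beta> :: real assume \<beta>: "0 < \<beta>"
  obtain t0 where t0: "!!t t' x. t0 <= t ==> t0 <= t' ==> cdf (\<mu> t) x <= cdf (\<mu> t') (x + 1) + \<beta> / 4"
   using cauchy[of 1 "\<beta> / 4"] \<beta> by auto
  have "\<forall>t. \<exists>a b. a < b & 1 - \<beta> / 2 < measure (\<mu> t) {a<..b}" using tight1[of "\<beta> / 2"] \<beta> by simp
  then obtain a b where ab: "!!t. a t < b t & 1 - \<beta> / 2 < measure (\<mu> t) {a t<..b t}" by metis
  define A where "A = Min (a ` {..t0}) - 1"
  define B where "B = Max (b ` {..t0}) + 1"
  have AB: "A <= a t - 1" "b t + 1 <= B" if "t <= t0" for t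
   unfolding A_def B_def using Min_le[of "a ` {..t0}" "a t"] Max_ge[of "b ` {..t0}" "b t"] that by auto
  have "A < B" using AB[of t0] ab[of t0] by linarith
  moreover have "1 - \<beta> < measure (\<mu> t) {A<..B}" for t
  proof (cases "t <= t0")
   case True
   have "measure (\<mu> t) {a t<..b t} <= measure (\<mu> t) {A<..B}"
    by (rule X.finite_measure_mono) (use AB[OF True] in auto)
   thus ?thesis using ab[of t] \<beta> by linarith
  next
   case False
   have "cdf (\<mu> t0) (b t0) <= cdf (\<mu> t) (b t0 + 1) + \<beta> / 4" using t0[of t0 t "b t0"] False by simp
   also have "cdf (\<mu> t) (b t0 + 1) <= cdf (\<mu> t) B" by (rule X.cdf_nondecreasing) (use AB[of t0] in simp)
   finally have 1: "cdf (\<mu> t0) (b t0) <= cdf (\<mu> t) B + \<beta> / 4" by simp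
   have "cdf (\<mu> t) A <= cdf (\<mu> t) (a t0 - 1)" by (rule X.cdf_nondecreasing) (use AB[of t0] in simp)
   also have "... <= cdf (\<mu> t0) (a t0) + \<beta> / 4" using t0[of t t0 "a t0 - 1"] False by simp
   finally have 2: "cdf (\<mu> t) A <= cdf (\<mu> t0) (a t0) + \<beta> / 4" .
   have "measure (\<mu> t) {A<..B} = cdf (\<mu> t) B - cdf (\<mu> t) A" by (rule X.cdf_diff_eq[symmetric]) fact
   moreover have "measure (\<mu> t0) {a t0<..b t0} = cdf (\<mu> t0) (b t0) - cdf (\<mu> t0) (a t0)" by (rule X.cdf_diff_eq[symmetric]) (use ab in simp)
   ultimately show ?thesis using 1 2 ab[of t0] by linarith
  qed
  ultimately show "\<exists>a b. a < b & (\<forall>n. 1 - \<beta> < measure (\<mu> n) {a<..b})" by blast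
 qed
 from tight_imp_convergent_subsubsequence[OF this strict_mono_id]
 obtain r D where r: "strict_mono (r :: nat => nat)" and D: "real_distribution D" and c: "weak_conv_m (\<mu> \<circ> id \<circ> r) D" by blast
 interpret D: real_distribution D by (rule D)
 have rt: "eventually (%k. t <= r k) sequentially" for t
  using filterlim_subseq[OF r] unfolding filterlim_at_top by blast
 have "weak_conv_m \<mu> D" unfolding weak_conv_m_def weak_conv_def
 proof (intro allI impI)
  fix x assume cont: "isCont (cdf D) x"
  show "(%t. cdf (\<mu> t) x) \<longlonglongrightarrow> cdf D x"
  proof (rule tendstoI)
   fix \<beta> :: real assume \<beta>: "0 < \<beta>"
   obtain \<delta> where \<delta>: "0 < \<delta>" "!!y. dist y x < \<delta> ==> dist (cdf D y) (cdf D x) < \<beta> / 4"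
    using cont[unfolded continuous_at_eps_delta, rule_format, of "\<beta> / 4"] \<beta> by auto
   obtain c1 where c1: "x < c1" "c1 < x + \<delta>" "(%k. cdf (\<mu> (r k)) c1) \<longlonglongrightarrow> cdf D c1"
    using cdf_limit[OF D _ c, of x "x + \<delta>"] \<delta> by auto
   obtain c2 where c2: "x - \<delta> < c2" "c2 < x" "(%k. cdf (\<mu> (r k)) c2) \<longlonglongrightarrow> cdf D c2"
    using cdf_limit[OF D _ c, of "x - \<delta>" x] \<delta> by auto
   obtain t1 where t1: "!!t t' y. t1 <= t ==> t1 <= t' ==> cdf (\<mu> t) y <= cdf (\<mu> t') (y + (c1 - x)) + \<beta> / 4"
    using cauchy[of "c1 - x" "\<beta> / 4"] \<beta> c1 by auto
   obtain t2 where t2: "!!t t' y. t2 <= t ==> t2 <= t' ==> cdf (\<mu> t) y <= cdf (\<mu> t') (y + (x - c2)) + \<beta> / 4"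
    using cauchy[of "x - c2" "\<beta> / 4"] \<beta> c2 by auto
   have "dist (cdf (\<mu> t) x) (cdf D x) < \<beta>" if t: "max t1 t2 <= t" for t
   proof -
    have "cdf (\<mu> t) x <= cdf D c1 + \<beta> / 4"
    proof (rule tendsto_lowerbound[OF tendsto_add[OF c1(3) tendsto_const]])
     show "eventually (%k. cdf (\<mu> t) x <= cdf (\<mu> (r k)) c1 + \<beta> / 4) sequentially"
      using rt[of t1] by eventually_elim (use t1[of t _ x] t in auto)
    qed simp
    moreover have "cdf D c2 <= cdf (\<mu> t) x + \<beta> / 4"
    proof (rule tendsto_upperbound[OF c2(3)])
     show "eventually (%k. cdf (\<mu> (r k)) c2 <= cdf (\<mu> t) x + \<beta> / 4) sequentially"
      using rt[of t2] by eventually_elim (use t2[of _ t c2] t in auto)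
    qed simp
    moreover have "dist (cdf D c1) (cdf D x) < \<beta> / 4" "dist (cdf D c2) (cdf D x) < \<beta> / 4"
     using \<delta>(2)[of c1] \<delta>(2)[of c2] c1 c2 by (auto simp: dist_real_def)
    ultimately show ?thesis unfolding dist_real_def using \<beta> by linarith
   qed
   thus "eventually (%t. dist (cdf (\<mu> t) x) (cdf D x) < \<beta>) sequentially"
    unfolding eventually_sequentially by blast
  qed
 qed
 thus ?thesis using D by blast
qed

section \<open>The quenched median\<close>

lemma walk_op_mono:
 assumes "valid e" "!!n i. f n i <= g n i"
 shows "walk_op e t f n i <= walk_op e t g n i"
 using assms(2)
proof (induction t arbitrary: n i)
 case (Suc t) thus ?case by (simp add: step_op_mono[OF assms(1)])
qed simp

lemma walk_op_compl:
 assumes "valid e"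
 shows "walk_op e t (%n i. 1 - f n i) n i = 1 - walk_op e t f n i"
proof (induction t arbitrary: n i)
 case (Suc t)
 have "walk_op e t (%n i. 1 - f n i) = (%n i. 1 - walk_op e t f n i)" using Suc by (intro HOL.ext)
 thus ?case using step_op_diff[of e "%_ _. 1" "walk_op e t f" n i] step_op_const[OF assms, of 1 n i] by simp
qed simp

lemma walk_op_mirror: "walk_op (mirror e) t f n i = walk_op e t (%k. f (- k)) (- n) i"
proof (induction t arbitrary: n i)
 case (Suc t)
 have "(%k. walk_op (mirror e) t f (- k)) = walk_op e t (%k. f (- k))" using Suc by (intro HOL.ext) simp
 moreover have "walk_op (mirror e) (Suc t) f n i = step_op e (%k. walk_op (mirror e) t f (- k)) (- n) i"
  unfolding step_op_mirror[symmetric] by simp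
 ultimately show ?case by simp
qed simp

lemma step_op_shift: "step_op e f (n + k) i = step_op (%n. e (n + k)) (%n. f (n + k)) n i"
 unfolding step_op_def by (simp add: algebra_simps)

lemma walk_op_shift: "walk_op e t f (n + k) i = walk_op (%n. e (n + k)) t (%n. f (n + k)) n i"
proof (induction t arbitrary: n i)
 case (Suc t)
 have "(%n. walk_op e t f (n + k)) = walk_op (%n. e (n + k)) t (%n. f (n + k))" using Suc by (intro HOL.ext)
 moreover have "walk_op e (Suc t) f (n + k) i = step_op (%n. e (n + k)) (%n. walk_op e t f (n + k)) n i"
  unfolding step_op_shift[symmetric] by simp
 ultimately show ?case by simp
qed simp

definition far :: "int => int => int => 'm => real" where
 "far r b n i = (if r < abs(n - b) then 1 else 0)"

text \<open>A walk from layer 0 is not below \<open>- t\<close> at time \<open>t\<close>, so the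
  shift by \<open>t\<close> turns the least integer median into a \<open>LEAST\<close> over the
  naturals.\<close>

definition median :: "'m::finite => nat => 'm env => int" where
 "median i t e = int (LEAST k. 1 / 2 <= walk_op e t (%n _. if n <= int k - int t then 1 else 0) 0 i) - int t"

text \<open>With more than half of the mass within \<open>r\<close> of \<open>b\<close>, the median
  cannot lie on either side of this window.\<close>

lemma median_close:
 assumes v: "valid e" and f: "walk_op e t (far r b) 0 i <= \<delta>" and \<delta>: "\<delta> < 1 / 2" and b: "- int t <= b + r" and r: "0 <= r"
 shows "abs(median i t e - b) <= r"
proof -
 let ?F = "%m. walk_op e t (%n _. if n <= m then 1 else 0) 0 i"
 let ?P = "%k. 1 / 2 <= ?F (int k - int t)"
 have up: "?F m <= \<delta>" if "m < b - r" for m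
 proof -
  have "?F m <= walk_op e t (far r b) 0 i" by (rule walk_op_mono[OF v]) (use that r in \<open>auto simp: far_def\<close>)
  thus ?thesis using f by linarith
 qed
 have "1 - ?F (b + r) = walk_op e t (%n i. 1 - (if n <= b + r then 1 else 0)) 0 i" by (rule walk_op_compl[OF v, symmetric])
 also have "... <= walk_op e t (far r b) 0 i" by (rule walk_op_mono[OF v]) (use r in \<open>auto simp: far_def\<close>)
 finally have "1 / 2 <= ?F (b + r)" using f \<delta> by linarith
 hence P: "?P (nat (b + r + int t))" using b by simp
 have "1 / 2 <= ?F (median i t e)" unfolding median_def by (rule LeastI[of ?P, OF P])
 hence "b - r <= median i t e" using up[of "median i t e"] \<delta> by linarith
 moreover have "(LEAST k. ?P k) <= nat (b + r + int t)" by (rule Least_le[of ?P, OF P])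
 hence "median i t e <= b + r" unfolding median_def using b by linarith
 ultimately show ?thesis by linarith
qed

lemma median_measurable:
 assumes e: "!!n. (%w. e w n) \<in> borel_measurable N"
 shows "(%w. median i t (e w)) \<in> N \<rightarrow>\<^sub>M count_space UNIV"
proof -
 have [measurable]: "(%w. walk_op (e w) t f n i) \<in> borel_measurable N" for f n by (rule walk_op_measurable[OF e]) simp
 have "(%w. LEAST k. 1 / 2 <= walk_op (e w) t (%n _. if n <= int k - int t then 1 else 0) 0 i) \<in> N \<rightarrow>\<^sub>M count_space UNIV"
  by (rule measurable_Least) measurable
 thus ?thesis unfolding median_def by (rule measurable_compose) simp
qed

section \<open>Localization of the walk\<close>

context strip_law
begin

abbreviation "CC \<equiv> 7 * ln (1 / \<epsilon>) + 1"

lemma clean_eq: "AE w in M. clean w = w"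
proof -
 have "AE w in M. \<phi> (w n) = w n" for n
 proof -
  have d: "distr M N (%w. w n) = N" using distr_PiM_component[of UNIV "%_. N" n] N by simp
  have "AE x in distr M N (%w. w n). \<phi> x = x" unfolding d by (rule fix_AE)
  thus ?thesis by (rule AE_distrD[rotated]) simp
 qed
 hence "AE w in M. \<forall>n. \<phi> (w n) = w n" by (simp add: AE_all_countable)
 thus ?thesis unfolding clean_def by eventually_elim (auto simp: fun_eq_iff)
qed

lemma valid_clean: "valid (clean w)" by (rule elliptic_env.trip[OF clean_env])

lemma pot_at_eq: "pot_at w x = site_pot (clean w) x"
 unfolding pot_at_def site_pot_def U_def by simp

lemma quenched:
 assumes sm: "smooth L d \<delta> t w" and v: "valley \<eta> \<rho> d (profile L t w) q" and n: "1 <= mesh L t" and L: "0 < L" and d: "0 <= d"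
  and T: "0 < ln (real t)" and big: "CC * (of_int d + 2) <= \<delta> * ln (real t)" and z: "z <= ln (real t) * \<eta> - 6 * (\<delta> * ln (real t))"
 shows "walk_op (clean w) t (far ((\<rho> + 1) * mesh L t) (q * mesh L t)) 0 i
  <= elliptic_env.KQ \<epsilon> D * (2 * of_int d * of_int (mesh L t))^2 * exp (- z)"
proof -
 define n where "n = mesh L t"
 define T where "T = ln (real t)"
 let ?s = "profile L t w"
 interpret E: elliptic_env "clean w" \<epsilon> D by (rule clean_env)
 interpret E': elliptic_env "mirror (clean w)" \<epsilon> D by (rule E.mirror_env)
 have n1: "1 <= n" "0 < n" and T0: "0 < T" and t0: "0 < t" using n T unfolding n_def T_def by (auto intro: Nat.gr0I)
 have c0: "E.c0 = ln (1 / \<epsilon>)" by (rule E.c0_def)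
 have \<delta>T: "6 * E.c0 <= \<delta> * T" "0 <= \<delta> * T"
 proof -
  have "CC * 1 <= CC * (of_int d + 2)" using E.c0_nonneg d unfolding c0 by (intro mult_left_mono) auto
  from order_trans[OF this big] have "CC <= \<delta> * T" unfolding T_def by (simp only: mult_1_right)
  thus "6 * E.c0 <= \<delta> * T" "0 <= \<delta> * T" using E.c0_nonneg unfolding c0 by linarith+
 qed
 have err: "abs(pot_at w x - T * ?s (x div n)) <= 2 * (\<delta> * T)" if "-d <= x div n" "x div n <= d" for x
  using pot_profile[OF sm n L T big, of x] that unfolding n_def T_def mult.assoc by blast
 have dm: "x div n <= y div n" if "x <= y" for x y using that n1 by (intro zdiv_mono1) auto
 have near: "abs(x - x div n * n) <= n" for x
  using n1 pos_mod_bound[of n x] pos_mod_sign[of n x] div_mult_mod_eq[of x n] by linarith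
 have size: "K * (real_of_int (c * n - a * n))^2 * exp (- z) <= K * (2 * of_int d * of_int n)^2 * exp (- z)"
  if "0 <= K" "c * n - a * n <= 2 * d * n" "a * n < 0" "0 <= q * n" "q * n < c * n" for K a c q
 proof -
  have "real_of_int (c * n - a * n) <= real_of_int (2 * d * n)" using that(2) by (simp only: of_int_le_iff)
  moreover have "0 <= real_of_int (c * n - a * n)" using that(3-5) by (subst of_int_0_le_iff) linarith
  ultimately have "(real_of_int (c * n - a * n))^2 <= (2 * of_int d * of_int n)^2" by (intro power_mono) auto
  thus ?thesis using that(1) by (intro mult_right_mono mult_left_mono) auto
 qed
 from v obtain a c where "valley_right \<eta> \<rho> d ?s a q c \<or> valley_right \<eta> \<rho> d (%k. ?s (- k)) (- c) (- q) (- a)"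
  unfolding valley_def by blast
 hence "walk_op (clean w) t (far ((\<rho> + 1) * n) (q * n)) 0 i <= E.KQ * (2 * of_int d * of_int n)^2 * exp (- z)"
 proof
  assume v: "valley_right \<eta> \<rho> d ?s a q c"
  have wT: "z <= T * \<eta> - 2 * (2 * (\<delta> * T))" using z \<delta>T unfolding T_def by linarith
  have err': "abs(site_pot (clean w) x - T * ?s (x div n)) <= 2 * (\<delta> * T)" if "-d <= x div n" "x div n <= d" for x
   using err[OF that] unfolding pot_at_eq .
  have fk: "(k * n) div n = k" for k using n1 by simp
  note l = valley_lift[OF v n1(1) T0 dm fk near err' wT]
  have "walk_op (clean w) t (%k j. if (\<rho> + 1) * n < abs(k - q * n) then 1 else 0) 0 i <= E.KQ * (real_of_int (c * n - a * n))^2 * exp (- z)"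
   by (rule E.quenched_localization[OF l(1-3) t0 T_def l(5-9)])
  also have "... <= E.KQ * (2 * of_int d * of_int n)^2 * exp (- z)" by (rule size[OF E.KQ_nonneg l(4) l(1-3)])
  finally show ?thesis unfolding far_def[abs_def] .
 next
  assume v: "valley_right \<eta> \<rho> d (%k. ?s (- k)) (- c) (- q) (- a)"
  \<comment> \<open>Reflection rounds up instead of down. Comparing the reflected potential with the
    original one costs \<open>6 * c0 <= \<delta> * T\<close>, which raises the error to
    \<open>3 * (\<delta> * T)\<close>; twice this is the 6 in the bound on \<open>z\<close>.\<close>
  define f where "f x = - ((- x) div n)" for x
  have wT: "z <= T * \<eta> - 2 * (3 * (\<delta> * T))" using z unfolding T_def by linarith
  have err': "abs(site_pot (mirror (clean w)) x - T * ?s (- f x)) <= 3 * (\<delta> * T)" if "-d <= f x" "f x <= d" for x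
   using err[of "-x"] E.site_pot_mirror[of x] that \<delta>T unfolding f_def pot_at_eq by simp
  have fm: "f x <= f y" if "x <= y" for x y using dm[of "-y" "-x"] that unfolding f_def by simp
  have fk: "f (k * n) = k" for k
  proof -
   have "- (k * n) = (- k) * n" by simp
   hence "(- (k * n)) div n = - k" using n1 by (simp only: nonzero_mult_div_cancel_right)
   thus ?thesis unfolding f_def by simp
  qed
  have fn: "abs(x - f x * n) <= n" for x using near[of "-x"] unfolding f_def by (simp add: abs_le_iff)
  note l = valley_lift[OF v n1(1) T0 fm fk fn err' wT]
  have "walk_op (mirror (clean w)) t (%k j. if (\<rho> + 1) * n < abs(k - (- q) * n) then 1 else 0) 0 i
   <= E.KQ * (real_of_int ((- a) * n - (- c) * n))^2 * exp (- z)"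
   by (rule E'.quenched_localization[OF l(1-3) t0 T_def l(5-9)])
  also have "... <= E.KQ * (2 * of_int d * of_int n)^2 * exp (- z)" by (rule size[OF E.KQ_nonneg l(4) l(1-3)])
  also have "walk_op (mirror (clean w)) t (%k j. if (\<rho> + 1) * n < abs(k - (- q) * n) then 1 else 0) 0 i
   = walk_op (clean w) t (%k j. if (\<rho> + 1) * n < abs(- k - (- q) * n) then 1 else 0) 0 i"
   unfolding walk_op_mirror by simp
  finally have "walk_op (clean w) t (%k j. if (\<rho> + 1) * n < abs(- k - (- q) * n) then 1 else 0) 0 i
   <= E.KQ * (2 * of_int d * of_int n)^2 * exp (- z)" .
  moreover have "(%k (j :: 'm). if (\<rho> + 1) * n < abs(- k - (- q) * n) then 1 else 0) = far ((\<rho> + 1) * n) (q * n)"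
  proof -
   have "abs(- k - (- q) * n) = abs(k - q * n)" for k by linarith
   thus ?thesis unfolding far_def[abs_def] by (simp only:)
  qed
  ultimately show ?thesis by (simp only:)
 qed
 thus ?thesis unfolding n_def .
qed

text \<open>With \<open>\<delta> = \<eta> / 16\<close> and margin \<open>\<eta> / 2\<close> the
  exponent left is \<open>\<eta> / 2 - 6 * \<eta> / 16 = \<eta> / 8\<close>, so the walk is far from
  the bottom with probability at most of order \<open>(ln t)^4\<close> times a negative power of
  \<open>t\<close>. The neighbourhood of the bottom and the rounding of \<open>mesh\<close> take
  \<open>e / 2\<close> each.\<close>

lemma quenched_eventually:
 assumes L: "0 < L" and d: "0 < d" and \<rho>: "0 <= \<rho>" and \<eta>: "0 < \<eta>" and e: "0 < e" "e < 1 / 2"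
  and r: "of_int (\<rho> + 1) <= e * \<sigma>^2 / 2 * of_int L"
 shows "\<forall>\<^sub>F t in sequentially. \<forall>w q. smooth L d (\<eta> / 16) t w --> valley (\<eta> / 2) \<rho> d (profile L t w) q -->
   abs(of_int (median i t (clean w)) / (ln (real t))^2 - of_int q / (\<sigma>^2 * of_int L)) <= e &
   1 - e <= walk_op (clean w) t (%k j. if abs(of_int k / (ln (real t))^2 - of_int (median i t (clean w)) / (ln (real t))^2) <= 2 * e then 1 else 0) 0 i"
proof -
 define s where "s = 1 / (\<sigma>^2 * of_int L)"
 have s: "0 < s" unfolding s_def using sigma_positive L by simp
 let ?K = "elliptic_env.KQ \<epsilon> D * (2 * of_int d)^2 * s^2"
 have mesh_le: "of_int (mesh L t) <= s * (ln (real t))^2" "s * (ln (real t))^2 - 1 <= of_int (mesh L t)" for t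
  unfolding mesh_def s_def using floor_correct[of "(ln (real t))^2 / (\<sigma>^2 * of_int L)"] by (simp_all, linarith?)
 have 1: "\<forall>\<^sub>F t in sequentially. 1 <= mesh L t"
  using mesh_lim(1)[OF sigma_positive L] unfolding filterlim_at_top by blast
 have 2: "\<forall>\<^sub>F t in sequentially. CC * (of_int d + 2) <= \<eta> / 16 * ln (real t)"
 proof -
  have "filterlim (%t. \<eta> / 16 * ln (real t)) at_top sequentially" using \<eta> by real_asymp
  thus ?thesis unfolding filterlim_at_top by blast
 qed
 have 3: "\<forall>\<^sub>F t in sequentially. ?K * (ln (real t) ^ 4 * exp (- (\<eta> / 8 * ln (real t)))) < e"
 proof -
  have "(%t. ln (real t) ^ 4 * exp (- (\<eta> / 8 * ln (real t)))) \<longlonglongrightarrow> 0" using \<eta> by real_asymp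
  hence "(%t. ?K * (ln (real t) ^ 4 * exp (- (\<eta> / 8 * ln (real t))))) \<longlonglongrightarrow> ?K * 0" by (rule tendsto_mult_left)
  thus ?thesis using e(1) by (simp add: order_tendsto_iff)
 qed
 have 4: "\<forall>\<^sub>F t in sequentially. of_int (\<rho> + 1 + d) * s * (ln (real t))^2 < real t"
 proof -
  define A where "A = of_int (\<rho> + 1 + d) * s"
  have "0 < A" unfolding A_def using s \<rho> d by simp
  hence "\<forall>\<^sub>F t in sequentially. A * (ln (real t))^2 < real t" by real_asymp
  thus ?thesis unfolding A_def .
 qed
 have 5: "\<forall>\<^sub>F t in sequentially. of_int d / (ln (real t))^2 < e / 2"
 proof -
  have "(%t. of_int d / (ln (real t))^2) \<longlonglongrightarrow> 0" by real_asymp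
  thus ?thesis by (rule order_tendstoD(2)) (use e in simp)
 qed
 show ?thesis using 1 2 3 4 5 eventually_gt_at_top[of 1]
 proof eventually_elim
  case (elim t)
  define T where "T = ln (real t)"
  define n where "n = mesh L t"
  have T: "0 < T" unfolding T_def using elim(6) by simp
  have n: "1 <= n" "of_int n <= s * T^2" "s * T^2 - 1 <= of_int n" using elim(1) mesh_le[of t] unfolding n_def T_def by auto
  show ?case
  proof (intro allI impI)
   fix w q assume sm: "smooth L d (\<eta> / 16) t w" and v: "valley (\<eta> / 2) \<rho> d (profile L t w) q"
   interpret E: elliptic_env "clean w" \<epsilon> D by (rule clean_env)
   let ?r = "(\<rho> + 1) * n"
   let ?b = "median i t (clean w)"
   have qd: "abs(q) <= d" using v unfolding valley_def valley_right_def by auto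
   have "walk_op (clean w) t (far ?r (q * n)) 0 i <= E.KQ * (2 * of_int d * of_int n)^2 * exp (- (\<eta> / 8 * T))"
    unfolding n_def by (rule quenched[OF sm v elim(1) L _ _ elim(2)]) (use T d in \<open>auto simp: T_def\<close>)
   also have "... <= E.KQ * (2 * of_int d * (s * T^2))^2 * exp (- (\<eta> / 8 * T))"
    using n d E.KQ_nonneg by (intro mult_right_mono mult_left_mono power_mono) auto
   also have "... = ?K * (T ^ 4 * exp (- (\<eta> / 8 * T)))" by (simp add: power_mult_distrib power_mult[symmetric])
   also have "... <= e" using elim(3) unfolding T_def by simp
   finally have far: "walk_op (clean w) t (far ?r (q * n)) 0 i <= e" .
   have r0: "0 <= ?r" using \<rho> n by simp
   have lo: "- int t <= q * n + ?r"
   proof -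
    have "of_int (d * n) <= of_int (\<rho> + 1 + d) * (s * T^2)"
     unfolding of_int_mult using n d \<rho> by (intro mult_mono) auto
    also have "... < real t" using elim(4) unfolding T_def by (simp add: mult.assoc)
    finally have "real_of_int (d * n) < real_of_int (int t)" by (simp only: of_int_of_nat_eq)
    hence "d * n < int t" by (simp only: of_int_less_iff)
    moreover have "(- d) * n <= q * n" using qd n by (intro mult_right_mono) auto
    ultimately show ?thesis using r0 by linarith
   qed
   have med: "abs(?b - q * n) <= ?r" by (rule median_close[OF valid_clean far e(2) lo r0])
   have rT: "of_int ?r / T^2 <= e / 2"
   proof -
    have "of_int ?r <= (e * \<sigma>^2 / 2 * of_int L) * (s * T^2)" unfolding of_int_mult using r n e \<rho> by (intro mult_mono) auto
    also have "... = e / 2 * T^2" unfolding s_def using sigma_positive L by simp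
    finally show ?thesis using T by (simp add: divide_le_eq)
   qed
   have close: "abs(of_int k / T^2 - of_int l / T^2) <= e / 2" if "abs(k - l) <= ?r" for k l
   proof -
    have "abs(real_of_int k - of_int l) <= of_int ?r" using that by (metis of_int_abs of_int_diff of_int_le_iff)
    hence "abs(real_of_int k - of_int l) / T^2 <= of_int ?r / T^2" by (intro divide_right_mono) auto
    moreover have "abs(of_int k / T^2 - of_int l / T^2) = abs(real_of_int k - of_int l) / T^2"
     by (simp add: diff_divide_distrib[symmetric] abs_divide)
    ultimately show ?thesis using rT by linarith
   qed
   have "abs(of_int (q * n) / T^2 - of_int q / (\<sigma>^2 * of_int L)) <= e / 2"
   proof -
    have "abs(of_int n - s * T^2) <= 1" using n by linarith
    hence "abs(of_int q) * abs(of_int n - s * T^2) <= of_int d * 1" using qd by (intro mult_mono) auto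
    hence "abs(of_int q * (of_int n - s * T^2)) / T^2 <= of_int d / T^2" unfolding abs_mult by (intro divide_right_mono) auto
    moreover have "of_int (q * n) / T^2 - of_int q / (\<sigma>^2 * of_int L) = of_int q * (of_int n - s * T^2) / T^2"
     using T by (simp add: s_def field_simps)
    moreover have "of_int d / T^2 < e / 2" using elim(5) unfolding T_def .
    ultimately show ?thesis by (simp only: abs_divide abs_power2)
   qed
   note q = this
   have tri: "abs(x - z) <= e" if "abs(x - y) <= e / 2" "abs(y - z) <= e / 2" for x y z :: real using that by linarith
   have 1: "abs(of_int ?b / T^2 - of_int q / (\<sigma>^2 * of_int L)) <= e" by (rule tri[OF close[OF med] q])
   have "1 - e <= 1 - walk_op (clean w) t (far ?r (q * n)) 0 i" using far by simp
   also have "... = walk_op (clean w) t (%k j. 1 - far ?r (q * n) k j) 0 i" by (rule walk_op_compl[OF valid_clean, symmetric])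
   also have "... <= walk_op (clean w) t (%k j. if abs(of_int k / T^2 - of_int ?b / T^2) <= 2 * e then 1 else 0) 0 i"
   proof (rule walk_op_mono[OF valid_clean])
    fix k j
    have "abs(of_int k / T^2 - of_int ?b / T^2) <= 2 * e" if "abs(k - q * n) <= ?r"
    proof -
     have "abs(of_int (q * n) / T^2 - of_int ?b / T^2) <= e / 2" using close[OF med] by (simp only: abs_minus_commute)
     from tri[OF close[OF that] this] show ?thesis using e(1) by simp
    qed
    thus "1 - far ?r (q * n) k j <= (if abs(of_int k / T^2 - of_int ?b / T^2) <= 2 * e then 1 else 0)"
     unfolding far_def by (auto simp: not_less)
   qed
   finally show "abs(of_int ?b / (ln (real t))^2 - of_int q / (\<sigma>^2 * of_int L)) <= e &
    1 - e <= walk_op (clean w) t (%k j. if abs(of_int k / (ln (real t))^2 - of_int ?b / (ln (real t))^2) <= 2 * e then 1 else 0) 0 i"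
    using 1 unfolding T_def by simp
  qed
 qed
qed

end

section \<open>The centre of localization\<close>

context strip_law
begin

definition center :: "'m => nat => 'm env => real" where
 "center i t w = of_int (median i t (clean w)) / (ln (real t))^2"

lemma center_measurable [measurable]: "center i t \<in> borel_measurable M"
 unfolding center_def[abs_def]
 by (rule measurable_compose[OF median_measurable[OF clean_measurable]]) simp

abbreviation near_center :: "'m => nat => real => 'm env => real" where
 "near_center i t e w \<equiv> walk_op (clean w) t (%k j. if abs(of_int k / (ln (real t))^2 - center i t w) <= e then 1 else 0) 0 i"

lemma near_center_measurable [measurable]: "near_center i t e \<in> borel_measurable M"
proof (rule walk_op_measurable[OF clean_measurable])
 have "Measurable.pred M (%w. abs(of_int k / (ln (real t))^2 - center i t w) <= e)" for k by measurable
 thus "(%w. if abs(of_int k / (ln (real t))^2 - center i t w) <= e then 1 else 0 :: real) \<in> borel_measurable M" for k j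
  by measurable
qed

abbreviation "good L d \<rho> \<eta> t w \<equiv> (\<exists>q. valley \<eta> \<rho> d (profile L t w) q) & smooth L d (\<eta> / 16) t w"

lemma valley_pred [measurable]: "Measurable.pred M (%w. \<exists>q. P q & valley \<eta> \<rho> d (profile L t w) q)"
 by (intro pred_intros_countable pred_intros_logic valley_measurable) measurable

lemma good_measurable: "{w \<in> space M. ~ good L d \<rho> \<eta> t w} \<in> sets M"
proof -
 have [measurable]: "Measurable.pred M (%w. \<exists>q. valley \<eta> \<rho> d (profile L t w) q)" using valley_pred[of "%_. True"] by simp
 show ?thesis by measurable
qed

lemma valley_exists_prob:
 assumes e: "0 < e" "e < 1 / 2" and \<beta>: "0 < \<beta>"
 obtains L d \<rho> \<eta> t0 where "0 < L" "0 < \<eta>"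
  "\<forall>t\<ge>t0. measure M {w \<in> space M. ~ good L d \<rho> \<eta> t w} <= 2 * \<beta>"
  "\<forall>t\<ge>t0. \<forall>t'\<ge>t0. \<forall>m.
   valley_prob L d \<rho> \<eta> t (%q. q <= m) <= valley_prob L d \<rho> (\<eta> / 2) t' (%q. q <= m) + \<beta>"
  "\<forall>t\<ge>t0. \<forall>w q. good L d \<rho> \<eta> t w --> valley (\<eta> / 2) \<rho> d (profile L t w) q -->
    abs(center i t w - of_int q / (\<sigma>^2 * of_int L)) <= e & 1 - e <= near_center i t (2 * e) w"
proof -
 have "0 < e * \<sigma>^2 / 2" using e sigma_positive by simp
 then obtain L d \<rho> \<eta> t3 where L: "0 < L" "0 < d" "0 <= \<rho>" "0 < \<eta>" and r: "of_int (\<rho> + 1) <= e * \<sigma>^2 / 2 * of_int L"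
  and p1: "\<forall>\<^sub>F t in sequentially. 1 - \<beta> <= measure M {w \<in> space M. \<exists>q. valley \<eta> \<rho> d (profile L t w) q}"
  and p2: "\<forall>\<^sub>F t in sequentially. measure M {w \<in> space M. ~ smooth L d (\<eta> / 16) t w} <= \<beta>"
  and p3: "\<forall>t\<ge>t3. \<forall>t'\<ge>t3. \<forall>m.
   valley_prob L d \<rho> \<eta> t (%q. q <= m) <= valley_prob L d \<rho> (\<eta> / 2) t' (%q. q <= m) + \<beta>"
  by (rule valley_probability[OF sigma_positive _ \<beta>])
 have "\<forall>\<^sub>F t in sequentially. measure M {w \<in> space M. ~ good L d \<rho> \<eta> t w} <= 2 * \<beta>"
  using p1 p2
 proof eventually_elim
  case (elim t)
  let ?V = "{w \<in> space M. \<exists>q. valley \<eta> \<rho> d (profile L t w) q}" and ?S = "{w \<in> space M. ~ smooth L d (\<eta> / 16) t w}"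
  have V: "?V \<in> sets M" using valley_pred[of "%_. True"] unfolding pred_def by simp
  have S: "?S \<in> sets M" by measurable
  have "{w \<in> space M. ~ good L d \<rho> \<eta> t w} = (space M - ?V) \<union> ?S" by auto
  hence "measure M {w \<in> space M. ~ good L d \<rho> \<eta> t w} <= measure M (space M - ?V) + measure M ?S"
   using measure_Un_le[OF sets.Diff[OF sets.top V] S] by simp
  thus ?case using elim prod.P.prob_compl[OF V] by linarith
 qed
 then obtain t1 where t1: "!!t. t1 <= t ==> measure M {w \<in> space M. ~ good L d \<rho> \<eta> t w} <= 2 * \<beta>"
  unfolding eventually_sequentially by blast
 obtain t2 where t2: "!!t w q. t2 <= t ==> smooth L d (\<eta> / 16) t w ==> valley (\<eta> / 2) \<rho> d (profile L t w) q ==>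
    abs(center i t w - of_int q / (\<sigma>^2 * of_int L)) <= e & 1 - e <= near_center i t (2 * e) w"
  using quenched_eventually[OF L e r, folded center_def] unfolding eventually_sequentially by blast
 show ?thesis by (rule that[of L \<eta> "max t1 (max t2 t3)" \<rho> d]) (use L t1 t2 p3 in auto)
qed

lemma center_concentration:
 assumes e: "0 < e" and \<beta>: "0 < \<beta>"
 shows "\<forall>\<^sub>F t in sequentially. 1 - \<beta> <= measure M {w \<in> space M. 1 - e <= near_center i t e w}"
proof -
 define e' where "e' = min (e / 2) (1 / 4)"
 have e': "0 < e'" "e' < 1 / 2" "2 * e' <= e" "e' <= e" unfolding e'_def using e by auto
 have "0 < \<beta> / 2" using \<beta> by simp
 then obtain L d \<rho> \<eta> t0 where L: "0 < L" and \<eta>: "0 < \<eta>" and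
  bad: "\<forall>t\<ge>t0. measure M {w \<in> space M. ~ good L d \<rho> \<eta> t w} <= 2 * (\<beta> / 2)" and
  "\<forall>t\<ge>t0. \<forall>t'\<ge>t0. \<forall>m.
   valley_prob L d \<rho> \<eta> t (%q. q <= m) <= valley_prob L d \<rho> (\<eta> / 2) t' (%q. q <= m) + \<beta> / 2" and
  q: "\<forall>t\<ge>t0. \<forall>w q. good L d \<rho> \<eta> t w --> valley (\<eta> / 2) \<rho> d (profile L t w) q -->
    abs(center i t w - of_int q / (\<sigma>^2 * of_int L)) <= e' & 1 - e' <= near_center i t (2 * e') w" by (rule valley_exists_prob[OF e'(1,2), where i=i])
 have "1 - \<beta> <= measure M {w \<in> space M. 1 - e <= near_center i t e w}" if t: "t0 <= t" for t
 proof -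
  let ?G = "{w \<in> space M. 1 - e <= near_center i t e w}"
  have G: "?G \<in> sets M" by measurable
  have "w \<in> ?G" if z: "w \<in> space M" "good L d \<rho> \<eta> t w" for w
  proof -
   from z obtain q where v: "valley \<eta> \<rho> d (profile L t w) q" by blast
   have "valley (\<eta> / 2) \<rho> d (profile L t w) q" by (rule valley_perturb[OF v, of _ 0]) (use \<eta> in auto)
   with q[rule_format, OF t z(2)] have "1 - e' <= near_center i t (2 * e') w" by blast
   also have "... <= near_center i t e w" by (rule walk_op_mono[OF valid_clean]) (use e' in auto)
   finally show ?thesis using e' z by simp
  qed
  hence "space M - ?G \<subseteq> {w \<in> space M. ~ good L d \<rho> \<eta> t w}" by blast
  hence "measure M (space M - ?G) <= measure M {w \<in> space M. ~ good L d \<rho> \<eta> t w}"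
   by (rule prod.P.finite_measure_mono[OF _ good_measurable])
  thus ?thesis using bad[rule_format, OF t] prod.P.prob_compl[OF G] by simp
 qed
 thus ?thesis unfolding eventually_sequentially by blast
qed

text \<open>The event at \<open>t\<close> produces a valley of margin \<open>\<eta>\<close> with
  bottom at most \<open>m\<close>; a valley of margin \<open>\<eta> / 2\<close> with such a bottom
  is nearly as likely at \<open>t'\<close>; and there every valley of that margin has its bottom
  near the centre, whichever it is. The error consists of two bad events of
  \<open>2 * \<beta> / 5\<close> and one comparison of \<open>\<beta> / 5\<close>.\<close>

lemma center_comparison:
 assumes e: "0 < e" and \<beta>: "0 < \<beta>"
 shows "\<exists>t0. \<forall>t\<ge>t0. \<forall>t'\<ge>t0. \<forall>x.
  measure M {w \<in> space M. center i t w <= x} <= measure M {w \<in> space M. center i t' w <= x + e} + \<beta>"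
proof -
 define e' where "e' = min (e / 2) (1 / 4)"
 have e': "0 < e'" "e' < 1 / 2" "2 * e' <= e" unfolding e'_def using e by auto
 have "0 < \<beta> / 5" using \<beta> by simp
 then obtain L d \<rho> \<eta> t0 where L: "0 < L" and \<eta>: "0 < \<eta>" and
  bad: "\<forall>t\<ge>t0. measure M {w \<in> space M. ~ good L d \<rho> \<eta> t w} <= 2 * (\<beta> / 5)" and
  cmp: "\<forall>t\<ge>t0. \<forall>t'\<ge>t0. \<forall>m.
   valley_prob L d \<rho> \<eta> t (%q. q <= m) <= valley_prob L d \<rho> (\<eta> / 2) t' (%q. q <= m) + \<beta> / 5" and
  q: "\<forall>t\<ge>t0. \<forall>w q. good L d \<rho> \<eta> t w --> valley (\<eta> / 2) \<rho> d (profile L t w) q -->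
    abs(center i t w - of_int q / (\<sigma>^2 * of_int L)) <= e' & 1 - e' <= near_center i t (2 * e') w" by (rule valley_exists_prob[OF e'(1,2), where i=i])
 have sL: "0 < \<sigma>^2 * of_int L" using sigma_positive L by simp
 have "measure M {w \<in> space M. center i t w <= x} <= measure M {w \<in> space M. center i t' w <= x + e} + \<beta>"
  if t: "t0 <= t" "t0 <= t'" for t t' x
 proof -
  define m where "m = \<lfloor>(x + e') * (\<sigma>^2 * of_int L)\<rfloor>"
  have m: "k <= m \<longleftrightarrow> of_int k / (\<sigma>^2 * of_int L) <= x + e'" for k
   unfolding m_def using sL by (simp only: le_floor_iff pos_divide_le_eq)
  let ?C = "{w \<in> space M. center i t w <= x}"
  let ?A = "%\<eta> t. {w \<in> space M. \<exists>q\<le>m. valley \<eta> \<rho> d (profile L t w) q}"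
  let ?B = "%t. {w \<in> space M. ~ good L d \<rho> \<eta> t w}"
  let ?E = "{w \<in> space M. center i t' w <= x + e}"
  have sub: "measure M X <= measure M Y + measure M (?B t)" if "X \<subseteq> Y \<union> ?B t" "Y \<in> sets M" for X Y t
   using prod.P.finite_measure_mono[OF that(1) sets.Un[OF that(2) good_measurable]] measure_Un_le[OF that(2) good_measurable]
   by (rule order_trans)
  have "measure M ?C <= measure M (?A \<eta> t) + measure M (?B t)"
  proof (rule sub)
   have "w \<in> ?A \<eta> t" if z: "w \<in> ?C" and g: "good L d \<rho> \<eta> t w" for w
   proof -
    obtain k where v: "valley \<eta> \<rho> d (profile L t w) k" using g by blast
    have "valley (\<eta> / 2) \<rho> d (profile L t w) k" by (rule valley_perturb[OF v, of _ 0]) (use \<eta> in auto)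
    from q[rule_format, OF t(1) g this] z have "k <= m" unfolding m abs_le_iff by simp
    thus ?thesis using v z by blast
   qed
   thus "?C \<subseteq> ?A \<eta> t \<union> ?B t" by blast
  qed measurable
  moreover have "measure M (?A \<eta> t) <= measure M (?A (\<eta> / 2) t') + \<beta> / 5" by (rule cmp[rule_format, OF t])
  moreover have "measure M (?A (\<eta> / 2) t') <= measure M ?E + measure M (?B t')"
  proof (rule sub)
   have "w \<in> ?E" if z: "w \<in> ?A (\<eta> / 2) t'" and g: "good L d \<rho> \<eta> t' w" for w
   proof -
    from z obtain k where k: "k <= m" and v: "valley (\<eta> / 2) \<rho> d (profile L t' w) k" by blast
    have "center i t' w <= x + e" using q[rule_format, OF t(2) g v] k[unfolded m] e'(3) unfolding abs_le_iff by linarith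
    thus ?thesis using z by blast
   qed
   thus "?A (\<eta> / 2) t' \<subseteq> ?E \<union> ?B t'" by blast
  qed measurable
  ultimately show ?thesis using bad[rule_format, OF t(1)] bad[rule_format, OF t(2)] by linarith
 qed
 thus ?thesis by blast
qed

lemma center_weak_conv: "\<exists>D. real_distribution D & weak_conv_m (%t. distr M borel (center i t)) D"
proof (rule weak_conv_of_cauchy)
 show "real_distribution (distr M borel (center i t))" for t by (rule prod.P.real_distribution_distr) simp
 fix e \<beta> :: real assume "0 < e" "0 < \<beta>"
 have c: "cdf (distr M borel (center i t)) x = measure M {w \<in> space M. center i t w <= x}" for t x
  unfolding cdf_def by (subst measure_distr) (auto simp: vimage_def Int_def conj_commute)
 show "\<exists>t0. \<forall>t\<ge>t0. \<forall>t'\<ge>t0. \<forall>x. cdf (distr M borel (center i t)) x <= cdf (distr M borel (center i t')) (x + e) + \<beta>"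
  unfolding c by (rule center_comparison) fact+
qed

lemma space_valid: "w \<in> space M ==> valid w"
proof -
 have "space N = triples" using sets_eq_imp_space_eq[OF sets_N] by (simp add: triple_space_def space_restrict_space)
 thus "w \<in> space M ==> valid w" unfolding valid_def by (auto simp: space_PiM)
qed

lemma coord_measurable: "(%w. w n) \<in> borel_measurable M"
proof -
 have "(%x. x) \<in> restrict_space borel triples \<rightarrow>\<^sub>M borel" by (rule measurable_restrict_space1) simp
 hence "(%x. x) \<in> borel_measurable N" using measurable_cong_sets[OF sets_N[unfolded triple_space_def] refl] by blast
 thus ?thesis by (rule measurable_compose[rotated]) (rule measurable_component_singleton, simp)
qed

text \<open>A start in layer \<open>n0\<close> is moved to layer 0 by shifting the environment,
  which preserves its law; the displacement \<open>n0 / (ln t)^2\<close> vanishes in the limit. The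
  median is formed in \<open>clean\<close> environments, which agree with the original ones almost
  surely.\<close>

theorem localization:
 fixes z :: "'m site"
 shows "\<exists>b :: nat => 'm env => real.
   (\<forall>t\<ge>1. b t \<in> borel_measurable M) &
   (\<exists>D. real_distribution D & weak_conv_m (%t. distr M borel (b t)) D) &
   (\<forall>\<epsilon>>0. (%t. measure M {w \<in> space M.
     measure (walk_law w z) {\<xi> \<in> space (walk_law w z). abs(real_of_int (fst (\<xi> t)) / (ln (real t))^2 - b t w) <= \<epsilon>}
      >= 1 - \<epsilon>}) \<longlonglongrightarrow> 1)"
proof -
 obtain n0 i where z: "z = (n0, i)" by (cases z)
 define \<theta> where "\<theta> w n = w (n + n0)" for w :: "'m env" and n
 have \<theta>m: "\<theta> \<in> M \<rightarrow>\<^sub>M M" unfolding \<theta>_def[abs_def] by (rule shift_measurable)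
 have \<theta>d: "distr M M \<theta> = M" unfolding \<theta>_def[abs_def] by (rule distr_shift)
 define b where "b t w = center i t (\<theta> w)" for t w
 have bm [measurable]: "b t \<in> borel_measurable M" for t unfolding b_def[abs_def] by (rule measurable_compose[OF \<theta>m center_measurable])
 have "distr M borel (b t) = distr M borel (center i t)" for t
  using distr_comp_shift[OF center_measurable[of i t], where k=n0] unfolding b_def[abs_def] \<theta>_def .
 hence v: "\<exists>D. real_distribution D & weak_conv_m (%t. distr M borel (b t)) D" using center_weak_conv[of i] by simp
 have conc: "(%t. measure M {w \<in> space M.
     measure (walk_law w z) {\<xi> \<in> space (walk_law w z). abs(real_of_int (fst (\<xi> t)) / (ln (real t))^2 - b t w) <= e}
      >= 1 - e}) \<longlonglongrightarrow> 1" if e: "0 < e" for e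
 proof -
  let ?A = "%t w. {s :: 'm site. abs(real_of_int (fst s) / (ln (real t))^2 - b t w) <= e}"
  let ?E = "%t. {w \<in> space M. 1 - e <= walk_op w t (%n j. indicator (?A t w) (n, j)) n0 i}"
  have Em: "?E t \<in> sets M" for t
  proof -
   have "(%w. walk_op w t (%n j. indicator (?A t w) (n, j)) n0 i) \<in> borel_measurable M"
   proof (rule walk_op_measurable[OF coord_measurable])
    have "Measurable.pred M (%w. abs(of_int n / (ln (real t))^2 - b t w) <= e)" for n by measurable
    thus "(%w. indicator (?A t w) (n, j) :: real) \<in> borel_measurable M" for n j
     unfolding indicator_def by simp
   qed
   thus ?thesis by measurable
  qed
  have eq: "{w \<in> space M. measure (walk_law w z) {\<xi> \<in> space (walk_law w z). abs(real_of_int (fst (\<xi> t)) / (ln (real t))^2 - b t w) <= e} >= 1 - e} = ?E t" for t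
  proof (rule Collect_cong, rule conj_cong[OF refl])
   fix w assume "w \<in> space M"
   have "{\<xi> \<in> space (walk_law w z). abs(real_of_int (fst (\<xi> t)) / (ln (real t))^2 - b t w) <= e} = {\<xi>. \<xi> t \<in> ?A t w}"
    by (simp add: space_walk_law)
   thus "(1 - e <= measure (walk_law w z) {\<xi> \<in> space (walk_law w z). abs(real_of_int (fst (\<xi> t)) / (ln (real t))^2 - b t w) <= e})
    = (1 - e <= walk_op w t (%n j. indicator (?A t w) (n, j)) n0 i)"
    using measure_walk_law[OF space_valid[OF \<open>w \<in> space M\<close>], of z t "?A t w"] unfolding z by simp
  qed
  have low: "\<forall>\<^sub>F t in sequentially. 1 - \<beta> <= measure M (?E t)" if \<beta>: "0 < \<beta>" for \<beta>
  proof -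
   have "(%t. abs(of_int n0) / (ln (real t))^2) \<longlonglongrightarrow> 0" by real_asymp
   hence "\<forall>\<^sub>F t in sequentially. abs(of_int n0) / (ln (real t))^2 < e / 2" by (rule order_tendstoD(2)) (use e in simp)
   moreover have "\<forall>\<^sub>F t in sequentially. 1 - \<beta> <= measure M {w \<in> space M. 1 - e / 2 <= near_center i t (e / 2) w}"
    by (rule center_concentration) (use e \<beta> in auto)
   ultimately show ?thesis
   proof eventually_elim
    case (elim t)
    let ?G = "{w \<in> space M. 1 - e / 2 <= near_center i t (e / 2) w}"
    have G: "?G \<in> sets M" by measurable
    have "measure M ?G = measure (distr M M \<theta>) ?G" unfolding \<theta>d ..
    also have "... = measure M (\<theta> -` ?G \<inter> space M)" by (rule measure_distr[OF \<theta>m G])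
    also have "... <= measure M (?E t)"
    proof (rule prod.P.finite_measure_mono_AE)
     show "AE w in M. w \<in> \<theta> -` ?G \<inter> space M --> w \<in> ?E t"
      using clean_eq
     proof eventually_elim
      fix w assume c: "clean w = w"
      show "w \<in> \<theta> -` ?G \<inter> space M --> w \<in> ?E t"
      proof
       assume v: "w \<in> \<theta> -` ?G \<inter> space M"
       have c\<theta>: "clean (\<theta> w) = \<theta> w" using c unfolding clean_def \<theta>_def fun_eq_iff by simp
       have "1 - e <= 1 - e / 2" using e by simp
       also have "... <= near_center i t (e / 2) (\<theta> w)" using v by simp
       also have "... <= walk_op (clean (\<theta> w)) t (%n j. indicator (?A t w) (n + n0, j)) 0 i"
       proof (rule walk_op_mono[OF valid_clean])
        fix k j
        have "abs(of_int (k + n0) / (ln (real t))^2 - b t w) <= e" if "abs(of_int k / (ln (real t))^2 - center i t (\<theta> w)) <= e / 2"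
        proof -
         have "abs(of_int n0 / (ln (real t))^2) < e / 2" using elim(1) by (simp add: abs_divide)
         moreover have "of_int (k + n0) / (ln (real t))^2 = of_int k / (ln (real t))^2 + of_int n0 / (ln (real t))^2"
          by (simp add: add_divide_distrib)
         moreover have "abs(x + y - c) <= e" if "abs(y) < e / 2" "abs(x - c) <= e / 2" for x y c :: real using that by linarith
         ultimately show ?thesis using that unfolding b_def by simp
        qed
        thus "(if abs(of_int k / (ln (real t))^2 - center i t (\<theta> w)) <= e / 2 then 1 else 0) <= (indicator (?A t w) (k + n0, j) :: real)"
         by (simp add: indicator_def)
       qed
       also have "... = walk_op w t (%n j. indicator (?A t w) (n, j)) (0 + n0) i"
        unfolding walk_op_shift[where e=w and n=0 and k=n0] c\<theta> by (simp add: \<theta>_def[abs_def])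
       finally show "w \<in> ?E t" using v by simp
      qed
     qed
    qed (rule Em)
    finally show ?case using elim(2) by linarith
   qed
  qed
  show ?thesis unfolding eq
  proof (rule tendstoI)
   fix \<beta> :: real assume \<beta>: "0 < \<beta>"
   have "0 < \<beta> / 2" using \<beta> by simp
   from low[OF this] show "\<forall>\<^sub>F t in sequentially. dist (measure M (?E t)) 1 < \<beta>"
   proof eventually_elim
    case (elim t)
    thus ?case using prod.P.prob_le_1[of "?E t"] \<beta> unfolding dist_real_def by linarith
   qed
  qed
 qed
 show ?thesis by (intro exI[of _ b] conjI allI impI bm v conc)
qed

end

section \<open>The support of the law of an environment\<close>

lemma support_eq: "- support N = \<Union> {U. open U & emeasure N U = 0}"
 unfolding support_def by (auto simp: zero_less_iff_neq_zero)

lemma closed_support: "closed (support N)"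
 unfolding closed_def support_eq by (intro open_Union) auto

text \<open>The complement of the support is a union of open null sets, and by the Lindelof property
  countably many of them suffice.\<close>

lemma AE_support:
 fixes N :: "'a::second_countable_topology measure"
 assumes "sets N = sets borel"
 shows "AE x in N. x \<in> support N"
proof -
 let ?F = "{U. open U & emeasure N U = 0}"
 obtain F' where F': "F' \<subseteq> ?F" "countable F'" "\<Union> F' = \<Union> ?F"
  by (rule Lindelof[of ?F]) auto
 have "(\<Union>U\<in>F'. U) \<in> null_sets N"
 proof (rule null_sets_UN'[OF F'(2)])
  show "U \<in> null_sets N" if "U \<in> F'" for U using that F'(1) assms by (auto simp: null_sets_def)
 qed
 hence "- support N \<in> null_sets N" unfolding support_eq F'(3)[symmetric] by simp
 from AE_not_in[OF this] show ?thesis by simp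
qed

lemma closed_triples: "closed (triples :: 'm::finite triple set)"
proof -
 have "(triples :: 'm triple set) = {x. (\<forall>i j. 0 <= fst x $ i $ j) & (\<forall>i j. 0 <= fst (snd x) $ i $ j) & (\<forall>i j. 0 <= snd (snd x) $ i $ j) &
   (\<forall>i. (SUM j:UNIV. fst x $ i $ j + fst (snd x) $ i $ j + snd (snd x) $ i $ j) = 1)}"
  unfolding triples_def by (auto simp: less_eq_vec_def vec_eq_iff matrix_vector_mult_def)
 moreover have "closed ..."
  by (intro closed_Collect_conj closed_Collect_all closed_Collect_le closed_Collect_eq continuous_intros)
 ultimately show ?thesis by simp
qed

theorem theorem1:
  fixes \<PP> :: "'m::finite env measure"
    and z :: "'m site"
  assumes "prob_space \<PP>"
    and "sets \<PP> = sets env_space"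
    and "condition_C \<PP>"
    and "AE \<omega> in \<PP>. recurrent \<omega>"
    and "\<not> env_support \<PP> \<subseteq> algebraic_triples"
  shows "\<exists>b :: nat \<Rightarrow> 'm env \<Rightarrow> real.
           (\<forall>t\<ge>1. b t \<in> borel_measurable \<PP>) \<and>
           (\<exists>D. real_distribution D \<and> weak_conv_m (\<lambda>t. distr \<PP> borel (b t)) D) \<and>
           (\<forall>\<epsilon>>0. (\<lambda>t. measure \<PP> {\<omega> \<in> space \<PP>.
                     measure (walk_law \<omega> z)
                       {\<xi> \<in> space (walk_law \<omega> z). \<bar>real_of_int (fst (\<xi> t)) / (ln (real t))\<^sup>2 - b t \<omega>\<bar> \<le> \<epsilon>}
                     \<ge> 1 - \<epsilon>}) \<longlonglongrightarrow> 1)"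
proof -
 interpret P: prob_space \<PP> by fact
 let ?T = "triple_space :: 'm triple measure"
 define N where "N = distr \<PP> ?T (%w. w 0)"
 have coord: "(%w. w n) \<in> \<PP> \<rightarrow>\<^sub>M ?T" for n
 proof -
  have "(%w. w n) \<in> Pi\<^sub>M UNIV (%_. ?T) \<rightarrow>\<^sub>M ?T" by (rule measurable_component_singleton) simp
  thus ?thesis using measurable_cong_sets[OF assms(2) refl] unfolding env_space_def by blast
 qed
 have N: "prob_space N" unfolding N_def by (rule P.prob_space_distr[OF coord])
 have sets_N: "sets N = sets ?T" unfolding N_def by simp
 have space_N: "space N = triples" using sets_eq_imp_space_eq[OF sets_N] by (simp add: triple_space_def space_restrict_space)
 have C1: "P.indep_vars (%_. ?T) (%n w. w n) UNIV" "distr \<PP> ?T (%w. w n) = N" for n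
  using assms(3) unfolding condition_C_def condition_C1_def N_def by blast+
 have PP: "\<PP> = Pi\<^sub>M UNIV (%_. N)"
 proof -
  have "distr \<PP> (Pi\<^sub>M UNIV (%_. ?T)) (%w. \<lambda>n\<in>UNIV. w n) = Pi\<^sub>M UNIV (%n. distr \<PP> ?T (%w. w n))"
   using P.indep_vars_iff_distr_eq_PiM[where I=UNIV and M'="%_. ?T" and X="%n w. w n"] coord C1(1) by simp
  hence "distr \<PP> (Pi\<^sub>M UNIV (%_. ?T)) (%w. w) = Pi\<^sub>M UNIV (%_. N)" unfolding C1(2) by (simp add: restrict_def)
  moreover have "distr \<PP> (Pi\<^sub>M UNIV (%_. ?T)) (%w. w) = \<PP>"
   by (rule distr_id2) (simp add: assms(2) env_space_def)
  ultimately show ?thesis by simp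
 qed
 have idm: "(%x. x) \<in> borel_measurable N"
 proof -
  have "(%x. x) \<in> restrict_space borel triples \<rightarrow>\<^sub>M borel" by (rule measurable_restrict_space1) simp
  thus ?thesis using measurable_cong_sets[OF sets_N[unfolded triple_space_def] refl] by blast
 qed
 define \<nu> where "\<nu> = distr N borel (%x. x)"
 define S where "S = env_support \<PP>"
 have "distr \<PP> borel (%w. w 0) = \<nu>"
  unfolding \<nu>_def N_def by (subst distr_distr) (use idm coord in \<open>auto simp: N_def comp_def\<close>)
 hence S: "S = support \<nu>" unfolding S_def env_support_def by simp
 have Sb: "S \<in> sets borel" unfolding S by (intro borel_closed closed_support)
 have "AE x in \<nu>. x \<in> S" unfolding S by (rule AE_support) (simp add: \<nu>_def)
 hence AES: "AE x in N. x \<in> S" unfolding \<nu>_def by (rule AE_distrD[OF idm])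
 \<comment> \<open>The triples form a closed set of full measure, so the support, although taken in
   the whole space of matrix triples, consists of elements of \<open>triples\<close>.\<close>
 have St: "x \<in> triples" if "x \<in> S" for x
 proof (rule ccontr)
  assume "x \<notin> triples"
  hence "0 < emeasure \<nu> (- triples)"
   using that closed_triples unfolding S support_def by (auto simp: closed_def)
  moreover have "emeasure \<nu> (- triples) = emeasure N ((- triples) \<inter> space N)"
   unfolding \<nu>_def by (subst emeasure_distr[OF idm]) (use closed_triples in \<open>auto intro: borel_open simp: closed_def\<close>)
  ultimately show False unfolding space_N by simp
 qed
 obtain \<epsilon> l where \<epsilon>: "0 < \<epsilon>" and C2: "\<forall>(P, Q, R) \<in> S. \<forall>i j. matrix_norm (matrix_power R l) <= 1 - \<epsilon> &
    (matrix_inv (mat 1 - R) ** P) $ i $ j >= \<epsilon> & (matrix_inv (mat 1 - R) ** Q) $ i $ j >= \<epsilon>"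
  using assms(3) unfolding condition_C_def condition_C2_def S_def by blast
 have ell: "elliptic \<epsilon> (real l / \<epsilon>) x" if x: "x \<in> S" for x
 proof -
  obtain P Q R where PQR: "x = (P, Q, R)" by (cases x)
  have c: "matrix_norm (matrix_power R l) <= 1 - \<epsilon> & (matrix_inv (mat 1 - R) ** P) $ i $ j >= \<epsilon> & (matrix_inv (mat 1 - R) ** Q) $ i $ j >= \<epsilon>" for i j
   using C2 x unfolding PQR by blast
  show ?thesis unfolding PQR by (rule elliptic_triple[OF St[OF x, unfolded PQR] \<epsilon>]) (use c in blast)+
 qed
 obtain x0 where x0: "x0 \<in> S" "x0 \<notin> algebraic_triples" using assms(5) unfolding S_def by blast
 \<comment> \<open>The default value is the non-algebraic triple \<open>x0\<close>, which is itself
   elliptic; the modification affects only a null set.\<close>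
 define \<phi> where "\<phi> x = (if x \<in> S then x else x0)" for x
 have \<phi>: "\<phi> \<in> borel_measurable N" unfolding \<phi>_def[abs_def]
 proof (rule measurable_If)
  show "{x \<in> space N. x \<in> S} \<in> sets N" using measurable_sets[OF idm Sb] by (simp add: vimage_def Int_def conj_commute)
 qed (use idm in auto)
 interpret N: prob_space N by (rule N)
 have fixp: "AE x in N. \<phi> x = x" using AES by eventually_elim (simp add: \<phi>_def)
 have supp: "0 < measure N {x \<in> space N. \<phi> x \<in> W}" if W: "open W" "x0 \<in> W" for W
 proof -
  have "0 < emeasure \<nu> W" using x0(1) W unfolding S support_def by blast
  also have "emeasure \<nu> W = emeasure N {x \<in> space N. x \<in> W}"
   unfolding \<nu>_def by (subst emeasure_distr[OF idm]) (use W in \<open>auto simp: Int_def conj_commute\<close>)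
  also have "... = emeasure N {x \<in> space N. \<phi> x \<in> W}"
  proof (rule emeasure_eq_AE)
   show "AE x in N. (x \<in> {x \<in> space N. x \<in> W}) = (x \<in> {x \<in> space N. \<phi> x \<in> W})" using fixp by eventually_elim simp
   show "{x \<in> space N. x \<in> W} \<in> sets N" using measurable_sets[OF idm borel_open[OF W(1)]] by (simp add: Int_def conj_commute)
   show "{x \<in> space N. \<phi> x \<in> W} \<in> sets N" using measurable_sets[OF \<phi> borel_open[OF W(1)]] by (simp add: vimage_def Int_def conj_commute)
  qed
  finally show ?thesis by (simp add: N.emeasure_eq_measure)
 qed
 have rec: "AE w in Pi\<^sub>M UNIV (%_. N). taboo_recurrent (%n. \<phi> (w n))"
 proof -
  have "AE w in \<PP>. \<phi> (w n) = w n" for n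
  proof (rule AE_distrD[OF coord])
   show "AE x in distr \<PP> ?T (%w. w n). \<phi> x = x" unfolding C1(2) by (rule fixp)
  qed
  hence "AE w in \<PP>. \<forall>n. \<phi> (w n) = w n" by (simp add: AE_all_countable)
  moreover have "AE w in \<PP>. valid w" unfolding PP
   by (rule AE_I2) (auto simp: space_PiM space_N valid_def)
  ultimately have "AE w in \<PP>. taboo_recurrent (%n. \<phi> (w n))" using assms(4)
  proof eventually_elim
   case (elim w)
   have "(%n. \<phi> (w n)) = w" using elim(1) by blast
   thus ?case unfolding taboo_recurrent_def using recurrent_taboo[OF elim(2,3)] by simp
  qed
  thus ?thesis unfolding PP .
 qed
 interpret strip_law N \<epsilon> "real l / \<epsilon>" \<phi> x0
 proof
  show "elliptic \<epsilon> (real l / \<epsilon>) (\<phi> x)" for x unfolding \<phi>_def using ell x0 by simp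
 qed (use N sets_N \<phi> \<epsilon> supp fixp ell x0 rec in auto)
 show ?thesis unfolding PP by (rule localization)
qed

end
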